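(* Let $F$ be a full vertex operator algebra and $M$ a module of the full vertex operator algebra $F$. Put $M^\vee=\bigoplus_{h,\bar h\in\mathbb R}M_{h,\bar h}^*$, with canonical pairing $\langle-,-\rangle:M^\vee\times M\to\mathbb C$, and define $Y_{M^\vee}(-,\underline z):F\to\mathrm{End}(M^\vee)[[z,\bar z,|z|^{\mathbb R}]]$ by $$\langle Y_{M^\vee}(a,\underline z)u,v\rangle=\langle u,Y_M(S_za,\underline z^{-1})v\rangle\qquad(a\in F,\ u\in M^\vee,\ v\in M).$$ Then $(M^\vee,Y_{M^\vee}(-,\underline z))$ is a module of the full vertex operator algebra $F$.
   Context: **Conventions.** $z,\bar z$ are independent formal variables, $\underline z=(z,\bar z)$, and $|z|$ stands for $z\bar z$ in exponents, so $|z|^r=z^r\bar z^r$. For a vector space $V$, $V[[z,\bar z,|z|^{\mathbb R}]]$ is the set of formal sums $\sum_{r,s\in\mathbb R}a_{r,s}z^r\bar z^s$ with countable support and $a_{r,s}=0$ unless $r-s\in\mathbb Z$; $V((z,\bar z,|z|^{\mathbb R}))$ is the subspace of those for which there is $N$ with $a_{r,s}=0$ unless $r,s\ge N$. **Function spaces.** $F_{0,1,\infty}$ is the space of real analytic functions $f:\mathbb CP^1\setminus\{0,1,\infty\}\to\mathbb C$ with conformal singularities at $0,1,\infty$: for each $\alpha\in\{0,1,\infty\}$ and each holomorphic chart $\chi$ at $\alpha$ with $\chi(\alpha)=0$ there is a series in $\mathbb C((p,\bar p,|p|^{\mathbb R}))$ converging absolutely and compactly to $f\circ\chi^{-1}(p)$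 in some punctured disc around $p=0$. For $\chi\in\{p,1/p,1-1/p\}$ ($p$ the standard coordinate) this uniquely determined series is denoted $j(\chi,f)$. $\mathrm{GCor}_2$ is the complex span of the functions on $Y_2=\{(z_1,z_2)\in\mathbb C^2: z_1\ne z_2, z_1\ne0,z_2\neq 0\}$ $$\mu=z_1^{\alpha_1}z_2^{\alpha_2}(z_1-z_2)^{\alpha_{12}}\bar z_1^{\beta_1}\bar z_2^{\beta_2}(\bar z_1-\bar z_2)^{\beta_{12}}f(z_2/z_1),$$ $f\in F_{0,1,\infty}$, $\alpha$'s, $\beta$'s real with $\alpha_1-\beta_1,\alpha_2-\beta_2,\alpha_{12}-\beta_{12}\in\mathbb Z$. Its expansions, extended linearly, are: $\mu|_{|z_1|>|z_2|}$: expand $(z_1-z_2)^{\alpha_{12}}(\bar z_1-\bar z_2)^{\beta_{12}}$ binomially in non-negative powers of $z_2/z_1,\bar z_2/\bar z_1$ and replace $f(z_2/z_1)$ by $j(p,f)$ at $p=z_2/z_1$; $\mu|_{|z_2|>|z_1|}$: expand in non-negative powers of $z_1/z_2,\bar z_1/\bar z_2$ (with sign $(-1)^{\alpha_{12}-\beta_{12}}$) and replace $f(z_2/z_1)$ by $j(p^{-1},f)$ at $p=z_1/z_2$; $\mu|_{|z_2|>|z_1-z_2|}$: put $z_1=z_2+z_0$, expand $(z_2+z_0)^{\alpha_1}(\bar z_2+\bar z_0)^{\beta_1}$ in non-negative powers of $z_0/z_2,\bar z_0/\bar z_2$ and replace $f(z_2/z_1)$ by $j(1-p^{-1},f)$ at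 $p=-z_0/z_2$. **Full vertex algebra.** For $F=\bigoplus_{h,\bar h\in\mathbb R}F_{h,\bar h}$ put $F^\vee=\bigoplus F_{h,\bar h}^*$. A full vertex algebra is such an $F$ over $\mathbb C$ with $Y(-,\underline z):F\to\mathrm{End}(F)[[z,\bar z,|z|^{\mathbb R}]]$, $Y(a,\underline z)=\sum_{r,s\in\mathbb R}a(r,s)z^{-r-1}\bar z^{-s-1}$, and $\mathbf 1\in F_{0,0}$ such that: (FV1) for all $a,b$ there is $N$ with $a(r,s)b=0$ if $r\ge N$ or $s\ge N$; (FV2) $F_{h,\bar h}=0$ unless $h-\bar h\in\mathbb Z$; (FV3) $Y(a,\underline z)\mathbf 1\in F[[z,\bar z]]$ with constant term $a$; (FV4) $Y(\mathbf 1,\underline z)=\mathrm{id}$; (FV5) for all $a,b,c\in F$, $u\in F^\vee$ there is $\mu\in\mathrm{GCor}_2$ with $u(Y(a,\underline z_1)Y(b,\underline z_2)c)=\mu|_{|z_1|>|z_2|}$, $u(Y(Y(a,\underline z_0)b,\underline z_2)c)=\mu|_{|z_2|>|z_1-z_2|}$ ($z_0=z_1-z_2$), $u(Y(b,\underline z_2)Y(a,\underline z_1)c)=\mu|_{|z_2|>|z_1|}$; (FV6) $F_{h,\bar h}(r,s)F_{h',\bar h'}\subset F_{h+h'-r-1,\bar h+\bar h'-s-1}$. Define $D,\bar D\in\mathrm{End}F$ by $Y(a,\underline z)\mathbf 1=a+Da\,z+\bar Da\,\bar z+\cdots$. **Full vertex operator algebra.** A full vertex algebra $F$ with $\omega,\bar\omega\in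 F$, $\bar D\omega=0$, $D\bar\omega=0$, such that $L(n)=\omega(n+1,-1)$ and $\bar L(n)=\bar\omega(-1,n+1)$ satisfy: $[L(n),L(m)]=(n-m)L(n+m)+\frac{n^3-n}{12}\delta_{n+m,0}c$ and $[\bar L(n),\bar L(m)]=(n-m)\bar L(n+m)+\frac{n^3-n}{12}\delta_{n+m,0}\bar c$ for some $c,\bar c\in\mathbb C$; $D=L(-1)$, $\bar D=\bar L(-1)$; $L(0)=h$, $\bar L(0)=\bar h$ on $F_{h,\bar h}$; $\dim F_{h,\bar h}<\infty$; there is $N\in\mathbb R$ with $F_{h,\bar h}=0$ if $h\le N$ or $\bar h\le N$. **Modules.** A module of a full vertex algebra $F$ is $M=\bigoplus_{h,\bar h\in\mathbb R}M_{h,\bar h}$ over $\mathbb C$ with $Y_M(-,\underline z):F\to\mathrm{End}(M)[[z,\bar z,|z|^{\mathbb R}]]$, $Y_M(a,\underline z)=\sum a(r,s)z^{-r-1}\bar z^{-s-1}$, such that: (FM1) for $a\in F,m\in M$ there is $N$ with $a(r,s)m=0$ if $r\ge N$ or $s\ge N$; (FM2) $M_{h,\bar h}=0$ unless $h-\bar h\in\mathbb Z$; (FM3) $Y_M(\mathbf 1,\underline z)=\mathrm{id}$; (FM4) for $a,b\in F$, $m\in M$, $u\in M^\vee$ there is $\mu\in\mathrm{GCor}_2$ with $u(Y_M(a,\underline z_1)Y_M(b,\underline z_2)m)=\mu|_{|z_1|>|z_2|}$, $u(Y_M(Y(a,\underline z_0)b,\underline z_2)m)=\mu|_{|z_2|>|z_1-z_2|}$,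 $u(Y_M(b,\underline z_2)Y_M(a,\underline z_1)m)=\mu|_{|z_2|>|z_1|}$; (FM5) $F_{h,\bar h}(r,s)M_{h',\bar h'}\subset M_{h+h'-r-1,\bar h+\bar h'-s-1}$. It is a module of the full vertex operator algebra $F$ if moreover $L(0)=h$, $\bar L(0)=\bar h$ on $M_{h,\bar h}$ (where $L(0),\bar L(0)$ act via $Y_M(\omega,\underline z),Y_M(\bar\omega,\underline z)$), $\dim M_{h,\bar h}<\infty$, and there is $N$ with $M_{h,\bar h}=0$ if $h\le N$ or $\bar h\le N$. $S_za=\exp(zL(1)+\bar z\bar L(1))(-1)^{h-\bar h}z^{-2h}\bar z^{-2\bar h}a$ for $a\in F_{h,\bar h}$ (a finite sum). *)

theory Defs
  imports "HOL-Analysis.Analysis" "HOL-Library.Function_Algebras"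
begin

section \<open>Formal series with real exponents\<close>

text \<open>
  A formal sum of terms \<open>c\<^sub>x\<^sub>,\<^sub>y z^x zbar^y\<close> with real exponents is the function
  taking \<open>x\<close> and \<open>y\<close> to the coefficient. In two pairs of variables the argument order is: exponent
  of the first variable, of its conjugate, of the second variable, of its conjugate.
\<close>

type_synonym series1 = "real \<Rightarrow> real \<Rightarrow> complex"
type_synonym series2 = "real \<Rightarrow> real \<Rightarrow> real \<Rightarrow> real \<Rightarrow> complex"

definition admissible_support :: "(real \<times> real) set \<Rightarrow> bool" where
  "admissible_support X \<longleftrightarrow> countable X \<and> (\<forall>(x, y)\<in>X. x - y \<in> \<int>)"

text \<open>The space \<open>C((z, zbar, |z|^R))\<close>.\<close>

definition laurent_series :: "series1 set" where
  "laurent_series = {a. admissible_support {(x, y). a x y \<noteq> 0} \<and>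
     (\<exists>N. \<forall>x y. a x y \<noteq> 0 \<longrightarrow> N \<le> x \<and> N \<le> y)}"

text \<open>
  The Cauchy product. The sum is finite if both factors have supports bounded below and one of them is
  supported in pairs of natural numbers, which is the only case needed.
\<close>

definition series_mult :: "series1 \<Rightarrow> series1 \<Rightarrow> series1" where
  "series_mult a b x y =
     (\<Sum>(r, s) \<in> {(r, s). a r s \<noteq> 0 \<and> b (x - r) (y - s) \<noteq> 0}. a r s * b (x - r) (y - s))"

text \<open>The expansion of \<open>(1 + e p)^\<alpha> (1 + e pbar)^\<beta>\<close> in non-negative powers of \<open>p\<close> and \<open>pbar\<close>.\<close>

definition binomial_series :: "complex \<Rightarrow> real \<Rightarrow> real \<Rightarrow> series1" where
  "binomial_series e \<alpha> \<beta> x y =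
     (if x \<in> \<nat> \<and> y \<in> \<nat> then
        of_real (\<alpha> gchoose nat \<lfloor>x\<rfloor>) * e ^ nat \<lfloor>x\<rfloor> * (of_real (\<beta> gchoose nat \<lfloor>y\<rfloor>) * e ^ nat \<lfloor>y\<rfloor>)
      else 0)"

definition sign_pow :: "real \<Rightarrow> complex" where
  "sign_pow t = (- 1) powi \<lfloor>t\<rfloor>"

text \<open>
  The function \<open>p^r pbar^s\<close>, single-valued and real analytic on the punctured plane for
  \<open>r - s \<in> \<int>\<close>. Writing \<open>cnj p powr s\<close> instead would be wrong on the negative real axis, where the
  principal logarithm does not commute with conjugation. The value at \<open>p = 0\<close> is always 0.
\<close>

definition zpow :: "complex \<Rightarrow> real \<Rightarrow> real \<Rightarrow> complex" where
  "zpow p r s = p powr of_real r * cnj (p powr of_real s)"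


section \<open>Functions with conformal singularities\<close>

definition real_analytic_on :: "(complex \<Rightarrow> complex) \<Rightarrow> complex set \<Rightarrow> bool" where
  "real_analytic_on f U \<longleftrightarrow>
     (\<forall>w\<in>U. \<exists>c :: nat \<Rightarrow> nat \<Rightarrow> complex. \<exists>\<epsilon>>0. \<forall>z\<in>ball w \<epsilon>.
        ((\<lambda>(m, n). c m n * of_real (Re (z - w)) ^ m * of_real (Im (z - w)) ^ n) has_sum f z) UNIV)"

text \<open>
  \<open>a\<close> is a series in \<open>C((p, pbar, |p|^R))\<close> converging absolutely and compactly to \<open>g\<close> in some punctured
  disc around 0.
\<close>

definition has_conformal_expansion :: "(complex \<Rightarrow> complex) \<Rightarrow> series1 \<Rightarrow> bool" where
  "has_conformal_expansion g a \<longleftrightarrow> a \<in> laurent_series \<and>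
     (\<exists>R>0.
        (\<forall>p. 0 < norm p \<and> norm p < R \<longrightarrow>
           (\<lambda>(r, s). norm (a r s * zpow p r s)) summable_on UNIV) \<and>
        (\<forall>K. compact K \<and> K \<subseteq> ball 0 R - {0} \<longrightarrow>
           uniform_limit K (\<lambda>A p. \<Sum>(r, s)\<in>A. a r s * zpow p r s) g (finite_subsets_at_top UNIV)))"

definition local_chart :: "complex \<Rightarrow> complex set \<Rightarrow> (complex \<Rightarrow> complex) \<Rightarrow> bool" where
  "local_chart w U \<phi> \<longleftrightarrow> open U \<and> w \<in> U \<and> \<phi> holomorphic_on U \<and> inj_on \<phi> U \<and> \<phi> w = 0"

definition conformal_singularity :: "(complex \<Rightarrow> complex) \<Rightarrow> complex \<Rightarrow> bool" where
  "conformal_singularity f w \<longleftrightarrow>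
     (\<forall>U \<phi>. local_chart w U \<phi> \<longrightarrow> (\<exists>a. has_conformal_expansion (\<lambda>p. f (inv_into U \<phi> p)) a))"

text \<open>
  \<open>CP^1\<close> without \<open>0, 1, \<infinity>\<close> is the plane without \<open>0, 1\<close>; values of \<open>f\<close> at these two points are
  irrelevant. The charts of \<open>CP^1\<close> at \<open>\<infinity>\<close> are the \<open>\<psi>(1/w)\<close> with \<open>\<psi>\<close> a chart of the plane at 0.
\<close>

definition F01inf :: "(complex \<Rightarrow> complex) set" where
  "F01inf = {f. real_analytic_on f (- {0, 1}) \<and>
     conformal_singularity f 0 \<and> conformal_singularity f 1 \<and>
     conformal_singularity (\<lambda>w. f (1 / w)) 0}"

text \<open>
  The expansions \<open>j(p,f)\<close>, \<open>j(1/p,f)\<close>, \<open>j(1-1/p,f)\<close>, as relations. The inverses of the three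
  charts are \<open>q \<mapsto> q\<close>, \<open>q \<mapsto> 1/q\<close>, \<open>q \<mapsto> 1/(1-q)\<close>.
\<close>

definition has_j_zero :: "(complex \<Rightarrow> complex) \<Rightarrow> series1 \<Rightarrow> bool" where
  "has_j_zero f a \<longleftrightarrow> has_conformal_expansion f a"

definition has_j_inf :: "(complex \<Rightarrow> complex) \<Rightarrow> series1 \<Rightarrow> bool" where
  "has_j_inf f a \<longleftrightarrow> has_conformal_expansion (\<lambda>q. f (1 / q)) a"

definition has_j_one :: "(complex \<Rightarrow> complex) \<Rightarrow> series1 \<Rightarrow> bool" where
  "has_j_one f a \<longleftrightarrow> has_conformal_expansion (\<lambda>q. f (1 / (1 - q))) a"


section \<open>Generalised two-point correlation functions\<close>

text \<open>
  The generating functions of \<open>GCor\<^sub>2\<close>. Since \<open>0 powr t = 0\<close> for all \<open>t\<close>, they vanish outside \<open>Y\<^sub>2\<close>,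
  so equality of such total functions is equality on \<open>Y\<^sub>2\<close>.
\<close>

definition gcor_fun ::
  "real \<Rightarrow> real \<Rightarrow> real \<Rightarrow> real \<Rightarrow> real \<Rightarrow> real \<Rightarrow> (complex \<Rightarrow> complex) \<Rightarrow> complex \<times> complex \<Rightarrow> complex" where
  "gcor_fun \<alpha>1 \<alpha>2 \<alpha>12 \<beta>1 \<beta>2 \<beta>12 f = (\<lambda>(z1, z2).
     zpow z1 \<alpha>1 \<beta>1 * zpow z2 \<alpha>2 \<beta>2 * zpow (z1 - z2) \<alpha>12 \<beta>12 * f (z2 / z1))"

text \<open>
  Expansion in \<open>|z1| > |z2|\<close>, in the variables \<open>z1, z2\<close>, where \<open>a\<close> is \<open>j(p,f)\<close>: the coefficients of
  \<open>z1^(\<alpha>1+\<alpha>12) z2^\<alpha>2 (1 - p)^\<alpha>12 a(p)\<close> and its conjugate counterpart at \<open>p = z2/z1\<close>.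
\<close>

definition expand_12 ::
  "real \<Rightarrow> real \<Rightarrow> real \<Rightarrow> real \<Rightarrow> real \<Rightarrow> real \<Rightarrow> series1 \<Rightarrow> series2" where
  "expand_12 \<alpha>1 \<alpha>2 \<alpha>12 \<beta>1 \<beta>2 \<beta>12 a x1 y1 x2 y2 =
     (if x1 + x2 = \<alpha>1 + \<alpha>2 + \<alpha>12 \<and> y1 + y2 = \<beta>1 + \<beta>2 + \<beta>12
      then series_mult (binomial_series (- 1) \<alpha>12 \<beta>12) a (x2 - \<alpha>2) (y2 - \<beta>2)
      else 0)"

text \<open>
  Expansion in \<open>|z2| > |z1|\<close>, in the variables \<open>z1, z2\<close>, where \<open>a\<close> is \<open>j(1/p,f)\<close>: the coefficients of
  \<open>(-1)^(\<alpha>12-\<beta>12) z1^\<alpha>1 z2^(\<alpha>2+\<alpha>12) (1 - q)^\<alpha>12 a(q)\<close> and its conjugate counterpart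
  at \<open>q = z1/z2\<close>.
\<close>

definition expand_21 ::
  "real \<Rightarrow> real \<Rightarrow> real \<Rightarrow> real \<Rightarrow> real \<Rightarrow> real \<Rightarrow> series1 \<Rightarrow> series2" where
  "expand_21 \<alpha>1 \<alpha>2 \<alpha>12 \<beta>1 \<beta>2 \<beta>12 a x1 y1 x2 y2 =
     (if x1 + x2 = \<alpha>1 + \<alpha>2 + \<alpha>12 \<and> y1 + y2 = \<beta>1 + \<beta>2 + \<beta>12
      then sign_pow (\<alpha>12 - \<beta>12) *
           series_mult (binomial_series (- 1) \<alpha>12 \<beta>12) a (x1 - \<alpha>1) (y1 - \<beta>1)
      else 0)"

text \<open>
  Expansion in \<open>|z2| > |z1 - z2|\<close>, in the variables \<open>z0, z2\<close>, where \<open>a\<close> is \<open>j(1-1/p,f)\<close>: the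
  coefficients of \<open>z0^\<alpha>12 z2^(\<alpha>1+\<alpha>2) (1 + q)^\<alpha>1 a(-q)\<close> and its conjugate counterpart at
  \<open>q = z0/z2\<close>.
\<close>

definition expand_02 ::
  "real \<Rightarrow> real \<Rightarrow> real \<Rightarrow> real \<Rightarrow> real \<Rightarrow> real \<Rightarrow> series1 \<Rightarrow> series2" where
  "expand_02 \<alpha>1 \<alpha>2 \<alpha>12 \<beta>1 \<beta>2 \<beta>12 a x0 y0 x2 y2 =
     (if x0 + x2 = \<alpha>1 + \<alpha>2 + \<alpha>12 \<and> y0 + y2 = \<beta>1 + \<beta>2 + \<beta>12
      then series_mult (binomial_series 1 \<alpha>1 \<beta>1) (\<lambda>r s. sign_pow (r - s) * a r s)
             (x0 - \<alpha>12) (y0 - \<beta>12)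
      else 0)"

text \<open>
  \<open>gcor2 \<mu> A B C\<close>: the function \<open>\<mu>\<close> belongs to \<open>GCor\<^sub>2\<close>, and its expansions in \<open>|z1| > |z2|\<close>,
  \<open>|z2| > |z1 - z2|\<close> and \<open>|z2| > |z1|\<close> are \<open>A\<close>, \<open>B\<close> and \<open>C\<close>. This is the graph of the linear
  extension of the three expansions from the generators to their complex span.
\<close>

inductive gcor2 ::
  "(complex \<times> complex \<Rightarrow> complex) \<Rightarrow> series2 \<Rightarrow> series2 \<Rightarrow> series2 \<Rightarrow> bool" where
  generator: "\<lbrakk>\<alpha>1 - \<beta>1 \<in> \<int>; \<alpha>2 - \<beta>2 \<in> \<int>; \<alpha>12 - \<beta>12 \<in> \<int>; f \<in> F01inf;
     has_j_zero f a; has_j_one f b; has_j_inf f c\<rbrakk> \<Longrightarrow>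
   gcor2 (gcor_fun \<alpha>1 \<alpha>2 \<alpha>12 \<beta>1 \<beta>2 \<beta>12 f)
     (expand_12 \<alpha>1 \<alpha>2 \<alpha>12 \<beta>1 \<beta>2 \<beta>12 a)
     (expand_02 \<alpha>1 \<alpha>2 \<alpha>12 \<beta>1 \<beta>2 \<beta>12 b)
     (expand_21 \<alpha>1 \<alpha>2 \<alpha>12 \<beta>1 \<beta>2 \<beta>12 c)"
| smult: "gcor2 \<mu> A B C \<Longrightarrow>
   gcor2 (\<lambda>z. k * \<mu> z)
     (\<lambda>x1 y1 x2 y2. k * A x1 y1 x2 y2)
     (\<lambda>x1 y1 x2 y2. k * B x1 y1 x2 y2)
     (\<lambda>x1 y1 x2 y2. k * C x1 y1 x2 y2)"
| add: "\<lbrakk>gcor2 \<mu> A B C; gcor2 \<mu>' A' B' C'\<rbrakk> \<Longrightarrow>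
   gcor2 (\<lambda>z. \<mu> z + \<mu>' z)
     (\<lambda>x1 y1 x2 y2. A x1 y1 x2 y2 + A' x1 y1 x2 y2)
     (\<lambda>x1 y1 x2 y2. B x1 y1 x2 y2 + B' x1 y1 x2 y2)
     (\<lambda>x1 y1 x2 y2. C x1 y1 x2 y2 + C' x1 y1 x2 y2)"


section \<open>Bigraded vector spaces and their graded duals\<close>

text \<open>
  A bigraded space is the internal direct sum of subspaces \<open>G h k\<close> of an ambient complex vector
  space. The sum \<open>gtotal\<close> need not be the whole type: this lets the graded dual be a bigraded space
  inside the type of all complex-valued functions.
\<close>

locale bigraded_space = vector_space sc
  for sc :: "complex \<Rightarrow> 'v::ab_group_add \<Rightarrow> 'v" +
  fixes G :: "real \<Rightarrow> real \<Rightarrow> 'v set"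
  assumes subspace_piece: "module.subspace sc (G h k)"
    and direct_sum: "\<lbrakk>finite I; \<And>h k. (h, k) \<in> I \<Longrightarrow> w (h, k) \<in> G h k; (\<Sum>i\<in>I. w i) = 0; i \<in> I\<rbrakk>
      \<Longrightarrow> w i = 0"

definition gtotal :: "(complex \<Rightarrow> 'v::ab_group_add \<Rightarrow> 'v) \<Rightarrow> (real \<Rightarrow> real \<Rightarrow> 'v set) \<Rightarrow> 'v set" where
  "gtotal sc G = module.span sc (\<Union>h k. G h k)"

text \<open>The homogeneous component of \<open>v\<close> of degree \<open>(h, k)\<close>.\<close>

definition gcomp :: "(real \<Rightarrow> real \<Rightarrow> 'v::ab_group_add set) \<Rightarrow> 'v \<Rightarrow> real \<Rightarrow> real \<Rightarrow> 'v" where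
  "gcomp G v = (THE w. (\<forall>h k. w h k \<in> G h k) \<and> finite {(h, k). w h k \<noteq> 0} \<and>
     v = (\<Sum>(h, k) \<in> {(h, k). w h k \<noteq> 0}. w h k))"

definition linear_map_on ::
  "(complex \<Rightarrow> 'v::ab_group_add \<Rightarrow> 'v) \<Rightarrow> (complex \<Rightarrow> 'w::ab_group_add \<Rightarrow> 'w) \<Rightarrow> 'v set \<Rightarrow> ('v \<Rightarrow> 'w) \<Rightarrow> bool" where
  "linear_map_on s1 s2 V f \<longleftrightarrow>
     (\<forall>v\<in>V. \<forall>w\<in>V. f (v + w) = f v + f w) \<and> (\<forall>c. \<forall>v\<in>V. f (s1 c v) = s2 c (f v))"

definition fun_scale :: "complex \<Rightarrow> ('v \<Rightarrow> complex) \<Rightarrow> 'v \<Rightarrow> complex" where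
  "fun_scale c u = (\<lambda>v. c * u v)"

text \<open>
  The dual of \<open>G h k\<close>, realised as the linear functionals on the total space which vanish on all other
  pieces. A functional on the total space is identified with its extension by 0 to the ambient type.
  Thus \<open>gtotal fun_scale (dual_piece sc G)\<close> is the graded dual, and the pairing is application.
\<close>

definition dual_piece ::
  "(complex \<Rightarrow> 'v::ab_group_add \<Rightarrow> 'v) \<Rightarrow> (real \<Rightarrow> real \<Rightarrow> 'v set) \<Rightarrow> real \<Rightarrow> real \<Rightarrow> ('v \<Rightarrow> complex) set" where
  "dual_piece sc G h k = {u.
     linear_map_on sc (*) (gtotal sc G) u \<and>
     (\<forall>v. v \<notin> gtotal sc G \<longrightarrow> u v = 0) \<and>
     (\<forall>h' k'. (h', k') \<noteq> (h, k) \<longrightarrow> (\<forall>v\<in>G h' k'. u v = 0))}"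

abbreviation graded_dual ::
  "(complex \<Rightarrow> 'v::ab_group_add \<Rightarrow> 'v) \<Rightarrow> (real \<Rightarrow> real \<Rightarrow> 'v set) \<Rightarrow> ('v \<Rightarrow> complex) set" where
  "graded_dual sc G \<equiv> gtotal fun_scale (dual_piece sc G)"


section \<open>Full vertex algebras and their modules\<close>

text \<open>
  A vertex operator map is given by its coefficients: \<open>Y a x y\<close> is the coefficient of
  \<open>z^x zbar^y\<close> in \<open>Y(a,z)\<close>, and \<open>mode Y a r s\<close> is the operator \<open>a(r,s)\<close>.
\<close>

definition mode :: "('a \<Rightarrow> real \<Rightarrow> real \<Rightarrow> 'm \<Rightarrow> 'm) \<Rightarrow> 'a \<Rightarrow> real \<Rightarrow> real \<Rightarrow> 'm \<Rightarrow> 'm" where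
  "mode Y a r s = Y a (- r - 1) (- s - 1)"

text \<open>
  The axioms which modules have in common with full vertex algebras: the bigraded space \<open>F\<close>, with
  vertex operators \<open>Y\<close> on itself and vacuum \<open>vac\<close>, acts on the bigraded space \<open>M\<close> by \<open>YM\<close>. Operators
  on \<open>F\<close> and \<open>M\<close> are functions on the ambient types, used on the total spaces only.
\<close>

locale full_vertex_action = F: bigraded_space sF F + M: bigraded_space sM M
  for sF :: "complex \<Rightarrow> 'a::ab_group_add \<Rightarrow> 'a" and F
    and sM :: "complex \<Rightarrow> 'm::ab_group_add \<Rightarrow> 'm" and M +
  fixes Y :: "'a \<Rightarrow> real \<Rightarrow> real \<Rightarrow> 'a \<Rightarrow> 'a"
    and vac :: 'a
    and YM :: "'a \<Rightarrow> real \<Rightarrow> real \<Rightarrow> 'm \<Rightarrow> 'm"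
  assumes endomorphism: "\<lbrakk>a \<in> gtotal sF F; v \<in> gtotal sM M\<rbrakk> \<Longrightarrow> YM a x y v \<in> gtotal sM M"
    and endomorphism_linear: "a \<in> gtotal sF F \<Longrightarrow> linear_map_on sM sM (gtotal sM M) (YM a x y)"
    and state_linear: "v \<in> gtotal sM M \<Longrightarrow> linear_map_on sF sM (gtotal sF F) (\<lambda>a. YM a x y v)"
    and support: "a \<in> gtotal sF F \<Longrightarrow> admissible_support {(x, y). \<exists>v\<in>gtotal sM M. YM a x y v \<noteq> 0}"
    and truncation: "\<lbrakk>a \<in> gtotal sF F; v \<in> gtotal sM M\<rbrakk> \<Longrightarrow>
      \<exists>N. \<forall>r s. r \<ge> N \<or> s \<ge> N \<longrightarrow> mode YM a r s v = 0"
    and integral_spin: "h - k \<notin> \<int> \<Longrightarrow> M h k = {0}"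
    and vacuum_identity: "v \<in> gtotal sM M \<Longrightarrow> YM vac x y v = (if x = 0 \<and> y = 0 then v else 0)"
    and correlator: "\<lbrakk>a \<in> gtotal sF F; b \<in> gtotal sF F; v \<in> gtotal sM M; u \<in> graded_dual sM M\<rbrakk> \<Longrightarrow>
      \<exists>\<mu>. gcor2 \<mu>
        (\<lambda>x1 y1 x2 y2. u (YM a x1 y1 (YM b x2 y2 v)))
        (\<lambda>x0 y0 x2 y2. u (YM (Y a x0 y0 b) x2 y2 v))
        (\<lambda>x1 y1 x2 y2. u (YM b x2 y2 (YM a x1 y1 v)))"
    and graded: "\<lbrakk>a \<in> F h k; v \<in> M h' k'\<rbrakk> \<Longrightarrow>
      mode YM a r s v \<in> M (h + h' - r - 1) (k + k' - s - 1)"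

locale full_vertex_algebra = full_vertex_action sF F sF F Y vac Y
  for sF :: "complex \<Rightarrow> 'a::ab_group_add \<Rightarrow> 'a" and F and Y and vac +
  assumes vacuum_degree: "vac \<in> F 0 0"
    and creation_regular: "\<lbrakk>a \<in> gtotal sF F; Y a x y vac \<noteq> 0\<rbrakk> \<Longrightarrow> x \<in> \<nat> \<and> y \<in> \<nat>"
    and creation: "a \<in> gtotal sF F \<Longrightarrow> Y a 0 0 vac = a"

locale full_vertex_module = alg: full_vertex_algebra sF F Y vac + full_vertex_action sF F sM M Y vac YM
  for sF :: "complex \<Rightarrow> 'a::ab_group_add \<Rightarrow> 'a" and F and Y and vac
    and sM :: "complex \<Rightarrow> 'm::ab_group_add \<Rightarrow> 'm" and M and YM


section \<open>Full vertex operator algebras and their modules\<close>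

text \<open>The operators \<open>D\<close> and \<open>Dbar\<close>: \<open>Y(a,z)1 = a + D a z + Dbar a zbar + \<dots>\<close>.\<close>

definition deriv_op :: "('a \<Rightarrow> real \<Rightarrow> real \<Rightarrow> 'a \<Rightarrow> 'a) \<Rightarrow> 'a \<Rightarrow> 'a \<Rightarrow> 'a" where
  "deriv_op Y vac a = Y a 1 0 vac"

definition deriv_op_bar :: "('a \<Rightarrow> real \<Rightarrow> real \<Rightarrow> 'a \<Rightarrow> 'a) \<Rightarrow> 'a \<Rightarrow> 'a \<Rightarrow> 'a" where
  "deriv_op_bar Y vac a = Y a 0 1 vac"

definition L_op :: "('a \<Rightarrow> real \<Rightarrow> real \<Rightarrow> 'm \<Rightarrow> 'm) \<Rightarrow> 'a \<Rightarrow> int \<Rightarrow> 'm \<Rightarrow> 'm" where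
  "L_op Y \<omega> n = mode Y \<omega> (of_int n + 1) (- 1)"

definition L_op_bar :: "('a \<Rightarrow> real \<Rightarrow> real \<Rightarrow> 'm \<Rightarrow> 'm) \<Rightarrow> 'a \<Rightarrow> int \<Rightarrow> 'm \<Rightarrow> 'm" where
  "L_op_bar Y \<omega>' n = mode Y \<omega>' (- 1) (of_int n + 1)"

definition virasoro_on ::
  "(complex \<Rightarrow> 'v::ab_group_add \<Rightarrow> 'v) \<Rightarrow> 'v set \<Rightarrow> (int \<Rightarrow> 'v \<Rightarrow> 'v) \<Rightarrow> complex \<Rightarrow> bool" where
  "virasoro_on sc V L c \<longleftrightarrow> (\<forall>n m. \<forall>v\<in>V.
     L n (L m v) - L m (L n v) = sc (of_int (n - m)) (L (n + m) v)
       + (if n + m = 0 then sc (of_int (n ^ 3 - n) / 12 * c) v else 0))"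

definition pieces_finite_dim :: "(complex \<Rightarrow> 'v::ab_group_add \<Rightarrow> 'v) \<Rightarrow> (real \<Rightarrow> real \<Rightarrow> 'v set) \<Rightarrow> bool" where
  "pieces_finite_dim sc G \<longleftrightarrow> (\<forall>h k. \<exists>B. finite B \<and> module.span sc B = G h k)"

definition degrees_bounded_below :: "(real \<Rightarrow> real \<Rightarrow> 'v::zero set) \<Rightarrow> bool" where
  "degrees_bounded_below G \<longleftrightarrow> (\<exists>N. \<forall>h k. h \<le> N \<or> k \<le> N \<longrightarrow> G h k = {0})"

locale full_vertex_operator_algebra = full_vertex_algebra sF F Y vac
  for sF :: "complex \<Rightarrow> 'a::ab_group_add \<Rightarrow> 'a" and F and Y and vac +
  fixes \<omega> \<omega>' :: 'a
  assumes conformal_vectors: "\<omega> \<in> gtotal sF F" "\<omega>' \<in> gtotal sF F"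
    and omega_holomorphic: "deriv_op_bar Y vac \<omega> = 0"
    and omega'_antiholomorphic: "deriv_op Y vac \<omega>' = 0"
    and virasoro: "\<exists>c. virasoro_on sF (gtotal sF F) (L_op Y \<omega>) c"
    and virasoro_bar: "\<exists>c'. virasoro_on sF (gtotal sF F) (L_op_bar Y \<omega>') c'"
    and L_minus_one: "a \<in> gtotal sF F \<Longrightarrow> deriv_op Y vac a = L_op Y \<omega> (- 1) a"
    and L_bar_minus_one: "a \<in> gtotal sF F \<Longrightarrow> deriv_op_bar Y vac a = L_op_bar Y \<omega>' (- 1) a"
    and L_zero: "a \<in> F h k \<Longrightarrow> L_op Y \<omega> 0 a = sF (of_real h) a"
    and L_bar_zero: "a \<in> F h k \<Longrightarrow> L_op_bar Y \<omega>' 0 a = sF (of_real k) a"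
    and finite_dim: "pieces_finite_dim sF F"
    and bounded_below: "degrees_bounded_below F"

locale full_vertex_operator_module =
    alg: full_vertex_operator_algebra sF F Y vac \<omega> \<omega>' + full_vertex_module sF F Y vac sM M YM
  for sF :: "complex \<Rightarrow> 'a::ab_group_add \<Rightarrow> 'a" and F and Y and vac and \<omega> and \<omega>'
    and sM :: "complex \<Rightarrow> 'm::ab_group_add \<Rightarrow> 'm" and M and YM +
  assumes module_L_zero: "v \<in> M h k \<Longrightarrow> L_op YM \<omega> 0 v = sM (of_real h) v"
    and module_L_bar_zero: "v \<in> M h k \<Longrightarrow> L_op_bar YM \<omega>' 0 v = sM (of_real k) v"
    and module_finite_dim: "pieces_finite_dim sM M"
    and module_bounded_below: "degrees_bounded_below M"


section \<open>The contragredient vertex operators\<close>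

text \<open>
  \<open>S_series \<dots> a x y\<close> is the coefficient of \<open>z^x zbar^y\<close> in
  \<open>S\<^sub>z a = exp(z L(1) + zbar Lbar(1)) (-1)^(h-hbar) z^(-2h) zbar^(-2hbar) a\<close> (for \<open>a\<close> homogeneous, extended
  linearly). \<open>S_initial\<close> gives the coefficients of the series to which the exponential is applied,
  and \<open>S_exponent\<close> is the operator \<open>z L(1) + zbar Lbar(1)\<close> on series with coefficients in \<open>F\<close>. Only
  finitely many terms of the exponential contribute to a given coefficient.
\<close>

definition S_initial ::
  "(complex \<Rightarrow> 'a::ab_group_add \<Rightarrow> 'a) \<Rightarrow> (real \<Rightarrow> real \<Rightarrow> 'a set) \<Rightarrow> 'a \<Rightarrow> real \<Rightarrow> real \<Rightarrow> 'a" where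
  "S_initial sF F a x y = sF (sign_pow ((- x / 2) - (- y / 2))) (gcomp F a (- x / 2) (- y / 2))"

definition S_exponent ::
  "('a \<Rightarrow> real \<Rightarrow> real \<Rightarrow> 'a \<Rightarrow> 'a) \<Rightarrow> 'a \<Rightarrow> 'a \<Rightarrow> (real \<Rightarrow> real \<Rightarrow> 'a::ab_group_add) \<Rightarrow> real \<Rightarrow> real \<Rightarrow> 'a" where
  "S_exponent Y \<omega> \<omega>' A x y = L_op Y \<omega> 1 (A (x - 1) y) + L_op_bar Y \<omega>' 1 (A x (y - 1))"

definition S_series ::
  "(complex \<Rightarrow> 'a::ab_group_add \<Rightarrow> 'a) \<Rightarrow> (real \<Rightarrow> real \<Rightarrow> 'a set) \<Rightarrow> ('a \<Rightarrow> real \<Rightarrow> real \<Rightarrow> 'a \<Rightarrow> 'a) \<Rightarrow>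
   'a \<Rightarrow> 'a \<Rightarrow> 'a \<Rightarrow> real \<Rightarrow> real \<Rightarrow> 'a" where
  "S_series sF F Y \<omega> \<omega>' a x y =
     (\<Sum>n | (S_exponent Y \<omega> \<omega>' ^^ n) (S_initial sF F a) x y \<noteq> 0.
        sF (1 / fact n) ((S_exponent Y \<omega> \<omega>' ^^ n) (S_initial sF F a) x y))"

text \<open>
  Comparing coefficients of \<open>z^x zbar^y\<close> in \<open>\<langle>Y\<^sub>M\<^sub>v(a,z)u, v\<rangle> = \<langle>u, Y\<^sub>M(S\<^sub>z a, 1/z) v\<rangle>\<close>: the term
  \<open>z^r zbar^s\<close> of \<open>S\<^sub>z a\<close> pairs with the coefficient of \<open>(1/z)^(r-x) (1/zbar)^(s-y)\<close>.
\<close>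

definition contragredient ::
  "(complex \<Rightarrow> 'a::ab_group_add \<Rightarrow> 'a) \<Rightarrow> (real \<Rightarrow> real \<Rightarrow> 'a set) \<Rightarrow> ('a \<Rightarrow> real \<Rightarrow> real \<Rightarrow> 'a \<Rightarrow> 'a) \<Rightarrow>
   'a \<Rightarrow> 'a \<Rightarrow> (complex \<Rightarrow> 'm::ab_group_add \<Rightarrow> 'm) \<Rightarrow> (real \<Rightarrow> real \<Rightarrow> 'm set) \<Rightarrow>
   ('a \<Rightarrow> real \<Rightarrow> real \<Rightarrow> 'm \<Rightarrow> 'm) \<Rightarrow> 'a \<Rightarrow> real \<Rightarrow> real \<Rightarrow> ('m \<Rightarrow> complex) \<Rightarrow> 'm \<Rightarrow> complex" where
  "contragredient sF F Y \<omega> \<omega>' sM M YM a x y u v =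
     (if v \<in> gtotal sM M
      then \<Sum>(r, s) \<in> {(r, s). S_series sF F Y \<omega> \<omega>' a r s \<noteq> 0}.
             u (YM (S_series sF F Y \<omega> \<omega>' a r s) (r - x) (s - y) v)
      else 0)"

end

theory Submission
  imports Defs "HOL-Complex_Analysis.Complex_Analysis"
begin

text \<open>
  Matrix coefficients of the contragredient operators are finite sums of matrix coefficients of \<open>YM\<close> with
  \<open>z1, z2\<close> replaced by their inverses and \<open>a, b\<close> by the states \<open>L(1)^i Lbar(1)^j a / (i! j!)\<close>. For products,
  (FM4) therefore follows once \<open>GCor\<^sub>2\<close> is seen to be stable under inversion of both variables, which turns
  \<open>f(p)\<close> into \<open>f(1/p)\<close> and exchanges the regions \<open>|z1| > |z2|\<close> and \<open>|z2| > |z1|\<close>. For the iterate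
  \<open>Y(Y(a,z0)b,z2)\<close> one moves \<open>exp(z L(1))\<close> past \<open>Y(a,z0)\<close>, and the resulting binomial coefficients are exactly
  those of the expansion of \<open>1/z1 - 1/z2 = - z0/(z2 (z2 + z0))\<close>.

  The commutator \<open>[L(1), Y(a,z)]\<close> comes from the correlators with one holomorphic argument \<open>\<omega>\<close>. With \<open>z2 = 1\<close>,
  such a correlator is real analytic off \<open>0, 1\<close> and holomorphic near one of the singularities, hence
  holomorphic everywhere, and comparing its residues gives the commutator formula.
\<close>

section \<open>The functions \<open>zpow\<close>\<close>

text \<open>(FV5) and (FM4) assert only that some \<open>\<mu>\<close> exists, so every identity
  between modes has to be extracted by analysis. For homogeneous states the exponents of
  \<open>z1\<close> determine those of \<open>z2\<close>, so \<open>z2 = 1\<close> loses nothing.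
  Three facts about such a slice suffice: its first-order Taylor coefficients at 1 (\<open>D\<close>
  is a derivative), equality of two monomials (holomorphic and antiholomorphic states commute), and
  a sum of residues (the commutator with \<open>L(1)\<close>). The last one is applied to
  \<open>\<omega>\<close> of degree (2,0); this degree is not an axiom and is derived from the
  Virasoro relations and the commutation. Commutators are needed on \<open>F\<close> alone, where
  \<open>S_z\<close> acts; correlators of \<open>M\<close> enter only through the inversion. There
  the expansion at 1 is the delicate one: the old coordinate is \<open>- q / (1 - q)\<close> in
  terms of the new one, so a series with real exponents is re-expanded, and the rearrangement needs
  a majorant. Finally, (FM4) for the dual is tested against functionals on the dual;
  finite-dimensional pieces turn these into vectors of \<open>M\<close>.\<close>

lemma zpow_0_left [simp]: "zpow 0 r s = 0"
  by (simp add: zpow_def)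

lemma norm_powr_of_real: "norm ((p::complex) powr of_real r) = norm p powr r"
  by (cases "p = 0") (auto simp: powr_def)

text \<open>The factor \<open>p powr s\<close> times its conjugate is \<open>|p|^(2s)\<close>, which
  leaves a single-valued integer power. Multiplicativity in \<open>p\<close> is read off this form,
  since complex \<open>powr\<close> is multiplicative in its base only up to a choice of
  branch.\<close>

lemma zpow_eq_powi:
  assumes "r - s = of_int n"
  shows "zpow p r s = p powi n * of_real (norm p powr (2 * s))"
proof (cases "p = 0")
  case False
  have r: "r = s + of_int n" using assms by simp
  have "p powr of_real r = p powr of_real s * p powi n"
    using False by (simp add: r powr_add complex_powr_of_int)
  moreover have "p powr of_real s * cnj (p powr of_real s) = of_real (norm p powr (2 * s))"
    by (simp only: complex_norm_square[symmetric] norm_powr_of_real)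
      (simp add: power2_eq_square flip: powr_add)
  ultimately show ?thesis
    unfolding zpow_def by (simp add: mult_ac)
qed simp

lemma norm_zpow: "norm (zpow p r s) = norm p powr (r + s)"
  by (simp add: zpow_def norm_mult norm_powr_of_real powr_add)

lemma zpow_nonzero: "p \<noteq> 0 \<Longrightarrow> zpow p r s \<noteq> 0"
  by (simp add: zpow_def)

lemma zpow_add: "zpow p (r + r') (s + s') = zpow p r s * zpow p r' s'"
  by (simp add: zpow_def powr_add)

lemma zpow_mult:
  assumes "r - s \<in> \<int>"
  shows "zpow (p * q) r s = zpow p r s * zpow q r s"
proof -
  obtain n where n: "r - s = of_int n" using assms Ints_cases by blast
  show ?thesis
    unfolding zpow_eq_powi[OF n]
    by (simp add: power_int_mult_distrib norm_mult powr_mult)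
qed

lemma zpow_one [simp]: "zpow 1 r s = 1"
  by (simp add: zpow_def)

lemma zpow_0_0: "p \<noteq> 0 \<Longrightarrow> zpow p 0 0 = 1"
  by (simp add: zpow_def)

lemma zpow_inverse:
  assumes "r - s \<in> \<int>"
  shows "zpow (inverse p) r s = zpow p (- r) (- s)"
proof (cases "p = 0")
  case False
  have "zpow (inverse p) r s * zpow p r s = 1"
    using False by (simp flip: zpow_mult[OF assms])
  moreover have "zpow p (- r) (- s) * zpow p r s = 1"
    using False by (simp add: zpow_0_0 flip: zpow_add)
  ultimately show ?thesis
    using zpow_nonzero[OF False] by (metis mult_right_cancel)
qed simp

lemma zpow_uminus:
  assumes "r - s \<in> \<int>"
  shows "zpow (- p) r s = sign_pow (r - s) * zpow p r s"
proof -
  obtain n where n: "r - s = of_int n" using assms Ints_cases by blast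
  have "(- p) powi n = (- 1) powi n * p powi n"
    by (metis mult_minus1 power_int_mult_distrib)
  then show ?thesis
    unfolding zpow_eq_powi[OF n] sign_pow_def n by simp
qed

lemma zpow_of_nat: "p \<noteq> 0 \<Longrightarrow> zpow p (of_nat m) (of_nat n) = p ^ m * cnj p ^ n"
  by (simp add: zpow_def powr_nat)

lemma zpow_of_int_0: "p \<noteq> 0 \<Longrightarrow> zpow p (of_int n) 0 = p powi n"
  using zpow_eq_powi[of "of_int n" 0 n p] by simp

lemma sign_pow_of_int: "sign_pow (of_int n) = (- 1) powi n"
  by (simp add: sign_pow_def)

lemma sign_pow_add:
  assumes "s \<in> \<int>" "t \<in> \<int>"
  shows "sign_pow (s + t) = sign_pow s * sign_pow t"
  using assms by (elim Ints_cases) (simp add: sign_pow_of_int power_int_add flip: of_int_add)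

lemma sign_pow_uminus: "s \<in> \<int> \<Longrightarrow> sign_pow (- s) = sign_pow s"
  by (elim Ints_cases) (simp add: sign_pow_of_int power_int_minus flip: of_int_minus power_int_inverse)

lemma sign_pow_square [simp]: "sign_pow s * sign_pow s = 1"
  by (simp add: sign_pow_def flip: power_int_mult_distrib)

lemma sign_pow_of_nat: "sign_pow (of_nat n) = (- 1) ^ n"
  using sign_pow_of_int[of "int n"] by simp

lemma sign_pow_0 [simp]: "sign_pow 0 = 1"
  by (simp add: sign_pow_def)

section \<open>Real analytic functions\<close>

text \<open>The number \<open>K\<close> bounds the weighted sum of the coefficient norms on the
  closed square of half-side \<open>\<rho>\<close>. This norm is submultiplicative, so products,
  infinite sums and substitutions are controlled by their bounds, without computing the resulting
  coefficients. A square, rather than a disc, fits series in the real and the imaginary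
  part.\<close>

definition ra_coeffs ::
  "real \<Rightarrow> (complex \<Rightarrow> complex) \<Rightarrow> real \<Rightarrow> (nat \<Rightarrow> nat \<Rightarrow> complex) \<Rightarrow> bool" where
  "ra_coeffs \<rho> g K c \<longleftrightarrow>
     (\<lambda>(m, n). norm (c m n) * \<rho> ^ (m + n)) summable_on UNIV \<and>
     (\<Sum>\<^sub>\<infinity>(m, n). norm (c m n) * \<rho> ^ (m + n)) \<le> K \<and>
     (\<forall>z. \<bar>Re z\<bar> \<le> \<rho> \<and> \<bar>Im z\<bar> \<le> \<rho> \<longrightarrow>
       ((\<lambda>(m, n). c m n * of_real (Re z) ^ m * of_real (Im z) ^ n) has_sum g z) UNIV)"

definition ra_bound :: "real \<Rightarrow> (complex \<Rightarrow> complex) \<Rightarrow> real \<Rightarrow> bool" where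
  "ra_bound \<rho> g K \<longleftrightarrow> (\<exists>c. ra_coeffs \<rho> g K c)"

lemma ra_boundE:
  assumes "ra_bound \<rho> g K"
  obtains c where "(\<lambda>(m, n). norm (c m n) * \<rho> ^ (m + n)) summable_on UNIV"
    and "(\<Sum>\<^sub>\<infinity>(m, n). norm (c m n) * \<rho> ^ (m + n)) \<le> K"
    and "\<And>z. \<bar>Re z\<bar> \<le> \<rho> \<Longrightarrow> \<bar>Im z\<bar> \<le> \<rho> \<Longrightarrow>
       ((\<lambda>(m, n). c m n * of_real (Re z) ^ m * of_real (Im z) ^ n) has_sum g z) UNIV"
proof -
  obtain c where c: "ra_coeffs \<rho> g K c" using assms unfolding ra_bound_def by blast
  show thesis by (rule that[of c]) (use c in \<open>simp_all add: ra_coeffs_def\<close>)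
qed

lemma ra_boundI:
  assumes "(\<lambda>(m, n). norm (c m n) * \<rho> ^ (m + n)) summable_on UNIV"
    and "(\<Sum>\<^sub>\<infinity>(m, n). norm (c m n) * \<rho> ^ (m + n)) \<le> K"
    and "\<And>z. \<bar>Re z\<bar> \<le> \<rho> \<Longrightarrow> \<bar>Im z\<bar> \<le> \<rho> \<Longrightarrow>
       ((\<lambda>(m, n). c m n * of_real (Re z) ^ m * of_real (Im z) ^ n) has_sum g z) UNIV"
  shows "ra_bound \<rho> g K"
  unfolding ra_bound_def ra_coeffs_def by (rule exI[of _ c]) (simp add: assms)

lemma ra_boundI_finite:
  assumes "\<And>z. \<bar>Re z\<bar> \<le> \<rho> \<Longrightarrow> \<bar>Im z\<bar> \<le> \<rho> \<Longrightarrow> g z = c * of_real (Re z) ^ m * of_real (Im z) ^ n"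
    and "0 \<le> \<rho>"
  shows "ra_bound \<rho> g (norm c * \<rho> ^ (m + n))"
proof -
  let ?c = "\<lambda>i j. if i = m \<and> j = n then c else 0"
  have "((\<lambda>(i, j). norm (?c i j) * \<rho> ^ (i + j)) has_sum (norm c * \<rho> ^ (m + n))) UNIV"
    by (rule has_sum_finite_neutralI[of "{(m, n)}"]) (auto split: if_splits)
  moreover have "((\<lambda>(i, j). ?c i j * of_real (Re z) ^ i * of_real (Im z) ^ j) has_sum g z) UNIV"
    if "\<bar>Re z\<bar> \<le> \<rho>" "\<bar>Im z\<bar> \<le> \<rho>" for z
    by (rule has_sum_finite_neutralI[of "{(m, n)}"]) (auto simp: assms(1)[OF that] split: if_splits)
  ultimately show ?thesis
    by (intro ra_boundI[of ?c]) (auto simp: has_sum_iff)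
qed

text \<open>Interchange of summations: the bounds \<open>K i\<close> make the family of all
  coefficients absolutely summable over \<open>i\<close>, \<open>m\<close>, \<open>n\<close>
  together, so summing over \<open>i\<close> first gives the coefficients of \<open>g\<close>. Sums,
  products and compositions below are instances with a suitable index type.\<close>

lemma ra_bound_infsum:
  fixes f :: "'i \<Rightarrow> complex \<Rightarrow> complex"
  assumes f: "\<And>i. ra_bound \<rho> (f i) (K i)" and K: "K summable_on UNIV" and "0 \<le> \<rho>"
    and g: "\<And>z. \<bar>Re z\<bar> \<le> \<rho> \<Longrightarrow> \<bar>Im z\<bar> \<le> \<rho> \<Longrightarrow> ((\<lambda>i. f i z) has_sum g z) UNIV"
  shows "ra_bound \<rho> g (infsum K UNIV)"
proof -
  have "\<forall>i. \<exists>c. ra_coeffs \<rho> (f i) (K i) c"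
    using f unfolding ra_bound_def by blast
  then obtain c where c: "\<And>i. ra_coeffs \<rho> (f i) (K i) (c i)"
    by metis
  have sm: "\<And>i. (\<lambda>(m, n). norm (c i m n) * \<rho> ^ (m + n)) summable_on UNIV"
    and le: "\<And>i. (\<Sum>\<^sub>\<infinity>(m, n). norm (c i m n) * \<rho> ^ (m + n)) \<le> K i"
    and hs: "\<And>i z. \<bar>Re z\<bar> \<le> \<rho> \<Longrightarrow> \<bar>Im z\<bar> \<le> \<rho> \<Longrightarrow>
       ((\<lambda>(m, n). c i m n * of_real (Re z) ^ m * of_real (Im z) ^ n) has_sum f i z) UNIV"
    using c unfolding ra_coeffs_def by auto
  let ?t = "\<lambda>(i, m, n). norm (c i m n) * \<rho> ^ (m + n)"
  have sK: "(\<lambda>i. \<Sum>\<^sub>\<infinity>(m, n). norm (c i m n) * \<rho> ^ (m + n)) summable_on UNIV"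
    by (rule summable_on_comparison_test[OF K])
      (use le \<open>0 \<le> \<rho>\<close> in \<open>auto intro!: infsum_nonneg\<close>)
  have st: "?t summable_on UNIV \<times> UNIV"
    by (rule summable_on_SigmaI[OF _ sK])
      (use sm \<open>0 \<le> \<rho>\<close> in \<open>auto simp: case_prod_unfold\<close>)
  show ?thesis
  \<comment> \<open>For radius 0 the weights \<open>\<rho> ^ (m + n)\<close> control only the
    constant coefficients, and the sums over \<open>i\<close> of the others need not converge. The
    square is then the point 0, where a constant series does.\<close>
  proof (cases "\<rho> = 0")
    case True
    define C0 where "C0 m n = (if m = 0 \<and> n = 0 then g 0 else 0)" for m n :: nat
    have "norm (c i 0 0) \<le> K i" for i
    proof -
      have "((\<lambda>(m, n). norm (c i m n) * \<rho> ^ (m + n)) has_sum (norm (c i 0 0))) UNIV"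
        by (rule has_sum_finite_neutralI[of "{(0, 0)}"]) (auto simp: True)
      then show ?thesis using le[of i] by (simp add: has_sum_iff)
    qed
    moreover have "f i 0 = c i 0 0" for i
    proof -
      have "((\<lambda>(m, n). c i m n * of_real (Re 0) ^ m * of_real (Im 0) ^ n) has_sum c i 0 0) UNIV"
        by (rule has_sum_finite_neutralI[of "{(0, 0)}"]) auto
      then show ?thesis using hs[of 0 i] True has_sum_unique by force
    qed
    ultimately have n: "norm (g 0) \<le> infsum K UNIV"
      using norm_infsum_le[OF g[of 0] has_sum_infsum[OF K]] True by simp
    have "((\<lambda>(m, n). norm (C0 m n) * \<rho> ^ (m + n)) has_sum norm (g 0)) UNIV"
      by (rule has_sum_finite_neutralI[of "{(0, 0)}"]) (auto simp: True C0_def)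
    moreover have "((\<lambda>(m, n). C0 m n * of_real (Re z) ^ m * of_real (Im z) ^ n) has_sum g z) UNIV"
      if "\<bar>Re z\<bar> \<le> \<rho>" "\<bar>Im z\<bar> \<le> \<rho>" for z
    proof -
      have "z = 0" using that True by (simp add: complex_eq_iff)
      then show ?thesis
        by (intro has_sum_finite_neutralI[of "{(0, 0)}"]) (auto simp: C0_def)
    qed
    ultimately show ?thesis
      using n by (intro ra_boundI[of C0]) (auto simp: has_sum_iff)
  next
    case False
    then have pos: "0 < \<rho>" using \<open>0 \<le> \<rho>\<close> by simp
    have st': "(\<lambda>(p, i). ?t (i, p)) summable_on UNIV \<times> UNIV"
      using st summable_on_swap[of ?t UNIV UNIV] by (simp add: case_prod_unfold)
    have si: "(\<lambda>i. norm (c i m n)) summable_on UNIV" for m n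
    proof -
      have "(\<lambda>i. norm (c i m n) * \<rho> ^ (m + n)) summable_on UNIV"
        using summable_on_SigmaD1[of "\<lambda>p i. ?t (i, p)" UNIV "\<lambda>_. UNIV" "(m, n)"] st' by auto
      then show ?thesis
        using pos by (simp add: summable_on_cmult_left')
    qed
    define D where "D m n = (\<Sum>\<^sub>\<infinity>i. c i m n)" for m n
    have D: "((\<lambda>i. c i m n) has_sum D m n) UNIV" for m n
      unfolding D_def using abs_summable_summable[OF si] by simp
    have normD: "norm (D m n) \<le> (\<Sum>\<^sub>\<infinity>i. norm (c i m n))" for m n
      unfolding D_def by (rule norm_infsum_bound[OF si])
    let ?S = "\<lambda>p. \<Sum>\<^sub>\<infinity>i. ?t (i, p)"
    have S: "?S (m, n) = (\<Sum>\<^sub>\<infinity>i. norm (c i m n)) * \<rho> ^ (m + n)" for m n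
      by (simp add: infsum_cmult_left')
    have sS: "?S summable_on UNIV"
      using summable_on_Sigma_banach[OF st'] by simp
    have "infsum ?S UNIV = (\<Sum>\<^sub>\<infinity>i. \<Sum>\<^sub>\<infinity>p. ?t (i, p))"
      using infsum_swap_banach[of "\<lambda>i p. ?t (i, p)" UNIV UNIV] st by simp
    also have "\<dots> \<le> infsum K UNIV"
      by (rule infsum_mono[OF _ K]) (use sK le in \<open>auto simp: case_prod_unfold\<close>)
    finally have SK: "infsum ?S UNIV \<le> infsum K UNIV" .
    have DS: "(case p of (m, n) \<Rightarrow> norm (D m n) * \<rho> ^ (m + n)) \<le> ?S p" for p
    proof -
      obtain m n where p: "p = (m, n)" by force
      show ?thesis
        unfolding p S using mult_right_mono[OF normD[of m n], of "\<rho> ^ (m + n)"] pos by simp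
    qed
    have sD: "(\<lambda>(m, n). norm (D m n) * \<rho> ^ (m + n)) summable_on UNIV"
      by (rule summable_on_comparison_test[OF sS DS]) (use pos in auto)
    have "(\<Sum>\<^sub>\<infinity>(m, n). norm (D m n) * \<rho> ^ (m + n)) \<le> infsum ?S UNIV"
      by (rule infsum_mono[OF sD sS DS])
    moreover have "((\<lambda>(m, n). D m n * of_real (Re z) ^ m * of_real (Im z) ^ n) has_sum g z) UNIV"
      if z: "\<bar>Re z\<bar> \<le> \<rho>" "\<bar>Im z\<bar> \<le> \<rho>" for z
    proof -
      let ?u = "\<lambda>(i, m, n). c i m n * of_real (Re z) ^ m * of_real (Im z) ^ n"
      have nb: "norm (?u q) \<le> ?t q" for q
      proof -
        obtain i m n where q: "q = (i, m, n)" by (metis prod_cases3)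
        have "\<bar>Re z\<bar> ^ m * \<bar>Im z\<bar> ^ n \<le> \<rho> ^ m * \<rho> ^ n"
          by (intro mult_mono power_mono z) (use \<open>0 \<le> \<rho>\<close> in auto)
        from mult_left_mono[OF this norm_ge_zero[of "c i m n"]] show ?thesis
          by (simp add: q norm_mult norm_power power_add mult.assoc)
      qed
      have su: "?u summable_on UNIV \<times> UNIV"
        by (rule abs_summable_summable, rule Infinite_Sum.abs_summable_on_comparison_test'[OF st])
          (rule nb)
      have "(?u has_sum g z) (UNIV \<times> UNIV)"
        by (rule has_sum_SigmaI[OF _ g[OF z] su]) (use hs[OF z] in auto)
      then have "((\<lambda>(p, i). ?u (i, p)) has_sum g z) (UNIV \<times> UNIV)"
        using has_sum_swap[of ?u UNIV UNIV "g z"] by (simp add: case_prod_unfold)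
      then show ?thesis
        by (rule has_sum_SigmaD) (auto intro!: has_sum_cmult_left D)
    qed
    ultimately show ?thesis
      using sD SK by (intro ra_boundI[of D]) auto
  qed
qed

lemma ra_bound_nonneg:
  assumes "ra_bound \<rho> f K" "0 \<le> \<rho>"
  shows "0 \<le> K"
proof -
  obtain c :: "nat \<Rightarrow> nat \<Rightarrow> complex" where "(\<Sum>\<^sub>\<infinity>(m, n). norm (c m n) * \<rho> ^ (m + n)) \<le> K"
    by (rule ra_boundE[OF assms(1)], rule that; assumption)
  moreover have "0 \<le> (\<Sum>\<^sub>\<infinity>(m, n). norm (c m n) * \<rho> ^ (m + n))"
    using assms(2) by (intro infsum_nonneg) auto
  ultimately show ?thesis by simp
qed

lemma ra_bound_mono:
  assumes "ra_bound \<rho> f K" "K \<le> K'"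
  shows "ra_bound \<rho> f K'"
  using assms unfolding ra_bound_def ra_coeffs_def by (meson order_trans)

lemma ra_bound_mono_radius:
  assumes "ra_bound \<rho> f K" "0 \<le> \<rho>'" "\<rho>' \<le> \<rho>"
  shows "ra_bound \<rho>' f K"
proof -
  obtain c where sm: "(\<lambda>(m, n). norm (c m n) * \<rho> ^ (m + n)) summable_on UNIV"
    and le: "(\<Sum>\<^sub>\<infinity>(m, n). norm (c m n) * \<rho> ^ (m + n)) \<le> K"
    and hs: "\<And>z. \<bar>Re z\<bar> \<le> \<rho> \<Longrightarrow> \<bar>Im z\<bar> \<le> \<rho> \<Longrightarrow>
       ((\<lambda>(m, n). c m n * of_real (Re z) ^ m * of_real (Im z) ^ n) has_sum f z) UNIV"
    by (rule ra_boundE[OF assms(1)], rule that; assumption)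
  have m: "norm (c m n) * \<rho>' ^ (m + n) \<le> norm (c m n) * \<rho> ^ (m + n)" for m n
    using assms by (intro mult_left_mono power_mono) auto
  have sm': "(\<lambda>(m, n). norm (c m n) * \<rho>' ^ (m + n)) summable_on UNIV"
    by (rule summable_on_comparison_test[OF sm]) (use m assms in auto)
  have "(\<Sum>\<^sub>\<infinity>(m, n). norm (c m n) * \<rho>' ^ (m + n)) \<le> K"
    by (rule order_trans[OF infsum_mono[OF sm' sm] le]) (use m in auto)
  with sm' hs assms show ?thesis
    by (intro ra_boundI[of c]) auto
qed

lemma ra_bound_add:
  assumes "ra_bound \<rho> f K" "ra_bound \<rho> g L" "0 \<le> \<rho>"
  shows "ra_bound \<rho> (\<lambda>z. f z + g z) (K + L)"
proof -
  \<comment> \<open>A sum of two terms is an infinite sum indexed by \<open>bool\<close>.\<close>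
  have "ra_bound \<rho> (\<lambda>z. f z + g z) (\<Sum>\<^sub>\<infinity>b. if b then K else L)"
    by (rule ra_bound_infsum[where f = "\<lambda>b. if b then f else g" and K = "\<lambda>b. if b then K else L"])
      (use assms in \<open>auto simp: has_sum_finite_iff UNIV_bool split: if_splits\<close>)
  then show ?thesis by (simp add: UNIV_bool add.commute)
qed

lemma ra_bound_cmult:
  assumes "ra_bound \<rho> f K" "0 \<le> \<rho>"
  shows "ra_bound \<rho> (\<lambda>z. k * f z) (norm k * K)"
proof -
  obtain c where sm: "(\<lambda>(m, n). norm (c m n) * \<rho> ^ (m + n)) summable_on UNIV"
    and le: "(\<Sum>\<^sub>\<infinity>(m, n). norm (c m n) * \<rho> ^ (m + n)) \<le> K"
    and hs: "\<And>z. \<bar>Re z\<bar> \<le> \<rho> \<Longrightarrow> \<bar>Im z\<bar> \<le> \<rho> \<Longrightarrow>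
       ((\<lambda>(m, n). c m n * of_real (Re z) ^ m * of_real (Im z) ^ n) has_sum f z) UNIV"
    by (rule ra_boundE[OF assms(1)], rule that; assumption)
  have e: "(\<lambda>(m, n). norm (k * c m n) * \<rho> ^ (m + n)) =
    (\<lambda>p. norm k * (case p of (m, n) \<Rightarrow> norm (c m n) * \<rho> ^ (m + n)))"
    by (auto simp: norm_mult mult_ac)
  have "(\<lambda>(m, n). norm (k * c m n) * \<rho> ^ (m + n)) summable_on UNIV"
    unfolding e by (rule summable_on_cmult_right[OF sm])
  moreover have "(\<Sum>\<^sub>\<infinity>(m, n). norm (k * c m n) * \<rho> ^ (m + n)) \<le> norm k * K"
    unfolding e infsum_cmult_right' by (rule mult_left_mono[OF le norm_ge_zero])
  moreover have "((\<lambda>(m, n). k * c m n * of_real (Re z) ^ m * of_real (Im z) ^ n) has_sum k * f z) UNIV"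
    if "\<bar>Re z\<bar> \<le> \<rho>" "\<bar>Im z\<bar> \<le> \<rho>" for z
    using has_sum_cmult_right[OF hs[OF that], of k] by (simp add: case_prod_unfold mult.assoc)
  ultimately show ?thesis
    by (rule ra_boundI)
qed

lemma ra_bound_times_monomial:
  assumes "ra_bound \<rho> f K" "0 \<le> \<rho>"
  shows "ra_bound \<rho> (\<lambda>z. of_real (Re z) ^ a * of_real (Im z) ^ b * f z) (\<rho> ^ (a + b) * K)"
proof -
  obtain c where sm: "(\<lambda>(m, n). norm (c m n) * \<rho> ^ (m + n)) summable_on UNIV"
    and le: "(\<Sum>\<^sub>\<infinity>(m, n). norm (c m n) * \<rho> ^ (m + n)) \<le> K"
    and hs: "\<And>z. \<bar>Re z\<bar> \<le> \<rho> \<Longrightarrow> \<bar>Im z\<bar> \<le> \<rho> \<Longrightarrow>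
       ((\<lambda>(m, n). c m n * of_real (Re z) ^ m * of_real (Im z) ^ n) has_sum f z) UNIV"
    by (rule ra_boundE[OF assms(1)], rule that; assumption)
  let ?K = "\<lambda>(m, n). \<rho> ^ (a + b) * (norm (c m n) * \<rho> ^ (m + n))"
  have "ra_bound \<rho> (\<lambda>z. of_real (Re z) ^ a * of_real (Im z) ^ b * f z) (infsum ?K UNIV)"
  proof (rule ra_bound_infsum)
    show "ra_bound \<rho> (case p of (m, n) \<Rightarrow> (\<lambda>z. c m n * of_real (Re z) ^ (a + m) * of_real (Im z) ^ (b + n)))
      (?K p)" for p
    proof -
      obtain m n where p: "p = (m, n)" by force
      show ?thesis unfolding p
        using ra_boundI_finite[of \<rho> "\<lambda>z. c m n * of_real (Re z) ^ (a + m) * of_real (Im z) ^ (b + n)" "c m n" "a + m" "b + n"] assms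
        by (simp add: power_add mult_ac)
    qed
    show "?K summable_on UNIV"
      using summable_on_cmult_right[OF sm] by (simp add: case_prod_unfold)
    fix z assume z: "\<bar>Re z\<bar> \<le> \<rho>" "\<bar>Im z\<bar> \<le> \<rho>"
    show "((\<lambda>p. (case p of (m, n) \<Rightarrow> (\<lambda>z. c m n * of_real (Re z) ^ (a + m) * of_real (Im z) ^ (b + n))) z)
        has_sum of_real (Re z) ^ a * of_real (Im z) ^ b * f z) UNIV"
      using has_sum_cmult_right[OF hs[OF z], of "of_real (Re z) ^ a * of_real (Im z) ^ b"]
      by (simp add: case_prod_unfold power_add mult_ac)
  qed fact
  moreover have "infsum ?K UNIV = \<rho> ^ (a + b) * (\<Sum>\<^sub>\<infinity>(m, n). norm (c m n) * \<rho> ^ (m + n))"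
    unfolding infsum_cmult_right'[symmetric] by (simp add: case_prod_unfold)
  ultimately show ?thesis
    using ra_bound_mono mult_left_mono[OF le] assms(2) by force
qed

text \<open>Only the first factor is expanded; each of its monomials times \<open>g\<close> is
  covered by \<open>ra_bound_times_monomial\<close>, and the Cauchy product never has to be written
  down.\<close>

lemma ra_bound_mult:
  assumes "ra_bound \<rho> f K" "ra_bound \<rho> g L" "0 \<le> \<rho>"
  shows "ra_bound \<rho> (\<lambda>z. f z * g z) (K * L)"
proof -
  obtain c where sm: "(\<lambda>(m, n). norm (c m n) * \<rho> ^ (m + n)) summable_on UNIV"
    and le: "(\<Sum>\<^sub>\<infinity>(m, n). norm (c m n) * \<rho> ^ (m + n)) \<le> K"
    and hs: "\<And>z. \<bar>Re z\<bar> \<le> \<rho> \<Longrightarrow> \<bar>Im z\<bar> \<le> \<rho> \<Longrightarrow>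
       ((\<lambda>(m, n). c m n * of_real (Re z) ^ m * of_real (Im z) ^ n) has_sum f z) UNIV"
    by (rule ra_boundE[OF assms(1)], rule that; assumption)
  let ?K = "\<lambda>(m, n). norm (c m n) * (\<rho> ^ (m + n) * L)"
  have "ra_bound \<rho> (\<lambda>z. f z * g z) (infsum ?K UNIV)"
  proof (rule ra_bound_infsum)
    show "ra_bound \<rho> (case p of (m, n) \<Rightarrow>
       (\<lambda>z. c m n * (of_real (Re z) ^ m * of_real (Im z) ^ n * g z))) (?K p)" for p
      by (cases p) (simp, intro ra_bound_cmult ra_bound_times_monomial assms)
    show "?K summable_on UNIV"
      using summable_on_cmult_left[OF sm, of L] by (simp add: case_prod_unfold mult_ac)
    fix z assume z: "\<bar>Re z\<bar> \<le> \<rho>" "\<bar>Im z\<bar> \<le> \<rho>"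
    show "((\<lambda>p. (case p of (m, n) \<Rightarrow> (\<lambda>z. c m n * (of_real (Re z) ^ m * of_real (Im z) ^ n * g z))) z)
        has_sum f z * g z) UNIV"
      using has_sum_cmult_left[OF hs[OF z], of "g z"]
      by (simp add: case_prod_unfold mult_ac)
  qed fact
  moreover have "infsum ?K UNIV = (\<Sum>\<^sub>\<infinity>(m, n). norm (c m n) * \<rho> ^ (m + n)) * L"
    unfolding infsum_cmult_left'[symmetric] by (simp add: case_prod_unfold mult_ac)
  ultimately show ?thesis
    using ra_bound_mono mult_right_mono[OF le ra_bound_nonneg[OF assms(2,3)]] by simp
qed

lemma ra_bound_const: "0 \<le> \<rho> \<Longrightarrow> ra_bound \<rho> (\<lambda>_. k) (norm k)"
  using ra_boundI_finite[of \<rho> "\<lambda>_. k" k 0 0] by simp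

lemma ra_bound_power: "ra_bound \<rho> f K \<Longrightarrow> 0 \<le> \<rho> \<Longrightarrow> ra_bound \<rho> (\<lambda>z. f z ^ n) (K ^ n)"
  by (induction n) (auto intro: ra_bound_mult ra_bound_const[of \<rho> 1, simplified])

text \<open>\<open>z\<close> is the sum of the monomials \<open>Re z\<close> and
  \<open>\<i> * Im z\<close>, each of bound \<open>\<rho>\<close>. This factor 2 is why power series
  in \<open>z\<close> are later required to converge at radius \<open>2 * \<rho>\<close>.\<close>

lemma ra_bound_id: "0 \<le> \<rho> \<Longrightarrow> ra_bound \<rho> (\<lambda>z. z) (2 * \<rho>)"
  using ra_bound_add[OF ra_boundI_finite[of \<rho> "\<lambda>z. of_real (Re z)" 1 1 0]
      ra_boundI_finite[of \<rho> "\<lambda>z. \<i> * of_real (Im z)" \<i> 0 1]]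
  by (simp flip: complex_eq)

lemma ra_bound_cnj:
  assumes "ra_bound \<rho> f K"
  shows "ra_bound \<rho> (\<lambda>z. cnj (f z)) K"
proof -
  obtain c where sm: "(\<lambda>(m, n). norm (c m n) * \<rho> ^ (m + n)) summable_on UNIV"
    and le: "(\<Sum>\<^sub>\<infinity>(m, n). norm (c m n) * \<rho> ^ (m + n)) \<le> K"
    and hs: "\<And>z. \<bar>Re z\<bar> \<le> \<rho> \<Longrightarrow> \<bar>Im z\<bar> \<le> \<rho> \<Longrightarrow>
       ((\<lambda>(m, n). c m n * of_real (Re z) ^ m * of_real (Im z) ^ n) has_sum f z) UNIV"
    by (rule ra_boundE[OF assms(1)], rule that; assumption)
  have "((\<lambda>(m, n). cnj (c m n) * of_real (Re z) ^ m * of_real (Im z) ^ n) has_sum cnj (f z)) UNIV"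
    if "\<bar>Re z\<bar> \<le> \<rho>" "\<bar>Im z\<bar> \<le> \<rho>" for z
    using has_sum_cnj_iff[THEN iffD2, OF hs[OF that]] by (simp add: case_prod_unfold)
  with sm le show ?thesis
    by (intro ra_boundI[of "\<lambda>m n. cnj (c m n)"]) auto
qed

text \<open>Convergence at the corner of a square forces absolute convergence on all of it, since
  unconditional summability of complex numbers is absolute. Hence the pointwise
  \<open>has_sum\<close> of the definition already gives a bound.\<close>

lemma real_analytic_on_iff_ra_bound:
  "real_analytic_on f U \<longleftrightarrow> (\<forall>w\<in>U. \<exists>\<rho>>0. \<exists>K. ra_bound \<rho> (\<lambda>z. f (w + z)) K)"
  unfolding real_analytic_on_def
proof (intro ball_cong refl iffI)
  fix w
  assume "\<exists>c :: nat \<Rightarrow> nat \<Rightarrow> complex. \<exists>\<epsilon>>0. \<forall>z\<in>ball w \<epsilon>.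
    ((\<lambda>(m, n). c m n * of_real (Re (z - w)) ^ m * of_real (Im (z - w)) ^ n) has_sum f z) UNIV"
  then obtain c :: "nat \<Rightarrow> nat \<Rightarrow> complex" and \<epsilon> where \<epsilon>: "\<epsilon> > 0" and
    c: "\<And>z. z \<in> ball w \<epsilon> \<Longrightarrow>
      ((\<lambda>(m, n). c m n * of_real (Re (z - w)) ^ m * of_real (Im (z - w)) ^ n) has_sum f z) UNIV"
    by blast
  \<comment> \<open>Points of the square satisfy
    \<open>|z| \<le> |Re z| + |Im z| \<le> 2 * \<rho>\<close>, which is below
    \<open>\<epsilon>\<close>.\<close>
  define \<rho> where "\<rho> = \<epsilon> / 3"
  have \<rho>: "\<rho> > 0" using \<epsilon> by (simp add: \<rho>_def)
  have in_ball: "w + z \<in> ball w \<epsilon>" if "\<bar>Re z\<bar> \<le> \<rho>" "\<bar>Im z\<bar> \<le> \<rho>" for z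
    using cmod_le[of z] that \<epsilon> by (simp add: dist_norm \<rho>_def)
  have "((\<lambda>(m, n). c m n * of_real \<rho> ^ m * of_real \<rho> ^ n) has_sum f (w + Complex \<rho> \<rho>)) UNIV"
    using c[OF in_ball[of "Complex \<rho> \<rho>"]] \<rho> by simp
  then have "(\<lambda>p. norm (case p of (m, n) \<Rightarrow> c m n * of_real \<rho> ^ m * of_real \<rho> ^ n)) summable_on UNIV"
    using has_sum_imp_summable summable_on_iff_abs_summable_on_complex by blast
  then have "(\<lambda>(m, n). norm (c m n) * \<rho> ^ (m + n)) summable_on UNIV"
    using \<rho> by (simp add: case_prod_unfold norm_mult norm_power power_add mult.assoc)
  then have "ra_bound \<rho> (\<lambda>z. f (w + z)) (\<Sum>\<^sub>\<infinity>(m, n). norm (c m n) * \<rho> ^ (m + n))"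
    by (intro ra_boundI[of c]) (use c[OF in_ball] in auto)
  then show "\<exists>\<rho>>0. \<exists>K. ra_bound \<rho> (\<lambda>z. f (w + z)) K" using \<rho> by blast
next
  fix w assume "\<exists>\<rho>>0. \<exists>K. ra_bound \<rho> (\<lambda>z. f (w + z)) K"
  then obtain \<rho> K where \<rho>: "\<rho> > 0" and K: "ra_bound \<rho> (\<lambda>z. f (w + z)) K" by blast
  obtain c where
    c: "\<And>z. \<bar>Re z\<bar> \<le> \<rho> \<Longrightarrow> \<bar>Im z\<bar> \<le> \<rho> \<Longrightarrow>
       ((\<lambda>(m, n). c m n * of_real (Re z) ^ m * of_real (Im z) ^ n) has_sum f (w + z)) UNIV"
    by (rule ra_boundE[OF K], rule that; assumption)
  have "((\<lambda>(m, n). c m n * of_real (Re (z - w)) ^ m * of_real (Im (z - w)) ^ n) has_sum f z) UNIV"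
    if "z \<in> ball w \<rho>" for z
  proof -
    have "\<bar>Re (z - w)\<bar> \<le> \<rho>" "\<bar>Im (z - w)\<bar> \<le> \<rho>"
      using that abs_Re_le_cmod[of "z - w"] abs_Im_le_cmod[of "z - w"]
      by (auto simp: dist_norm norm_minus_commute)
    from c[OF this] show ?thesis by simp
  qed
  then show "\<exists>c :: nat \<Rightarrow> nat \<Rightarrow> complex. \<exists>\<epsilon>>0. \<forall>z\<in>ball w \<epsilon>.
    ((\<lambda>(m, n). c m n * of_real (Re (z - w)) ^ m * of_real (Im (z - w)) ^ n) has_sum f z) UNIV"
    using \<rho> by blast
qed

text \<open>One \<open>K\<close> serves all smaller radii, so that two functions can be treated on a
  common square.\<close>

lemma real_analytic_onE:
  assumes "real_analytic_on f U" "w \<in> U"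
  obtains \<rho>0 K where "\<rho>0 > 0" "\<And>\<rho>. 0 < \<rho> \<Longrightarrow> \<rho> \<le> \<rho>0 \<Longrightarrow> ra_bound \<rho> (\<lambda>z. f (w + z)) K"
proof -
  obtain \<rho>0 K where "\<rho>0 > 0" "ra_bound \<rho>0 (\<lambda>z. f (w + z)) K"
    using assms unfolding real_analytic_on_iff_ra_bound by blast
  then show thesis using that ra_bound_mono_radius[of \<rho>0 _ K] by (meson less_imp_le)
qed

section \<open>Closure properties of real analytic functions\<close>

lemma real_analytic_on_subset: "real_analytic_on f U \<Longrightarrow> V \<subseteq> U \<Longrightarrow> real_analytic_on f V"
  unfolding real_analytic_on_def by blast

lemma real_analytic_on_Un:
  "real_analytic_on f U \<Longrightarrow> real_analytic_on f V \<Longrightarrow> real_analytic_on f (U \<union> V)"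
  unfolding real_analytic_on_def by blast

lemma real_analytic_on_mult:
  assumes "real_analytic_on f U" "real_analytic_on g U"
  shows "real_analytic_on (\<lambda>z. f z * g z) U"
  unfolding real_analytic_on_iff_ra_bound
proof
  fix w assume w: "w \<in> U"
  obtain r K where r: "r > 0" "\<And>\<rho>. 0 < \<rho> \<Longrightarrow> \<rho> \<le> r \<Longrightarrow> ra_bound \<rho> (\<lambda>z. f (w + z)) K"
    using real_analytic_onE[OF assms(1) w] by metis
  obtain s L where s: "s > 0" "\<And>\<rho>. 0 < \<rho> \<Longrightarrow> \<rho> \<le> s \<Longrightarrow> ra_bound \<rho> (\<lambda>z. g (w + z)) L"
    using real_analytic_onE[OF assms(2) w] by metis
  have "ra_bound (min r s) (\<lambda>z. f (w + z) * g (w + z)) (K * L)"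
    by (intro ra_bound_mult r s) (use r(1) s(1) in auto)
  then show "\<exists>\<rho>>0. \<exists>K. ra_bound \<rho> (\<lambda>z. f (w + z) * g (w + z)) K"
    using r(1) s(1) by (intro exI[of _ "min r s"]) auto
qed

lemma real_analytic_on_add:
  assumes "real_analytic_on f U" "real_analytic_on g U"
  shows "real_analytic_on (\<lambda>z. f z + g z) U"
  unfolding real_analytic_on_iff_ra_bound
proof
  fix w assume w: "w \<in> U"
  obtain r K where r: "r > 0" "\<And>\<rho>. 0 < \<rho> \<Longrightarrow> \<rho> \<le> r \<Longrightarrow> ra_bound \<rho> (\<lambda>z. f (w + z)) K"
    using real_analytic_onE[OF assms(1) w] by metis
  obtain s L where s: "s > 0" "\<And>\<rho>. 0 < \<rho> \<Longrightarrow> \<rho> \<le> s \<Longrightarrow> ra_bound \<rho> (\<lambda>z. g (w + z)) L"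
    using real_analytic_onE[OF assms(2) w] by metis
  have "ra_bound (min r s) (\<lambda>z. f (w + z) + g (w + z)) (K + L)"
    by (intro ra_bound_add r s) (use r(1) s(1) in auto)
  then show "\<exists>\<rho>>0. \<exists>K. ra_bound \<rho> (\<lambda>z. f (w + z) + g (w + z)) K"
    using r(1) s(1) by (intro exI[of _ "min r s"]) auto
qed

lemma real_analytic_on_const: "real_analytic_on (\<lambda>_. k) U"
  unfolding real_analytic_on_iff_ra_bound using ra_bound_const[of 1] by (intro ballI exI[of _ 1]) auto

lemma real_analytic_on_cnj:
  "real_analytic_on f U \<Longrightarrow> real_analytic_on (\<lambda>z. cnj (f z)) U"
  unfolding real_analytic_on_iff_ra_bound using ra_bound_cnj by blast

lemma ra_bound_power_series:
  assumes sm: "(\<lambda>n. norm (a n) * (2 * \<rho>) ^ n) summable_on UNIV" and "0 \<le> \<rho>"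
    and g: "\<And>z. norm z \<le> 2 * \<rho> \<Longrightarrow> ((\<lambda>n. a n * z ^ n) has_sum g z) UNIV"
  shows "ra_bound \<rho> g (\<Sum>\<^sub>\<infinity>n. norm (a n) * (2 * \<rho>) ^ n)"
proof (rule ra_bound_infsum[OF _ sm \<open>0 \<le> \<rho>\<close>])
  show "ra_bound \<rho> (\<lambda>z. a n * z ^ n) (norm (a n) * (2 * \<rho>) ^ n)" for n
    by (intro ra_bound_cmult ra_bound_power ra_bound_id \<open>0 \<le> \<rho>\<close>)
  show "((\<lambda>n. a n * z ^ n) has_sum g z) UNIV" if "\<bar>Re z\<bar> \<le> \<rho>" "\<bar>Im z\<bar> \<le> \<rho>" for z
    by (rule g) (use cmod_le[of z] that in auto)
qed

text \<open>The inner function of a composition needs an arbitrarily small bound in order to be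
  substituted in the outer series. Without its constant term a power series has a bound that tends
  to 0 with the radius.\<close>

lemma holomorphic_ra_bound_small:
  assumes "\<phi> holomorphic_on ball w r" "0 < r" "0 < \<epsilon>"
  obtains \<rho> where "0 < \<rho>" "ra_bound \<rho> (\<lambda>z. \<phi> (w + z) - \<phi> w) \<epsilon>"
proof -
  define a where "a n = (deriv ^^ n) \<phi> w / fact n" for n
  define R where "R = r / 2"
  have R: "0 < R" "R < r" using assms by (auto simp: R_def)
  have sums: "(\<lambda>n. a n * z ^ n) sums \<phi> (w + z)" if "norm z < r" for z
    using holomorphic_power_series[OF assms(1), of "w + z"] that by (simp add: a_def dist_norm)
  have abs_sm: "summable (\<lambda>n. norm (a n * z ^ n))" if z: "norm z \<le> R" for z
  proof (rule powser_insidea)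
    show "summable (\<lambda>n. a n * (of_real ((R + r) / 2)) ^ n)"
      by (rule sums_summable[OF sums], unfold norm_of_real) (use R in simp)
    show "norm z < norm (complex_of_real ((R + r) / 2))"
      using z R unfolding norm_of_real by simp
  qed
  have "summable (\<lambda>n. norm (a n) * R ^ n)"
    using abs_sm[of "of_real R"] R by (simp add: norm_mult norm_power)
  then have smR: "(\<lambda>n. norm (a n) * R ^ n) summable_on UNIV"
    using R by (subst summable_on_UNIV_nonneg_real_iff) auto
  define C where "C = (\<Sum>\<^sub>\<infinity>n. norm (a n) * R ^ n)"
  have C: "0 \<le> C" unfolding C_def by (rule infsum_nonneg) (use R in auto)
  \<comment> \<open>Shrinking the radius by \<open>t \<le> 1\<close> multiplies the
    \<open>n\<close>-th term by \<open>t ^ n \<le> t\<close> for \<open>n \<ge> 1\<close>, so the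
    bound becomes at most \<open>t * C\<close>. The summand 1 keeps \<open>t\<close> positive when
    \<open>C = 0\<close>.\<close>
  define t where "t = min 1 (\<epsilon> / (C + 1))"
  have t: "0 < t" "t \<le> 1" "t * C \<le> \<epsilon>"
    using assms(3) C by (auto simp: t_def min_def field_simps)
  define b where "b n = (if n = 0 then 0 else a n)" for n
  define \<rho> where "\<rho> = t * R / 2"
  have \<rho>: "0 < \<rho>" using t R by (simp add: \<rho>_def)
  have le: "norm (b n) * (2 * \<rho>) ^ n \<le> t * (norm (a n) * R ^ n)" for n
  proof (cases n)
    case (Suc m)
    have "t ^ n \<le> t" using power_decreasing[of 1 n t] t Suc by simp
    then have "t ^ n * (norm (a n) * R ^ n) \<le> t * (norm (a n) * R ^ n)"
      using R by (intro mult_right_mono) auto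
    then show ?thesis using Suc by (simp add: b_def \<rho>_def power_mult_distrib mult_ac)
  qed (use t in \<open>simp add: b_def\<close>)
  have sb: "(\<lambda>n. norm (b n) * (2 * \<rho>) ^ n) summable_on UNIV"
    by (rule summable_on_comparison_test[OF summable_on_cmult_right[OF smR, of t]])
      (use le \<rho> in auto)
  have "(\<Sum>\<^sub>\<infinity>n. norm (b n) * (2 * \<rho>) ^ n) \<le> (\<Sum>\<^sub>\<infinity>n. t * (norm (a n) * R ^ n))"
    by (rule infsum_mono[OF sb summable_on_cmult_right[OF smR, of t]]) (rule le)
  also have "\<dots> = t * C" by (simp add: infsum_cmult_right' C_def)
  finally have "(\<Sum>\<^sub>\<infinity>n. norm (b n) * (2 * \<rho>) ^ n) \<le> \<epsilon>" using t(3) by simp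
  moreover have "ra_bound \<rho> (\<lambda>z. \<phi> (w + z) - \<phi> w) (\<Sum>\<^sub>\<infinity>n. norm (b n) * (2 * \<rho>) ^ n)"
  proof (rule ra_bound_power_series[OF sb])
    fix z :: complex assume "norm z \<le> 2 * \<rho>"
    moreover have "2 * \<rho> \<le> R" using t(2) R by (simp add: \<rho>_def)
    ultimately have z: "norm z \<le> R" by simp
    have "((\<lambda>n. a n * z ^ n) has_sum \<phi> (w + z)) UNIV"
      by (rule norm_summable_imp_has_sum[OF abs_sm[OF z] sums]) (use z R in simp)
    moreover have "((\<lambda>n. if n = 0 then - \<phi> w else 0) has_sum - \<phi> w) UNIV"
      by (rule has_sum_finite_neutralI[of "{0}"]) auto
    ultimately have "((\<lambda>n. a n * z ^ n + (if n = 0 then - \<phi> w else 0)) has_sum (\<phi> (w + z) + - \<phi> w)) UNIV"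
      by (rule has_sum_add)
    moreover have "a n * z ^ n + (if n = 0 then - \<phi> w else 0) = b n * z ^ n" for n
      by (simp add: b_def a_def)
    ultimately show "((\<lambda>n. b n * z ^ n) has_sum \<phi> (w + z) - \<phi> w) UNIV" by simp
  qed (use \<rho> in simp)
  ultimately show thesis using that \<rho> ra_bound_mono by blast
qed

text \<open>The real and imaginary parts of \<open>\<xi>\<close> are
  \<open>(\<xi> + cnj \<xi>) / 2\<close> and \<open>(\<xi> - cnj \<xi>) / (2 * \<i>)\<close>, so
  both inherit the bound \<open>R\<close> of \<open>\<xi>\<close>. Substituted in the outer series
  they give monomials whose bounds are exactly its summable weights
  \<open>R ^ (m + n)\<close>.\<close>

lemma real_analytic_on_compose_holomorphic:
  assumes f: "real_analytic_on f U" and \<phi>: "\<phi> holomorphic_on V" "open V" "\<phi> ` V \<subseteq> U"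
  shows "real_analytic_on (\<lambda>z. f (\<phi> z)) V"
  unfolding real_analytic_on_iff_ra_bound
proof
  fix w assume w: "w \<in> V"
  obtain r where r: "0 < r" "ball w r \<subseteq> V"
    using \<phi>(2) w by (auto simp: open_contains_ball)
  obtain R K where R: "0 < R" "ra_bound R (\<lambda>z. f (\<phi> w + z)) K"
    using f \<phi>(3) w unfolding real_analytic_on_iff_ra_bound by blast
  obtain c where sm: "(\<lambda>(m, n). norm (c m n) * R ^ (m + n)) summable_on UNIV"
    and hs: "\<And>z. \<bar>Re z\<bar> \<le> R \<Longrightarrow> \<bar>Im z\<bar> \<le> R \<Longrightarrow>
       ((\<lambda>(m, n). c m n * of_real (Re z) ^ m * of_real (Im z) ^ n) has_sum f (\<phi> w + z)) UNIV"
    by (rule ra_boundE[OF R(2)], rule that; assumption)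
  obtain \<rho> where \<rho>: "0 < \<rho>" "ra_bound \<rho> (\<lambda>z. \<phi> (w + z) - \<phi> w) R"
    using holomorphic_ra_bound_small[OF holomorphic_on_subset[OF \<phi>(1) r(2)] r(1) R(1)] by metis
  define \<xi> where "\<xi> z = \<phi> (w + z) - \<phi> w" for z
  have "ra_bound \<rho> (\<lambda>z. (1/2) * (\<xi> z + cnj (\<xi> z))) (norm (1/2::complex) * (R + R))"
    unfolding \<xi>_def using \<rho> by (intro ra_bound_cmult ra_bound_add ra_bound_cnj) auto
  then have re: "ra_bound \<rho> (\<lambda>z. of_real (Re (\<xi> z))) R"
    by (simp add: complex_add_cnj)
  have "ra_bound \<rho> (\<lambda>z. (1/(2*\<i>)) * (\<xi> z + (-1) * cnj (\<xi> z))) (norm (1/(2*\<i>)) * (R + norm (-1::complex) * R))"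
    unfolding \<xi>_def using \<rho> by (intro ra_bound_cmult ra_bound_add ra_bound_cnj) auto
  moreover have "(1/(2*\<i>)) * (\<xi> z + (-1) * cnj (\<xi> z)) = of_real (Im (\<xi> z))" for z
    using complex_diff_cnj[of "\<xi> z"] by (simp add: field_simps)
  ultimately have im: "ra_bound \<rho> (\<lambda>z. of_real (Im (\<xi> z))) R"
    by (simp add: norm_divide norm_mult)
  \<comment> \<open>The bound also majorises values, hence \<open>\<xi> z\<close> stays in the
    square on which the outer series represents \<open>f\<close>.\<close>
  have bd: "norm (g z) \<le> R" if gz: "ra_bound \<rho> g R" "\<bar>Re z\<bar> \<le> \<rho>" "\<bar>Im z\<bar> \<le> \<rho>" for g z
  proof -
    obtain d where d: "(\<lambda>(m, n). norm (d m n) * \<rho> ^ (m + n)) summable_on UNIV"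
      "(\<Sum>\<^sub>\<infinity>(m, n). norm (d m n) * \<rho> ^ (m + n)) \<le> R"
      "\<And>z. \<bar>Re z\<bar> \<le> \<rho> \<Longrightarrow> \<bar>Im z\<bar> \<le> \<rho> \<Longrightarrow>
       ((\<lambda>(m, n). d m n * of_real (Re z) ^ m * of_real (Im z) ^ n) has_sum g z) UNIV"
      by (rule ra_boundE[OF gz(1)], rule that; assumption)
    have "norm (g z) \<le> (\<Sum>\<^sub>\<infinity>(m, n). norm (d m n) * \<rho> ^ (m + n))"
    proof (rule norm_infsum_le[OF d(3)[OF gz(2,3)] has_sum_infsum[OF d(1)]])
      fix p :: "nat \<times> nat"
      obtain m n where p: "p = (m, n)" by force
      have "\<bar>Re z\<bar> ^ m * \<bar>Im z\<bar> ^ n \<le> \<rho> ^ m * \<rho> ^ n"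
        by (intro mult_mono power_mono gz) (use \<rho> in auto)
      from mult_left_mono[OF this norm_ge_zero[of "d m n"]]
      show "norm (case p of (m, n) \<Rightarrow> d m n * of_real (Re z) ^ m * of_real (Im z) ^ n)
        \<le> (case p of (m, n) \<Rightarrow> norm (d m n) * \<rho> ^ (m + n))"
        by (simp add: p norm_mult norm_power power_add mult.assoc)
    qed
    then show ?thesis using d(2) by simp
  qed
  have "ra_bound \<rho> (\<lambda>z. f (\<phi> (w + z))) (infsum (\<lambda>(m, n). norm (c m n) * R ^ (m + n)) UNIV)"
  proof (rule ra_bound_infsum[OF _ sm])
    fix p :: "nat \<times> nat"
    obtain m n where p: "p = (m, n)" by force
    have "ra_bound \<rho> (\<lambda>z. c m n * (of_real (Re (\<xi> z)) ^ m * of_real (Im (\<xi> z)) ^ n))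
      (norm (c m n) * (R ^ m * R ^ n))"
      by (intro ra_bound_cmult ra_bound_mult ra_bound_power re im) (use \<rho> in auto)
    then show "ra_bound \<rho> (case p of (m, n) \<Rightarrow>
        (\<lambda>z. c m n * (of_real (Re (\<xi> z)) ^ m * of_real (Im (\<xi> z)) ^ n)))
      (case p of (m, n) \<Rightarrow> norm (c m n) * R ^ (m + n))"
      by (simp add: p power_add)
  next
    fix z assume z: "\<bar>Re z\<bar> \<le> \<rho>" "\<bar>Im z\<bar> \<le> \<rho>"
    have "\<bar>Re (\<xi> z)\<bar> \<le> R" "\<bar>Im (\<xi> z)\<bar> \<le> R"
      using bd[OF re z] bd[OF im z] by simp_all
    from hs[OF this] show "((\<lambda>p. (case p of (m, n) \<Rightarrow>
        (\<lambda>z. c m n * (of_real (Re (\<xi> z)) ^ m * of_real (Im (\<xi> z)) ^ n))) z)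
      has_sum f (\<phi> (w + z))) UNIV"
      by (simp add: \<xi>_def case_prod_unfold mult.assoc)
  qed (use \<rho> in auto)
  then show "\<exists>\<rho>>0. \<exists>K. ra_bound \<rho> (\<lambda>z. f (\<phi> (w + z))) K" using \<rho> by blast
qed

lemma real_analytic_on_id: "real_analytic_on (\<lambda>z. z) U"
  unfolding real_analytic_on_iff_ra_bound
proof
  fix w
  have "ra_bound 1 (\<lambda>z. w + z) (norm w + 2 * 1)"
    by (intro ra_bound_add ra_bound_const ra_bound_id) auto
  then show "\<exists>\<rho>>0. \<exists>K. ra_bound \<rho> (\<lambda>z. w + z) K" by (intro exI[of _ 1]) auto
qed

lemma holomorphic_imp_real_analytic_on:
  assumes "f holomorphic_on U" "open U"
  shows "real_analytic_on f U"
  using real_analytic_on_compose_holomorphic[OF real_analytic_on_id[of UNIV] assms] by simp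

text \<open>The principal powers are holomorphic only off the non-positive axis. On the plane slit
  along the non-negative axis the function is reached through \<open>- z\<close>, at the price of a
  sign, and the two slit planes cover everything but 0.\<close>

lemma real_analytic_on_zpow:
  assumes "r - s \<in> \<int>"
  shows "real_analytic_on (\<lambda>z. zpow z r s) (- {0})"
proof -
  have slit: "real_analytic_on (\<lambda>z. zpow z r s) (- \<real>\<^sub>\<le>\<^sub>0)" 
    unfolding zpow_def
    by (intro real_analytic_on_mult real_analytic_on_cnj holomorphic_imp_real_analytic_on)
      (auto intro!: holomorphic_intros simp: open_Compl)
  have "real_analytic_on (\<lambda>z. zpow (- z) r s) (uminus -` (- \<real>\<^sub>\<le>\<^sub>0))"
    by (rule real_analytic_on_compose_holomorphic[OF slit])
      (auto intro!: holomorphic_intros open_vimage continuous_intros simp: open_Compl)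
  then have "real_analytic_on (\<lambda>z. sign_pow (r - s) * zpow (- z) r s) (uminus -` (- \<real>\<^sub>\<le>\<^sub>0))"
    by (intro real_analytic_on_mult real_analytic_on_const)
  then have "real_analytic_on (\<lambda>z. zpow z r s) (uminus -` (- \<real>\<^sub>\<le>\<^sub>0))"
    by (simp add: zpow_uminus[OF assms] flip: mult.assoc)
  then have "real_analytic_on (\<lambda>z. zpow z r s) (- \<real>\<^sub>\<le>\<^sub>0 \<union> uminus -` (- \<real>\<^sub>\<le>\<^sub>0))"
    using slit real_analytic_on_Un by blast
  moreover have "- {0} \<subseteq> - \<real>\<^sub>\<le>\<^sub>0 \<union> uminus -` (- \<real>\<^sub>\<le>\<^sub>0 :: complex set)"
    by (auto simp: complex_nonpos_Reals_iff complex_eq_iff)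
  ultimately show ?thesis using real_analytic_on_subset by blast
qed

text \<open>
  Along a real line through a point \<open>w'\<close>, a real analytic function is the restriction of
  a holomorphic function on a disc whose radius does not depend on \<open>w'\<close>, so the Taylor series at \<open>w'\<close>
  converges to it beyond the domain where it is known to be holomorphic.
\<close>

lemma real_analytic_holomorphic_propagation:
  assumes g: "real_analytic_on g U" and U: "open U" "connected U"
    and V: "open V" "V \<noteq> {}" "V \<subseteq> U" "g holomorphic_on V"
  shows "g holomorphic_on U"
proof -
  define S where "S = {w\<in>U. \<exists>r>0. g holomorphic_on ball w r}"
  have "openin (top_of_set U) S"
  proof -
    have "open S"
      unfolding open_contains_ball
    proof
      fix w assume "w \<in> S"
      then obtain r where r: "r > 0" "g holomorphic_on ball w r" and w: "w \<in> U"
        unfolding S_def by blast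
      obtain r' where r': "r' > 0" "ball w r' \<subseteq> U"
        using U(1) w by (auto simp: open_contains_ball)
      have "z \<in> S" if "z \<in> ball w (min r r')" for z
      proof -
        have "z \<in> ball w r" using that by simp
        then obtain e where "e > 0" "ball z e \<subseteq> ball w r"
          using open_ball[of w r] unfolding open_contains_ball by blast
        then have "\<exists>e>0. g holomorphic_on ball z e"
          using holomorphic_on_subset[OF r(2)] by blast
        moreover have "z \<in> U" using that r'(2) by auto
        ultimately show ?thesis unfolding S_def by simp
      qed
      then show "\<exists>e>0. ball w e \<subseteq> S" using r(1) r'(1) by (intro exI[of _ "min r r'"]) auto
    qed
    moreover have "S \<subseteq> U" unfolding S_def by blast
    ultimately show ?thesis by (simp add: open_subset)
  qed
  moreover have "closedin (top_of_set U) S"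
  proof -
    have "w \<in> S" if w: "w \<in> U" "w \<in> closure S" for w
    proof -
      obtain \<rho> K where \<rho>: "\<rho> > 0" "ra_bound \<rho> (\<lambda>z. g (w + z)) K"
        using g w(1) unfolding real_analytic_on_iff_ra_bound by blast
      obtain c where sm: "(\<lambda>(m, n). norm (c m n) * \<rho> ^ (m + n)) summable_on UNIV"
        and hs: "\<And>z. \<bar>Re z\<bar> \<le> \<rho> \<Longrightarrow> \<bar>Im z\<bar> \<le> \<rho> \<Longrightarrow>
           ((\<lambda>(m, n). c m n * of_real (Re z) ^ m * of_real (Im z) ^ n) has_sum g (w + z)) UNIV"
        by (rule ra_boundE[OF \<rho>(2)], rule that; assumption)
      have "0 < \<rho> / 3" using \<rho>(1) by simp
      then obtain w' where w': "w' \<in> S" "dist w' w < \<rho> / 3"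
        using w(2) unfolding closure_approachable by blast
      obtain r where r: "r > 0" "g holomorphic_on ball w' r"
        using w'(1) unfolding S_def by blast
      define v where "v = w' - w"
      \<comment> \<open>Two requirements: \<open>\<rho> / 3 + \<delta> \<le> \<rho>\<close>, so that
        the complexified line through \<open>w'\<close> stays where the series at \<open>w\<close>
        converges for parameters up to \<open>\<delta>\<close>, and
        \<open>\<delta> > \<rho> / 3\<close>, so that the disc around \<open>w'\<close> contains
        \<open>w\<close>.\<close>
      define \<delta> where "\<delta> = \<rho> / 2"
      have nv: "norm v < \<rho> / 3" using w'(2) by (simp add: v_def dist_norm)
      have bound: "\<bar>x\<bar> + \<delta> \<le> \<rho>" if "\<bar>x\<bar> \<le> norm v" for x
        using nv that \<rho>(1) by (simp add: \<delta>_def)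
      have "(\<lambda>n. (deriv ^^ n) g w' / fact n * (z - w') ^ n) sums g z" if z: "z \<in> ball w' \<delta>" for z
      proof (cases "z = w'")
        case True
        then show ?thesis using r(1) holomorphic_power_series[OF r(2), of w'] by simp
      next
        case False
        define T where "T = norm (z - w')"
        define e where "e = (z - w') / of_real T"
        have e: "norm e = 1" "z = w' + of_real T * e"
          using False by (simp_all add: e_def T_def norm_divide)
        have T: "0 < T" "T < \<delta>" using False z by (auto simp: T_def dist_norm norm_minus_commute)
        \<comment> \<open>The real coordinates of \<open>v + t * e\<close> with the parameter made
          complex; the series of \<open>g\<close> at \<open>w\<close>, evaluated in them, is
          holomorphic in \<open>t\<close>.\<close>
        define X where "X t = of_real (Re v) + t * of_real (Re e)" for t :: complex
        define Y where "Y t = of_real (Im v) + t * of_real (Im e)" for t :: complex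
        have re: "\<bar>Re e\<bar> \<le> 1" "\<bar>Im e\<bar> \<le> 1"
          using abs_Re_le_cmod[of e] abs_Im_le_cmod[of e] e(1) by auto
        have X: "norm (X t) \<le> \<rho>" if "norm t \<le> \<delta>" for t
        proof -
          have "norm (X t) \<le> \<bar>Re v\<bar> + norm t * \<bar>Re e\<bar>"
            unfolding X_def by (rule norm_triangle_le) (simp add: norm_mult)
          also have "\<dots> \<le> \<bar>Re v\<bar> + \<delta> * 1"
            by (intro add_left_mono mult_mono) (use that re order_trans[OF norm_ge_zero that] in auto)
          also have "\<dots> \<le> \<rho>" using bound[OF abs_Re_le_cmod] by simp
          finally show ?thesis .
        qed
        have Y: "norm (Y t) \<le> \<rho>" if "norm t \<le> \<delta>" for t
        proof -
          have "norm (Y t) \<le> \<bar>Im v\<bar> + norm t * \<bar>Im e\<bar>"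
            unfolding Y_def by (rule norm_triangle_le) (simp add: norm_mult)
          also have "\<dots> \<le> \<bar>Im v\<bar> + \<delta> * 1"
            by (intro add_left_mono mult_mono) (use that re order_trans[OF norm_ge_zero that] in auto)
          also have "\<dots> \<le> \<rho>" using bound[OF abs_Im_le_cmod] by simp
          finally show ?thesis .
        qed
        define P where "P p t = (case p of (m, n) \<Rightarrow> c m n * X t ^ m * Y t ^ n)" for p t
        define G where "G t = (\<Sum>\<^sub>\<infinity>p. P p t)" for t
        have ul: "uniform_limit (cball 0 \<delta>) (\<lambda>A t. \<Sum>p\<in>A. P p t) G (finite_subsets_at_top UNIV)"
          unfolding G_def
        proof (rule Weierstrass_m_test_general[OF _ sm])
          fix p :: "nat \<times> nat" and t :: complex assume "t \<in> cball 0 \<delta>"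
          then have t: "norm t \<le> \<delta>" by simp
          obtain m n where p: "p = (m, n)" by force
          have "norm (X t) ^ m * norm (Y t) ^ n \<le> \<rho> ^ m * \<rho> ^ n"
            by (intro mult_mono power_mono X[OF t] Y[OF t]) (use \<rho> in auto)
          from mult_left_mono[OF this norm_ge_zero[of "c m n"]]
          show "norm (P p t) \<le> (case p of (m, n) \<Rightarrow> norm (c m n) * \<rho> ^ (m + n))"
            by (simp add: p P_def norm_mult norm_power power_add mult.assoc)
        qed
        have holP: "(\<lambda>t. \<Sum>p\<in>A. P p t) holomorphic_on B" for A B
          unfolding P_def X_def Y_def case_prod_unfold by (intro holomorphic_intros)
        have holG: "G holomorphic_on ball 0 \<delta>"
          by (rule holomorphic_uniform_limit[OF _ ul])
            (use holP in \<open>auto intro!: always_eventually holomorphic_on_imp_continuous_on\<close>)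
        have Greal: "G (of_real t) = g (w' + of_real t * e)" if t: "\<bar>t\<bar> < \<delta>" for t
        proof -
          let ?z = "v + of_real t * e"
          have Xt: "X (of_real t) = of_real (Re ?z)" "Y (of_real t) = of_real (Im ?z)"
            by (simp_all add: X_def Y_def)
          have "\<bar>Re ?z\<bar> \<le> \<rho>" "\<bar>Im ?z\<bar> \<le> \<rho>"
            using X[of "of_real t"] Y[of "of_real t"] t unfolding Xt norm_of_real by auto
          from hs[OF this] have "((\<lambda>p. P p (of_real t)) has_sum g (w + ?z)) UNIV"
            unfolding P_def Xt .
          then have "G (of_real t) = g (w + ?z)" unfolding G_def by (rule infsumI)
          then show ?thesis by (simp add: v_def)
        qed
        define q where "q = min r \<delta>"
        have \<delta>: "0 < \<delta>" using \<rho> by (simp add: \<delta>_def)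
        have q: "0 < q" "q \<le> r" "q \<le> \<delta>" using r(1) \<delta> by (auto simp: q_def)
        have inb: "w' + t * e \<in> ball w' r" if "norm t < q" for t
          using that e(1) q by (simp add: dist_norm norm_mult)
        have holg: "(\<lambda>t. g (w' + t * e)) holomorphic_on ball 0 q"
          by (rule holomorphic_on_compose_gen[OF _ r(2), unfolded o_def])
            (use inb in \<open>auto intro!: holomorphic_intros\<close>)
        \<comment> \<open>Both are holomorphic in \<open>t\<close> near 0 and agree on a real
          segment, so the Taylor coefficients of \<open>G\<close> at 0 are those of \<open>g\<close>
          at \<open>w'\<close> times powers of \<open>e\<close>. Only \<open>G\<close> is known to
          be holomorphic up to \<open>\<delta>\<close>, and its series at \<open>t = T\<close> is
          the one that converges to \<open>g z\<close>.\<close>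
        have eqG: "G t - g (w' + t * e) = 0" if "t \<in> ball 0 q" for t
        proof (rule analytic_continuation[of "\<lambda>t. G t - g (w' + t * e)" "ball 0 q" "of_real ` {0<..<q}" 0 t])
          show "(\<lambda>t. G t - g (w' + t * e)) holomorphic_on ball 0 q"
            by (intro holomorphic_on_diff holg holomorphic_on_subset[OF holG]) (use q in auto)
          show "of_real ` {0<..<q} \<subseteq> ball (0::complex) q" by auto
          show "(0::complex) islimpt of_real ` {0<..<q}"
            unfolding islimpt_approachable
          proof (intro allI impI)
            fix d :: real assume "d > 0"
            define x where "x = min d q / 2"
            have "0 < x" "x < q" "x < d" using \<open>d > 0\<close> q(1) by (auto simp: x_def)
            then show "\<exists>x'\<in>of_real ` {0<..<q}. x' \<noteq> (0::complex) \<and> dist x' 0 < d"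
              by (intro bexI[of _ "of_real x"]) auto
          qed
          show "G s - g (w' + s * e) = 0" if "s \<in> of_real ` {0<..<q}" for s
            using that Greal q by auto
        qed (use q that in auto)
        have sumsG: "(\<lambda>n. (deriv ^^ n) G 0 / fact n * (of_real T) ^ n) sums g z"
          using holomorphic_power_series[OF holG, of "of_real T"] T Greal[of T] e(2) by simp
        have "(deriv ^^ n) G 0 / fact n * of_real T ^ n = (deriv ^^ n) g w' / fact n * (z - w') ^ n" for n
        proof -
          have "G holomorphic_on ball 0 q"
            by (rule holomorphic_on_subset[OF holG]) (use q in auto)
          then have "(deriv ^^ n) G 0 = (deriv ^^ n) (\<lambda>t. g (w' + t * e)) 0"
            by (rule higher_deriv_transform_within_open[OF _ holg open_ball]) (use eqG q in simp_all)
          also have "\<dots> = e ^ n * (deriv ^^ n) g (e * 0 + w')"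
            using higher_deriv_compose_linear'[of g "ball w' r" "ball 0 q" 0 e w' n] r(2) q inb
            by (simp add: mult.commute add.commute)
          finally show ?thesis using e(2) by (simp add: power_mult_distrib)
        qed
        then show ?thesis using sumsG by simp
      qed
      then have "g holomorphic_on ball w' \<delta>"
        by (intro power_series_holomorphic[of w' \<delta> "\<lambda>n. (deriv ^^ n) g w' / fact n"])
      moreover have "w \<in> ball w' \<delta>"
        using w'(2) \<rho>(1) by (simp add: \<delta>_def)
      then obtain e where "e > 0" "ball w e \<subseteq> ball w' \<delta>"
        using open_ball[of w' \<delta>] unfolding open_contains_ball by blast
      ultimately have "\<exists>e>0. g holomorphic_on ball w e"
        using holomorphic_on_subset by blast
      then show ?thesis unfolding S_def using w(1) by simp
    qed
    moreover have SU: "S \<subseteq> U" unfolding S_def by blast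
    ultimately show ?thesis
      unfolding closedin_closed by (intro exI[of _ "closure S"]) (use closure_subset[of S] SU in blast)
  qed
  moreover have "S \<noteq> {}"
  proof -
    obtain v where v: "v \<in> V" using V(2) by blast
    then obtain r where "r > 0" "ball v r \<subseteq> V" using V(1) by (auto simp: open_contains_ball)
    then have "\<exists>e>0. g holomorphic_on ball v e"
      using holomorphic_on_subset[OF V(4)] by blast
    then have "v \<in> S" unfolding S_def using v V(3) by blast
    then show ?thesis by blast
  qed
  ultimately have "S = U" using U(2) unfolding connected_clopen by metis
  then have loc: "\<exists>r>0. g holomorphic_on ball z r" if "z \<in> U" for z
    using that unfolding S_def by blast
  show ?thesis
    unfolding holomorphic_on_def
  proof
    fix z assume "z \<in> U"
    then obtain r where "r > 0" "g holomorphic_on ball z r" using loc by blast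
    then have "g field_differentiable at z"
      by (intro holomorphic_on_imp_differentiable_at[of g "ball z r"]) auto
    then show "g field_differentiable at z within U"
      by (rule field_differentiable_at_within)
  qed
qed

section \<open>Expansions\<close>

lemma has_sum_reindex_support:
  assumes "inj \<iota>" "\<And>x. x \<notin> range \<iota> \<Longrightarrow> T x = 0"
  shows "(T has_sum s) UNIV \<longleftrightarrow> ((\<lambda>x. T (\<iota> x)) has_sum s) UNIV"
proof -
  have "(T has_sum s) UNIV \<longleftrightarrow> (T has_sum s) (range \<iota>)"
    by (rule has_sum_cong_neutral) (use assms(2) in auto)
  also have "\<dots> \<longleftrightarrow> ((\<lambda>x. T (\<iota> x)) has_sum s) UNIV"
    using has_sum_reindex[OF assms(1)] by (simp add: o_def)
  finally show ?thesis .
qed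

lemma has_sum_times_complex:
  fixes f :: "'i \<Rightarrow> complex" and g :: "'j \<Rightarrow> complex"
  assumes "(f has_sum x) A" "(g has_sum y) B"
  shows "((\<lambda>(i, j). f i * g j) has_sum (x * y)) (A \<times> B)"
proof (rule has_sum_SigmaI)
  show "((\<lambda>j. case (i, j) of (i, j) \<Rightarrow> f i * g j) has_sum (f i * y)) B" for i
    using has_sum_cmult_right[OF assms(2)] by simp
  show "((\<lambda>i. f i * y) has_sum x * y) A"
    using has_sum_cmult_left[OF assms(1)] by simp
  have f: "(\<lambda>i. norm (f i)) summable_on A"
    using has_sum_imp_summable[OF assms(1)] summable_on_iff_abs_summable_on_complex by metis
  have g: "(\<lambda>j. norm (g j)) summable_on B"
    using has_sum_imp_summable[OF assms(2)] summable_on_iff_abs_summable_on_complex by metis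
  have "(\<lambda>(i, j). norm (f i) * norm (g j)) summable_on (A \<times> B)"
  proof (rule summable_on_SigmaI)
    show "((\<lambda>j. case (i, j) of (i, j) \<Rightarrow> norm (f i) * norm (g j)) has_sum (norm (f i) * infsum (\<lambda>j. norm (g j)) B)) B" for i
      using has_sum_cmult_right[OF has_sum_infsum[OF g]] by simp
    show "(\<lambda>i. norm (f i) * infsum (\<lambda>j. norm (g j)) B) summable_on A"
      by (rule summable_on_cmult_left[OF f])
  qed auto
  then have "(\<lambda>p. norm (case p of (i, j) \<Rightarrow> f i * g j)) summable_on (A \<times> B)"
    by (simp add: case_prod_unfold norm_mult)
  then show "(\<lambda>(i, j). f i * g j) summable_on A \<times> B"
    by (rule abs_summable_summable)
qed

text \<open>A monomial on an annulus is dominated by the sum of its sizes on the two boundary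
  circles, whatever the sign of the exponent; this yields summable majorants on compact
  sets.\<close>

lemma powr_le_add_powr:
  fixes m M t x :: real
  assumes "0 < m" "m \<le> x" "x \<le> M"
  shows "x powr t \<le> m powr t + M powr t"
proof (cases "0 \<le> t")
  case True
  then have "x powr t \<le> M powr t" using assms by (intro powr_mono2) auto
  then show ?thesis using powr_ge_zero[of m t] by linarith
next
  case False
  then have "x powr t \<le> m powr t" using assms by (intro powr_mono2') auto
  then show ?thesis using powr_ge_zero[of M t] by linarith
qed

text \<open>Pointwise convergence suffices, since the norm of a monomial is monotone in the radius.\<close>

lemma has_conformal_expansion_iff:
  "has_conformal_expansion g a \<longleftrightarrow> a \<in> laurent_series \<and>
    (\<exists>R>0. \<forall>p. 0 < norm p \<and> norm p < R \<longrightarrow> ((\<lambda>(r, s). a r s * zpow p r s) has_sum g p) UNIV)"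
  (is "?L \<longleftrightarrow> ?R")
proof
  assume ?L
  then obtain R where a: "a \<in> laurent_series" and R: "R > 0" and
    ul: "\<And>K. compact K \<Longrightarrow> K \<subseteq> ball 0 R - {0} \<Longrightarrow>
           uniform_limit K (\<lambda>A p. \<Sum>(r, s)\<in>A. a r s * zpow p r s) g (finite_subsets_at_top UNIV)"
    unfolding has_conformal_expansion_def by auto
  have "((\<lambda>(r, s). a r s * zpow p r s) has_sum g p) UNIV" if p: "0 < norm p \<and> norm p < R" for p
  proof -
    have "uniform_limit {p} (\<lambda>A p. \<Sum>(r, s)\<in>A. a r s * zpow p r s) g (finite_subsets_at_top UNIV)"
      by (rule ul) (use p in auto)
    then have "((\<lambda>A. \<Sum>(r, s)\<in>A. a r s * zpow p r s) \<longlongrightarrow> g p) (finite_subsets_at_top UNIV)"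
      by (rule tendsto_uniform_limitI) simp
    then show ?thesis by (simp add: has_sum_def)
  qed
  then show ?R using a R by auto
next
  assume ?R
  then obtain R where a: "a \<in> laurent_series" and R: "R > 0" and
    hs: "\<And>p. 0 < norm p \<Longrightarrow> norm p < R \<Longrightarrow> ((\<lambda>(r, s). a r s * zpow p r s) has_sum g p) UNIV"
    by auto
  have sm: "(\<lambda>(r, s). norm (a r s * zpow p r s)) summable_on UNIV" if p: "0 < norm p" "norm p < R" for p
  proof -
    have "(\<lambda>q. norm (case q of (r, s) \<Rightarrow> a r s * zpow p r s)) summable_on UNIV"
      using has_sum_imp_summable[OF hs[OF p]] summable_on_iff_abs_summable_on_complex by metis
    then show ?thesis by (simp add: case_prod_unfold)
  qed
  have "uniform_limit K (\<lambda>A p. \<Sum>(r, s)\<in>A. a r s * zpow p r s) g (finite_subsets_at_top UNIV)"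
    if K: "compact K" "K \<subseteq> ball 0 R - {0}" for K
  proof (cases "K = {}")
    case False
    have "continuous_on K norm" by (intro continuous_intros)
    then obtain p0 p1 where p0: "p0 \<in> K" "\<And>p. p \<in> K \<Longrightarrow> norm p0 \<le> norm p"
      and p1: "p1 \<in> K" "\<And>p. p \<in> K \<Longrightarrow> norm p \<le> norm p1"
      using continuous_attains_inf[OF K(1) False] continuous_attains_sup[OF K(1) False] by metis
    have m: "0 < norm p0" "norm p0 < R" "0 < norm p1" "norm p1 < R"
      using p0(1) p1(1) K(2) by auto
    have "uniform_limit K (\<lambda>A p. \<Sum>q\<in>A. (case q of (r, s) \<Rightarrow> a r s * zpow p r s)) g (finite_subsets_at_top UNIV)"
    proof (rule Weierstrass_m_test_general')
      show "(\<lambda>q. (case q of (r, s) \<Rightarrow> norm (a r s * zpow p0 r s)) +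
        (case q of (r, s) \<Rightarrow> norm (a r s * zpow p1 r s))) summable_on UNIV"
        by (rule summable_on_add[OF sm[OF m(1,2)] sm[OF m(3,4)]])
      show "((\<lambda>q. case q of (r, s) \<Rightarrow> a r s * zpow p r s) has_sum g p) UNIV" if "p \<in> K" for p
        by (rule hs) (use that K(2) in auto)
      fix q :: "real \<times> real" and p assume p: "p \<in> K"
      obtain r s where q: "q = (r, s)" by force
      have "norm p powr (r + s) \<le> norm p0 powr (r + s) + norm p1 powr (r + s)"
        by (rule powr_le_add_powr) (use m p0 p1 p in auto)
      from mult_left_mono[OF this norm_ge_zero[of "a r s"]]
      show "norm (case q of (r, s) \<Rightarrow> a r s * zpow p r s) \<le> (case q of (r, s) \<Rightarrow> norm (a r s * zpow p0 r s)) +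
        (case q of (r, s) \<Rightarrow> norm (a r s * zpow p1 r s))"
        by (simp add: q norm_mult norm_zpow distrib_left)
    qed
    then show ?thesis by simp
  qed simp
  then show ?L
    unfolding has_conformal_expansion_def using a R sm by auto
qed

section \<open>Cauchy products and binomial series\<close>

lemma finite_series_mult_support:
  fixes a b :: series1
  assumes "\<And>r s. a r s \<noteq> 0 \<Longrightarrow> r \<in> \<nat> \<and> s \<in> \<nat>" "\<And>r s. b r s \<noteq> 0 \<Longrightarrow> N \<le> r \<and> N \<le> s"
  shows "finite {(r, s). a r s \<noteq> 0 \<and> b (x - r) (y - s) \<noteq> 0}"
proof (rule finite_subset)
  let ?I = "\<lambda>x. real ` {..nat \<lceil>x - N\<rceil>}"
  show "finite (?I x \<times> ?I y)" by blast
  have "r \<in> ?I x" if "r \<in> \<nat>" "N \<le> x - r" for r x :: real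
  proof -
    obtain n where n: "r = real n" using \<open>r \<in> \<nat>\<close> Nats_cases by blast
    then have "n \<le> nat \<lceil>x - N\<rceil>" using that(2) by linarith
    then show ?thesis using n by blast
  qed
  then show "{(r, s). a r s \<noteq> 0 \<and> b (x - r) (y - s) \<noteq> 0} \<subseteq> ?I x \<times> ?I y"
    using assms by (auto simp del: atMost_iff)
qed

text \<open>The product of two absolutely convergent sums is regrouped by total exponent. The
  support hypotheses make each group finite, so that its value is the finite sum
  \<open>series_mult\<close>.\<close>

lemma series_mult_has_sum:
  assumes a: "((\<lambda>(r, s). a r s * zpow p r s) has_sum x) UNIV"
    and b: "((\<lambda>(r, s). b r s * zpow p r s) has_sum y) UNIV"
    and supp: "\<And>r s. a r s \<noteq> 0 \<Longrightarrow> r \<in> \<nat> \<and> s \<in> \<nat>" "\<And>r s. b r s \<noteq> 0 \<Longrightarrow> N \<le> r \<and> N \<le> s"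
  shows "((\<lambda>(r, s). series_mult a b r s * zpow p r s) has_sum x * y) UNIV"
proof -
  let ?a = "\<lambda>(r, s). a r s * zpow p r s" and ?b = "\<lambda>(r, s). b r s * zpow p r s"
  have "((\<lambda>(u, v). ?a u * ?b v) has_sum x * y) (UNIV \<times> UNIV)"
    by (rule has_sum_times_complex[OF a b])
  then have "((\<lambda>(w, u). ?a u * ?b (w - u)) has_sum x * y) (UNIV \<times> UNIV)"
    by (rule has_sum_reindex_bij_witness[of _ "\<lambda>(w, u). (u, w - u)" "\<lambda>(u, v). (u + v, u)", THEN iffD1, rotated -1])
      auto
  then have "((\<lambda>w. case w of (r, s) \<Rightarrow> series_mult a b r s * zpow p r s) has_sum x * y) UNIV"
  proof (rule has_sum_SigmaD)
    fix w :: "real \<times> real"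
    obtain X Y where w: "w = (X, Y)" by force
    let ?S = "{(r, s). a r s \<noteq> 0 \<and> b (X - r) (Y - s) \<noteq> 0}"
    have e: "?a u * ?b (w - u) = (case u of (r, s) \<Rightarrow> a r s * b (X - r) (Y - s)) * zpow p X Y" for u
    proof -
      obtain r s where u: "u = (r, s)" by force
      have "zpow p X Y = zpow p r s * zpow p (X - r) (Y - s)"
        by (simp flip: zpow_add)
      then show ?thesis by (simp add: u w)
    qed
    have "((\<lambda>u. ?a u * ?b (w - u)) has_sum (\<Sum>u\<in>?S. ?a u * ?b (w - u))) UNIV"
      by (rule has_sum_finite_neutralI[of ?S])
        (use finite_series_mult_support[of a b N X Y] supp in \<open>auto simp: w\<close>)
    also have "(\<Sum>u\<in>?S. ?a u * ?b (w - u)) = series_mult a b X Y * zpow p X Y"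
      unfolding e by (simp add: series_mult_def sum_distrib_right)
    finally show "((\<lambda>u. case (w, u) of (w, u) \<Rightarrow> ?a u * ?b (w - u))
      has_sum (case w of (r, s) \<Rightarrow> series_mult a b r s * zpow p r s)) UNIV"
      by (simp add: w)
  qed
  then show ?thesis by simp
qed

lemma of_real_gbinomial: "of_real (a gchoose n) = (of_real a gchoose n :: complex)"
  by (simp add: gbinomial_prod_rev)

lemma powr_binomial_has_sum:
  assumes "norm (z::complex) < 1"
  shows "((\<lambda>n. of_real (\<alpha> gchoose n) * z ^ n) has_sum (1 + z) powr of_real \<alpha>) UNIV"
proof -
  have s: "(\<lambda>n. of_real (\<alpha> gchoose n) * w ^ n) sums (1 + w) powr of_real \<alpha>" if "norm w < 1" for w :: complex
    using gen_binomial_complex[OF that, of "of_real \<alpha>"] by (simp add: of_real_gbinomial)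
  define t where "t = (1 + norm z) / 2"
  have t: "norm z < t" "t < 1" using assms by (auto simp: t_def)
  then have t0: "0 \<le> t" using norm_ge_zero[of z] by linarith
  have "summable (\<lambda>n. norm (of_real (\<alpha> gchoose n) * z ^ n :: complex))"
  proof (rule powser_insidea)
    show "summable (\<lambda>n. of_real (\<alpha> gchoose n) * (of_real t) ^ n :: complex)"
      by (rule sums_summable[OF s], unfold norm_of_real) (use t t0 in simp)
  qed (unfold norm_of_real, use t t0 in simp)
  then show ?thesis
    by (rule norm_summable_imp_has_sum[OF _ s[OF assms]])
qed

lemma binomial_series_support: "binomial_series e \<alpha> \<beta> r s \<noteq> 0 \<Longrightarrow> r \<in> \<nat> \<and> s \<in> \<nat>"
  by (auto simp: binomial_series_def split: if_splits)

text \<open>The antiholomorphic factor is the conjugate of a holomorphic binomial series;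
  \<open>e\<close> must be real to survive conjugation, and the two signs are those occurring in the
  expansions.\<close>

lemma binomial_series_has_sum:
  assumes p: "0 < norm p" "norm p < 1" and e: "e = 1 \<or> e = - 1"
  shows "((\<lambda>(r, s). binomial_series e \<alpha> \<beta> r s * zpow p r s) has_sum zpow (1 + e * p) \<alpha> \<beta>) UNIV"
proof -
  let ?\<iota> = "\<lambda>(m, n). (real m, real n)"
  have ne: "norm (e * p) < 1" "norm (e * cnj p) < 1" using p e by (auto simp: norm_mult)
  have "((\<lambda>n. cnj (of_real (\<beta> gchoose n) * (e * p) ^ n)) has_sum cnj ((1 + e * p) powr of_real \<beta>)) UNIV"
    using has_sum_cnj_iff[THEN iffD2, OF powr_binomial_has_sum[OF ne(1)]] .
  moreover have "cnj (of_real (\<beta> gchoose n) * (e * p) ^ n) = of_real (\<beta> gchoose n) * (e * cnj p) ^ n" for n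
    using e by auto
  ultimately have "((\<lambda>n. of_real (\<beta> gchoose n) * (e * cnj p) ^ n) has_sum cnj ((1 + e * p) powr of_real \<beta>)) UNIV"
    by (simp only:)
  from has_sum_times_complex[OF powr_binomial_has_sum[OF ne(1)] this]
  have "((\<lambda>(m, n). of_real (\<alpha> gchoose m) * (e * p) ^ m * (of_real (\<beta> gchoose n) * (e * cnj p) ^ n))
      has_sum zpow (1 + e * p) \<alpha> \<beta>) UNIV"
    by (simp add: zpow_def)
  moreover have "(case ?\<iota> q of (r, s) \<Rightarrow> binomial_series e \<alpha> \<beta> r s * zpow p r s) =
    (case q of (m, n) \<Rightarrow> of_real (\<alpha> gchoose m) * (e * p) ^ m * (of_real (\<beta> gchoose n) * (e * cnj p) ^ n))" for q
    using p by (cases q) (simp add: binomial_series_def zpow_of_nat power_mult_distrib)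
  ultimately have "((\<lambda>q. case ?\<iota> q of (r, s) \<Rightarrow> binomial_series e \<alpha> \<beta> r s * zpow p r s)
      has_sum zpow (1 + e * p) \<alpha> \<beta>) UNIV"
    by simp
  note hs = this
  have inj: "inj ?\<iota>" by (auto simp: inj_def)
  have "(case q of (r, s) \<Rightarrow> binomial_series e \<alpha> \<beta> r s * zpow p r s) = 0" if "q \<notin> range ?\<iota>" for q
  proof (rule ccontr)
    assume "\<not> ?thesis"
    then have "fst q \<in> \<nat>" "snd q \<in> \<nat>" using binomial_series_support by (auto simp: case_prod_unfold)
    then obtain m n where "fst q = real m" "snd q = real n" by (auto elim!: Nats_cases)
    then have "q = ?\<iota> (m, n)" by (simp add: prod_eq_iff)
    then show False using that by blast
  qed
  from has_sum_reindex_support[OF inj this, THEN iffD2, OF _ hs] show ?thesis .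
qed

lemma laurent_series_int:
  assumes "a \<in> laurent_series" "a r s \<noteq> 0"
  shows "r - s \<in> \<int>"
  using assms by (auto simp: laurent_series_def admissible_support_def)

lemma laurent_series_bound:
  assumes "a \<in> laurent_series"
  obtains N where "\<And>r s. a r s \<noteq> 0 \<Longrightarrow> N \<le> r \<and> N \<le> s"
  using assms by (auto simp: laurent_series_def)

lemma series_mult_nonzeroE:
  assumes "series_mult a b x y \<noteq> 0"
  obtains r s where "a r s \<noteq> 0" "b (x - r) (y - s) \<noteq> 0"
proof -
  have "{(r, s). a r s \<noteq> 0 \<and> b (x - r) (y - s) \<noteq> 0} \<noteq> {}"
  proof
    assume E: "{(r, s). a r s \<noteq> 0 \<and> b (x - r) (y - s) \<noteq> 0} = {}"
    have "series_mult a b x y = 0" by (simp only: series_mult_def E sum.empty)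
    with assms show False by simp
  qed
  then show thesis using that by auto
qed

lemma series_mult_binomial_int:
  assumes "series_mult (binomial_series e \<alpha> \<beta>) b x y \<noteq> 0" "\<And>r s. b r s \<noteq> 0 \<Longrightarrow> r - s \<in> \<int>"
  shows "x - y \<in> \<int>"
proof -
  obtain r s where rs: "binomial_series e \<alpha> \<beta> r s \<noteq> 0" "b (x - r) (y - s) \<noteq> 0"
    using assms(1) by (rule series_mult_nonzeroE)
  have "r \<in> \<int>" "s \<in> \<int>" using binomial_series_support[OF rs(1)] Nats_subset_Ints by blast+
  moreover have "x - r - (y - s) \<in> \<int>" by (rule assms(2)[OF rs(2)])
  ultimately have "(x - r - (y - s)) + r - s \<in> \<int>" by (metis Ints_add Ints_diff)
  then show ?thesis by (simp add: algebra_simps)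
qed

text \<open>The restriction to \<open>z2 = 1\<close>.\<close>

definition slice_expansions ::
  "(complex \<times> complex \<Rightarrow> complex) \<Rightarrow> series2 \<Rightarrow> series2 \<Rightarrow> series2 \<Rightarrow> real \<Rightarrow> bool" where
  "slice_expansions \<mu> A B C R \<longleftrightarrow> (\<forall>z. 0 < norm z \<and> norm z < R \<longrightarrow>
     ((\<lambda>(x1, y1, x2, y2). A x1 y1 x2 y2 * zpow (inverse z) x1 y1) has_sum \<mu> (inverse z, 1)) UNIV \<and>
     ((\<lambda>(x0, y0, x2, y2). B x0 y0 x2 y2 * zpow z x0 y0) has_sum \<mu> (1 + z, 1)) UNIV \<and>
     ((\<lambda>(x1, y1, x2, y2). C x1 y1 x2 y2 * zpow z x1 y1) has_sum \<mu> (z, 1)) UNIV)"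

lemma slice_expansionsD:
  assumes "slice_expansions \<mu> A B C R" "0 < norm z" "norm z < R"
  shows "((\<lambda>(x1, y1, x2, y2). A x1 y1 x2 y2 * zpow (inverse z) x1 y1) has_sum \<mu> (inverse z, 1)) UNIV"
    and "((\<lambda>(x0, y0, x2, y2). B x0 y0 x2 y2 * zpow z x0 y0) has_sum \<mu> (1 + z, 1)) UNIV"
    and "((\<lambda>(x1, y1, x2, y2). C x1 y1 x2 y2 * zpow z x1 y1) has_sum \<mu> (z, 1)) UNIV"
proof -
  note h = assms(1)[unfolded slice_expansions_def, THEN spec, THEN mp, OF conjI, OF assms(2,3)]
  show "((\<lambda>(x1, y1, x2, y2). A x1 y1 x2 y2 * zpow (inverse z) x1 y1) has_sum \<mu> (inverse z, 1)) UNIV"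
    by (rule conjunct1[OF h])
  show "((\<lambda>(x0, y0, x2, y2). B x0 y0 x2 y2 * zpow z x0 y0) has_sum \<mu> (1 + z, 1)) UNIV"
    by (rule conjunct1[OF conjunct2[OF h]])
  show "((\<lambda>(x1, y1, x2, y2). C x1 y1 x2 y2 * zpow z x1 y1) has_sum \<mu> (z, 1)) UNIV"
    by (rule conjunct2[OF conjunct2[OF h]])
qed

lemma gcor_fun_slice_analytic:
  assumes "\<alpha>1 - \<beta>1 \<in> \<int>" "\<alpha>2 - \<beta>2 \<in> \<int>" "\<alpha>12 - \<beta>12 \<in> \<int>" "f \<in> F01inf"
  shows "real_analytic_on (\<lambda>z. gcor_fun \<alpha>1 \<alpha>2 \<alpha>12 \<beta>1 \<beta>2 \<beta>12 f (z, 1)) (- {0, 1})"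
proof -
  have f: "real_analytic_on f (- {0, 1})" using assms(4) by (simp add: F01inf_def)
  have o: "open (- {0, 1 :: complex})" by (intro open_Compl finite_imp_closed) simp
  have "real_analytic_on (\<lambda>z. f (1 / z)) (- {0, 1})"
    by (rule real_analytic_on_compose_holomorphic[OF f _ o]) (auto intro!: holomorphic_intros)
  moreover have "real_analytic_on (\<lambda>z. zpow z \<alpha>1 \<beta>1) (- {0, 1})"
    by (rule real_analytic_on_subset[OF real_analytic_on_zpow[OF assms(1)]]) auto
  moreover have "real_analytic_on (\<lambda>z. zpow (z - 1) \<alpha>12 \<beta>12) (- {0, 1})"
    by (rule real_analytic_on_compose_holomorphic[OF real_analytic_on_zpow[OF assms(3)] _ o])
      (auto intro!: holomorphic_intros)
  ultimately show ?thesis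
    unfolding gcor_fun_def by (simp add: real_analytic_on_mult)
qed

text \<open>With \<open>z2 = 1\<close> each expansion depends on one small variable:
  \<open>1/z1\<close> in the first region, \<open>z1 - 1\<close> in the second, \<open>z1\<close> in
  the third. The fixed total degree leaves two free exponents out of four, and the maps
  \<open>?\<iota>\<close> parametrise that support. The radius is at most 1 because of the binomial
  factors.\<close>

lemma gcor_fun_slice_expansions:
  assumes ints: "\<alpha>1 - \<beta>1 \<in> \<int>" "\<alpha>2 - \<beta>2 \<in> \<int>" "\<alpha>12 - \<beta>12 \<in> \<int>"
    and abc: "has_j_zero f a" "has_j_one f b" "has_j_inf f c"
  shows "\<exists>R>0. slice_expansions (gcor_fun \<alpha>1 \<alpha>2 \<alpha>12 \<beta>1 \<beta>2 \<beta>12 f)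
     (expand_12 \<alpha>1 \<alpha>2 \<alpha>12 \<beta>1 \<beta>2 \<beta>12 a) (expand_02 \<alpha>1 \<alpha>2 \<alpha>12 \<beta>1 \<beta>2 \<beta>12 b)
     (expand_21 \<alpha>1 \<alpha>2 \<alpha>12 \<beta>1 \<beta>2 \<beta>12 c) R"
proof -
  obtain Ra where a: "a \<in> laurent_series" and Ra: "Ra > 0" and
    ha: "\<And>p. 0 < norm p \<Longrightarrow> norm p < Ra \<Longrightarrow> ((\<lambda>(r, s). a r s * zpow p r s) has_sum f p) UNIV"
    using abc(1) unfolding has_j_zero_def has_conformal_expansion_iff by auto
  obtain Rb where b: "b \<in> laurent_series" and Rb: "Rb > 0" and
    hb: "\<And>p. 0 < norm p \<Longrightarrow> norm p < Rb \<Longrightarrow> ((\<lambda>(r, s). b r s * zpow p r s) has_sum f (1 / (1 - p))) UNIV"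
    using abc(2) unfolding has_j_one_def has_conformal_expansion_iff by auto
  obtain Rc where c: "c \<in> laurent_series" and Rc: "Rc > 0" and
    hc: "\<And>p. 0 < norm p \<Longrightarrow> norm p < Rc \<Longrightarrow> ((\<lambda>(r, s). c r s * zpow p r s) has_sum f (1 / p)) UNIV"
    using abc(3) unfolding has_j_inf_def has_conformal_expansion_iff by auto
  obtain Na where Na: "\<And>r s. a r s \<noteq> 0 \<Longrightarrow> Na \<le> r \<and> Na \<le> s" using laurent_series_bound[OF a] by metis
  obtain Nb where Nb: "\<And>r s. b r s \<noteq> 0 \<Longrightarrow> Nb \<le> r \<and> Nb \<le> s" using laurent_series_bound[OF b] by metis
  obtain Nc where Nc: "\<And>r s. c r s \<noteq> 0 \<Longrightarrow> Nc \<le> r \<and> Nc \<le> s" using laurent_series_bound[OF c] by metis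
  define R where "R = min 1 (min Ra (min Rb Rc))"
  have R: "R > 0" "R \<le> 1" "R \<le> Ra" "R \<le> Rb" "R \<le> Rc" using Ra Rb Rc by (auto simp: R_def)
  let ?d = "\<alpha>1 + \<alpha>2 + \<alpha>12" and ?e = "\<beta>1 + \<beta>2 + \<beta>12"
  show ?thesis
    unfolding slice_expansions_def
  proof (rule exI[of _ R], intro conjI allI impI \<open>R > 0\<close>)
    fix z :: complex assume "0 < norm z \<and> norm z < R"
    then have z: "0 < norm z" "norm z < 1" "norm z < Ra" "norm z < Rb" "norm z < Rc" "z \<noteq> 0"
      using R by auto
    have bin: "((\<lambda>(r, s). binomial_series (- 1) \<alpha>12 \<beta>12 r s * zpow z r s) has_sum zpow (1 - z) \<alpha>12 \<beta>12) UNIV"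
      using binomial_series_has_sum[OF z(1,2), of "- 1"] by simp
    show "((\<lambda>(x1, y1, x2, y2). expand_12 \<alpha>1 \<alpha>2 \<alpha>12 \<beta>1 \<beta>2 \<beta>12 a x1 y1 x2 y2 * zpow (inverse z) x1 y1)
      has_sum gcor_fun \<alpha>1 \<alpha>2 \<alpha>12 \<beta>1 \<beta>2 \<beta>12 f (inverse z, 1)) UNIV"
    proof -
      let ?S = "series_mult (binomial_series (- 1) \<alpha>12 \<beta>12) a"
      let ?\<iota> = "\<lambda>(x, y). (\<alpha>1 + \<alpha>12 - x, \<beta>1 + \<beta>12 - y, x + \<alpha>2, y + \<beta>2)"
      have inj: "inj ?\<iota>" by (auto simp: inj_def)
      have "((\<lambda>(r, s). ?S r s * zpow z r s) has_sum zpow (1 - z) \<alpha>12 \<beta>12 * f z) UNIV"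
        by (rule series_mult_has_sum[OF bin ha[OF z(1,3)]]) (use binomial_series_support Na in blast)+
      from has_sum_cmult_right[OF this, of "zpow (inverse z) (\<alpha>1 + \<alpha>12) (\<beta>1 + \<beta>12)"]
      have "((\<lambda>q. zpow (inverse z) (\<alpha>1 + \<alpha>12) (\<beta>1 + \<beta>12) * (case q of (r, s) \<Rightarrow> ?S r s * zpow z r s))
        has_sum zpow (inverse z) (\<alpha>1 + \<alpha>12) (\<beta>1 + \<beta>12) * (zpow (1 - z) \<alpha>12 \<beta>12 * f z)) UNIV" .
      also have "zpow (inverse z) (\<alpha>1 + \<alpha>12) (\<beta>1 + \<beta>12) * (zpow (1 - z) \<alpha>12 \<beta>12 * f z) =
        gcor_fun \<alpha>1 \<alpha>2 \<alpha>12 \<beta>1 \<beta>2 \<beta>12 f (inverse z, 1)"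
      proof -
        \<comment> \<open>This splits the \<open>\<alpha>12\<close>-th power of
          \<open>z1 - z2\<close> into the leading power of \<open>z1\<close>, which sits in the
          prefactor, and the binomial factor in \<open>p = z\<close>.\<close>
        have "inverse z - 1 = inverse z * (1 - z)" using z(6) by (simp add: field_simps)
        then show ?thesis
          by (simp add: gcor_fun_def zpow_add zpow_mult[OF ints(3)] divide_inverse mult_ac)
      qed
      also have "(\<lambda>q. zpow (inverse z) (\<alpha>1 + \<alpha>12) (\<beta>1 + \<beta>12) * (case q of (r, s) \<Rightarrow> ?S r s * zpow z r s)) =
        (\<lambda>q. case ?\<iota> q of (x1, y1, x2, y2) \<Rightarrow> expand_12 \<alpha>1 \<alpha>2 \<alpha>12 \<beta>1 \<beta>2 \<beta>12 a x1 y1 x2 y2 * zpow (inverse z) x1 y1)"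
      proof
        fix q :: "real \<times> real"
        obtain r s where q: "q = (r, s)" by force
        have "?S r s * zpow z r s = ?S r s * zpow (inverse z) (- r) (- s)"
        proof (cases "?S r s = 0")
          case False
          then have "r - s \<in> \<int>"
            by (rule series_mult_binomial_int) (rule laurent_series_int[OF a])
          then have "- r - - s \<in> \<int>" using Ints_minus[of "r - s"] by simp
          from zpow_inverse[OF this, of z] show ?thesis by simp
        qed simp
        moreover have "zpow (inverse z) (\<alpha>1 + \<alpha>12 - r) (\<beta>1 + \<beta>12 - s) =
          zpow (inverse z) (\<alpha>1 + \<alpha>12) (\<beta>1 + \<beta>12) * zpow (inverse z) (- r) (- s)"
          by (simp flip: zpow_add)
        ultimately show "zpow (inverse z) (\<alpha>1 + \<alpha>12) (\<beta>1 + \<beta>12) * (case q of (r, s) \<Rightarrow> ?S r s * zpow z r s) =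
          (case ?\<iota> q of (x1, y1, x2, y2) \<Rightarrow> expand_12 \<alpha>1 \<alpha>2 \<alpha>12 \<beta>1 \<beta>2 \<beta>12 a x1 y1 x2 y2 * zpow (inverse z) x1 y1)"
          by (cases "?S r s = 0") (simp_all add: q expand_12_def mult_ac)
      qed
      finally show ?thesis
      proof (subst has_sum_reindex_support[OF inj])
        fix q :: "real \<times> real \<times> real \<times> real" assume q: "q \<notin> range ?\<iota>"
        obtain x1 y1 x2 y2 where qe: "q = (x1, y1, x2, y2)" by (metis prod_cases4)
        show "(case q of (x1, y1, x2, y2) \<Rightarrow> expand_12 \<alpha>1 \<alpha>2 \<alpha>12 \<beta>1 \<beta>2 \<beta>12 a x1 y1 x2 y2 * zpow (inverse z) x1 y1) = 0"
        proof (rule ccontr)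
          assume "\<not> ?thesis"
          then have "x1 + x2 = ?d" "y1 + y2 = ?e" by (auto simp: qe expand_12_def split: if_splits)
          then have "q = ?\<iota> (x2 - \<alpha>2, y2 - \<beta>2)" by (simp add: qe algebra_simps)
          then show False using q by blast
        qed
      qed simp
    qed
    show "((\<lambda>(x0, y0, x2, y2). expand_02 \<alpha>1 \<alpha>2 \<alpha>12 \<beta>1 \<beta>2 \<beta>12 b x0 y0 x2 y2 * zpow z x0 y0)
      has_sum gcor_fun \<alpha>1 \<alpha>2 \<alpha>12 \<beta>1 \<beta>2 \<beta>12 f (1 + z, 1)) UNIV"
    proof -
      \<comment> \<open>In the chart \<open>1 - 1/p\<close> the point \<open>z1 = 1 + z\<close>,
        \<open>z2 = 1\<close> has the coordinate \<open>- z\<close>, whence the sign.\<close>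
      let ?b = "\<lambda>r s. sign_pow (r - s) * b r s"
      let ?S = "series_mult (binomial_series 1 \<alpha>1 \<beta>1) ?b"
      let ?\<iota> = "\<lambda>(x, y). (x + \<alpha>12, y + \<beta>12, \<alpha>1 + \<alpha>2 - x, \<beta>1 + \<beta>2 - y)"
      have inj: "inj ?\<iota>" by (auto simp: inj_def)
      have bin: "((\<lambda>(r, s). binomial_series 1 \<alpha>1 \<beta>1 r s * zpow z r s) has_sum zpow (1 + z) \<alpha>1 \<beta>1) UNIV"
        using binomial_series_has_sum[OF z(1,2), of 1] by simp
      have "((\<lambda>(r, s). b r s * zpow (- z) r s) has_sum f (1 / (1 + z))) UNIV"
        using hb[of "- z"] z by simp
      moreover have "b r s * zpow (- z) r s = ?b r s * zpow z r s" for r s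
        by (cases "b r s = 0") (simp_all add: zpow_uminus laurent_series_int[OF b])
      ultimately have hb': "((\<lambda>(r, s). ?b r s * zpow z r s) has_sum f (1 / (1 + z))) UNIV" by simp
      have "((\<lambda>(r, s). ?S r s * zpow z r s) has_sum zpow (1 + z) \<alpha>1 \<beta>1 * f (1 / (1 + z))) UNIV"
        by (rule series_mult_has_sum[OF bin hb', of Nb])
          (use binomial_series_support Nb in \<open>auto simp del: mult_eq_0_iff simp: mult_eq_0_iff[of _ "b _ _"]\<close>)
      from has_sum_cmult_right[OF this, of "zpow z \<alpha>12 \<beta>12"]
      have "((\<lambda>q. zpow z \<alpha>12 \<beta>12 * (case q of (r, s) \<Rightarrow> ?S r s * zpow z r s))
        has_sum zpow z \<alpha>12 \<beta>12 * (zpow (1 + z) \<alpha>1 \<beta>1 * f (1 / (1 + z)))) UNIV" .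
      also have "zpow z \<alpha>12 \<beta>12 * (zpow (1 + z) \<alpha>1 \<beta>1 * f (1 / (1 + z))) =
        gcor_fun \<alpha>1 \<alpha>2 \<alpha>12 \<beta>1 \<beta>2 \<beta>12 f (1 + z, 1)"
        by (simp add: gcor_fun_def mult_ac)
      also have "(\<lambda>q. zpow z \<alpha>12 \<beta>12 * (case q of (r, s) \<Rightarrow> ?S r s * zpow z r s)) =
        (\<lambda>q. case ?\<iota> q of (x0, y0, x2, y2) \<Rightarrow> expand_02 \<alpha>1 \<alpha>2 \<alpha>12 \<beta>1 \<beta>2 \<beta>12 b x0 y0 x2 y2 * zpow z x0 y0)"
        by (auto simp: fun_eq_iff expand_02_def zpow_add mult_ac)
      finally show ?thesis
      proof (subst has_sum_reindex_support[OF inj])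
        fix q :: "real \<times> real \<times> real \<times> real" assume q: "q \<notin> range ?\<iota>"
        obtain x1 y1 x2 y2 where qe: "q = (x1, y1, x2, y2)" by (metis prod_cases4)
        show "(case q of (x0, y0, x2, y2) \<Rightarrow> expand_02 \<alpha>1 \<alpha>2 \<alpha>12 \<beta>1 \<beta>2 \<beta>12 b x0 y0 x2 y2 * zpow z x0 y0) = 0"
        proof (rule ccontr)
          assume "\<not> ?thesis"
          then have "x1 + x2 = ?d" "y1 + y2 = ?e" by (auto simp: qe expand_02_def split: if_splits)
          then have "q = ?\<iota> (x1 - \<alpha>12, y1 - \<beta>12)" by (simp add: qe algebra_simps)
          then show False using q by blast
        qed
      qed simp
    qed
    show "((\<lambda>(x1, y1, x2, y2). expand_21 \<alpha>1 \<alpha>2 \<alpha>12 \<beta>1 \<beta>2 \<beta>12 c x1 y1 x2 y2 * zpow z x1 y1)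
      has_sum gcor_fun \<alpha>1 \<alpha>2 \<alpha>12 \<beta>1 \<beta>2 \<beta>12 f (z, 1)) UNIV"
    proof -
      let ?S = "series_mult (binomial_series (- 1) \<alpha>12 \<beta>12) c"
      let ?\<iota> = "\<lambda>(x, y). (x + \<alpha>1, y + \<beta>1, \<alpha>2 + \<alpha>12 - x, \<beta>2 + \<beta>12 - y)"
      let ?k = "sign_pow (\<alpha>12 - \<beta>12) * zpow z \<alpha>1 \<beta>1"
      have inj: "inj ?\<iota>" by (auto simp: inj_def)
      have "((\<lambda>(r, s). ?S r s * zpow z r s) has_sum zpow (1 - z) \<alpha>12 \<beta>12 * f (1 / z)) UNIV"
        by (rule series_mult_has_sum[OF bin hc[OF z(1,5)]]) (use binomial_series_support Nc in blast)+
      from has_sum_cmult_right[OF this, of ?k]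
      have "((\<lambda>q. ?k * (case q of (r, s) \<Rightarrow> ?S r s * zpow z r s))
        has_sum ?k * (zpow (1 - z) \<alpha>12 \<beta>12 * f (1 / z))) UNIV" .
      also have "?k * (zpow (1 - z) \<alpha>12 \<beta>12 * f (1 / z)) =
        gcor_fun \<alpha>1 \<alpha>2 \<alpha>12 \<beta>1 \<beta>2 \<beta>12 f (z, 1)"
        using zpow_uminus[OF ints(3), of "1 - z"] by (simp add: gcor_fun_def mult_ac)
      also have "(\<lambda>q. ?k * (case q of (r, s) \<Rightarrow> ?S r s * zpow z r s)) =
        (\<lambda>q. case ?\<iota> q of (x1, y1, x2, y2) \<Rightarrow> expand_21 \<alpha>1 \<alpha>2 \<alpha>12 \<beta>1 \<beta>2 \<beta>12 c x1 y1 x2 y2 * zpow z x1 y1)"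
        by (auto simp: fun_eq_iff expand_21_def zpow_add mult_ac)
      finally show ?thesis
      proof (subst has_sum_reindex_support[OF inj])
        fix q :: "real \<times> real \<times> real \<times> real" assume q: "q \<notin> range ?\<iota>"
        obtain x1 y1 x2 y2 where qe: "q = (x1, y1, x2, y2)" by (metis prod_cases4)
        show "(case q of (x1, y1, x2, y2) \<Rightarrow> expand_21 \<alpha>1 \<alpha>2 \<alpha>12 \<beta>1 \<beta>2 \<beta>12 c x1 y1 x2 y2 * zpow z x1 y1) = 0"
        proof (rule ccontr)
          assume "\<not> ?thesis"
          then have "x1 + x2 = ?d" "y1 + y2 = ?e" by (auto simp: qe expand_21_def split: if_splits)
          then have "q = ?\<iota> (x1 - \<alpha>1, y1 - \<beta>1)" by (simp add: qe algebra_simps)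
          then show False using q by blast
        qed
      qed simp
    qed
  qed
qed

text \<open>The span consists of finite combinations of generators, so by induction a common radius
  of convergence exists.\<close>

lemma gcor2_slice_expansions:
  assumes "gcor2 \<mu> A B C"
  shows "real_analytic_on (\<lambda>z. \<mu> (z, 1)) (- {0, 1}) \<and> (\<exists>R>0. slice_expansions \<mu> A B C R)"
  using assms
proof induction
  case (generator \<alpha>1 \<beta>1 \<alpha>2 \<beta>2 \<alpha>12 \<beta>12 f a b c)
  show ?case
    by (rule conjI[OF gcor_fun_slice_analytic[OF generator(1-4)]
          gcor_fun_slice_expansions[OF generator(1-3,5-7)]])
next
  case (smult \<mu> A B C k)
  obtain R where R: "R > 0" "slice_expansions \<mu> A B C R"
    using conjunct2[OF smult.IH] by blast
  have "slice_expansions (\<lambda>z. k * \<mu> z) (\<lambda>x1 y1 x2 y2. k * A x1 y1 x2 y2)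
     (\<lambda>x1 y1 x2 y2. k * B x1 y1 x2 y2) (\<lambda>x1 y1 x2 y2. k * C x1 y1 x2 y2) R"
    unfolding slice_expansions_def
  proof (intro allI impI)
    fix z :: complex assume "0 < norm z \<and> norm z < R"
    then have z: "0 < norm z" "norm z < R" by auto
    note h = slice_expansionsD[OF R(2) z]
    from h[THEN has_sum_cmult_right[where c = k]]
    show "((\<lambda>(x1, y1, x2, y2). k * A x1 y1 x2 y2 * zpow (inverse z) x1 y1) has_sum k * \<mu> (inverse z, 1)) UNIV \<and>
     ((\<lambda>(x0, y0, x2, y2). k * B x0 y0 x2 y2 * zpow z x0 y0) has_sum k * \<mu> (1 + z, 1)) UNIV \<and>
     ((\<lambda>(x1, y1, x2, y2). k * C x1 y1 x2 y2 * zpow z x1 y1) has_sum k * \<mu> (z, 1)) UNIV"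
      by (simp add: case_prod_unfold mult.assoc)
  qed
  with R(1) have "\<exists>R>0. slice_expansions (\<lambda>z. k * \<mu> z) (\<lambda>x1 y1 x2 y2. k * A x1 y1 x2 y2)
     (\<lambda>x1 y1 x2 y2. k * B x1 y1 x2 y2) (\<lambda>x1 y1 x2 y2. k * C x1 y1 x2 y2) R"
    by (intro exI[of _ R] conjI)
  then show ?case
    by (rule conjI[OF real_analytic_on_mult[OF real_analytic_on_const conjunct1[OF smult.IH]]])
next
  case (add \<mu> A B C \<mu>' A' B' C')
  obtain R where R: "R > 0" "slice_expansions \<mu> A B C R"
    using conjunct2[OF add.IH(1)] by blast
  obtain R' where R': "R' > 0" "slice_expansions \<mu>' A' B' C' R'"
    using conjunct2[OF add.IH(2)] by blast
  have "slice_expansions (\<lambda>z. \<mu> z + \<mu>' z) (\<lambda>x1 y1 x2 y2. A x1 y1 x2 y2 + A' x1 y1 x2 y2)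
     (\<lambda>x1 y1 x2 y2. B x1 y1 x2 y2 + B' x1 y1 x2 y2)
     (\<lambda>x1 y1 x2 y2. C x1 y1 x2 y2 + C' x1 y1 x2 y2) (min R R')"
    unfolding slice_expansions_def
  proof (intro allI impI)
    fix z :: complex assume "0 < norm z \<and> norm z < min R R'"
    then have z: "0 < norm z" "norm z < R" "norm z < R'" by auto
    note h = slice_expansionsD[OF R(2) z(1,2)] and h' = slice_expansionsD[OF R'(2) z(1,3)]
    from has_sum_add[OF h(1) h'(1)] has_sum_add[OF h(2) h'(2)] has_sum_add[OF h(3) h'(3)]
    show "((\<lambda>(x1, y1, x2, y2). (A x1 y1 x2 y2 + A' x1 y1 x2 y2) * zpow (inverse z) x1 y1) has_sum \<mu> (inverse z, 1) + \<mu>' (inverse z, 1)) UNIV \<and>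
     ((\<lambda>(x0, y0, x2, y2). (B x0 y0 x2 y2 + B' x0 y0 x2 y2) * zpow z x0 y0) has_sum \<mu> (1 + z, 1) + \<mu>' (1 + z, 1)) UNIV \<and>
     ((\<lambda>(x1, y1, x2, y2). (C x1 y1 x2 y2 + C' x1 y1 x2 y2) * zpow z x1 y1) has_sum \<mu> (z, 1) + \<mu>' (z, 1)) UNIV"
      by (simp add: case_prod_unfold distrib_right)
  qed
  moreover have "min R R' > 0" using R(1) R'(1) by simp
  ultimately have "\<exists>R>0. slice_expansions (\<lambda>z. \<mu> z + \<mu>' z) (\<lambda>x1 y1 x2 y2. A x1 y1 x2 y2 + A' x1 y1 x2 y2)
     (\<lambda>x1 y1 x2 y2. B x1 y1 x2 y2 + B' x1 y1 x2 y2)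
     (\<lambda>x1 y1 x2 y2. C x1 y1 x2 y2 + C' x1 y1 x2 y2) R"
    by (intro exI[of _ "min R R'"] conjI)
  then show ?case
    by (rule conjI[OF real_analytic_on_add[OF conjunct1[OF add.IH(1)] conjunct1[OF add.IH(2)]]])
qed

text \<open>A fixed total degree determines the exponents of \<open>z2\<close> and its conjugate
  from those of \<open>z1\<close>, so the restriction to \<open>z2 = 1\<close> keeps all
  coefficients. The same function \<open>g\<close> appears in the three expansions, which is what
  relates them.\<close>

lemma gcor2_homogeneous_slice:
  assumes "gcor2 \<mu> A B C"
    and deg: "\<And>x1 y1 x2 y2. A x1 y1 x2 y2 \<noteq> 0 \<or> B x1 y1 x2 y2 \<noteq> 0 \<or> C x1 y1 x2 y2 \<noteq> 0 \<Longrightarrow>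
      x1 + x2 = X \<and> y1 + y2 = Y"
  obtains g R where "real_analytic_on g (- {0, 1})" "0 < R"
    "\<And>z. 0 < norm z \<Longrightarrow> norm z < R \<Longrightarrow>
      ((\<lambda>(x, y). A x y (X - x) (Y - y) * zpow (inverse z) x y) has_sum g (inverse z)) UNIV"
    "\<And>z. 0 < norm z \<Longrightarrow> norm z < R \<Longrightarrow>
      ((\<lambda>(x, y). B x y (X - x) (Y - y) * zpow z x y) has_sum g (1 + z)) UNIV"
    "\<And>z. 0 < norm z \<Longrightarrow> norm z < R \<Longrightarrow>
      ((\<lambda>(x, y). C x y (X - x) (Y - y) * zpow z x y) has_sum g z) UNIV"
proof -
  obtain R where R: "R > 0" "slice_expansions \<mu> A B C R"
    using conjunct2[OF gcor2_slice_expansions[OF assms(1)]] by blast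
  let ?\<iota> = "\<lambda>(x, y). (x, y, X - x, Y - y)"
  have red: "((\<lambda>(x, y). D x y (X - x) (Y - y) * zpow w x y) has_sum s) UNIV"
    if D: "((\<lambda>(x1, y1, x2, y2). D x1 y1 x2 y2 * zpow w x1 y1) has_sum s) UNIV"
      and dD: "\<And>x1 y1 x2 y2. D x1 y1 x2 y2 \<noteq> 0 \<Longrightarrow> x1 + x2 = X \<and> y1 + y2 = Y" for D :: series2 and w s
  proof -
    let ?T = "\<lambda>(x1, y1, x2, y2). D x1 y1 x2 y2 * zpow w x1 y1"
    have T0: "?T q = 0" if q: "q \<notin> range ?\<iota>" for q
    proof (rule ccontr)
      assume nz: "?T q \<noteq> 0"
      obtain x1 y1 x2 y2 where qe: "q = (x1, y1, x2, y2)" by (metis prod_cases4)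
      have "x1 + x2 = X" "y1 + y2 = Y" using nz dD[of x1 y1 x2 y2] by (auto simp: qe)
      then have "q = ?\<iota> (x1, y1)" by (auto simp: qe)
      then show False using q by blast
    qed
    have inj: "inj ?\<iota>" by (auto simp: inj_def)
    have "((\<lambda>p. ?T (?\<iota> p)) has_sum s) UNIV"
      using has_sum_reindex_support[OF inj T0, THEN iffD1, OF _ D] .
    then show ?thesis by (simp add: case_prod_unfold)
  qed
  show thesis
  proof (rule that[of "\<lambda>z. \<mu> (z, 1)" R])
    show "real_analytic_on (\<lambda>z. \<mu> (z, 1)) (- {0, 1})"
      by (rule conjunct1[OF gcor2_slice_expansions[OF assms(1)]])
    fix z :: complex assume z: "0 < norm z" "norm z < R"
    note h = slice_expansionsD[OF R(2) z]
    show "((\<lambda>(x, y). A x y (X - x) (Y - y) * zpow (inverse z) x y) has_sum \<mu> (inverse z, 1)) UNIV"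
      by (rule red[OF h(1)]) (use deg in blast)
    show "((\<lambda>(x, y). B x y (X - x) (Y - y) * zpow z x y) has_sum \<mu> (1 + z, 1)) UNIV"
      by (rule red[OF h(2)]) (use deg in blast)
    show "((\<lambda>(x, y). C x y (X - x) (Y - y) * zpow z x y) has_sum \<mu> (z, 1)) UNIV"
      by (rule red[OF h(3)]) (use deg in blast)
  qed (rule R(1))
qed

section \<open>Consequences for correlators of special shape\<close>

lemma connected_minus_0_1: "connected (- {0, 1 :: complex})"
  using connected_open_delete_finite[of "UNIV :: complex set" "{0, 1}"]
  by (simp add: Compl_eq_Diff_UNIV connected_UNIV)

lemma open_minus_0_1: "open (- {0, 1 :: complex})"
  by (intro open_Compl finite_imp_closed) simp

lemma inverse_less_of_one_divide_less:
  fixes R t :: real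
  assumes "0 < R" "1 / R < t"
  shows "inverse t < R"
proof -
  have "1 < t * R" using assms by (simp add: pos_divide_less_eq)
  moreover have "0 < t" using assms by (meson divide_pos_pos less_trans zero_less_one)
  ultimately show ?thesis by (simp add: inverse_eq_divide pos_divide_less_eq mult.commute)
qed

lemma has_sum_imp_abs_summable_complex:
  fixes f :: "'i \<Rightarrow> complex"
  assumes "(f has_sum s) A"
  shows "(\<lambda>x. norm (f x)) summable_on A"
  using has_sum_imp_summable[OF assms] unfolding summable_on_iff_abs_summable_on_complex[of f A] .

text \<open>The difference vanishes near infinity, hence is holomorphic there, hence holomorphic
  everywhere by propagation, and then 0 by analytic continuation. The monomial need not be
  holomorphic, which is why the difference is formed first.\<close>

lemma real_analytic_monomial:
  assumes g: "real_analytic_on g (- {0, 1})" and de: "d - e \<in> \<int>" and "0 < R"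
    and near: "\<And>z. 0 < norm z \<Longrightarrow> norm z < R \<Longrightarrow> g (inverse z) = k * zpow (inverse z) d e"
    and z: "z \<noteq> 0" "z \<noteq> 1"
  shows "g z = k * zpow z d e"
proof -
  define h where "h z = g z + (- k) * zpow z d e" for z
  have "real_analytic_on (\<lambda>z. zpow z d e) (- {0, 1})"
    by (rule real_analytic_on_subset[OF real_analytic_on_zpow[OF de]]) auto
  then have ra: "real_analytic_on h (- {0, 1})"
    unfolding h_def by (intro real_analytic_on_add g real_analytic_on_mult real_analytic_on_const)
  define V where "V = - cball (0::complex) (max 1 (1 / R))"
  have V: "open V" "V \<subseteq> - {0, 1}"
    by (auto simp: V_def open_Compl)
  have h0: "h z = 0" if "z \<in> V" for z
  proof -
    have "norm z > 1 / R" "norm z > 1" using that by (auto simp: V_def)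
    then have "0 < norm (inverse z)" "norm (inverse z) < R"
      unfolding norm_inverse using inverse_less_of_one_divide_less[OF \<open>0 < R\<close>] by auto
    from near[OF this] show ?thesis by (simp add: h_def)
  qed
  have "of_real (max 1 (1 / R) + 1) \<in> V" unfolding V_def by (simp del: of_real_add)
  then have ne: "V \<noteq> {}" by blast
  have "h holomorphic_on V"
    by (rule holomorphic_transform[of "\<lambda>_. 0"]) (use h0 in auto)
  then have hol: "h holomorphic_on - {0, 1}"
    using real_analytic_holomorphic_propagation[OF ra open_minus_0_1 connected_minus_0_1 V(1) ne V(2)] by simp
  have "h z = 0"
    by (rule analytic_continuation_open[OF V(1) open_minus_0_1 ne connected_minus_0_1 V(2) hol, of "\<lambda>_. 0"])
      (use h0 z in auto)
  then show ?thesis by (simp add: h_def)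
qed

lemma linear_le_quadratic_imp_zero:
  fixes a b :: complex
  assumes "0 < \<rho>" and le: "\<And>t. 0 < t \<Longrightarrow> t \<le> \<rho> \<Longrightarrow> norm (a + b * of_real t) \<le> K * t\<^sup>2"
  shows "a = 0" "b = 0"
proof -
  have ev: "\<forall>\<^sub>F t in at_right 0. 0 < t \<and> t \<le> \<rho>"
    using \<open>0 < \<rho>\<close> by (auto simp: eventually_at_right_field intro!: exI[of _ \<rho>])
  have "norm a \<le> 0"
  proof (rule tendsto_le[OF trivial_limit_at_right_real])
    show "((\<lambda>t. norm (a + b * of_real t)) \<longlongrightarrow> norm a) (at_right 0)"
      by (auto intro!: tendsto_eq_intros)
    show "((\<lambda>t. K * t\<^sup>2) \<longlongrightarrow> 0) (at_right 0)"
      by (auto intro!: tendsto_eq_intros)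
    show "\<forall>\<^sub>F t in at_right 0. norm (a + b * of_real t) \<le> K * t\<^sup>2"
      by (rule eventually_mono[OF ev]) (use le in auto)
  qed
  then show a: "a = 0" by simp
  have "norm b \<le> 0"
  proof (rule tendsto_le[OF trivial_limit_at_right_real])
    show "((\<lambda>t. norm b) \<longlongrightarrow> norm b) (at_right (0::real))"
      by (rule tendsto_const)
    show "((\<lambda>t. K * t) \<longlongrightarrow> 0) (at_right 0)"
      by (auto intro!: tendsto_eq_intros)
    show "\<forall>\<^sub>F t in at_right 0. norm b \<le> K * t"
    proof (rule eventually_mono[OF ev])
      fix t assume t: "0 < t \<and> t \<le> \<rho>"
      then have "norm b * t \<le> (K * t) * t"
        using le[of t] a by (simp add: norm_mult power2_eq_square mult.assoc)
      then show "norm b \<le> K * t" using t by simp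
    qed
  qed
  then show "b = 0" by simp
qed

text \<open>After the terms of order at most 1 the remainder is quadratic in \<open>|z|\<close>.
  Along the positive real and imaginary rays this forces \<open>c 1 0 + c 0 1\<close> and
  \<open>\<i> * c 1 0 - \<i> * c 0 1\<close> to vanish.\<close>

lemma double_power_series_zero_first_order:
  fixes c :: "nat \<Rightarrow> nat \<Rightarrow> complex"
  assumes "0 < R" and hs: "\<And>z. 0 < norm z \<Longrightarrow> norm z < R \<Longrightarrow>
    ((\<lambda>(m, n). c m n * (z ^ m * cnj z ^ n)) has_sum 0) UNIV"
  shows "c 1 0 = 0" "c 0 1 = 0"
proof -
  define \<rho> where "\<rho> = R / 2"
  have \<rho>: "0 < \<rho>" "\<rho> < R" using assms(1) by (auto simp: \<rho>_def)
  have "(\<lambda>p. norm (case p of (m, n) \<Rightarrow> c m n * (of_real \<rho> ^ m * cnj (of_real \<rho>) ^ n))) summable_on UNIV"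
    by (rule has_sum_imp_abs_summable_complex[OF hs]) (use \<rho> in auto)
  then have sm: "(\<lambda>(m, n). norm (c m n) * \<rho> ^ (m + n)) summable_on UNIV"
    using \<rho> by (simp add: case_prod_unfold norm_mult norm_power power_add mult.assoc)
  let ?P = "{(0, 0), (1, 0), (0, 1)} :: (nat \<times> nat) set"
  define S where "S = infsum (\<lambda>(m, n). norm (c m n) * \<rho> ^ (m + n)) (- ?P)"
  have smP: "(\<lambda>(m, n). norm (c m n) * \<rho> ^ (m + n)) summable_on (- ?P)"
    by (rule summable_on_subset_banach[OF sm]) simp
  have bound: "norm (c 0 0 + c 1 0 * z + c 0 1 * cnj z) \<le> S / \<rho>\<^sup>2 * (norm z)\<^sup>2" if z: "0 < norm z" "norm z \<le> \<rho>" for z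
  proof -
    let ?f = "\<lambda>(m, n). c m n * (z ^ m * cnj z ^ n)"
    have "(?f has_sum 0) UNIV" using hs[of z] z \<rho> by simp
    moreover have "(?f has_sum (\<Sum>p\<in>?P. ?f p)) ?P" by (rule has_sum_finite) simp
    ultimately have "(?f has_sum (0 - (\<Sum>p\<in>?P. ?f p))) (UNIV - ?P)"
      by (rule has_sum_Diff) simp
    then have fP: "(?f has_sum (- (c 0 0 + c 1 0 * z + c 0 1 * cnj z))) (- ?P)"
      by (simp add: Compl_eq_Diff_UNIV algebra_simps)
    have hS: "((\<lambda>p. (norm z / \<rho>)\<^sup>2 * (case p of (m, n) \<Rightarrow> norm (c m n) * \<rho> ^ (m + n))) has_sum (norm z / \<rho>)\<^sup>2 * S) (- ?P)"
      unfolding S_def by (rule has_sum_cmult_right[OF has_sum_infsum[OF smP]])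
    have "norm (?f p) \<le> (norm z / \<rho>)\<^sup>2 * (case p of (m, n) \<Rightarrow> norm (c m n) * \<rho> ^ (m + n))"
      if p: "p \<in> - ?P" for p
    proof -
      obtain m n where mn: "p = (m, n)" by force
      have ge: "2 \<le> m + n"
      proof (rule ccontr)
        assume "\<not> ?thesis"
        then have "m = 0 \<and> n = 0 \<or> m = 1 \<and> n = 0 \<or> m = 0 \<and> n = 1" by linarith
        then show False using p mn by auto
      qed
      obtain k where k: "m + n = 2 + k" using le_Suc_ex[OF ge] by blast
      have "norm z ^ k \<le> \<rho> ^ k" using z by (intro power_mono) auto
      then have "norm z ^ (m + n) \<le> (norm z)\<^sup>2 * \<rho> ^ k"
        unfolding k power_add by (rule mult_left_mono) simp
      also have "\<dots> = (norm z / \<rho>)\<^sup>2 * \<rho> ^ (m + n)"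
        unfolding k using \<rho> by (simp add: power_add power_divide power2_eq_square)
      finally have "norm (c m n) * norm z ^ (m + n) \<le> norm (c m n) * ((norm z / \<rho>)\<^sup>2 * \<rho> ^ (m + n))"
        by (rule mult_left_mono) simp
      then show ?thesis by (simp add: mn norm_mult norm_power power_add mult_ac)
    qed
    from norm_infsum_le[OF fP hS this]
    have "norm (- (c 0 0 + c 1 0 * z + c 0 1 * cnj z)) \<le> (norm z / \<rho>)\<^sup>2 * S" .
    then have "norm (c 0 0 + c 1 0 * z + c 0 1 * cnj z) \<le> (norm z / \<rho>)\<^sup>2 * S"
      by (simp only: norm_minus_cancel)
    then show ?thesis by (simp add: power_divide mult_ac)
  qed
  have "c 1 0 + c 0 1 = 0"
  proof (rule linear_le_quadratic_imp_zero(2)[OF \<rho>(1)])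
    fix t :: real assume t: "0 < t" "t \<le> \<rho>"
    have "norm (c 0 0 + c 1 0 * of_real t + c 0 1 * cnj (of_real t)) \<le> S / \<rho>\<^sup>2 * (norm (complex_of_real t))\<^sup>2"
      by (rule bound) (use t in auto)
    then show "norm (c 0 0 + (c 1 0 + c 0 1) * of_real t) \<le> S / \<rho>\<^sup>2 * t\<^sup>2"
      using t by (simp add: algebra_simps)
  qed
  moreover have "\<i> * c 1 0 - \<i> * c 0 1 = 0"
  proof (rule linear_le_quadratic_imp_zero(2)[OF \<rho>(1)])
    fix t :: real assume t: "0 < t" "t \<le> \<rho>"
    have "norm (c 0 0 + c 1 0 * (\<i> * of_real t) + c 0 1 * cnj (\<i> * of_real t)) \<le> S / \<rho>\<^sup>2 * (norm (\<i> * complex_of_real t))\<^sup>2"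
      by (rule bound) (use t in \<open>auto simp: norm_mult\<close>)
    then show "norm (c 0 0 + (\<i> * c 1 0 - \<i> * c 0 1) * of_real t) \<le> S / \<rho>\<^sup>2 * t\<^sup>2"
      using t by (simp add: algebra_simps norm_mult)
  qed
  then have "c 1 0 = c 0 1" by (simp flip: right_diff_distrib)
  ultimately show "c 1 0 = 0" "c 0 1 = 0" by simp_all
qed

lemma has_sum_monomial_eq:
  assumes "((\<lambda>(x, y). D x y * zpow w x y) has_sum s) UNIV"
    and "\<And>x y. D x y \<noteq> 0 \<Longrightarrow> x = d \<and> y = e"
  shows "s = D d e * zpow w d e"
proof -
  have "((\<lambda>(x, y). D x y * zpow w x y) has_sum D d e * zpow w d e) UNIV"
  proof (rule has_sum_finite_neutralI[of "{(d, e)}"])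
    fix q assume q: "q \<in> UNIV - {(d, e)}"
    obtain x y where qe: "q = (x, y)" by force
    show "(case q of (x, y) \<Rightarrow> D x y * zpow w x y) = 0"
      using assms(2)[of x y] q by (auto simp: qe)
  qed auto
  then show ?thesis by (rule has_sum_unique[OF assms(1)])
qed

text \<open>If the expansion in \<open>|z1| > |z2|\<close> is one monomial, then the slice is that
  monomial everywhere, and its expansion around 1 is binomial, with first-order coefficients
  \<open>d\<close> and \<open>e\<close>. The intended second state is the vacuum.\<close>

lemma gcor2_monomial_first_order:
  assumes gc: "gcor2 \<mu> A B C"
    and deg: "\<And>x1 y1 x2 y2. A x1 y1 x2 y2 \<noteq> 0 \<or> B x1 y1 x2 y2 \<noteq> 0 \<or> C x1 y1 x2 y2 \<noteq> 0 \<Longrightarrow>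
      x1 + x2 = X \<and> y1 + y2 = Y"
    and A: "\<And>x1 y1 x2 y2. A x1 y1 x2 y2 \<noteq> 0 \<Longrightarrow> x1 = d \<and> y1 = e" and de: "d - e \<in> \<int>"
    and B: "\<And>x1 y1 x2 y2. B x1 y1 x2 y2 \<noteq> 0 \<Longrightarrow> x1 \<in> \<nat> \<and> y1 \<in> \<nat>"
  shows "B 1 0 (X - 1) Y = of_real d * A d e (X - d) (Y - e)"
    and "B 0 1 X (Y - 1) = of_real e * A d e (X - d) (Y - e)"
proof -
  obtain g R where g: "real_analytic_on g (- {0, 1})" "0 < R"
    "\<And>z. 0 < norm z \<Longrightarrow> norm z < R \<Longrightarrow>
      ((\<lambda>(x, y). A x y (X - x) (Y - y) * zpow (inverse z) x y) has_sum g (inverse z)) UNIV"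
    "\<And>z. 0 < norm z \<Longrightarrow> norm z < R \<Longrightarrow>
      ((\<lambda>(x, y). B x y (X - x) (Y - y) * zpow z x y) has_sum g (1 + z)) UNIV"
    by (rule gcor2_homogeneous_slice[OF gc deg], assumption) (rule that; assumption)
  define k where "k = A d e (X - d) (Y - e)"
  have mono: "g z = k * zpow z d e" if "z \<noteq> 0" "z \<noteq> 1" for z
  proof (rule real_analytic_monomial[OF g(1) de g(2) _ that])
    fix z :: complex assume z: "0 < norm z" "norm z < R"
    show "g (inverse z) = k * zpow (inverse z) d e"
      unfolding k_def by (rule has_sum_monomial_eq[OF g(3)[OF z]]) (use A in blast)
  qed
  define c where "c m n = B (real m) (real n) (X - real m) (Y - real n) -
    k * (of_real (d gchoose m) * of_real (e gchoose n))" for m n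
  have "((\<lambda>(m, n). c m n * (z ^ m * cnj z ^ n)) has_sum 0) UNIV"
    if z: "0 < norm z" "norm z < min R 1" for z
  proof -
    let ?\<iota> = "\<lambda>(m, n). (real m, real n)"
    have nz: "z \<noteq> 0" "1 + z \<noteq> 0" "1 + z \<noteq> 1"
      using z by (auto simp: add_eq_0_iff)
    have inj: "inj ?\<iota>" by (auto simp: inj_def)
    have ran: "q \<in> range ?\<iota>" if q: "fst q \<in> \<nat>" "snd q \<in> \<nat>" for q
    proof -
      obtain m where "fst q = real m" using q(1) by (rule Nats_cases)
      moreover obtain n where "snd q = real n" using q(2) by (rule Nats_cases)
      ultimately have "q = ?\<iota> (m, n)" by (simp add: prod_eq_iff)
      then show ?thesis by blast
    qed
    let ?TB = "\<lambda>(x, y). B x y (X - x) (Y - y) * zpow z x y"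
    have "(?TB has_sum g (1 + z)) UNIV"
      using g(4) z by simp
    note hsB = this
    have "?TB q = 0" if "q \<notin> range ?\<iota>" for q
    proof (rule ccontr)
      assume "?TB q \<noteq> 0"
      then have "B (fst q) (snd q) (X - fst q) (Y - snd q) \<noteq> 0" by (simp add: case_prod_unfold)
      from B[OF this] ran that show False by blast
    qed
    from has_sum_reindex_support[OF inj this, THEN iffD1, OF _ hsB]
    have 1: "((\<lambda>p. ?TB (?\<iota> p)) has_sum g (1 + z)) UNIV" .
    let ?TE = "\<lambda>(x, y). binomial_series 1 d e x y * zpow z x y"
    have "(?TE has_sum zpow (1 + z) d e) UNIV"
      using binomial_series_has_sum[of z 1 d e] z by simp
    note hsE = this
    have "?TE q = 0" if "q \<notin> range ?\<iota>" for q
    proof (rule ccontr)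
      assume "?TE q \<noteq> 0"
      then have "binomial_series 1 d e (fst q) (snd q) \<noteq> 0" by (simp add: case_prod_unfold)
      from binomial_series_support[OF this] ran that show False by blast
    qed
    from has_sum_reindex_support[OF inj this, THEN iffD1, OF _ hsE]
    have "((\<lambda>p. ?TE (?\<iota> p)) has_sum zpow (1 + z) d e) UNIV" .
    from has_sum_add[OF 1 has_sum_cmult_right[OF this, of "- k"]]
    have "((\<lambda>p. ?TB (?\<iota> p) + - k * ?TE (?\<iota> p)) has_sum g (1 + z) + - k * zpow (1 + z) d e) UNIV" .
    moreover have "g (1 + z) + - k * zpow (1 + z) d e = 0"
      using mono[OF nz(2,3)] by simp
    moreover have "(\<lambda>p. ?TB (?\<iota> p) + - k * ?TE (?\<iota> p)) = (\<lambda>(m, n). c m n * (z ^ m * cnj z ^ n))"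
      using nz by (auto simp: fun_eq_iff c_def binomial_series_def zpow_of_nat algebra_simps)
    ultimately show ?thesis by (simp only:)
  qed
  from double_power_series_zero_first_order[of "min R 1" c, OF _ this]
  have "c 1 0 = 0" "c 0 1 = 0" using g(2) by simp_all
  then show "B 1 0 (X - 1) Y = of_real d * A d e (X - d) (Y - e)"
    "B 0 1 X (Y - 1) = of_real e * A d e (X - d) (Y - e)"
    by (simp_all add: c_def k_def)
qed

text \<open>The monomial found near infinity determines the slice everywhere, in particular near 0,
  where it is compared with the other monomial at a single point. Applied to a holomorphic and an
  antiholomorphic state this gives their commutation.\<close>

lemma gcor2_monomials_agree:
  assumes gc: "gcor2 \<mu> A B C"
    and deg: "\<And>x1 y1 x2 y2. A x1 y1 x2 y2 \<noteq> 0 \<or> B x1 y1 x2 y2 \<noteq> 0 \<or> C x1 y1 x2 y2 \<noteq> 0 \<Longrightarrow>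
      x1 + x2 = X \<and> y1 + y2 = Y"
    and A: "\<And>x1 y1 x2 y2. A x1 y1 x2 y2 \<noteq> 0 \<Longrightarrow> x1 = d \<and> y1 = e" and de: "d - e \<in> \<int>"
    and C: "\<And>x1 y1 x2 y2. C x1 y1 x2 y2 \<noteq> 0 \<Longrightarrow> x1 = d \<and> y1 = e"
  shows "A d e (X - d) (Y - e) = C d e (X - d) (Y - e)"
proof -
  obtain g R where g: "real_analytic_on g (- {0, 1})" "0 < R"
    "\<And>z. 0 < norm z \<Longrightarrow> norm z < R \<Longrightarrow>
      ((\<lambda>(x, y). A x y (X - x) (Y - y) * zpow (inverse z) x y) has_sum g (inverse z)) UNIV"
    "\<And>z. 0 < norm z \<Longrightarrow> norm z < R \<Longrightarrow>
      ((\<lambda>(x, y). C x y (X - x) (Y - y) * zpow z x y) has_sum g z) UNIV"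
    by (rule gcor2_homogeneous_slice[OF gc deg], assumption) (rule that; assumption)
  define z :: complex where "z = of_real (min R 1 / 2)"
  have z: "0 < norm z" "norm z < R" "norm z < 1"
    unfolding z_def norm_of_real using g(2) by auto
  then have nz: "z \<noteq> 0" "z \<noteq> 1" by auto
  have "g z = A d e (X - d) (Y - e) * zpow z d e"
  proof (rule real_analytic_monomial[OF g(1) de g(2) _ nz])
    fix z :: complex assume z: "0 < norm z" "norm z < R"
    show "g (inverse z) = A d e (X - d) (Y - e) * zpow (inverse z) d e"
      by (rule has_sum_monomial_eq[OF g(3)[OF z]]) (use A in blast)
  qed
  moreover have "g z = C d e (X - d) (Y - e) * zpow z d e"
    by (rule has_sum_monomial_eq[OF g(4)[OF z(1,2)]]) (use C in blast)
  ultimately show ?thesis using zpow_nonzero[OF nz(1)] by simp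
qed

section \<open>Laurent series, residues and contour integrals\<close>

lemma laurent_has_contour_integral:
  fixes a :: "int \<Rightarrow> complex"
  assumes "0 < r" and hs: "\<And>z. norm z = r \<Longrightarrow> ((\<lambda>n. a n * z powi n) has_sum f (w + z)) UNIV"
  shows "(f has_contour_integral 2 * pi * \<i> * a (- 1)) (circlepath w r)"
proof -
  let ?F = "finite_subsets_at_top (UNIV :: int set)"
  let ?s = "\<lambda>A z. \<Sum>n\<in>A. a n * (z - w) powi n"
  have img: "norm (z - w) = r" if "z \<in> path_image (circlepath w r)" for z
    using that \<open>0 < r\<close> by (auto simp: dist_norm norm_minus_commute)
  have "(\<lambda>n. norm (a n * of_real r powi n)) summable_on UNIV"
    by (rule has_sum_imp_abs_summable_complex[OF hs]) (use \<open>0 < r\<close> in auto)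
  then have sm: "(\<lambda>n. norm (a n) * r powi n) summable_on UNIV"
    using \<open>0 < r\<close> by (simp add: norm_mult norm_power_int)
  have ul: "uniform_limit (path_image (circlepath w r)) ?s f ?F"
  proof (rule Weierstrass_m_test_general'[OF _ _ sm])
    fix z n assume "z \<in> path_image (circlepath w r)"
    then show "norm (a n * (z - w) powi n) \<le> norm (a n) * r powi n"
      using img by (simp add: norm_mult norm_power_int)
  next
    fix z assume "z \<in> path_image (circlepath w r)"
    then show "((\<lambda>n. a n * (z - w) powi n) has_sum f z) UNIV"
      using hs[of "z - w"] img by simp
  qed
  have mono: "((\<lambda>z. (z - w) powi n) has_contour_integral (if n = - 1 then 2 * pi * \<i> else 0)) (circlepath w r)" for n
  proof (cases "n = - 1")
    case True
    have "((\<lambda>u. 1 / (u - w)) has_contour_integral 2 * pi * \<i> * winding_number (circlepath w r) w) (circlepath w r)"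
      by (rule has_contour_integral_winding_number) (use \<open>0 < r\<close> in auto)
    then show ?thesis
      using True winding_number_circlepath[of w w r] \<open>0 < r\<close> by (simp add: power_int_minus divide_inverse)
  next
    case False
    have "((\<lambda>z. (z - w) powi n) has_contour_integral 0) (circlepath w r)"
    proof (rule Cauchy_theorem_primitive[of "- {w}" "\<lambda>z. (z - w) powi (n + 1) / of_int (n + 1)"])
      fix x assume "x \<in> - {w}"
      then have x: "x - w \<noteq> 0" by simp
      have n1: "of_int (n + 1) \<noteq> (0 :: complex)" using False by (metis add.inverse_unique add.commute of_int_eq_0_iff)
      have "((\<lambda>z. (z - w) powi (n + 1)) has_field_derivative of_int (n + 1) * (x - w) powi (n + 1 - 1) * 1) (at x within - {w})"
        by (rule DERIV_power_int) (use x in \<open>auto intro!: derivative_eq_intros\<close>)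
      then show "((\<lambda>z. (z - w) powi (n + 1) / of_int (n + 1)) has_field_derivative (x - w) powi n) (at x within - {w})"
        using DERIV_cdivide[of "\<lambda>z. (z - w) powi (n + 1)" "of_int (n + 1) * (x - w) powi n" x "- {w}" "of_int (n + 1)"] n1
        by simp
    qed (use \<open>0 < r\<close> in auto)
    then show ?thesis using False by simp
  qed
  have sum: "(?s A has_contour_integral (\<Sum>n\<in>A. a n * (if n = - 1 then 2 * pi * \<i> else 0))) (circlepath w r)"
    if "finite A" for A
    by (intro has_contour_integral_sum has_contour_integral_lmul mono that)
  have fin: "\<forall>\<^sub>F A in ?F. finite A \<and> {- 1} \<subseteq> A"
    by (auto simp: eventually_finite_subsets_at_top intro!: exI[of _ "{- 1}"])
  have ev: "\<forall>\<^sub>F A in ?F. ?s A contour_integrable_on circlepath w r"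
    by (rule eventually_mono[OF fin]) (use sum has_contour_integral_integrable in blast)
  have int: "f contour_integrable_on circlepath w r"
    and lim: "((\<lambda>A. contour_integral (circlepath w r) (?s A)) \<longlongrightarrow> contour_integral (circlepath w r) f) ?F"
    using contour_integral_uniform_limit_circlepath[OF ev, of f] ul \<open>0 < r\<close> by auto
  have "\<forall>\<^sub>F A in ?F. contour_integral (circlepath w r) (?s A) = 2 * pi * \<i> * a (- 1)"
  proof (rule eventually_mono[OF fin])
    fix A :: "int set" assume A: "finite A \<and> {- 1} \<subseteq> A"
    have "(\<Sum>n\<in>A. a n * (if n = - 1 then 2 * pi * \<i> else 0)) = (\<Sum>n\<in>{- 1}. a n * (if n = - 1 then 2 * pi * \<i> else 0))"
      by (rule sum.mono_neutral_right) (use A in auto)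
    then show "contour_integral (circlepath w r) (?s A) = 2 * pi * \<i> * a (- 1)"
      using contour_integral_unique[OF sum[of A]] A by (simp add: mult_ac)
  qed
  then have "((\<lambda>A. contour_integral (circlepath w r) (?s A)) \<longlongrightarrow> 2 * pi * \<i> * a (- 1)) ?F"
    by (rule tendsto_eventually)
  then have "contour_integral (circlepath w r) f = 2 * pi * \<i> * a (- 1)"
    using lim by (intro tendsto_unique[OF _ lim]) auto
  then show ?thesis using int has_contour_integral_integral by metis
qed

lemma residue_eq_laurent_coeff:
  fixes a :: "int \<Rightarrow> complex"
  assumes "open S" "w \<in> S" "f holomorphic_on S - {w}" "0 < R"
    and hs: "\<And>z. 0 < norm z \<Longrightarrow> norm z < R \<Longrightarrow> ((\<lambda>n. a n * z powi n) has_sum f (w + z)) UNIV"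
  shows "residue f w = a (- 1)"
proof -
  obtain e where e: "e > 0" "cball w e \<subseteq> S"
    using assms(1,2) by (auto simp: open_contains_cball)
  define r where "r = min e (R / 2)"
  have r: "0 < r" "r < R" "cball w r \<subseteq> S"
    using e assms(4) by (auto simp: r_def)
  have "(f has_contour_integral 2 * pi * \<i> * residue f w) (circlepath w r)"
    by (rule base_residue[OF assms(1,2) r(1) assms(3) r(3)])
  moreover have "(f has_contour_integral 2 * pi * \<i> * a (- 1)) (circlepath w r)"
    by (rule laurent_has_contour_integral[OF r(1)]) (use hs r in auto)
  ultimately have "2 * pi * \<i> * residue f w = 2 * pi * \<i> * a (- 1)"
    by (rule has_contour_integral_unique)
  then show ?thesis by simp
qed

text \<open>The circle of radius \<open>T\<close> encloses 0 and 1 and lies where the expansion at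
  infinity converges. As \<open>a\<close> is written in powers of the large variable,
  \<open>a (- 1)\<close> is the integral over this circle divided by \<open>2 * pi * \<i>\<close>,
  without change of sign.\<close>

lemma residues_0_1_infinity:
  fixes a b c :: "int \<Rightarrow> complex"
  assumes hol: "f holomorphic_on - {0, 1}" and "0 < R"
    and a: "\<And>z. 0 < norm z \<Longrightarrow> norm z < R \<Longrightarrow> ((\<lambda>n. a n * inverse z powi n) has_sum f (inverse z)) UNIV"
    and b: "\<And>z. 0 < norm z \<Longrightarrow> norm z < R \<Longrightarrow> ((\<lambda>n. b n * z powi n) has_sum f (1 + z)) UNIV"
    and c: "\<And>z. 0 < norm z \<Longrightarrow> norm z < R \<Longrightarrow> ((\<lambda>n. c n * z powi n) has_sum f z) UNIV"
  shows "a (- 1) = b (- 1) + c (- 1)"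
proof -
  define T where "T = max 1 (1 / R) + 1"
  have T: "T > 1" "T > 1 / R" by (auto simp: T_def)
  have "(f has_contour_integral 2 * pi * \<i> * a (- 1)) (circlepath 0 T)"
  proof (rule laurent_has_contour_integral)
    fix z :: complex assume z: "norm z = T"
    have "0 < norm (inverse z)" "norm (inverse z) < R"
      unfolding norm_inverse z using T inverse_less_of_one_divide_less[OF \<open>0 < R\<close>] by auto
    from a[OF this] show "((\<lambda>n. a n * z powi n) has_sum f (0 + z)) UNIV" by simp
  qed (use T in simp)
  then have "contour_integral (circlepath 0 T) f = 2 * pi * \<i> * a (- 1)"
    by (rule contour_integral_unique)
  moreover have "contour_integral (circlepath 0 T) f =
      2 * pi * \<i> * (\<Sum>p\<in>{0, 1}. winding_number (circlepath 0 T) p * residue f p)"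
    by (rule Residue_theorem[of UNIV])
      (use T hol in \<open>auto simp: Compl_eq_Diff_UNIV[symmetric] dist_norm\<close>)
  moreover have "winding_number (circlepath 0 T) p = 1" if "p \<in> {0, 1}" for p
    by (rule winding_number_circlepath) (use that T in auto)
  ultimately have "a (- 1) = residue f 0 + residue f 1" by simp
  moreover have "residue f 0 = c (- 1)"
    by (rule residue_eq_laurent_coeff[of "- {1}" _ _ R]) 
      (use hol c \<open>0 < R\<close> in \<open>auto simp: Compl_eq_Diff_UNIV Diff_insert2[symmetric] insert_commute elim!: holomorphic_on_subset\<close>)
  moreover have "residue f 1 = b (- 1)"
    by (rule residue_eq_laurent_coeff[of "- {0}" _ _ R]) 
      (use hol b \<open>0 < R\<close> in \<open>auto simp: Compl_eq_Diff_UNIV Diff_insert2[symmetric] insert_commute elim!: holomorphic_on_subset\<close>)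
  ultimately show ?thesis by simp
qed

text \<open>This supplies the open set on which a slice is first known to be holomorphic, from which
  propagation starts.\<close>

lemma laurent_holomorphic:
  fixes c :: "int \<Rightarrow> complex" and f :: "complex \<Rightarrow> complex"
  assumes hs: "\<And>z. 0 < norm z \<Longrightarrow> norm z < R \<Longrightarrow> ((\<lambda>n. c n * z powi n) has_sum f z) UNIV"
  shows "f holomorphic_on ball 0 R - {0}"
  unfolding holomorphic_on_def
proof
  fix w :: complex assume "w \<in> ball 0 R - {0}"
  then have w: "0 < norm w" "norm w < R" by auto
  define \<delta> where "\<delta> = min (norm w) (R - norm w) / 2"
  define m where "m = norm w - \<delta>"
  define M where "M = norm w + \<delta>"
  have "0 < \<delta>" "2 * \<delta> \<le> norm w" "2 * \<delta> \<le> R - norm w"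
    using w unfolding \<delta>_def by auto
  then have \<delta>: "0 < \<delta>" "0 < m" "m < R" "0 < M" "M < R"
    using w unfolding m_def M_def by linarith+
  have mM: "m \<le> norm z" "norm z \<le> M" if "z \<in> cball w \<delta>" for z
    using that norm_triangle_ineq2[of w "w - z"] norm_triangle_ineq3[of w z]
    by (auto simp: m_def M_def dist_norm)
  have sm: "(\<lambda>n. norm (c n) * t powi n) summable_on UNIV" if "0 < t" "t < R" for t
  proof -
    have "(\<lambda>n. norm (c n * of_real t powi n)) summable_on UNIV"
      by (rule has_sum_imp_abs_summable_complex[OF hs]) (use that in auto)
    then show ?thesis using that by (simp add: norm_mult norm_power_int)
  qed
  have ul: "uniform_limit (cball w \<delta>) (\<lambda>A z. \<Sum>n\<in>A. c n * z powi n) f (finite_subsets_at_top UNIV)"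
  proof (rule Weierstrass_m_test_general'[OF _ _ summable_on_add[OF sm[OF \<delta>(2,3)] sm[OF \<delta>(4,5)]]])
    fix n z assume z: "z \<in> cball w \<delta>"
    have "norm z powr of_int n \<le> m powr of_int n + M powr of_int n"
      by (rule powr_le_add_powr) (use \<delta> mM[OF z] in auto)
    moreover have "0 < norm z" using \<delta> mM[OF z] by linarith
    ultimately have "norm z powi n \<le> m powi n + M powi n"
      using \<delta> by (simp add: powr_real_of_int')
    from mult_left_mono[OF this norm_ge_zero[of "c n"]]
    show "norm (c n * z powi n) \<le> norm (c n) * m powi n + norm (c n) * M powi n"
      by (simp add: norm_mult norm_power_int distrib_left)
  next
    fix z assume z: "z \<in> cball w \<delta>"
    show "((\<lambda>n. c n * z powi n) has_sum f z) UNIV"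
      by (rule hs) (use mM[OF z] \<delta> in auto)
  qed
  have nz: "z \<noteq> 0" if "z \<in> cball w \<delta>" for z using mM[OF that] \<delta> by auto
  have hol: "(\<lambda>z. \<Sum>n\<in>A. c n * z powi n) holomorphic_on cball w \<delta>" for A
    by (intro holomorphic_intros) (use nz in blast)
  have "f holomorphic_on ball w \<delta>"
    by (rule holomorphic_uniform_limit[OF _ ul])
      (auto intro!: always_eventually holomorphic_on_imp_continuous_on[OF hol] holomorphic_on_subset[OF hol])
  then have "f field_differentiable at w"
    by (rule holomorphic_on_imp_differentiable_at) (use \<delta> in auto)
  then show "f field_differentiable at w within ball 0 R - {0}"
    by (rule field_differentiable_at_within)
qed

text \<open>Comparison of the residues of \<open>z^2 g\<close>.\<close>

lemma real_analytic_laurent_relation: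
  fixes a b c :: "int \<Rightarrow> complex"
  assumes ra: "real_analytic_on g (- {0, 1})" and "0 < R"
    and a: "\<And>z. 0 < norm z \<Longrightarrow> norm z < R \<Longrightarrow> ((\<lambda>n. a n * inverse z powi n) has_sum g (inverse z)) UNIV"
    and b: "\<And>z. 0 < norm z \<Longrightarrow> norm z < R \<Longrightarrow> ((\<lambda>n. b n * z powi n) has_sum g (1 + z)) UNIV"
    and c: "\<And>z. 0 < norm z \<Longrightarrow> norm z < R \<Longrightarrow> ((\<lambda>n. c n * z powi n) has_sum g z) UNIV"
  shows "a (- 3) = b (- 1) + 2 * b (- 2) + b (- 3) + c (- 3)"
proof -
  have "g holomorphic_on ball 0 (min R 1) - {0}"
    by (rule laurent_holomorphic) (use c in auto)
  moreover have "of_real (min R 1 / 2) \<in> ball (0::complex) (min R 1) - {0}"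
    using \<open>0 < R\<close> by (auto simp: dist_norm simp del: of_real_divide)
  then have "ball (0::complex) (min R 1) - {0} \<noteq> {}" by blast
  ultimately have hol: "g holomorphic_on - {0, 1}"
    by (intro real_analytic_holomorphic_propagation[OF ra open_minus_0_1 connected_minus_0_1,
          of "ball 0 (min R 1) - {0}"]) auto
  \<comment> \<open>In \<open>Y \<omega>\<close> the operator \<open>L n\<close> has the exponent
    \<open>- n - 2\<close>, so \<open>L 1\<close> sits at \<open>- 3\<close> and the weight
    \<open>z^2\<close> moves it to the residue. Around the point 1 the weight is
    \<open>(1 + z)^2\<close>, hence the factors 1, 2, 1 in front of the coefficients at
    \<open>- 1\<close>, \<open>- 2\<close>, \<open>- 3\<close>.\<close>
  define f where "f z = z\<^sup>2 * g z" for z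
  have shift: "((\<lambda>n. d (n - k) * w powi n) has_sum w powi k * s) UNIV"
    if d: "((\<lambda>n. d n * w powi n) has_sum s) UNIV" and "w \<noteq> 0" for d :: "int \<Rightarrow> complex" and w s k
  proof -
    have "((\<lambda>n. w powi k * (d n * w powi n)) has_sum w powi k * s) UNIV"
      by (rule has_sum_cmult_right[OF d])
    then have "((\<lambda>n. w powi k * (d (n - k) * w powi (n - k))) has_sum w powi k * s) UNIV"
      by (rule has_sum_reindex_bij_witness[of _ "\<lambda>n. n - k" "\<lambda>n. n + k", THEN iffD1, rotated -1]) auto
    moreover have "w powi k * (d (n - k) * w powi (n - k)) = d (n - k) * w powi n" for n
      using \<open>w \<noteq> 0\<close> by (simp add: power_int_diff)
    ultimately show ?thesis by simp
  qed
  have "a (- 1 - 2) = (b (- 1) + 2 * b (- 1 - 1) + b (- 1 - 2)) + c (- 1 - 2)"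
  proof (rule residues_0_1_infinity[where f = f and a = "\<lambda>n. a (n - 2)" and c = "\<lambda>n. c (n - 2)"
        and b = "\<lambda>n. b n + 2 * b (n - 1) + b (n - 2)"])
    show "f holomorphic_on - {0, 1}" unfolding f_def by (intro holomorphic_intros hol)
    show "0 < R" by fact
    fix z :: complex assume z: "0 < norm z" "norm z < R"
    then have nz: "z \<noteq> 0" "inverse z \<noteq> 0" by auto
    show "((\<lambda>n. a (n - 2) * inverse z powi n) has_sum f (inverse z)) UNIV"
      using shift[OF a[OF z] nz(2), of 2] by (simp add: f_def)
    show "((\<lambda>n. c (n - 2) * z powi n) has_sum f z) UNIV"
      using shift[OF c[OF z] nz(1), of 2] by (simp add: f_def)
    have "((\<lambda>n. b n * z powi n + 2 * (b (n - 1) * z powi n) + b (n - 2) * z powi n) has_sum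
        g (1 + z) + 2 * (z powi 1 * g (1 + z)) + z powi 2 * g (1 + z)) UNIV"
      by (intro has_sum_add has_sum_cmult_right b z shift nz)
    then show "((\<lambda>n. (b n + 2 * b (n - 1) + b (n - 2)) * z powi n) has_sum f (1 + z)) UNIV"
      by (simp add: f_def algebra_simps power2_eq_square)
  qed
  then show ?thesis by simp
qed

section \<open>Commutator relations from holomorphic and antiholomorphic correlators\<close>

lemma has_sum_holomorphic_part:
  assumes "((\<lambda>(x, y). D x y * zpow w x y) has_sum s) UNIV" "w \<noteq> 0"
    and "\<And>x y. D x y \<noteq> 0 \<Longrightarrow> x \<in> \<int> \<and> y = 0"
  shows "((\<lambda>n. D (of_int n) 0 * w powi n) has_sum s) UNIV"
proof -
  let ?\<iota> = "\<lambda>n. (of_int n :: real, 0 :: real)"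
  have inj: "inj ?\<iota>" by (auto simp: inj_def)
  have "(case q of (x, y) \<Rightarrow> D x y * zpow w x y) = 0" if q: "q \<notin> range ?\<iota>" for q
  proof (rule ccontr)
    assume nz: "\<not> ?thesis"
    obtain x y where qe: "q = (x, y)" by force
    have "x \<in> \<int>" "y = 0" using nz assms(3)[of x y] by (auto simp: qe)
    then obtain n where "q = ?\<iota> n" by (auto simp: qe elim!: Ints_cases)
    then show False using q by blast
  qed
  from has_sum_reindex_support[OF inj this, THEN iffD1, OF _ assms(1)]
  have "((\<lambda>n. case ?\<iota> n of (x, y) \<Rightarrow> D x y * zpow w x y) has_sum s) UNIV" .
  then show ?thesis by (simp add: zpow_of_int_0[OF assms(2)])
qed

text \<open>Conjugating the function exchanges the two exponents, and real analyticity is stable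
  under conjugation, so the antiholomorphic case reduces to the holomorphic one.\<close>

lemma has_sum_antiholomorphic_part:
  assumes "((\<lambda>(x, y). D x y * zpow w x y) has_sum s) UNIV" "w \<noteq> 0"
    and "\<And>x y. D x y \<noteq> 0 \<Longrightarrow> x = 0 \<and> y \<in> \<int>"
  shows "((\<lambda>n. cnj (D 0 (of_int n)) * w powi n) has_sum cnj s) UNIV"
proof -
  have "((\<lambda>q. cnj (case q of (x, y) \<Rightarrow> D x y * zpow w x y)) has_sum cnj s) UNIV"
    using assms(1) by (simp only: has_sum_cnj_iff)
  then have "((\<lambda>(y, x). cnj (D x y * zpow w x y)) has_sum cnj s) UNIV"
    by (rule has_sum_reindex_bij_witness[of _ prod.swap prod.swap, THEN iffD1, rotated -1]) auto
  moreover have "cnj (zpow w x y) = zpow w y x" for x y by (simp add: zpow_def mult.commute)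
  ultimately have "((\<lambda>(y, x). cnj (D x y) * zpow w y x) has_sum cnj s) UNIV" by simp
  then show ?thesis
    by (rule has_sum_holomorphic_part) (use assms in \<open>auto simp: complex_cnj_zero_iff\<close>)
qed

text \<open>For \<open>\<omega>\<close> as first state and \<open>b\<close> as second the three
  coefficients of \<open>B\<close> carry \<open>L (- 1) b\<close>, \<open>L 0 b\<close> and
  \<open>L 1 b\<close>, while \<open>A\<close> and \<open>C\<close> carry \<open>L 1\<close> to the
  left and to the right of a mode of \<open>b\<close>: this is the commutator formula for
  \<open>L 1\<close>, tested by a functional.\<close>

lemma gcor2_holomorphic_relation:
  assumes gc: "gcor2 \<mu> A B C"
    and deg: "\<And>x1 y1 x2 y2. A x1 y1 x2 y2 \<noteq> 0 \<or> B x1 y1 x2 y2 \<noteq> 0 \<or> C x1 y1 x2 y2 \<noteq> 0 \<Longrightarrow>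
      x1 + x2 = X \<and> y1 + y2 = Y"
    and hol: "\<And>x1 y1 x2 y2. A x1 y1 x2 y2 \<noteq> 0 \<or> B x1 y1 x2 y2 \<noteq> 0 \<or> C x1 y1 x2 y2 \<noteq> 0 \<Longrightarrow>
      x1 \<in> \<int> \<and> y1 = 0"
  shows "A (- 3) 0 (X + 3) Y = B (- 1) 0 (X + 1) Y + 2 * B (- 2) 0 (X + 2) Y + B (- 3) 0 (X + 3) Y
    + C (- 3) 0 (X + 3) Y"
proof -
  obtain g R where g: "real_analytic_on g (- {0, 1})" "0 < R"
    "\<And>z. 0 < norm z \<Longrightarrow> norm z < R \<Longrightarrow>
      ((\<lambda>(x, y). A x y (X - x) (Y - y) * zpow (inverse z) x y) has_sum g (inverse z)) UNIV"
    "\<And>z. 0 < norm z \<Longrightarrow> norm z < R \<Longrightarrow>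
      ((\<lambda>(x, y). B x y (X - x) (Y - y) * zpow z x y) has_sum g (1 + z)) UNIV"
    "\<And>z. 0 < norm z \<Longrightarrow> norm z < R \<Longrightarrow>
      ((\<lambda>(x, y). C x y (X - x) (Y - y) * zpow z x y) has_sum g z) UNIV"
    by (rule gcor2_homogeneous_slice[OF gc deg], assumption) (rule that; assumption)
  let ?c = "\<lambda>D n. D (of_int n) 0 (X - of_int n) (Y - 0) :: complex"
  have "?c A (- 3) = ?c B (- 1) + 2 * ?c B (- 2) + ?c B (- 3) + ?c C (- 3)"
    by (rule real_analytic_laurent_relation[OF g(1,2)])
      (rule has_sum_holomorphic_part[OF g(3)] has_sum_holomorphic_part[OF g(4)] has_sum_holomorphic_part[OF g(5)];
        use hol in force)+
  then show ?thesis by simp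
qed

lemma gcor2_antiholomorphic_relation:
  assumes gc: "gcor2 \<mu> A B C"
    and deg: "\<And>x1 y1 x2 y2. A x1 y1 x2 y2 \<noteq> 0 \<or> B x1 y1 x2 y2 \<noteq> 0 \<or> C x1 y1 x2 y2 \<noteq> 0 \<Longrightarrow>
      x1 + x2 = X \<and> y1 + y2 = Y"
    and hol: "\<And>x1 y1 x2 y2. A x1 y1 x2 y2 \<noteq> 0 \<or> B x1 y1 x2 y2 \<noteq> 0 \<or> C x1 y1 x2 y2 \<noteq> 0 \<Longrightarrow>
      x1 = 0 \<and> y1 \<in> \<int>"
  shows "A 0 (- 3) X (Y + 3) = B 0 (- 1) X (Y + 1) + 2 * B 0 (- 2) X (Y + 2) + B 0 (- 3) X (Y + 3)
    + C 0 (- 3) X (Y + 3)"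
proof -
  obtain g R where g: "real_analytic_on g (- {0, 1})" "0 < R"
    "\<And>z. 0 < norm z \<Longrightarrow> norm z < R \<Longrightarrow>
      ((\<lambda>(x, y). A x y (X - x) (Y - y) * zpow (inverse z) x y) has_sum g (inverse z)) UNIV"
    "\<And>z. 0 < norm z \<Longrightarrow> norm z < R \<Longrightarrow>
      ((\<lambda>(x, y). B x y (X - x) (Y - y) * zpow z x y) has_sum g (1 + z)) UNIV"
    "\<And>z. 0 < norm z \<Longrightarrow> norm z < R \<Longrightarrow>
      ((\<lambda>(x, y). C x y (X - x) (Y - y) * zpow z x y) has_sum g z) UNIV"
    by (rule gcor2_homogeneous_slice[OF gc deg], assumption) (rule that; assumption)
  let ?c = "\<lambda>D n. cnj (D 0 (of_int n) (X - 0) (Y - of_int n))"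
  have "?c A (- 3) = ?c B (- 1) + 2 * ?c B (- 2) + ?c B (- 3) + ?c C (- 3)"
    by (rule real_analytic_laurent_relation[OF real_analytic_on_cnj[OF g(1)] g(2)])
      (rule has_sum_antiholomorphic_part[OF g(3)] has_sum_antiholomorphic_part[OF g(4)] has_sum_antiholomorphic_part[OF g(5)];
        use hol in force)+
  then have "cnj (?c A (- 3)) = cnj (?c B (- 1) + 2 * ?c B (- 2) + ?c B (- 3) + ?c C (- 3))" by simp
  then show ?thesis by simp
qed

section \<open>Correlators under inversion\<close>

text \<open>The values of an inverted chart outside its range are arbitrary, so expansions are
  compared on a small punctured disc only.\<close>

lemma has_conformal_expansion_cong:
  assumes "has_conformal_expansion g a" "0 < \<delta>"
    and eq: "\<And>p. 0 < norm p \<Longrightarrow> norm p < \<delta> \<Longrightarrow> g p = g' p"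
  shows "has_conformal_expansion g' a"
proof -
  obtain R where a: "a \<in> laurent_series" and R: "R > 0" and
    h: "\<And>p. 0 < norm p \<Longrightarrow> norm p < R \<Longrightarrow> ((\<lambda>(r, s). a r s * zpow p r s) has_sum g p) UNIV"
    using assms(1) unfolding has_conformal_expansion_iff by auto
  have "((\<lambda>(r, s). a r s * zpow p r s) has_sum g' p) UNIV" if "0 < norm p" "norm p < min R \<delta>" for p
    using h[of p] eq[of p] that by simp
  then show ?thesis
    unfolding has_conformal_expansion_iff using a R \<open>0 < \<delta>\<close>
    by (intro conjI exI[of _ "min R \<delta>"]) auto
qed

text \<open>Inversion fixes 1, so \<open>\<phi>\<close> precomposed with it is again a chart at 1,
  defined once 0 has been removed from \<open>U\<close>. The open mapping theorem provides a disc
  around 0 on which the inverses of the two charts differ by inversion.\<close>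

lemma conformal_singularity_inversion:
  assumes f: "conformal_singularity f 1"
  shows "conformal_singularity (\<lambda>w. f (1 / w)) 1"
  unfolding conformal_singularity_def
proof (intro allI impI)
  fix U \<phi> assume "local_chart 1 U \<phi>"
  then have U: "open U" "1 \<in> U" "\<phi> holomorphic_on U" "inj_on \<phi> U" "\<phi> 1 = 0"
    by (auto simp: local_chart_def)
  define U1 where "U1 = U - {0}"
  define U' where "U' = inverse ` U1"
  have U1: "open U1" "U1 \<subseteq> U" "1 \<in> U1" "0 \<notin> U1"
    using U by (auto simp: U1_def)
  have U'_eq: "U' = inverse -` U1 \<inter> - {0}"
    using U1 by (auto simp: U'_def image_iff) (metis inverse_inverse_eq)
  have "open U'"
    unfolding U'_eq
    by (rule continuous_on_open_vimage[THEN iffD1, rule_format]) (use U1 in \<open>auto intro!: continuous_intros\<close>)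
  moreover have "1 \<in> U'" using U1 by (force simp: U'_def image_iff)
  moreover have "(\<lambda>w. \<phi> (inverse w)) holomorphic_on U'"
    by (rule holomorphic_on_compose_gen[of inverse U' \<phi> U1, unfolded o_def])
      (use U U1 in \<open>auto simp: U'_eq intro!: holomorphic_intros elim: holomorphic_on_subset\<close>)
  moreover have "inj_on (\<lambda>w. \<phi> (inverse w)) U'"
    using U(4) U1(2) by (auto simp: inj_on_def U'_def) 
  ultimately have chart: "local_chart 1 U' (\<lambda>w. \<phi> (inverse w))"
    using U by (simp add: local_chart_def)
  obtain a where a: "has_conformal_expansion (\<lambda>p. f (inv_into U' (\<lambda>w. \<phi> (inverse w)) p)) a"
    using f chart unfolding conformal_singularity_def by blast
  have "open (\<phi> ` U1)"
    by (rule open_mapping_thm3) (use U U1 in \<open>auto intro: holomorphic_on_subset inj_on_subset\<close>)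
  moreover have "0 \<in> \<phi> ` U1" using U(5) U1(3) by (metis imageI)
  ultimately obtain \<delta> where \<delta>: "\<delta> > 0" "ball 0 \<delta> \<subseteq> \<phi> ` U1"
    unfolding open_contains_ball by blast
  have "has_conformal_expansion (\<lambda>p. f (1 / inv_into U \<phi> p)) a"
  proof (rule has_conformal_expansion_cong[OF a \<delta>(1)])
    fix p :: complex assume "0 < norm p" "norm p < \<delta>"
    then have "p \<in> \<phi> ` U1" using \<delta>(2) by auto
    then obtain u where u: "u \<in> U1" "p = \<phi> u" by blast
    have "inv_into U \<phi> p = u" using u U1(2) U(4) by auto
    moreover have "inv_into U' (\<lambda>w. \<phi> (inverse w)) p = inverse u"
    proof (rule inv_into_f_eq)
      show "inj_on (\<lambda>w. \<phi> (inverse w)) U'" using chart by (simp add: local_chart_def)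
    qed (use u in \<open>auto simp: U'_def\<close>)
    ultimately show "f (inv_into U' (\<lambda>w. \<phi> (inverse w)) p) = f (1 / inv_into U \<phi> p)"
      by (simp add: divide_inverse)
  qed
  then show "\<exists>a. has_conformal_expansion (\<lambda>p. f (1 / inv_into U \<phi> p)) a" by blast
qed

text \<open>Inversion exchanges 0 and infinity; since \<open>1 / (1 / w) = w\<close>, the conditions
  at these two points trade places.\<close>

lemma F01inf_inversion:
  assumes "f \<in> F01inf"
  shows "(\<lambda>w. f (1 / w)) \<in> F01inf"
proof -
  have f: "real_analytic_on f (- {0, 1})" "conformal_singularity f 0" "conformal_singularity f 1"
    "conformal_singularity (\<lambda>w. f (1 / w)) 0"
    using assms by (auto simp: F01inf_def)
  have "real_analytic_on (\<lambda>w. f (1 / w)) (- {0, 1})"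
    by (rule real_analytic_on_compose_holomorphic[OF f(1) _ open_minus_0_1]) (auto intro!: holomorphic_intros)
  then show ?thesis
    unfolding F01inf_def using f(2,4) conformal_singularity_inversion[OF f(3)] by simp
qed

section \<open>The expansion at 1 under inversion\<close>

lemma pochhammer_abs_le: "\<bar>pochhammer r m\<bar> \<le> pochhammer \<bar>r\<bar> m" for r :: real
proof (induction m)
  case (Suc m)
  have "\<bar>r + real m\<bar> \<le> \<bar>r\<bar> + real m" by linarith
  then show ?case
    unfolding pochhammer_Suc abs_mult
    by (intro mult_mono Suc) (use order_trans[OF abs_ge_zero Suc] in auto)
qed simp

text \<open>\<open>(1 - t)^(-r)\<close> is dominated coefficientwise by
  \<open>(1 - t)^(-|r|)\<close>, whose coefficients are non-negative; this majorises the double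
  expansion in \<open>flip_series_has_sum\<close>.\<close>

lemma gbinomial_minus_abs_le: "\<bar>(- r) gchoose m\<bar> \<le> (- 1) ^ m * ((- \<bar>r\<bar>) gchoose m)" for r :: real
  using pochhammer_abs_le[of r m]
  by (simp add: gbinomial_pochhammer abs_mult divide_right_mono flip: power_add mult.assoc)

lemma majorant_binomial_has_sum:
  fixes r t :: real
  assumes "0 \<le> t" "t < 1"
  shows "((\<lambda>m. (- 1) ^ m * ((- \<bar>r\<bar>) gchoose m) * t ^ m) has_sum (1 - t) powr (- \<bar>r\<bar>)) UNIV"
proof -
  have s: "(\<lambda>m. (- 1) ^ m * ((- \<bar>r\<bar>) gchoose m) * t ^ m) sums (1 - t) powr (- \<bar>r\<bar>)"
    using gen_binomial_real[of "- t" "- \<bar>r\<bar>"] assms by (simp add: power_minus[of t] mult_ac)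
  have nn: "0 \<le> (- 1) ^ m * ((- \<bar>r\<bar>) gchoose m) * t ^ m" for m
    using order_trans[OF abs_ge_zero gbinomial_minus_abs_le[of r m]] assms(1) by simp
  show ?thesis
    by (rule norm_summable_imp_has_sum[OF _ s]) (simp only: real_norm_def abs_of_nonneg[OF nn] sums_summable[OF s])
qed

text \<open>The coefficients of \<open>b(-q/(1-q))\<close>.\<close>

definition flip_series :: "series1 \<Rightarrow> series1" where
  "flip_series b x y = (\<Sum>(m, n) | b (x - real m) (y - real n) \<noteq> 0.
     sign_pow ((x - m) - (y - n)) * b (x - m) (y - n) *
     ((- 1) ^ m * of_real ((- (x - m)) gchoose m) * ((- 1) ^ n * of_real ((- (y - n)) gchoose n))))"

lemma bounded_support_index:
  fixes b :: series1
  assumes "\<And>r s. b r s \<noteq> 0 \<Longrightarrow> N \<le> r \<and> N \<le> s" "x - N < real K + 1" "y - N < real K + 1"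
  shows "b (x - real m) (y - real n) \<noteq> 0 \<Longrightarrow> m \<le> K \<and> n \<le> K"
proof -
  assume "b (x - real m) (y - real n) \<noteq> 0"
  then have "N \<le> x - real m" "N \<le> y - real n" using assms(1) by blast+
  then have "real m < real K + 1" "real n < real K + 1" using assms(2,3) by linarith+
  then show ?thesis by simp
qed

lemma sum_support_box:
  fixes t :: "nat \<Rightarrow> nat \<Rightarrow> complex"
  assumes "\<And>m n. P m n \<Longrightarrow> m \<le> K \<and> n \<le> K" "\<And>m n. \<not> P m n \<Longrightarrow> t m n = 0"
  shows "(\<Sum>(m, n) | P m n. t m n) = (\<Sum>m\<le>K. \<Sum>n\<le>K. t m n)"
proof -
  have "(\<Sum>m\<le>K. \<Sum>n\<le>K. t m n) = (\<Sum>(m, n)\<in>{..K} \<times> {..K}. t m n)"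
    by (rule sum.cartesian_product)
  also have "\<dots> = (\<Sum>(m, n) | P m n. t m n)"
    by (rule sum.mono_neutral_right) (use assms in auto)
  finally show ?thesis by simp
qed

text \<open>The index set of the definition depends on the support of \<open>b\<close> and on the
  exponents. A box that serves several terms at once allows sums to be added, swapped and
  reindexed.\<close>

lemma flip_series_box:
  assumes "\<And>r s. b r s \<noteq> 0 \<Longrightarrow> N \<le> r \<and> N \<le> s" "x - N < real K + 1" "y - N < real K + 1"
  shows "flip_series b x y = (\<Sum>m\<le>K. \<Sum>n\<le>K.
     sign_pow ((x - m) - (y - n)) * b (x - m) (y - n) *
     ((- 1) ^ m * of_real ((- (x - m)) gchoose m) * ((- 1) ^ n * of_real ((- (y - n)) gchoose n))))"
  unfolding flip_series_def
  by (rule sum_support_box) (use bounded_support_index[of b N x K y] assms in auto)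

lemma box_index_exists:
  fixes u v :: real
  obtains K :: nat where "u < real K + 1" "v < real K + 1"
proof -
  obtain K :: nat where "max u v < real K" using reals_Archimedean2 by blast
  then show thesis using that[of K] by simp
qed

lemma flip_series_nonzeroE:
  assumes "flip_series b x y \<noteq> 0"
  obtains m n :: nat where "b (x - m) (y - n) \<noteq> 0"
proof -
  have "{(m, n). b (x - real m) (y - real n) \<noteq> 0} \<noteq> {}"
  proof
    assume E: "{(m, n). b (x - real m) (y - real n) \<noteq> 0} = {}"
    have "flip_series b x y = 0" by (simp only: flip_series_def E sum.empty)
    with assms show False by simp
  qed
  then show thesis using that by auto
qed

lemma flip_series_laurent:
  assumes b: "b \<in> laurent_series"
  shows "flip_series b \<in> laurent_series"
proof -
  obtain N where N: "\<And>r s. b r s \<noteq> 0 \<Longrightarrow> N \<le> r \<and> N \<le> s" using laurent_series_bound[OF b] by metis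
  have cb: "countable {(r, s). b r s \<noteq> 0}"
    using b by (simp add: laurent_series_def admissible_support_def)
  have sub: "{(x, y). flip_series b x y \<noteq> 0} \<subseteq>
    (\<lambda>((r, s), m, n). (r + real m, s + real n)) ` ({(r, s). b r s \<noteq> 0} \<times> UNIV)"
  proof clarify
    fix x y assume "flip_series b x y \<noteq> 0"
    then obtain m n :: nat where "b (x - m) (y - n) \<noteq> 0" by (rule flip_series_nonzeroE)
    then show "(x, y) \<in> (\<lambda>((r, s), m, n). (r + real m, s + real n)) ` ({(r, s). b r s \<noteq> 0} \<times> UNIV)"
      by (intro image_eqI[of _ _ "((x - m, y - n), m, n)"]) auto
  qed
  have "countable {(x, y). flip_series b x y \<noteq> 0}"
    by (rule countable_subset[OF sub]) (intro countable_image countable_SIGMA cb; simp)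
  moreover have "x - y \<in> \<int> \<and> N \<le> x \<and> N \<le> y" if nz: "flip_series b x y \<noteq> 0" for x y
  proof -
    obtain m n :: nat where mn: "b (x - m) (y - n) \<noteq> 0" by (rule flip_series_nonzeroE[OF nz])
    have "(x - m) - (y - n) \<in> \<int>" by (rule laurent_series_int[OF b mn])
    then have "(x - m) - (y - n) + (real m - real n) \<in> \<int>" by (intro Ints_add) auto
    moreover have "(x - m) - (y - n) + (real m - real n) = x - y" by simp
    ultimately show ?thesis using N[OF mn] by auto
  qed
  ultimately show ?thesis
    unfolding laurent_series_def admissible_support_def by auto
qed

text \<open>Each power of \<open>- q / (1 - q)\<close> is expanded in \<open>q\<close>, and the
  double family is regrouped by total exponent. Absolute summability comes from the convergence of
  \<open>b\<close> at the larger radius \<open>t / (1 - t)\<close>, the maximum of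
  \<open>|q / (1 - q)|\<close> on \<open>|q| = t\<close>, which must therefore lie below
  \<open>R\<close>.\<close>

lemma flip_series_has_sum:
  assumes b: "b \<in> laurent_series" and "0 < R" 
    and hb: "\<And>p. 0 < norm p \<Longrightarrow> norm p < R \<Longrightarrow> ((\<lambda>(r, s). b r s * zpow p r s) has_sum g p) UNIV"
    and q: "0 < norm q" "norm q < 1" "norm q / (1 - norm q) < R"
  shows "((\<lambda>(x, y). flip_series b x y * zpow q x y) has_sum g (- q / (1 - q))) UNIV"
proof -
  obtain N0 where N0: "\<And>r s. b r s \<noteq> 0 \<Longrightarrow> N0 \<le> r \<and> N0 \<le> s" using laurent_series_bound[OF b] by metis
  define N where "N = min N0 0"
  have N: "N \<le> r" "N \<le> s" if "b r s \<noteq> 0" for r s using N0[OF that] by (auto simp: N_def)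
  have N_le: "N \<le> 0" by (simp add: N_def)
  define t where "t = norm q"
  have t: "0 < t" "t < 1" "t / (1 - t) < R" using q by (auto simp: t_def)
  define c where "c r m = (- 1) ^ m * (of_real ((- r) gchoose m) :: complex)" for r :: real and m :: nat
  define T where "T = (\<lambda>((r, s), m, n). sign_pow (r - s) * b r s * (c r m * c s n) * zpow q (r + real m) (s + real n))"
  have q0: "q \<noteq> 0" "1 - q \<noteq> 0" using q by auto
  have p: "0 < norm (- q / (1 - q))" "norm (- q / (1 - q)) < R"
  proof -
    have "1 - norm q \<le> norm (1 - q)" using norm_triangle_ineq2[of 1 q] by simp
    then have "norm q / norm (1 - q) \<le> norm q / (1 - norm q)"
      using q by (intro divide_left_mono) (auto intro!: mult_pos_pos)
    then show "norm (- q / (1 - q)) < R" using q(3) by (simp add: norm_divide)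
    show "0 < norm (- q / (1 - q))" using q0 by simp
  qed
  have inner: "((\<lambda>y. T (x, y)) has_sum (case x of (r, s) \<Rightarrow> b r s * zpow (- q / (1 - q)) r s)) UNIV" for x
  proof -
    obtain r s where x: "x = (r, s)" by force
    show ?thesis
    proof (cases "b r s = 0")
      case True
      then show ?thesis unfolding x by (simp add: T_def)
    next
      case False
      have rs: "r - s \<in> \<int>" by (rule laurent_series_int[OF b False])
      have nq: "norm (- q) < 1" "norm (- cnj q) < 1" using q by auto
      have h1: "((\<lambda>m. c r m * q ^ m) has_sum (1 - q) powr of_real (- r)) UNIV"
        using powr_binomial_has_sum[OF nq(1), of "- r"] by (simp add: c_def power_minus[of q] mult_ac)
      have "((\<lambda>n. cnj (c s n * q ^ n)) has_sum cnj ((1 - q) powr of_real (- s))) UNIV"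
        using has_sum_cnj_iff[THEN iffD2, OF powr_binomial_has_sum[OF nq(1), of "- s"]]
        by (simp add: c_def power_minus[of q] power_minus[of "cnj q"] mult_ac)
      moreover have "cnj (c s n * q ^ n) = c s n * cnj q ^ n" for n by (simp add: c_def)
      ultimately have h2: "((\<lambda>n. c s n * cnj q ^ n) has_sum cnj ((1 - q) powr of_real (- s))) UNIV"
        by (simp only:)
      from has_sum_times_complex[OF h1 h2]
      have "((\<lambda>(m, n). c r m * q ^ m * (c s n * cnj q ^ n)) has_sum zpow (1 - q) (- r) (- s)) UNIV"
        by (simp add: zpow_def)
      from has_sum_cmult_right[OF this, of "sign_pow (r - s) * b r s * zpow q r s"]
      have "((\<lambda>y. sign_pow (r - s) * b r s * zpow q r s * (case y of (m, n) \<Rightarrow> c r m * q ^ m * (c s n * cnj q ^ n)))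
        has_sum sign_pow (r - s) * b r s * zpow q r s * zpow (1 - q) (- r) (- s)) UNIV" .
      also have "(\<lambda>y. sign_pow (r - s) * b r s * zpow q r s * (case y of (m, n) \<Rightarrow> c r m * q ^ m * (c s n * cnj q ^ n)))
         = (\<lambda>y. T (x, y))"
        by (auto simp: fun_eq_iff x T_def zpow_add zpow_of_nat[OF q0(1)] mult_ac)
      also have "sign_pow (r - s) * b r s * zpow q r s * zpow (1 - q) (- r) (- s) = b r s * zpow (- q / (1 - q)) r s"
        using zpow_mult[OF rs, of "- q" "inverse (1 - q)"] zpow_inverse[OF rs, of "1 - q"] zpow_uminus[OF rs, of q]
        by (simp add: divide_inverse mult_ac)
      finally show ?thesis by (simp add: x)
    qed
  qed
  define G where "G = (\<lambda>((r, s), m, n). norm (b r s) * t powr (r + s) *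
    ((- 1) ^ m * ((- \<bar>r\<bar>) gchoose m) * t ^ m * ((- 1) ^ n * ((- \<bar>s\<bar>) gchoose n) * t ^ n)))"
  have maj_nonneg: "0 \<le> (- 1) ^ m * ((- \<bar>r\<bar>) gchoose m) * t ^ m" for r :: real and m
    using order_trans[OF abs_ge_zero gbinomial_minus_abs_le[of r m]] t by simp
  have TG: "norm (T x) \<le> G x" for x
  proof -
    obtain r s m n where x: "x = ((r, s), m, n)" by (metis surj_pair)
    have n1: "norm (c r m) * t ^ m \<le> (- 1) ^ m * ((- \<bar>r\<bar>) gchoose m) * t ^ m" for r m
      using gbinomial_minus_abs_le[of r m] t by (simp add: c_def norm_mult norm_power mult_right_mono)
    have "norm (T x) = norm (sign_pow (r - s)) * (norm (b r s) * t powr (r + s) * ((norm (c r m) * t ^ m) * (norm (c s n) * t ^ n)))"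
    proof -
      have "t powr (r + real m + (s + real n)) = t powr (r + s) * (t ^ m * t ^ n)"
        using t by (simp add: powr_add powr_realpow mult_ac)
      then show ?thesis unfolding x T_def by (simp add: norm_mult norm_zpow t_def mult_ac)
    qed
    also have "norm (sign_pow (r - s)) = 1" by (simp add: sign_pow_def norm_power_int)
    also have "1 * (norm (b r s) * t powr (r + s) * ((norm (c r m) * t ^ m) * (norm (c s n) * t ^ n))) \<le> G x"
      unfolding x G_def
      by (simp only: mult_1_left prod.case, intro mult_left_mono mult_mono n1) (use t maj_nonneg in auto)
    finally show ?thesis .
  qed
  have Ginner: "((\<lambda>y. G (x, y)) has_sum (case x of (r, s) \<Rightarrow>
      norm (b r s) * t powr (r + s) * ((1 - t) powr (- \<bar>r\<bar>) * (1 - t) powr (- \<bar>s\<bar>)))) UNIV" for x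
  proof -
    obtain r s where x: "x = (r, s)" by force
    let ?f = "\<lambda>m. (- 1) ^ m * ((- \<bar>r\<bar>) gchoose m) * t ^ m" and ?g = "\<lambda>n. (- 1) ^ n * ((- \<bar>s\<bar>) gchoose n) * t ^ n"
    have f: "(?f has_sum (1 - t) powr (- \<bar>r\<bar>)) UNIV" and g: "(?g has_sum (1 - t) powr (- \<bar>s\<bar>)) UNIV"
      using majorant_binomial_has_sum t by auto
    have fg: "((\<lambda>n. ?f m * ?g n) has_sum ?f m * (1 - t) powr (- \<bar>s\<bar>)) UNIV" for m
      by (rule has_sum_cmult_right[OF g])
    have fgo: "((\<lambda>m. ?f m * (1 - t) powr (- \<bar>s\<bar>)) has_sum (1 - t) powr (- \<bar>r\<bar>) * (1 - t) powr (- \<bar>s\<bar>)) UNIV"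
      by (rule has_sum_cmult_left[OF f])
    have sfg: "(\<lambda>(m, n). ?f m * ?g n) summable_on UNIV \<times> UNIV"
      by (rule summable_on_SigmaI[OF _ has_sum_imp_summable[OF fgo]])
        (use fg maj_nonneg in \<open>auto intro!: mult_nonneg_nonneg\<close>)
    have "((\<lambda>(m, n). ?f m * ?g n) has_sum (1 - t) powr (- \<bar>r\<bar>) * (1 - t) powr (- \<bar>s\<bar>)) (UNIV \<times> UNIV)"
      by (rule has_sum_SigmaI[OF _ fgo sfg]) (use fg in auto)
    from has_sum_cmult_right[OF this, of "norm (b r s) * t powr (r + s)"]
    show ?thesis by (simp add: x G_def case_prod_unfold)
  qed
  have tR: "0 < t / (1 - t)" using t by simp
  have "(\<lambda>x. norm (case x of (r, s) \<Rightarrow> b r s * zpow (of_real (t / (1 - t))) r s)) summable_on UNIV"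
    by (rule has_sum_imp_abs_summable_complex[OF hb]) (unfold norm_of_real, use tR t in auto)
  then have "(\<lambda>x. (1 - t) powr (4 * N) * norm (case x of (r, s) \<Rightarrow> b r s * zpow (of_real (t / (1 - t))) r s)) summable_on UNIV"
    by (rule summable_on_cmult_right)
  then have Gouter: "(\<lambda>x. case x of (r, s) \<Rightarrow>
      norm (b r s) * t powr (r + s) * ((1 - t) powr (- \<bar>r\<bar>) * (1 - t) powr (- \<bar>s\<bar>))) summable_on UNIV"
  proof (rule summable_on_comparison_test)
    fix x :: "real \<times> real"
    obtain r s where x: "x = (r, s)" by force
    show "0 \<le> (case x of (r, s) \<Rightarrow>
      norm (b r s) * t powr (r + s) * ((1 - t) powr (- \<bar>r\<bar>) * (1 - t) powr (- \<bar>s\<bar>)))"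
      by (simp add: x)
    show "(case x of (r, s) \<Rightarrow>
      norm (b r s) * t powr (r + s) * ((1 - t) powr (- \<bar>r\<bar>) * (1 - t) powr (- \<bar>s\<bar>)))
      \<le> (1 - t) powr (4 * N) * norm (case x of (r, s) \<Rightarrow> b r s * zpow (of_real (t / (1 - t))) r s)"
    proof (cases "b r s = 0")
      case False
      \<comment> \<open>For \<open>N \<le> u\<close> and \<open>N \<le> 0\<close> one has
        \<open>- |u| \<ge> 2 * N - u\<close>. So replacing the true exponent \<open>- u\<close> by
        \<open>- |u|\<close> in the majorant costs at most the constant factor
        \<open>(1 - t) powr (2 * N)\<close>.\<close>
      have le: "(1 - t) powr (- \<bar>u\<bar>) \<le> (1 - t) powr (2 * N - u)" if "N \<le> u" for u
        by (rule powr_mono') (use t that N_le in auto)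
      have "(1 - t) powr (- \<bar>r\<bar>) * (1 - t) powr (- \<bar>s\<bar>) \<le> (1 - t) powr (2 * N - r) * (1 - t) powr (2 * N - s)"
        by (intro mult_mono le N[OF False]) auto
      also have "\<dots> = (1 - t) powr (4 * N) * (1 - t) powr (- (r + s))"
        by (simp flip: powr_add)
      finally have "norm (b r s) * t powr (r + s) * ((1 - t) powr (- \<bar>r\<bar>) * (1 - t) powr (- \<bar>s\<bar>)) \<le>
        norm (b r s) * t powr (r + s) * ((1 - t) powr (4 * N) * (1 - t) powr (- (r + s)))"
        by (intro mult_left_mono) auto
      also have "\<dots> = (1 - t) powr (4 * N) * (norm (b r s) * (t / (1 - t)) powr (r + s))"
      proof -
        have "(t / (1 - t)) powr (r + s) = t powr (r + s) / (1 - t) powr (r + s)"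
          using t by (simp add: powr_divide)
        then show ?thesis by (simp only: powr_minus divide_inverse mult_ac)
      qed
      also have "\<dots> = (1 - t) powr (4 * N) * norm (b r s * zpow (of_real (t / (1 - t))) r s)"
        unfolding norm_mult norm_zpow norm_of_real abs_of_pos[OF tR] ..
      finally show ?thesis by (simp add: x)
    qed (simp add: x)
  qed
  have "G summable_on UNIV \<times> UNIV"
    by (rule summable_on_SigmaI[OF Ginner Gouter]) (rule order_trans[OF norm_ge_zero TG])
  then have "(\<lambda>x. norm (T x)) summable_on UNIV \<times> UNIV"
    by (rule Infinite_Sum.abs_summable_on_comparison_test') (rule TG)
  then have sT: "T summable_on UNIV \<times> UNIV"
    by (rule abs_summable_summable)
  have "(T has_sum g (- q / (1 - q))) (UNIV \<times> UNIV)"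
    by (rule has_sum_SigmaI[OF inner hb[OF p] sT])
  \<comment> \<open>Reindexing by the total exponents \<open>r + m\<close> and \<open>s + n\<close>;
    only finitely many terms share given total exponents, because the exponents of \<open>b\<close>
    are bounded below.\<close>
  then have "((\<lambda>((x, y), m, n). T ((x - real m, y - real n), m, n)) has_sum g (- q / (1 - q))) (UNIV \<times> UNIV)"
    by (rule has_sum_reindex_bij_witness[of _ "\<lambda>((x, y), m, n). ((x - real m, y - real n), m, n)"
          "\<lambda>((x, y), m, n). ((x + real m, y + real n), m, n)", THEN iffD1, rotated -1]) auto
  then have "((\<lambda>w. case w of (x, y) \<Rightarrow> flip_series b x y * zpow q x y) has_sum g (- q / (1 - q))) UNIV"
  proof (rule has_sum_SigmaD)
    fix w :: "real \<times> real"
    obtain X Y where w: "w = (X, Y)" by force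
    obtain K :: nat where K: "X - N < real K + 1" "Y - N < real K + 1" by (rule box_index_exists)
    let ?S = "{..K} \<times> {..K}"
    let ?t = "\<lambda>(m, n). T ((X - real m, Y - real n), m, n)"
    have "(?t has_sum (\<Sum>u\<in>?S. ?t u)) UNIV"
    proof (rule has_sum_finite_neutralI[of ?S])
      fix u :: "nat \<times> nat" assume u: "u \<in> UNIV - ?S"
      obtain m n where mn: "u = (m, n)" by force
      have "b (X - real m) (Y - real n) = 0"
        using bounded_support_index[of b N X K Y m n] N K u by (auto simp: mn)
      then show "?t u = 0" by (simp add: mn T_def)
    qed auto
    also have "(\<Sum>u\<in>?S. ?t u) = flip_series b X Y * zpow q X Y"
    proof -
      have fs: "flip_series b X Y = (\<Sum>(m, n)\<in>?S.
         sign_pow ((X - m) - (Y - n)) * b (X - m) (Y - n) *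
         ((- 1) ^ m * of_real ((- (X - m)) gchoose m) * ((- 1) ^ n * of_real ((- (Y - n)) gchoose n))))"
        unfolding sum.cartesian_product[symmetric]
        by (rule flip_series_box[of b N]) (use N K in auto)
      show ?thesis
        unfolding fs sum_distrib_right by (rule sum.cong) (auto simp: T_def c_def)
    qed
    finally show "((\<lambda>u. (\<lambda>((x, y), m, n). T ((x - real m, y - real n), m, n)) (w, u)) has_sum
        (case w of (x, y) \<Rightarrow> flip_series b x y * zpow q x y)) UNIV"
      by (simp add: w)
  qed
  then show ?thesis .
qed

text \<open>The new coordinate \<open>q\<close> stands for the argument
  \<open>1 / (1 / (1 - q)) = 1 - q\<close> of \<open>f\<close>, and
  \<open>1 - q = 1 / (1 - p)\<close> for \<open>p = - q / (1 - q)\<close>.\<close>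

lemma has_j_one_inversion:
  assumes "has_j_one f b"
  shows "has_j_one (\<lambda>w. f (1 / w)) (flip_series b)"
proof -
  obtain R where b: "b \<in> laurent_series" and R: "R > 0" and
    hb: "\<And>p. 0 < norm p \<Longrightarrow> norm p < R \<Longrightarrow> ((\<lambda>(r, s). b r s * zpow p r s) has_sum f (1 / (1 - p))) UNIV"
    using assms unfolding has_j_one_def has_conformal_expansion_iff by auto
  \<comment> \<open>For \<open>|q| < 1\<close> the inequality \<open>|q| < R / (1 + R)\<close> says
    that \<open>|q| / (1 - |q|) < R\<close>.\<close>
  define S where "S = min 1 R / (1 + R)"
  have S: "0 < S" "S \<le> R / (1 + R)" "S < 1" using R by (auto simp: S_def min_def divide_simps)
  have "((\<lambda>(x, y). flip_series b x y * zpow q x y) has_sum f (1 / (1 / (1 - q)))) UNIV"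
    if q: "0 < norm q" "norm q < S" for q
  proof -
    have q1: "norm q < 1" using q S by simp
    have "norm q < R / (1 + R)" using q(2) S(2) by simp
    then have "norm q * (1 + R) < R" using R by (simp add: pos_less_divide_eq)
    then have "norm q < R * (1 - norm q)" by (simp add: algebra_simps)
    then have "norm q / (1 - norm q) < R" using q1 by (simp add: pos_divide_less_eq)
    from flip_series_has_sum[OF b R hb q(1) q1 this]
    have "((\<lambda>(x, y). flip_series b x y * zpow q x y) has_sum f (1 / (1 - (- q / (1 - q))))) UNIV" .
    moreover have "1 - q \<noteq> 0" using q1 by auto
    then have "1 - (- q / (1 - q)) = 1 / (1 - q)" by (simp add: field_simps)
    ultimately show ?thesis by simp
  qed
  then show ?thesis
    unfolding has_j_one_def has_conformal_expansion_iff
    using S(1) flip_series_laurent[OF b] by blast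
qed

section \<open>The binomial identity behind inversion in the region
  \<open>|z2| > |z1 - z2|\<close>\<close>

lemma series_mult_binomial_box:
  assumes N: "\<And>r s. g r s \<noteq> 0 \<Longrightarrow> N \<le> r \<and> N \<le> s" and K: "x - N < real K + 1" "y - N < real K + 1"
  shows "series_mult (binomial_series e \<alpha> \<beta>) g x y = (\<Sum>m\<le>K. \<Sum>n\<le>K.
    of_real (\<alpha> gchoose m) * e ^ m * (of_real (\<beta> gchoose n) * e ^ n) * g (x - real m) (y - real n))"
proof -
  let ?S = "{(r, s). binomial_series e \<alpha> \<beta> r s \<noteq> 0 \<and> g (x - r) (y - s) \<noteq> 0}"
  let ?I = "(\<lambda>(m, n). (real m, real n)) ` ({..K} \<times> {..K})"
  have sub: "?S \<subseteq> ?I"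
  proof clarify
    fix r s assume rs: "binomial_series e \<alpha> \<beta> r s \<noteq> 0" "g (x - r) (y - s) \<noteq> 0"
    obtain m where m: "r = real m" using binomial_series_support[OF rs(1)] by (auto elim: Nats_cases)
    obtain n where n: "s = real n" using binomial_series_support[OF rs(1)] by (auto elim: Nats_cases)
    have "m \<le> K \<and> n \<le> K"
      using bounded_support_index[of g N x K y m n] N K rs(2) by (simp add: m n)
    then show "(r, s) \<in> ?I" unfolding m n by force
  qed
  have "series_mult (binomial_series e \<alpha> \<beta>) g x y = (\<Sum>(r, s)\<in>?I. binomial_series e \<alpha> \<beta> r s * g (x - r) (y - s))"
    unfolding series_mult_def by (rule sum.mono_neutral_left) (use sub in auto)
  also have "\<dots> = (\<Sum>(m, n)\<in>{..K} \<times> {..K}. binomial_series e \<alpha> \<beta> (real m) (real n) * g (x - real m) (y - real n))"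
    by (subst sum.reindex) (auto simp: inj_on_def case_prod_unfold)
  finally show ?thesis
    by (simp add: binomial_series_def sum.cartesian_product)
qed

lemma sum_box_triangle:
  fixes f :: "nat \<Rightarrow> nat \<Rightarrow> 'a::comm_monoid_add"
  assumes "\<And>m j. K < m + j \<Longrightarrow> f m j = 0"
  shows "(\<Sum>m\<le>K. \<Sum>j\<le>K. f m j) = (\<Sum>n\<le>K. \<Sum>m\<le>n. f m (n - m))"
proof -
  have "(\<Sum>m\<le>K. \<Sum>j\<le>K. f m j) = (\<Sum>(m, j)\<in>{..K} \<times> {..K}. f m j)"
    by (rule sum.cartesian_product)
  also have "\<dots> = (\<Sum>(m, j)\<in>{(m, j). m + j \<le> K}. f m j)"
  proof (rule sum.mono_neutral_right)
    show "\<forall>p\<in>{..K} \<times> {..K} - {(m, j). m + j \<le> K}. (case p of (m, j) \<Rightarrow> f m j) = 0"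
      using assms linorder_not_le by auto
  qed auto
  finally show ?thesis by (simp add: sum.triangle_reindex_eq)
qed

text \<open>The terms are regrouped by the totals \<open>m + j\<close> and \<open>m' + j'\<close>;
  the summand vanishes where a total exceeds \<open>K\<close>, so box and triangle carry the same
  terms.\<close>

lemma sum_box_triangle2:
  fixes g :: "nat \<Rightarrow> nat \<Rightarrow> nat \<Rightarrow> nat \<Rightarrow> 'a::comm_monoid_add"
  assumes z: "\<And>m m' j j'. K < m + j \<or> K < m' + j' \<Longrightarrow> g m m' j j' = 0"
  shows "(\<Sum>m\<le>K. \<Sum>m'\<le>K. \<Sum>j\<le>K. \<Sum>j'\<le>K. g m m' j j') =
    (\<Sum>n\<le>K. \<Sum>n'\<le>K. \<Sum>m\<le>n. \<Sum>m'\<le>n'. g m m' (n - m) (n' - m'))"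
proof -
  have "(\<Sum>m\<le>K. \<Sum>m'\<le>K. \<Sum>j\<le>K. \<Sum>j'\<le>K. g m m' j j') = (\<Sum>m\<le>K. \<Sum>j\<le>K. \<Sum>m'\<le>K. \<Sum>j'\<le>K. g m m' j j')"
    by (intro sum.cong refl sum.swap)
  also have "\<dots> = (\<Sum>n\<le>K. \<Sum>m\<le>n. \<Sum>m'\<le>K. \<Sum>j'\<le>K. g m m' (n - m) j')"
    by (rule sum_box_triangle) (use z in simp)
  also have "\<dots> = (\<Sum>n\<le>K. \<Sum>m\<le>n. \<Sum>n'\<le>K. \<Sum>m'\<le>n'. g m m' (n - m) (n' - m'))"
    by (intro sum.cong refl sum_box_triangle) (use z in simp)
  also have "\<dots> = (\<Sum>n\<le>K. \<Sum>n'\<le>K. \<Sum>m\<le>n. \<Sum>m'\<le>n'. g m m' (n - m) (n' - m'))"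
    by (intro sum.cong refl sum.swap)
  finally show ?thesis .
qed

lemma sum_product_scaled:
  fixes c :: "'a::semiring_0"
  shows "(\<Sum>i\<in>A. \<Sum>j\<in>B. f i * g j * c) = sum f A * sum g B * c"
  by (subst sum_product) (simp only: sum_distrib_right)

text \<open>Both sides equal \<open>(\<sigma> - \<alpha> - X + n) gchoose n\<close>: the right one
  by Vandermonde directly, the left one by Vandermonde after negating the upper index. They are the
  weights that arise on the two sides of \<open>expand_02_inversion\<close>.\<close>

lemma gbinomial_flip_convolution:
  fixes \<sigma> \<alpha> X :: real
  shows "(\<Sum>m\<le>n. (\<sigma> - X + real m gchoose m) * ((\<alpha> gchoose (n - m)) * (- 1) ^ (n - m))) =
    (\<Sum>i\<le>n. (\<sigma> - \<alpha> gchoose i) * ((- (X - real n)) gchoose (n - i)))"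
proof -
  have vand: "(\<Sum>k\<le>n. (a gchoose k) * (b gchoose (n - k))) = (a + b) gchoose n" for a b :: real
    using gbinomial_Vandermonde[of a b n] by (simp add: atLeast0AtMost)
  have "(\<Sum>m\<le>n. (\<sigma> - X + real m gchoose m) * ((\<alpha> gchoose (n - m)) * (- 1) ^ (n - m))) =
    (\<Sum>m\<le>n. (- 1) ^ n * ((X - \<sigma> - 1 gchoose m) * (\<alpha> gchoose (n - m))))"
  proof (rule sum.cong[OF refl])
    fix m assume "m \<in> {..n}"
    then have "(- 1 :: real) ^ n = (- 1) ^ m * (- 1) ^ (n - m)" by (simp flip: power_add)
    moreover have "(\<sigma> - X + real m gchoose m) = (- 1) ^ m * (X - \<sigma> - 1 gchoose m)"
      by (subst gbinomial_negated_upper) (simp add: algebra_simps)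
    ultimately show "(\<sigma> - X + real m gchoose m) * ((\<alpha> gchoose (n - m)) * (- 1) ^ (n - m)) =
      (- 1) ^ n * ((X - \<sigma> - 1 gchoose m) * (\<alpha> gchoose (n - m)))"
      by simp
  qed
  also have "\<dots> = (- 1) ^ n * ((X - \<sigma> - 1 + \<alpha>) gchoose n)"
    by (simp only: sum_distrib_left[symmetric] vand)
  also have "\<dots> = (\<sigma> - \<alpha> + - (X - real n)) gchoose n"
    by (subst (2) gbinomial_negated_upper) (simp add: algebra_simps)
  also have "\<dots> = (\<Sum>i\<le>n. (\<sigma> - \<alpha> gchoose i) * ((- (X - real n)) gchoose (n - i)))"
    by (rule vand[symmetric])
  finally show ?thesis .
qed

text \<open>
  The coefficients, in \<open>z0\<close> and \<open>z2\<close>, of \<open>z1^\<rho> z2^\<tau> B(w0, w2)\<close> (and its conjugate counterpart) for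
  \<open>w0 = 1/z1 - 1/z2 = - z0/(z2 (z2 + z0))\<close> and \<open>w2 = 1/z2\<close>, where \<open>z1 = z2 + z0\<close>.
\<close>

definition inversion_02 :: "real \<Rightarrow> real \<Rightarrow> real \<Rightarrow> real \<Rightarrow> series2 \<Rightarrow> series2" where
  "inversion_02 \<rho> \<rho>' \<tau> \<tau>' B x0 y0 x2 y2 =
    (\<Sum>(m, n) | B (x0 - real m) (y0 - real n) (\<rho> + \<tau> - 2 * x0 + m - x2) (\<rho>' + \<tau>' - 2 * y0 + n - y2) \<noteq> 0.
      sign_pow ((x0 - m) - (y0 - n)) * (of_real ((\<rho> - x0 + m) gchoose m) * of_real ((\<rho>' - y0 + n) gchoose n)) *
      B (x0 - m) (y0 - n) (\<rho> + \<tau> - 2 * x0 + m - x2) (\<rho>' + \<tau>' - 2 * y0 + n - y2))"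

lemma inversion_02_box:
  assumes "\<forall>x0 y0 x2 y2. B x0 y0 x2 y2 \<noteq> 0 \<longrightarrow> N \<le> x0 \<and> N \<le> y0"
    and "x0 - N < real K + 1" "y0 - N < real K + 1"
  shows "inversion_02 \<rho> \<rho>' \<tau> \<tau>' B x0 y0 x2 y2 = (\<Sum>m\<le>K. \<Sum>n\<le>K.
      sign_pow ((x0 - m) - (y0 - n)) * (of_real ((\<rho> - x0 + m) gchoose m) * of_real ((\<rho>' - y0 + n) gchoose n)) *
      B (x0 - m) (y0 - n) (\<rho> + \<tau> - 2 * x0 + m - x2) (\<rho>' + \<tau>' - 2 * y0 + n - y2))"
  unfolding inversion_02_def
proof (rule sum_support_box)
  fix m n assume nz: "B (x0 - real m) (y0 - real n) (\<rho> + \<tau> - 2 * x0 + m - x2) (\<rho>' + \<tau>' - 2 * y0 + n - y2) \<noteq> 0"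
  have "N \<le> x0 - real m" "N \<le> y0 - real n" using assms(1) nz by blast+
  then have "real m < real K + 1" "real n < real K + 1" using assms(2,3) by linarith+
  then show "m \<le> K \<and> n \<le> K" by simp
qed simp

lemma sign_pow_diff_nat:
  assumes "X - Y \<in> \<int>"
  shows "sign_pow ((X - real m) - (Y - real n)) = sign_pow (X - Y) * ((- 1) ^ m * (- 1) ^ n)"
proof -
  have "(X - real m) - (Y - real n) = (X - Y) + (- real m + real n)" by simp
  moreover have i: "- real m \<in> \<int>" "real n \<in> \<int>" by simp_all
  ultimately have "sign_pow ((X - real m) - (Y - real n)) = sign_pow (X - Y) * (sign_pow (- real m) * sign_pow (real n))"
    by (simp only: sign_pow_add[OF assms Ints_add[OF i]] sign_pow_add[OF i])
  then show ?thesis by (simp add: sign_pow_uminus sign_pow_of_nat)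
qed

text \<open>With \<open>q = z0/z2\<close> the substitution gives \<open>w0/w2 = - q/(1 + q)\<close>
  and \<open>1 + w0/w2 = 1/(1 + q)\<close>. Hence \<open>b(- w0/w2) = b(q/(1 + q))\<close> is
  \<open>flip_series b\<close> at \<open>- q\<close>, the powers of \<open>1 + q\<close> add up to
  \<open>\<rho> - \<alpha>1 - \<alpha>12\<close>, and the minus sign of \<open>w0\<close> produces
  \<open>sign_pow (\<alpha>12 - \<beta>12)\<close>.\<close>

lemma expand_02_inversion:
  assumes b: "b \<in> laurent_series" and a12: "\<alpha>12 - \<beta>12 \<in> \<int>"
  shows "inversion_02 \<rho> \<rho>' \<tau> \<tau>' (expand_02 \<alpha>1 \<alpha>2 \<alpha>12 \<beta>1 \<beta>2 \<beta>12 b) x0 y0 x2 y2 =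
    sign_pow (\<alpha>12 - \<beta>12) *
    expand_02 (\<rho> - \<alpha>1 - \<alpha>12) (\<tau> - \<alpha>2 - \<alpha>12) \<alpha>12 (\<rho>' - \<beta>1 - \<beta>12) (\<tau>' - \<beta>2 - \<beta>12) \<beta>12 (flip_series b) x0 y0 x2 y2"
proof -
  obtain N where N: "\<And>r s. b r s \<noteq> 0 \<Longrightarrow> N \<le> r \<and> N \<le> s" using laurent_series_bound[OF b] by metis
  define X where "X = x0 - \<alpha>12"
  define Y where "Y = y0 - \<beta>12"
  obtain K where K: "X - N < real K + 1" "Y - N < real K + 1" by (rule box_index_exists)
  define sb where "sb r s = sign_pow (r - s) * b r s" for r s
  have Nsb: "N \<le> r \<and> N \<le> s" if "sb r s \<noteq> 0" for r s using N[of r s] that by (auto simp: sb_def)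
  have bz: "b (X - real m) (Y - real n) = 0" if "K < m \<or> K < n" for m n
    using bounded_support_index[of b N X K Y m n] N K that by fastforce
  define deg where "deg \<longleftrightarrow> x0 + x2 = \<rho> + \<tau> - \<alpha>1 - \<alpha>2 - \<alpha>12 \<and> y0 + y2 = \<rho>' + \<tau>' - \<beta>1 - \<beta>2 - \<beta>12"
  show ?thesis
  \<comment> \<open>In the wrong total degree or with \<open>X - Y\<close> not integral both sides
    are 0. Integrality is split off because \<open>sign_pow\<close> turns sums into products only on
    integers.\<close>
  proof (cases "deg \<and> X - Y \<in> \<int>")
    case False
    have "inversion_02 \<rho> \<rho>' \<tau> \<tau>' (expand_02 \<alpha>1 \<alpha>2 \<alpha>12 \<beta>1 \<beta>2 \<beta>12 b) x0 y0 x2 y2 = 0"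
    proof -
      have "expand_02 \<alpha>1 \<alpha>2 \<alpha>12 \<beta>1 \<beta>2 \<beta>12 b (x0 - real m) (y0 - real n)
         (\<rho> + \<tau> - 2 * x0 + m - x2) (\<rho>' + \<tau>' - 2 * y0 + n - y2) = 0" for m n
      proof (rule ccontr)
        assume nz: "\<not> ?thesis"
        then have d: "x0 - real m + (\<rho> + \<tau> - 2 * x0 + m - x2) = \<alpha>1 + \<alpha>2 + \<alpha>12"
          "y0 - real n + (\<rho>' + \<tau>' - 2 * y0 + n - y2) = \<beta>1 + \<beta>2 + \<beta>12"
          by (auto simp: expand_02_def split: if_splits)
        then have deg by (simp add: deg_def)
        have "series_mult (binomial_series 1 \<alpha>1 \<beta>1) (\<lambda>r s. sign_pow (r - s) * b r s)
             (x0 - real m - \<alpha>12) (y0 - real n - \<beta>12) \<noteq> 0"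
          using nz d by (simp add: expand_02_def)
        then have "(x0 - real m - \<alpha>12) - (y0 - real n - \<beta>12) \<in> \<int>"
          by (rule series_mult_binomial_int) (use laurent_series_int[OF b] in auto)
        then have "(x0 - real m - \<alpha>12) - (y0 - real n - \<beta>12) + (real m - real n) \<in> \<int>"
          by (intro Ints_add) auto
        moreover have "(x0 - real m - \<alpha>12) - (y0 - real n - \<beta>12) + (real m - real n) = X - Y"
          by (simp add: X_def Y_def)
        ultimately show False using False \<open>deg\<close> by simp
      qed
      then show ?thesis unfolding inversion_02_def by simp
    qed
    moreover have "expand_02 (\<rho> - \<alpha>1 - \<alpha>12) (\<tau> - \<alpha>2 - \<alpha>12) \<alpha>12 (\<rho>' - \<beta>1 - \<beta>12) (\<tau>' - \<beta>2 - \<beta>12) \<beta>12 (flip_series b) x0 y0 x2 y2 = 0"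
    proof (rule ccontr)
      assume nz: "\<not> ?thesis"
      then have d: deg by (auto simp: expand_02_def deg_def split: if_splits)
      have "series_mult (binomial_series 1 (\<rho> - \<alpha>1 - \<alpha>12) (\<rho>' - \<beta>1 - \<beta>12)) (\<lambda>r s. sign_pow (r - s) * flip_series b r s) X Y \<noteq> 0"
        using nz by (auto simp: expand_02_def X_def Y_def split: if_splits)
      then have "X - Y \<in> \<int>"
        by (rule series_mult_binomial_int) (use laurent_series_int[OF flip_series_laurent[OF b]] in auto)
      then show False using False d by simp
    qed
    ultimately show ?thesis by simp
  next
    case True
    then have deg and XY: "X - Y \<in> \<int>" by auto
    \<comment> \<open>Both sides become combinations of these shifted coefficients of
      \<open>b\<close>, with \<open>n\<close> and \<open>n'\<close> the total shifts.
      \<open>kL\<close> collects the weights of the left side and \<open>kR\<close> those of the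
      right; summed over a given total shift they agree by
      \<open>gbinomial_flip_convolution\<close>.\<close>
    define w where "w n n' = sign_pow (X - Y) * b (X - real n) (Y - real n')" for n n'
    define s0 where "s0 = sign_pow (\<alpha>12 - \<beta>12)"
    define kL where "kL m j = (\<rho> - \<alpha>12 - X + real m gchoose m) * ((\<alpha>1 gchoose j) * (- 1) ^ j)" for m j
    define kL' where "kL' m j = (\<rho>' - \<beta>12 - Y + real m gchoose m) * ((\<beta>1 gchoose j) * (- 1) ^ j)" for m j
    define kR where "kR i l = (\<rho> - \<alpha>12 - \<alpha>1 gchoose i) * ((- (X - real (i + l))) gchoose l)" for i l
    define kR' where "kR' i l = (\<rho>' - \<beta>12 - \<beta>1 gchoose i) * ((- (Y - real (i + l))) gchoose l)" for i l
    have wz: "w n n' = 0" if "K < n \<or> K < n'" for n n' using bz[OF that] by (simp add: w_def)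
    have sXY: "sign_pow ((X - real m) - (Y - real n)) = sign_pow (X - Y) * ((- 1) ^ m * (- 1) ^ n)" for m n
      by (rule sign_pow_diff_nat[OF XY])
    have xy0: "x0 - y0 = (\<alpha>12 - \<beta>12) + (X - Y)" by (simp add: X_def Y_def)
    have xy0_int: "x0 - y0 \<in> \<int>" unfolding xy0 by (intro Ints_add a12 XY)
    have s0: "sign_pow ((x0 - real m) - (y0 - real n)) = s0 * sign_pow (X - Y) * ((- 1) ^ m * (- 1) ^ n)" for m n
      unfolding sign_pow_diff_nat[OF xy0_int] unfolding xy0 s0_def sign_pow_add[OF a12 XY] ..
    have E: "expand_02 \<alpha>1 \<alpha>2 \<alpha>12 \<beta>1 \<beta>2 \<beta>12 b (x0 - real m) (y0 - real n)
         (\<rho> + \<tau> - 2 * x0 + m - x2) (\<rho>' + \<tau>' - 2 * y0 + n - y2) =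
         (\<Sum>j\<le>K. \<Sum>j'\<le>K. of_real (\<alpha>1 gchoose j) * of_real (\<beta>1 gchoose j') *
           ((- 1) ^ (m + j) * (- 1) ^ (n + j') * w (m + j) (n + j')))" for m n
    proof -
      have "expand_02 \<alpha>1 \<alpha>2 \<alpha>12 \<beta>1 \<beta>2 \<beta>12 b (x0 - real m) (y0 - real n)
         (\<rho> + \<tau> - 2 * x0 + m - x2) (\<rho>' + \<tau>' - 2 * y0 + n - y2) =
         series_mult (binomial_series 1 \<alpha>1 \<beta>1) sb (X - real m) (Y - real n)"
        using \<open>deg\<close> by (auto simp: expand_02_def deg_def X_def Y_def sb_def[abs_def] algebra_simps)
      also have "\<dots> = (\<Sum>j\<le>K. \<Sum>j'\<le>K. of_real (\<alpha>1 gchoose j) * 1 ^ j * (of_real (\<beta>1 gchoose j') * 1 ^ j') *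
          sb (X - real m - real j) (Y - real n - real j'))"
        by (rule series_mult_binomial_box[of sb N]) (use Nsb K in auto)
      also have "\<dots> = (\<Sum>j\<le>K. \<Sum>j'\<le>K. of_real (\<alpha>1 gchoose j) * of_real (\<beta>1 gchoose j') *
           ((- 1) ^ (m + j) * (- 1) ^ (n + j') * w (m + j) (n + j')))"
      proof (intro sum.cong refl)
        fix j j'
        have "sb (X - real m - real j) (Y - real n - real j') = (- 1) ^ (m + j) * (- 1) ^ (n + j') * w (m + j) (n + j')"
          using sXY[of "m + j" "n + j'"] by (simp add: sb_def w_def diff_diff_eq mult_ac)
        then show "of_real (\<alpha>1 gchoose j) * 1 ^ j * (of_real (\<beta>1 gchoose j') * 1 ^ j') *
          sb (X - real m - real j) (Y - real n - real j') = of_real (\<alpha>1 gchoose j) * of_real (\<beta>1 gchoose j') *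
           ((- 1) ^ (m + j) * (- 1) ^ (n + j') * w (m + j) (n + j'))"
          by simp
      qed
      finally show ?thesis .
    qed
    have "inversion_02 \<rho> \<rho>' \<tau> \<tau>' (expand_02 \<alpha>1 \<alpha>2 \<alpha>12 \<beta>1 \<beta>2 \<beta>12 b) x0 y0 x2 y2 =
      (\<Sum>m\<le>K. \<Sum>n\<le>K. sign_pow ((x0 - m) - (y0 - n)) *
        (of_real ((\<rho> - x0 + m) gchoose m) * of_real ((\<rho>' - y0 + n) gchoose n)) *
        expand_02 \<alpha>1 \<alpha>2 \<alpha>12 \<beta>1 \<beta>2 \<beta>12 b (x0 - m) (y0 - n) (\<rho> + \<tau> - 2 * x0 + m - x2) (\<rho>' + \<tau>' - 2 * y0 + n - y2))"
      unfolding inversion_02_def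
    proof (rule sum_support_box)
      fix m n assume nz: "expand_02 \<alpha>1 \<alpha>2 \<alpha>12 \<beta>1 \<beta>2 \<beta>12 b (x0 - real m) (y0 - real n)
        (\<rho> + \<tau> - 2 * x0 + m - x2) (\<rho>' + \<tau>' - 2 * y0 + n - y2) \<noteq> 0"
      show "m \<le> K \<and> n \<le> K"
      proof (rule ccontr)
        assume "\<not> ?thesis"
        then have "w (m + j) (n + j') = 0" for j j' by (intro wz) auto
        then show False using nz unfolding E by simp
      qed
    qed simp
    also have "\<dots> = (\<Sum>m\<le>K. \<Sum>n\<le>K. \<Sum>j\<le>K. \<Sum>j'\<le>K. s0 * (of_real (kL m j) * of_real (kL' n j') * 
        (sign_pow (X - Y) * w (m + j) (n + j'))))"
    proof (intro sum.cong refl)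
      fix m n
      have x0: "\<rho> - x0 + real m = \<rho> - \<alpha>12 - X + real m" "\<rho>' - y0 + real n = \<rho>' - \<beta>12 - Y + real n"
        by (simp_all add: X_def Y_def)
      have sgn: "(- 1 :: complex) ^ m * ((- 1) ^ (m + j)) = (- 1) ^ j" for m j
        by (simp add: power_add flip: mult.assoc power_mult_distrib)
      show "sign_pow ((x0 - m) - (y0 - n)) *
        (of_real ((\<rho> - x0 + m) gchoose m) * of_real ((\<rho>' - y0 + n) gchoose n)) *
        expand_02 \<alpha>1 \<alpha>2 \<alpha>12 \<beta>1 \<beta>2 \<beta>12 b (x0 - m) (y0 - n) (\<rho> + \<tau> - 2 * x0 + m - x2) (\<rho>' + \<tau>' - 2 * y0 + n - y2)
        = (\<Sum>j\<le>K. \<Sum>j'\<le>K. s0 * (of_real (kL m j) * of_real (kL' n j') * (sign_pow (X - Y) * w (m + j) (n + j'))))"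
        unfolding E sum_distrib_left
      proof (intro sum.cong refl)
        fix j j'
        have "sign_pow (x0 - real m - (y0 - real n)) *
           (of_real (\<rho> - x0 + real m gchoose m) * of_real (\<rho>' - y0 + real n gchoose n)) *
           (of_real (\<alpha>1 gchoose j) * of_real (\<beta>1 gchoose j') *
            ((- 1) ^ (m + j) * (- 1) ^ (n + j') * w (m + j) (n + j'))) =
          s0 * sign_pow (X - Y) * (((- 1) ^ m * (- 1) ^ (m + j)) * ((- 1) ^ n * (- 1) ^ (n + j'))) *
           (of_real (\<rho> - x0 + real m gchoose m) * of_real (\<rho>' - y0 + real n gchoose n)) *
           (of_real (\<alpha>1 gchoose j) * of_real (\<beta>1 gchoose j') * w (m + j) (n + j'))"
          unfolding s0 by (simp only: mult_ac)
        then show "sign_pow (x0 - real m - (y0 - real n)) *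
           (of_real (\<rho> - x0 + real m gchoose m) * of_real (\<rho>' - y0 + real n gchoose n)) *
           (of_real (\<alpha>1 gchoose j) * of_real (\<beta>1 gchoose j') *
            ((- 1) ^ (m + j) * (- 1) ^ (n + j') * w (m + j) (n + j'))) =
           s0 * (of_real (kL m j) * of_real (kL' n j') * (sign_pow (X - Y) * w (m + j) (n + j')))"
          unfolding sgn x0 kL_def kL'_def of_real_mult of_real_power of_real_minus of_real_1 by (simp only: mult_ac)
      qed
    qed
    also have "\<dots> = (\<Sum>n\<le>K. \<Sum>n'\<le>K. \<Sum>m\<le>n. \<Sum>m'\<le>n'. s0 * (of_real (kL m (n - m)) * of_real (kL' m' (n' - m')) *
        (sign_pow (X - Y) * w (m + (n - m)) (m' + (n' - m')))))"
      by (rule sum_box_triangle2) (simp add: wz)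
    also have "\<dots> = (\<Sum>n\<le>K. \<Sum>n'\<le>K. s0 * (of_real (\<Sum>m\<le>n. kL m (n - m)) * of_real (\<Sum>m'\<le>n'. kL' m' (n' - m')) *
        (sign_pow (X - Y) * w n n')))"
    proof (intro sum.cong refl)
      fix n n'
      have "(\<Sum>m\<le>n. \<Sum>m'\<le>n'. s0 * (of_real (kL m (n - m)) * of_real (kL' m' (n' - m')) *
        (sign_pow (X - Y) * w (m + (n - m)) (m' + (n' - m'))))) =
        (\<Sum>m\<le>n. \<Sum>m'\<le>n'. of_real (kL m (n - m)) * of_real (kL' m' (n' - m')) * (s0 * (sign_pow (X - Y) * w n n')))"
        by (intro sum.cong refl) (simp add: mult_ac)
      also have "\<dots> = of_real (\<Sum>m\<le>n. kL m (n - m)) * of_real (\<Sum>m'\<le>n'. kL' m' (n' - m')) * (s0 * (sign_pow (X - Y) * w n n'))"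
        unfolding of_real_sum by (rule sum_product_scaled)
      finally show "(\<Sum>m\<le>n. \<Sum>m'\<le>n'. s0 * (of_real (kL m (n - m)) * of_real (kL' m' (n' - m')) *
        (sign_pow (X - Y) * w (m + (n - m)) (m' + (n' - m'))))) =
        s0 * (of_real (\<Sum>m\<le>n. kL m (n - m)) * of_real (\<Sum>m'\<le>n'. kL' m' (n' - m')) *
        (sign_pow (X - Y) * w n n'))"
        by (simp only: mult_ac)
    qed
    also have "\<dots> = (\<Sum>n\<le>K. \<Sum>n'\<le>K. s0 * (of_real (\<Sum>m\<le>n. kR m (n - m)) * of_real (\<Sum>m'\<le>n'. kR' m' (n' - m')) *
        (sign_pow (X - Y) * w n n')))"
    proof -
      have "(\<Sum>m\<le>n. kL m (n - m)) = (\<Sum>m\<le>n. kR m (n - m))" for n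
        using gbinomial_flip_convolution[where \<sigma> = "\<rho> - \<alpha>12" and X = X and n = n and \<alpha> = \<alpha>1] by (simp add: kL_def kR_def)
      moreover have "(\<Sum>m\<le>n. kL' m (n - m)) = (\<Sum>m\<le>n. kR' m (n - m))" for n
        using gbinomial_flip_convolution[where \<sigma> = "\<rho>' - \<beta>12" and X = Y and n = n and \<alpha> = \<beta>1] by (simp add: kL'_def kR'_def)
      ultimately show ?thesis by simp
    qed
    also have "\<dots> = (\<Sum>n\<le>K. \<Sum>n'\<le>K. \<Sum>m\<le>n. \<Sum>m'\<le>n'. s0 * (of_real (kR m (n - m)) * of_real (kR' m' (n' - m')) *
        (sign_pow (X - Y) * w (m + (n - m)) (m' + (n' - m')))))"
    proof (intro sum.cong refl)
      fix n n'
      have "(\<Sum>m\<le>n. \<Sum>m'\<le>n'. s0 * (of_real (kR m (n - m)) * of_real (kR' m' (n' - m')) *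
        (sign_pow (X - Y) * w (m + (n - m)) (m' + (n' - m'))))) =
        (\<Sum>m\<le>n. \<Sum>m'\<le>n'. of_real (kR m (n - m)) * of_real (kR' m' (n' - m')) * (s0 * (sign_pow (X - Y) * w n n')))"
        by (intro sum.cong refl) (simp add: mult_ac)
      also have "\<dots> = of_real (\<Sum>m\<le>n. kR m (n - m)) * of_real (\<Sum>m'\<le>n'. kR' m' (n' - m')) * (s0 * (sign_pow (X - Y) * w n n'))"
        unfolding of_real_sum by (rule sum_product_scaled)
      finally show "s0 * (of_real (\<Sum>m\<le>n. kR m (n - m)) * of_real (\<Sum>m'\<le>n'. kR' m' (n' - m')) *
        (sign_pow (X - Y) * w n n')) = (\<Sum>m\<le>n. \<Sum>m'\<le>n'. s0 * (of_real (kR m (n - m)) * of_real (kR' m' (n' - m')) *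
        (sign_pow (X - Y) * w (m + (n - m)) (m' + (n' - m')))))"
        by (simp only: mult_ac)
    qed
    also have "\<dots> = (\<Sum>m\<le>K. \<Sum>n\<le>K. \<Sum>j\<le>K. \<Sum>j'\<le>K. s0 * (of_real (kR m j) * of_real (kR' n j') *
        (sign_pow (X - Y) * w (m + j) (n + j'))))"
      by (rule sum_box_triangle2[symmetric]) (simp add: wz)
    also have "\<dots> = s0 * series_mult (binomial_series 1 (\<rho> - \<alpha>1 - \<alpha>12) (\<rho>' - \<beta>1 - \<beta>12)) (\<lambda>r s. sign_pow (r - s) * flip_series b r s) X Y"
    proof -
      have Nf: "N \<le> r \<and> N \<le> s" if "sign_pow (r - s) * flip_series b r s \<noteq> 0" for r s
      proof -
        have "flip_series b r s \<noteq> 0" using that by auto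
        then obtain m n :: nat where "b (r - m) (s - n) \<noteq> 0" by (rule flip_series_nonzeroE)
        from N[OF this] show ?thesis by simp
      qed
      have "series_mult (binomial_series 1 (\<rho> - \<alpha>1 - \<alpha>12) (\<rho>' - \<beta>1 - \<beta>12)) (\<lambda>r s. sign_pow (r - s) * flip_series b r s) X Y =
        (\<Sum>m\<le>K. \<Sum>n\<le>K. of_real ((\<rho> - \<alpha>1 - \<alpha>12) gchoose m) * 1 ^ m * (of_real ((\<rho>' - \<beta>1 - \<beta>12) gchoose n) * 1 ^ n) *
          (sign_pow (X - real m - (Y - real n)) * flip_series b (X - real m) (Y - real n)))"
        by (rule series_mult_binomial_box[of _ N]) (use Nf K in auto)
      moreover have "sign_pow (X - real m - (Y - real n)) * flip_series b (X - real m) (Y - real n) =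
        (\<Sum>j\<le>K. \<Sum>j'\<le>K. of_real ((- (X - real (m + j))) gchoose j) * of_real ((- (Y - real (n + j'))) gchoose j') *
           (sign_pow (X - Y) * w (m + j) (n + j')))" for m n
      proof -
        have "flip_series b (X - real m) (Y - real n) = (\<Sum>j\<le>K. \<Sum>j'\<le>K.
           sign_pow ((X - real m - j) - (Y - real n - j')) * b (X - real m - j) (Y - real n - j') *
           ((- 1) ^ j * of_real ((- (X - real m - j)) gchoose j) * ((- 1) ^ j' * of_real ((- (Y - real n - j')) gchoose j'))))"
          by (rule flip_series_box[of b N]) (use N K in auto)
        also have "\<dots> = (\<Sum>j\<le>K. \<Sum>j'\<le>K. (- 1) ^ m * (- 1) ^ n *
           (of_real ((- (X - real (m + j))) gchoose j) * of_real ((- (Y - real (n + j'))) gchoose j') * w (m + j) (n + j')))"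
        proof (intro sum.cong refl)
          fix j j'
          have e: "X - real m - real j = X - real (m + j)" "Y - real n - real j' = Y - real (n + j')" by simp_all
          have sg: "(- 1 :: complex) ^ (m + j) * (- 1) ^ j = (- 1) ^ m" for m j
            by (simp add: power_add mult.assoc flip: power_mult_distrib)
          have "sign_pow (X - real (m + j) - (Y - real (n + j'))) * b (X - real (m + j)) (Y - real (n + j')) *
           ((- 1) ^ j * of_real ((- (X - real (m + j))) gchoose j) * ((- 1) ^ j' * of_real ((- (Y - real (n + j'))) gchoose j'))) =
           (((- 1) ^ (m + j) * (- 1) ^ j) * ((- 1) ^ (n + j') * (- 1) ^ j')) *
           (of_real ((- (X - real (m + j))) gchoose j) * of_real ((- (Y - real (n + j'))) gchoose j') * w (m + j) (n + j'))"
            unfolding sXY w_def by (simp only: mult_ac)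
          then show "sign_pow (X - real m - real j - (Y - real n - real j')) * b (X - real m - real j) (Y - real n - real j') *
           ((- 1) ^ j * of_real ((- (X - real m - real j)) gchoose j) * ((- 1) ^ j' * of_real ((- (Y - real n - real j')) gchoose j'))) =
           (- 1) ^ m * (- 1) ^ n *
           (of_real ((- (X - real (m + j))) gchoose j) * of_real ((- (Y - real (n + j'))) gchoose j') * w (m + j) (n + j'))"
            unfolding e sg .
        qed
        also have "\<dots> = (- 1) ^ m * (- 1) ^ n * (\<Sum>j\<le>K. \<Sum>j'\<le>K. 
           (of_real ((- (X - real (m + j))) gchoose j) * of_real ((- (Y - real (n + j'))) gchoose j') * w (m + j) (n + j')))"
          by (simp only: sum_distrib_left)
        finally have "sign_pow (X - real m - (Y - real n)) * flip_series b (X - real m) (Y - real n) =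
          sign_pow (X - Y) * (((- 1) ^ m * (- 1) ^ m) * ((- 1) ^ n * (- 1) ^ n)) * (\<Sum>j\<le>K. \<Sum>j'\<le>K. 
           (of_real ((- (X - real (m + j))) gchoose j) * of_real ((- (Y - real (n + j'))) gchoose j') * w (m + j) (n + j')))"
          unfolding sXY by (simp only: mult_ac)
        also have "((- 1 :: complex) ^ m * (- 1) ^ m) * ((- 1) ^ n * (- 1) ^ n) = 1"
          by (simp flip: power_mult_distrib)
        finally show ?thesis
          by (simp only: mult_1_left mult_1_right sum_distrib_left mult_ac)
      qed
      ultimately show ?thesis
        by (simp add: sum_distrib_left kR_def kR'_def algebra_simps)
    qed
    also have "\<dots> = sign_pow (\<alpha>12 - \<beta>12) *
      expand_02 (\<rho> - \<alpha>1 - \<alpha>12) (\<tau> - \<alpha>2 - \<alpha>12) \<alpha>12 (\<rho>' - \<beta>1 - \<beta>12) (\<tau>' - \<beta>2 - \<beta>12) \<beta>12 (flip_series b) x0 y0 x2 y2"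
      using \<open>deg\<close> by (auto simp: expand_02_def deg_def s0_def X_def Y_def)
    finally show ?thesis .
  qed
qed

section \<open>Passage from generators to their span\<close>

lemma expand_02_lower_bound:
  assumes "b \<in> laurent_series"
  shows "\<exists>N. \<forall>x0 y0 x2 y2. expand_02 \<alpha>1 \<alpha>2 \<alpha>12 \<beta>1 \<beta>2 \<beta>12 b x0 y0 x2 y2 \<noteq> 0 \<longrightarrow> N \<le> x0 \<and> N \<le> y0"
proof -
  obtain N where N: "\<And>r s. b r s \<noteq> 0 \<Longrightarrow> N \<le> r \<and> N \<le> s" using laurent_series_bound[OF assms] by metis
  have "N + min \<alpha>12 \<beta>12 \<le> x0 \<and> N + min \<alpha>12 \<beta>12 \<le> y0"
    if nz: "expand_02 \<alpha>1 \<alpha>2 \<alpha>12 \<beta>1 \<beta>2 \<beta>12 b x0 y0 x2 y2 \<noteq> 0" for x0 y0 x2 y2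
  proof -
    have "series_mult (binomial_series 1 \<alpha>1 \<beta>1) (\<lambda>r s. sign_pow (r - s) * b r s) (x0 - \<alpha>12) (y0 - \<beta>12) \<noteq> 0"
      using nz by (auto simp: expand_02_def split: if_splits)
    then obtain r s where rs: "binomial_series 1 \<alpha>1 \<beta>1 r s \<noteq> 0"
      "sign_pow ((x0 - \<alpha>12 - r) - (y0 - \<beta>12 - s)) * b (x0 - \<alpha>12 - r) (y0 - \<beta>12 - s) \<noteq> 0"
      by (rule series_mult_nonzeroE)
    have "0 \<le> r" "0 \<le> s" using binomial_series_support[OF rs(1)] by (auto elim!: Nats_cases)
    moreover have "N \<le> x0 - \<alpha>12 - r \<and> N \<le> y0 - \<beta>12 - s" by (rule N) (use rs(2) in auto)
    ultimately show ?thesis by linarith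
  qed
  then show ?thesis by blast
qed

text \<open>The index set of \<open>inversion_02\<close> depends on the support of \<open>B\<close>,
  which changes under addition. A common lower bound gives a common box, and on a box
  \<open>inversion_02\<close> is visibly linear.\<close>

lemma gcor2_lower_bound:
  assumes "gcor2 \<mu> A B C"
  shows "\<exists>N. \<forall>x0 y0 x2 y2. B x0 y0 x2 y2 \<noteq> 0 \<longrightarrow> N \<le> x0 \<and> N \<le> y0"
  using assms
proof induction
  case (generator \<alpha>1 \<beta>1 \<alpha>2 \<beta>2 \<alpha>12 \<beta>12 f a b c)
  then have "b \<in> laurent_series" by (simp add: has_j_one_def has_conformal_expansion_def)
  then show ?case by (rule expand_02_lower_bound)
next
  case (smult \<mu> A B C k)
  then obtain N where "\<And>x0 y0 x2 y2. B x0 y0 x2 y2 \<noteq> 0 \<Longrightarrow> N \<le> x0 \<and> N \<le> y0" by blast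
  then show ?case by (intro exI[of _ N]) auto
next
  case (add \<mu> A B C \<mu>' A' B' C')
  obtain N where N: "\<And>x0 y0 x2 y2. B x0 y0 x2 y2 \<noteq> 0 \<Longrightarrow> N \<le> x0 \<and> N \<le> y0" using add.IH(1) by blast
  obtain N' where N': "\<And>x0 y0 x2 y2. B' x0 y0 x2 y2 \<noteq> 0 \<Longrightarrow> N' \<le> x0 \<and> N' \<le> y0" using add.IH(2) by blast
  have "min N N' \<le> x0 \<and> min N N' \<le> y0" if nz: "B x0 y0 x2 y2 + B' x0 y0 x2 y2 \<noteq> 0" for x0 y0 x2 y2
  proof -
    have "B x0 y0 x2 y2 \<noteq> 0 \<or> B' x0 y0 x2 y2 \<noteq> 0" using nz by auto
    then show ?thesis using N[of x0 y0 x2 y2] N'[of x0 y0 x2 y2] by auto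
  qed
  then show ?case by blast
qed

definition gcor :: "series2 \<Rightarrow> series2 \<Rightarrow> series2 \<Rightarrow> bool" where
  "gcor A B C \<longleftrightarrow> (\<exists>\<mu>. gcor2 \<mu> A B C)"

lemma gcor_add:
  assumes "gcor A B C" "gcor A' B' C'"
  shows "gcor (\<lambda>x1 y1 x2 y2. A x1 y1 x2 y2 + A' x1 y1 x2 y2) (\<lambda>x1 y1 x2 y2. B x1 y1 x2 y2 + B' x1 y1 x2 y2)
    (\<lambda>x1 y1 x2 y2. C x1 y1 x2 y2 + C' x1 y1 x2 y2)"
  using assms gcor2.add unfolding gcor_def by blast

lemma gcor_smult:
  assumes "gcor A B C"
  shows "gcor (\<lambda>x1 y1 x2 y2. k * A x1 y1 x2 y2) (\<lambda>x1 y1 x2 y2. k * B x1 y1 x2 y2)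
    (\<lambda>x1 y1 x2 y2. k * C x1 y1 x2 y2)"
  using assms gcor2.smult unfolding gcor_def by blast

lemma zero_F01inf: "(\<lambda>_. 0) \<in> F01inf"
  and has_conformal_expansion_zero: "has_conformal_expansion (\<lambda>_. 0) (\<lambda>_ _. 0)"
proof -
  show e: "has_conformal_expansion (\<lambda>_. 0) (\<lambda>_ _. 0)"
    unfolding has_conformal_expansion_iff
    by (auto simp: laurent_series_def admissible_support_def case_prod_unfold intro!: exI[of _ 1])
  show "(\<lambda>_. 0) \<in> F01inf"
    unfolding F01inf_def conformal_singularity_def using real_analytic_on_const e by blast
qed

lemma gcor_zero: "gcor (\<lambda>_ _ _ _. 0) (\<lambda>_ _ _ _. 0) (\<lambda>_ _ _ _. 0)"
proof -
  have "gcor2 (gcor_fun 0 0 0 0 0 0 (\<lambda>_. 0)) (expand_12 0 0 0 0 0 0 (\<lambda>_ _. 0)) (expand_02 0 0 0 0 0 0 (\<lambda>_ _. 0))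
    (expand_21 0 0 0 0 0 0 (\<lambda>_ _. 0))"
    by (rule gcor2.generator)
      (auto simp: zero_F01inf has_j_zero_def has_j_one_def has_j_inf_def has_conformal_expansion_zero)
  from gcor2.smult[OF this, of 0] show ?thesis unfolding gcor_def by auto
qed

lemma gcor_sum:
  assumes "finite I" "\<And>i. i \<in> I \<Longrightarrow> gcor (A i) (B i) (C i)"
  shows "gcor (\<lambda>x1 y1 x2 y2. \<Sum>i\<in>I. A i x1 y1 x2 y2) (\<lambda>x1 y1 x2 y2. \<Sum>i\<in>I. B i x1 y1 x2 y2)
    (\<lambda>x1 y1 x2 y2. \<Sum>i\<in>I. C i x1 y1 x2 y2)"
  using assms
proof (induction I rule: finite_induct)
  case empty
  then show ?case by (simp add: gcor_zero)
next
  case (insert i I)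
  then show ?case using gcor_add[of "A i" "B i" "C i"] by simp
qed

text \<open>From \<open>1/z1 - 1/z2 = - (z1 - z2)/(z1 z2)\<close> the inverted generator has the
  exponents \<open>\<rho> - \<alpha>1 - \<alpha>12\<close>,
  \<open>\<tau> - \<alpha>2 - \<alpha>12\<close>, \<open>\<alpha>12\<close>, the function
  \<open>f(1/w)\<close> and a sign. The series \<open>j(p,f)\<close> and \<open>j(1/p,f)\<close>
  change roles, so \<open>expand_12\<close> and \<open>expand_21\<close> are exchanged.\<close>

lemma gcor_inversion_generator:
  assumes ints: "\<alpha>1 - \<beta>1 \<in> \<int>" "\<alpha>2 - \<beta>2 \<in> \<int>" "\<alpha>12 - \<beta>12 \<in> \<int>" and f: "f \<in> F01inf"
    and abc: "has_j_zero f a" "has_j_one f b" "has_j_inf f c"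
    and \<rho>: "\<rho> - \<rho>' \<in> \<int>" "\<tau> - \<tau>' \<in> \<int>"
  shows "gcor (\<lambda>x1 y1 x2 y2. expand_21 \<alpha>1 \<alpha>2 \<alpha>12 \<beta>1 \<beta>2 \<beta>12 c (\<rho> - x1) (\<rho>' - y1) (\<tau> - x2) (\<tau>' - y2))
    (inversion_02 \<rho> \<rho>' \<tau> \<tau>' (expand_02 \<alpha>1 \<alpha>2 \<alpha>12 \<beta>1 \<beta>2 \<beta>12 b))
    (\<lambda>x1 y1 x2 y2. expand_12 \<alpha>1 \<alpha>2 \<alpha>12 \<beta>1 \<beta>2 \<beta>12 a (\<rho> - x1) (\<rho>' - y1) (\<tau> - x2) (\<tau>' - y2))"
proof -
  let ?s = "sign_pow (\<alpha>12 - \<beta>12)"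
  have b: "b \<in> laurent_series" using abc(2) by (simp add: has_j_one_def has_conformal_expansion_def)
  have "(\<rho> - \<rho>') - (\<alpha>1 - \<beta>1) - (\<alpha>12 - \<beta>12) \<in> \<int>" by (intro Ints_diff \<rho> ints)
  then have i1: "\<rho> - \<alpha>1 - \<alpha>12 - (\<rho>' - \<beta>1 - \<beta>12) \<in> \<int>" by (simp add: algebra_simps)
  have "(\<tau> - \<tau>') - (\<alpha>2 - \<beta>2) - (\<alpha>12 - \<beta>12) \<in> \<int>" by (intro Ints_diff \<rho> ints)
  then have i2: "\<tau> - \<alpha>2 - \<alpha>12 - (\<tau>' - \<beta>2 - \<beta>12) \<in> \<int>" by (simp add: algebra_simps)
  have z: "has_j_zero (\<lambda>w. f (1 / w)) c"
    using abc(3) by (simp add: has_j_zero_def has_j_inf_def)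
  have i: "has_j_inf (\<lambda>w. f (1 / w)) a"
    using abc(1) by (simp add: has_j_zero_def has_j_inf_def)
  note gen = gcor2.smult[OF gcor2.generator[OF i1 i2 ints(3) F01inf_inversion[OF f] z has_j_one_inversion[OF abc(2)] i], of ?s]
  have A: "expand_21 \<alpha>1 \<alpha>2 \<alpha>12 \<beta>1 \<beta>2 \<beta>12 c (\<rho> - x1) (\<rho>' - y1) (\<tau> - x2) (\<tau>' - y2) =
    ?s * expand_12 (\<rho> - \<alpha>1 - \<alpha>12) (\<tau> - \<alpha>2 - \<alpha>12) \<alpha>12 (\<rho>' - \<beta>1 - \<beta>12) (\<tau>' - \<beta>2 - \<beta>12) \<beta>12 c x1 y1 x2 y2"
    for x1 y1 x2 y2
  proof -
    have d: "(\<rho> - x1 + (\<tau> - x2) = \<alpha>1 + \<alpha>2 + \<alpha>12 \<and> \<rho>' - y1 + (\<tau>' - y2) = \<beta>1 + \<beta>2 + \<beta>12) \<longleftrightarrow>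
      (x1 + x2 = \<rho> - \<alpha>1 - \<alpha>12 + (\<tau> - \<alpha>2 - \<alpha>12) + \<alpha>12 \<and> y1 + y2 = \<rho>' - \<beta>1 - \<beta>12 + (\<tau>' - \<beta>2 - \<beta>12) + \<beta>12)"
      by auto
    show ?thesis
    proof (cases "x1 + x2 = \<rho> - \<alpha>1 - \<alpha>12 + (\<tau> - \<alpha>2 - \<alpha>12) + \<alpha>12 \<and> y1 + y2 = \<rho>' - \<beta>1 - \<beta>12 + (\<tau>' - \<beta>2 - \<beta>12) + \<beta>12")
      case True
      then have e: "\<rho> - x1 - \<alpha>1 = x2 - (\<tau> - \<alpha>2 - \<alpha>12)" "\<rho>' - y1 - \<beta>1 = y2 - (\<tau>' - \<beta>2 - \<beta>12)" by auto
      show ?thesis unfolding expand_21_def expand_12_def d if_P[OF True] e ..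
    next
      case False
      show ?thesis unfolding expand_21_def expand_12_def d if_not_P[OF False] by simp
    qed
  qed
  have C: "expand_12 \<alpha>1 \<alpha>2 \<alpha>12 \<beta>1 \<beta>2 \<beta>12 a (\<rho> - x1) (\<rho>' - y1) (\<tau> - x2) (\<tau>' - y2) =
    ?s * expand_21 (\<rho> - \<alpha>1 - \<alpha>12) (\<tau> - \<alpha>2 - \<alpha>12) \<alpha>12 (\<rho>' - \<beta>1 - \<beta>12) (\<tau>' - \<beta>2 - \<beta>12) \<beta>12 a x1 y1 x2 y2"
    for x1 y1 x2 y2
  proof -
    have d: "(\<rho> - x1 + (\<tau> - x2) = \<alpha>1 + \<alpha>2 + \<alpha>12 \<and> \<rho>' - y1 + (\<tau>' - y2) = \<beta>1 + \<beta>2 + \<beta>12) \<longleftrightarrow>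
      (x1 + x2 = \<rho> - \<alpha>1 - \<alpha>12 + (\<tau> - \<alpha>2 - \<alpha>12) + \<alpha>12 \<and> y1 + y2 = \<rho>' - \<beta>1 - \<beta>12 + (\<tau>' - \<beta>2 - \<beta>12) + \<beta>12)"
      by auto
    show ?thesis
    proof (cases "x1 + x2 = \<rho> - \<alpha>1 - \<alpha>12 + (\<tau> - \<alpha>2 - \<alpha>12) + \<alpha>12 \<and> y1 + y2 = \<rho>' - \<beta>1 - \<beta>12 + (\<tau>' - \<beta>2 - \<beta>12) + \<beta>12")
      case True
      then have e: "\<tau> - x2 - \<alpha>2 = x1 - (\<rho> - \<alpha>1 - \<alpha>12)" "\<tau>' - y2 - \<beta>2 = y1 - (\<rho>' - \<beta>1 - \<beta>12)" by auto
      show ?thesis unfolding expand_21_def expand_12_def d if_P[OF True] e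
        by (simp only: mult.assoc[symmetric] sign_pow_square mult_1_left)
    next
      case False
      show ?thesis unfolding expand_21_def expand_12_def d if_not_P[OF False] by simp
    qed
  qed
  have B: "inversion_02 \<rho> \<rho>' \<tau> \<tau>' (expand_02 \<alpha>1 \<alpha>2 \<alpha>12 \<beta>1 \<beta>2 \<beta>12 b) =
    (\<lambda>x0 y0 x2 y2. ?s * expand_02 (\<rho> - \<alpha>1 - \<alpha>12) (\<tau> - \<alpha>2 - \<alpha>12) \<alpha>12 (\<rho>' - \<beta>1 - \<beta>12) (\<tau>' - \<beta>2 - \<beta>12) \<beta>12 (flip_series b) x0 y0 x2 y2)"
    by (intro ext expand_02_inversion[OF b ints(3)])
  show ?thesis
    unfolding A B C gcor_def by (rule exI, rule gen)
qed

text \<open>The extra powers \<open>z1^\<rho>\<close> and \<open>z2^\<tau>\<close>, with conjugate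
  exponents \<open>\<rho>'\<close> and \<open>\<tau>'\<close>, absorb what \<open>S_z\<close>
  contributes: a state of degree \<open>(h, k)\<close> hit by \<open>L(1)^i Lbar(1)^j\<close> comes
  with the exponents \<open>i - 2h\<close> and \<open>j - 2k\<close>.\<close>

lemma gcor_inversion:
  assumes "gcor A B C" and \<rho>: "\<rho> - \<rho>' \<in> \<int>" "\<tau> - \<tau>' \<in> \<int>"
  shows "gcor (\<lambda>x1 y1 x2 y2. C (\<rho> - x1) (\<rho>' - y1) (\<tau> - x2) (\<tau>' - y2))
    (inversion_02 \<rho> \<rho>' \<tau> \<tau>' B)
    (\<lambda>x1 y1 x2 y2. A (\<rho> - x1) (\<rho>' - y1) (\<tau> - x2) (\<tau>' - y2))"
proof -
  obtain \<mu> where "gcor2 \<mu> A B C" using assms(1) gcor_def by blast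
  then show ?thesis
  proof induction
    case (generator \<alpha>1 \<beta>1 \<alpha>2 \<beta>2 \<alpha>12 \<beta>12 f a b c)
    then show ?case by (rule gcor_inversion_generator) (rule \<rho>)+
  next
    case (smult \<mu> A B C k)
    obtain N where N: "\<forall>x0 y0 x2 y2. B x0 y0 x2 y2 \<noteq> 0 \<longrightarrow> N \<le> x0 \<and> N \<le> y0"
      using gcor2_lower_bound[OF smult.hyps] by blast
    then have kN: "\<forall>x0 y0 x2 y2. k * B x0 y0 x2 y2 \<noteq> 0 \<longrightarrow> N \<le> x0 \<and> N \<le> y0"
      unfolding mult_eq_0_iff by blast
    have e: "inversion_02 \<rho> \<rho>' \<tau> \<tau>' (\<lambda>x0 y0 x2 y2. k * B x0 y0 x2 y2) x0 y0 x2 y2 = k * inversion_02 \<rho> \<rho>' \<tau> \<tau>' B x0 y0 x2 y2"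
      for x0 y0 x2 y2
    proof -
      obtain K :: nat where K: "x0 - N < real K + 1" "y0 - N < real K + 1" by (rule box_index_exists)
      show ?thesis
        unfolding inversion_02_box[of B N, OF N K] inversion_02_box[of "\<lambda>x0 y0 x2 y2. k * B x0 y0 x2 y2" N, OF kN K]
        by (simp add: sum_distrib_left mult_ac)
    qed
    have "inversion_02 \<rho> \<rho>' \<tau> \<tau>' (\<lambda>x0 y0 x2 y2. k * B x0 y0 x2 y2) =
      (\<lambda>x0 y0 x2 y2. k * inversion_02 \<rho> \<rho>' \<tau> \<tau>' B x0 y0 x2 y2)"
      by (intro ext e)
    then show ?case by (simp only: gcor_smult[OF smult.IH])
  next
    case (add \<mu> A B C \<mu>' A' B' C')
    obtain N1 where N1: "\<And>x0 y0 x2 y2. B x0 y0 x2 y2 \<noteq> 0 \<Longrightarrow> N1 \<le> x0 \<and> N1 \<le> y0"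
      using gcor2_lower_bound[OF add.hyps(1)] by blast
    obtain N2 where N2: "\<And>x0 y0 x2 y2. B' x0 y0 x2 y2 \<noteq> 0 \<Longrightarrow> N2 \<le> x0 \<and> N2 \<le> y0"
      using gcor2_lower_bound[OF add.hyps(2)] by blast
    define N where "N = min N1 N2"
    have NB: "\<forall>x0 y0 x2 y2. B x0 y0 x2 y2 \<noteq> 0 \<longrightarrow> N \<le> x0 \<and> N \<le> y0"
    proof (intro allI impI)
      fix x0 y0 x2 y2 assume "B x0 y0 x2 y2 \<noteq> 0"
      from N1[OF this] show "N \<le> x0 \<and> N \<le> y0" by (auto simp: N_def)
    qed
    have NB': "\<forall>x0 y0 x2 y2. B' x0 y0 x2 y2 \<noteq> 0 \<longrightarrow> N \<le> x0 \<and> N \<le> y0"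
    proof (intro allI impI)
      fix x0 y0 x2 y2 assume "B' x0 y0 x2 y2 \<noteq> 0"
      from N2[OF this] show "N \<le> x0 \<and> N \<le> y0" by (auto simp: N_def)
    qed
    have NS: "\<forall>x0 y0 x2 y2. B x0 y0 x2 y2 + B' x0 y0 x2 y2 \<noteq> 0 \<longrightarrow> N \<le> x0 \<and> N \<le> y0"
    proof (intro allI impI)
      fix x0 y0 x2 y2 assume nz: "B x0 y0 x2 y2 + B' x0 y0 x2 y2 \<noteq> 0"
      have "B x0 y0 x2 y2 \<noteq> 0 \<or> B' x0 y0 x2 y2 \<noteq> 0"
        by (rule ccontr) (use nz in simp)
      then show "N \<le> x0 \<and> N \<le> y0" using NB NB' by blast
    qed
    have e: "inversion_02 \<rho> \<rho>' \<tau> \<tau>' (\<lambda>x0 y0 x2 y2. B x0 y0 x2 y2 + B' x0 y0 x2 y2) x0 y0 x2 y2 =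
      inversion_02 \<rho> \<rho>' \<tau> \<tau>' B x0 y0 x2 y2 + inversion_02 \<rho> \<rho>' \<tau> \<tau>' B' x0 y0 x2 y2"
      for x0 y0 x2 y2
    proof -
      obtain K :: nat where K: "x0 - N < real K + 1" "y0 - N < real K + 1" by (rule box_index_exists)
      show ?thesis
        unfolding inversion_02_box[of B N, OF NB K] inversion_02_box[of B' N, OF NB' K]
          inversion_02_box[of "\<lambda>x0 y0 x2 y2. B x0 y0 x2 y2 + B' x0 y0 x2 y2" N, OF NS K]
        by (simp add: sum.distrib distrib_left)
    qed
    have "inversion_02 \<rho> \<rho>' \<tau> \<tau>' (\<lambda>x0 y0 x2 y2. B x0 y0 x2 y2 + B' x0 y0 x2 y2) =
      (\<lambda>x0 y0 x2 y2. inversion_02 \<rho> \<rho>' \<tau> \<tau>' B x0 y0 x2 y2 + inversion_02 \<rho> \<rho>' \<tau> \<tau>' B' x0 y0 x2 y2)"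
      by (intro ext e)
    then show ?case by (simp only: gcor_add[OF add.IH])
  qed
qed

section \<open>Bigraded spaces and graded duals\<close>

lemma fun_sum_apply: "(\<Sum>i\<in>A. f i) x = (\<Sum>i\<in>A. f i x)"
  by (induction A rule: infinite_finite_induct) auto

lemma linear_map_onD:
  assumes "linear_map_on s1 s2 V f"
  shows "v \<in> V \<Longrightarrow> w \<in> V \<Longrightarrow> f (v + w) = f v + f w" "v \<in> V \<Longrightarrow> f (s1 c v) = s2 c (f v)"
  using assms unfolding linear_map_on_def by blast+

context bigraded_space
begin

lemma total_base: "v \<in> G h k \<Longrightarrow> v \<in> gtotal sc G"
  unfolding gtotal_def by (rule span_base) blast

lemma total_add: "v \<in> gtotal sc G \<Longrightarrow> w \<in> gtotal sc G \<Longrightarrow> v + w \<in> gtotal sc G"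
  unfolding gtotal_def by (rule span_add)

lemma total_scale: "v \<in> gtotal sc G \<Longrightarrow> sc c v \<in> gtotal sc G"
  unfolding gtotal_def by (rule span_scale)

lemma total_zero: "0 \<in> gtotal sc G"
  unfolding gtotal_def by (rule span_zero)

lemma total_sum: "(\<And>i. i \<in> I \<Longrightarrow> v i \<in> gtotal sc G) \<Longrightarrow> (\<Sum>i\<in>I. v i) \<in> gtotal sc G"
  unfolding gtotal_def by (rule span_sum)

lemma piece_add: "v \<in> G h k \<Longrightarrow> w \<in> G h k \<Longrightarrow> v + w \<in> G h k"
  using subspace_piece by (rule subspace_add)

lemma piece_scale: "v \<in> G h k \<Longrightarrow> sc c v \<in> G h k"
  using subspace_piece by (rule subspace_scale)

lemma piece_zero: "0 \<in> G h k"
  using subspace_piece by (rule subspace_0)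

lemma piece_diff: "v \<in> G h k \<Longrightarrow> w \<in> G h k \<Longrightarrow> v - w \<in> G h k"
  using subspace_piece by (rule subspace_diff)

lemma piece_sum: "(\<And>i. i \<in> I \<Longrightarrow> v i \<in> G h k) \<Longrightarrow> (\<Sum>i\<in>I. v i) \<in> G h k"
  using subspace_piece by (rule subspace_sum)

lemma linear_total_sum:
  assumes f: "linear_map_on sc s2 (gtotal sc G) f" and "\<And>i. i \<in> I \<Longrightarrow> v i \<in> gtotal sc G"
  shows "f (\<Sum>i\<in>I. v i) = (\<Sum>i\<in>I. f (v i))"
proof -
  have "f (0 + 0) = f 0 + f 0" by (rule linear_map_onD(1)[OF f total_zero total_zero])
  then have f0: "f 0 = 0" by simp
  show ?thesis
    using assms(2)
  proof (induction I rule: infinite_finite_induct)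
    case (insert i I)
    have "f (v i + sum v I) = f (v i) + f (sum v I)"
      by (rule linear_map_onD(1)[OF f]) (use insert.prems total_sum[of I v] in auto)
    then show ?case using insert by simp
  qed (use f0 in auto)
qed

text \<open>Scalar multiples stay within a piece, so the span of the pieces is generated by sums
  alone.\<close>

lemma total_induct [consumes 1, case_names piece add]:
  assumes v: "v \<in> gtotal sc G"
    and piece: "\<And>h k v. v \<in> G h k \<Longrightarrow> P v"
    and add: "\<And>v w. v \<in> gtotal sc G \<Longrightarrow> w \<in> gtotal sc G \<Longrightarrow> P v \<Longrightarrow> P w \<Longrightarrow> P (v + w)"
  shows "P v"
proof -
  have "v \<in> span (\<Union>h k. G h k)" using v by (simp add: gtotal_def)
  then have "v \<in> gtotal sc G \<and> P v"
  proof (induction rule: span_induct_alt)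
    case base
    then show ?case using piece[OF piece_zero] total_zero by blast
  next
    case (step c x y)
    then obtain h k where "x \<in> G h k" by blast
    then have "sc c x \<in> G h k" by (rule piece_scale)
    then show ?case using step add[OF total_base] piece total_add[OF total_base] by blast
  qed
  then show ?thesis by blast
qed

text \<open>The predicate inside the definite description of \<open>gcomp\<close>; naming it
  separates existence and uniqueness from the choice operator.\<close>

definition decomposes :: "'v \<Rightarrow> (real \<Rightarrow> real \<Rightarrow> 'v) \<Rightarrow> bool" where
  "decomposes v w \<longleftrightarrow> (\<forall>h k. w h k \<in> G h k) \<and> finite {(h, k). w h k \<noteq> 0} \<and>
     v = (\<Sum>(h, k) \<in> {(h, k). w h k \<noteq> 0}. w h k)"

lemma decomposes_on:
  assumes "decomposes v w" "finite I" "{(h, k). w h k \<noteq> 0} \<subseteq> I"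
  shows "v = (\<Sum>(h, k)\<in>I. w h k)"
proof -
  have "v = (\<Sum>(h, k) \<in> {(h, k). w h k \<noteq> 0}. w h k)" using assms(1) by (simp add: decomposes_def)
  also have "\<dots> = (\<Sum>(h, k)\<in>I. w h k)"
    by (rule sum.mono_neutral_left) (use assms in auto)
  finally show ?thesis .
qed

lemma decomposesI:
  assumes "\<And>h k. w h k \<in> G h k" "finite I" "{(h, k). w h k \<noteq> 0} \<subseteq> I" "v = (\<Sum>(h, k)\<in>I. w h k)"
  shows "decomposes v w"
  unfolding decomposes_def
proof (intro conjI allI assms(1))
  show "finite {(h, k). w h k \<noteq> 0}" by (rule finite_subset[OF assms(3,2)])
  have "(\<Sum>(h, k)\<in>I. w h k) = (\<Sum>(h, k) \<in> {(h, k). w h k \<noteq> 0}. w h k)"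
    by (rule sum.mono_neutral_right) (use assms in auto)
  then show "v = (\<Sum>(h, k) \<in> {(h, k). w h k \<noteq> 0}. w h k)" using assms(4) by simp
qed

lemma decomposes_add:
  assumes "decomposes v w" "decomposes v' w'"
  shows "decomposes (v + v') (\<lambda>h k. w h k + w' h k)"
proof (rule decomposesI)
  let ?I = "{(h, k). w h k \<noteq> 0} \<union> {(h, k). w' h k \<noteq> 0}"
  show fin: "finite ?I" using assms by (simp add: decomposes_def)
  show "w h k + w' h k \<in> G h k" for h k using assms by (simp add: decomposes_def piece_add)
  show "{(h, k). w h k + w' h k \<noteq> 0} \<subseteq> ?I" by auto
  have "v = (\<Sum>(h, k)\<in>?I. w h k)" "v' = (\<Sum>(h, k)\<in>?I. w' h k)"
    by (rule decomposes_on[OF assms(1) fin], blast) (rule decomposes_on[OF assms(2) fin], blast)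
  then show "v + v' = (\<Sum>(h, k)\<in>?I. w h k + w' h k)"
    by (simp add: case_prod_unfold sum.distrib)
qed

lemma decomposes_scale:
  assumes "decomposes v w"
  shows "decomposes (sc c v) (\<lambda>h k. sc c (w h k))"
proof (rule decomposesI)
  let ?I = "{(h, k). w h k \<noteq> 0}"
  show fin: "finite ?I" using assms by (simp add: decomposes_def)
  show "sc c (w h k) \<in> G h k" for h k using assms by (simp add: decomposes_def piece_scale)
  show "{(h, k). sc c (w h k) \<noteq> 0} \<subseteq> ?I" by auto
  have "v = (\<Sum>(h, k)\<in>?I. w h k)" by (rule decomposes_on[OF assms fin]) blast
  then show "sc c v = (\<Sum>(h, k)\<in>?I. sc c (w h k))"
    by (simp add: case_prod_unfold scale_sum_right)
qed

lemma decomposes_unique: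
  assumes "decomposes v w" "decomposes v w'"
  shows "w = w'"
proof (intro ext)
  fix h k
  let ?I = "insert (h, k) ({(h, k). w h k \<noteq> 0} \<union> {(h, k). w' h k \<noteq> 0})"
  have fin: "finite ?I" using assms by (simp add: decomposes_def)
  have "v = (\<Sum>(h, k)\<in>?I. w h k)" "v = (\<Sum>(h, k)\<in>?I. w' h k)"
    by (rule decomposes_on[OF assms(1) fin], blast) (rule decomposes_on[OF assms(2) fin], blast)
  then have "(\<Sum>(h, k)\<in>?I. w h k - w' h k) = 0"
    by (simp add: case_prod_unfold sum_subtractf)
  moreover have "(case (h, k) of (h, k) \<Rightarrow> w h k - w' h k) \<in> G h k" for h k
    using assms by (simp add: decomposes_def piece_diff)
  ultimately have "(case (h, k) of (h, k) \<Rightarrow> w h k - w' h k) = 0"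
    using direct_sum[OF fin, of "\<lambda>(h, k). w h k - w' h k" "(h, k)"] by blast
  then show "w h k = w' h k" by simp
qed

lemma decomposes_piece:
  assumes "v \<in> G h k"
  shows "decomposes v (\<lambda>h' k'. if h' = h \<and> k' = k then v else 0)"
  by (rule decomposesI[of _ "{(h, k)}"]) (use assms piece_zero in auto)

lemma decomposes_exists: "v \<in> gtotal sc G \<Longrightarrow> \<exists>w. decomposes v w"
proof (induction rule: total_induct)
  case (piece h k v)
  show ?case by (rule exI, rule decomposes_piece[OF piece])
next
  case (add v w)
  then obtain f g where "decomposes v f" "decomposes w g" by blast
  then show ?case by (intro exI) (rule decomposes_add)
qed

lemma gcomp_eq:
  assumes "decomposes v w"
  shows "gcomp G v = w"
  unfolding gcomp_def decomposes_def[symmetric]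
proof (rule the_equality)
  show "decomposes v w" by (rule assms)
  show "w' = w" if "decomposes v w'" for w' by (rule decomposes_unique[OF that assms])
qed

lemma decomposes_gcomp:
  assumes "v \<in> gtotal sc G"
  shows "decomposes v (gcomp G v)"
proof -
  obtain w where w: "decomposes v w" using decomposes_exists[OF assms] by blast
  show ?thesis unfolding gcomp_eq[OF w] by (rule w)
qed

lemma gcomp_mem: "v \<in> gtotal sc G \<Longrightarrow> gcomp G v h k \<in> G h k"
  using decomposes_gcomp[of v] unfolding decomposes_def by blast

lemma gcomp_add:
  assumes "v \<in> gtotal sc G" "w \<in> gtotal sc G"
  shows "gcomp G (v + w) h k = gcomp G v h k + gcomp G w h k"
  by (simp add: gcomp_eq[OF decomposes_add[OF decomposes_gcomp[OF assms(1)] decomposes_gcomp[OF assms(2)]]])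

lemma gcomp_scale:
  assumes "v \<in> gtotal sc G"
  shows "gcomp G (sc c v) h k = sc c (gcomp G v h k)"
  by (simp add: gcomp_eq[OF decomposes_scale[OF decomposes_gcomp[OF assms]]])

lemma gcomp_piece:
  assumes "v \<in> G h k"
  shows "gcomp G v h' k' = (if h' = h \<and> k' = k then v else 0)"
  by (simp add: gcomp_eq[OF decomposes_piece[OF assms]])

lemma sum_gcomp:
  assumes "v \<in> gtotal sc G"
  shows "finite {(h, k). gcomp G v h k \<noteq> 0}" "v = (\<Sum>(h, k) \<in> {(h, k). gcomp G v h k \<noteq> 0}. gcomp G v h k)"
  using decomposes_gcomp[OF assms] by (auto simp: decomposes_def)

section \<open>Duals of the pieces\<close>

lemma dual_piece_linear:
  assumes "u \<in> dual_piece sc G h k"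
  shows "v \<in> gtotal sc G \<Longrightarrow> w \<in> gtotal sc G \<Longrightarrow> u (v + w) = u v + u w"
    and "v \<in> gtotal sc G \<Longrightarrow> u (sc c v) = c * u v"
    and "v \<notin> gtotal sc G \<Longrightarrow> u v = 0"
    and "v \<in> G h' k' \<Longrightarrow> (h', k') \<noteq> (h, k) \<Longrightarrow> u v = 0"
proof -
  have l: "linear_map_on sc (*) (gtotal sc G) u" and z: "\<forall>v. v \<notin> gtotal sc G \<longrightarrow> u v = 0"
    and p: "\<forall>h' k'. (h', k') \<noteq> (h, k) \<longrightarrow> (\<forall>v\<in>G h' k'. u v = 0)"
    using assms by (simp_all add: dual_piece_def)
  show "v \<in> gtotal sc G \<Longrightarrow> w \<in> gtotal sc G \<Longrightarrow> u (v + w) = u v + u w"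
    "v \<in> gtotal sc G \<Longrightarrow> u (sc c v) = c * u v" by (rule linear_map_onD[OF l]; assumption)+
  show "v \<notin> gtotal sc G \<Longrightarrow> u v = 0" using z by blast
  show "v \<in> G h' k' \<Longrightarrow> (h', k') \<noteq> (h, k) \<Longrightarrow> u v = 0" using p by blast
qed

lemma dual_piece_gcomp:
  assumes "u \<in> dual_piece sc G h k" "v \<in> gtotal sc G"
  shows "u v = u (gcomp G v h k)"
  using assms(2)
proof (induction rule: total_induct)
  case (piece h' k' v)
  have "u (v + 0) = u v + u 0" using dual_piece_linear(1)[OF assms(1)] total_base[OF piece] total_zero by blast
  then have u0: "u 0 = 0" by simp
  show ?case
  proof (cases "h' = h \<and> k' = k")
    case False
    then have "u v = 0" using dual_piece_linear(4)[OF assms(1) piece] by blast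
    then show ?thesis using False u0 by (auto simp: gcomp_piece[OF piece])
  qed (simp add: gcomp_piece[OF piece])
next
  case (add v w)
  then show ?case
    by (simp add: gcomp_add dual_piece_linear(1)[OF assms(1)] total_base[OF gcomp_mem])
qed

lemma dual_piece_ext:
  assumes "u \<in> dual_piece sc G h k" "u' \<in> dual_piece sc G h k" "\<And>v. v \<in> G h k \<Longrightarrow> u v = u' v"
  shows "u = u'"
proof
  fix v
  show "u v = u' v"
  proof (cases "v \<in> gtotal sc G")
    case True
    then show ?thesis
      using dual_piece_gcomp[OF assms(1) True] dual_piece_gcomp[OF assms(2) True] assms(3)[OF gcomp_mem[OF True]] by simp
  next
    case False
    then show ?thesis using dual_piece_linear(3)[OF assms(1)] dual_piece_linear(3)[OF assms(2)] by simp
  qed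
qed

lemma dual_pieceI:
  assumes "\<And>v w. v \<in> G h k \<Longrightarrow> w \<in> G h k \<Longrightarrow> f (v + w) = f v + f w" "\<And>c v. v \<in> G h k \<Longrightarrow> f (sc c v) = c * f v"
  shows "(\<lambda>v. if v \<in> gtotal sc G then f (gcomp G v h k) else 0) \<in> dual_piece sc G h k"
proof -
  let ?u = "\<lambda>v. if v \<in> gtotal sc G then f (gcomp G v h k) else 0"
  have f0: "f 0 = 0" using assms(2)[OF piece_zero, of 0] by simp
  have "linear_map_on sc (*) (gtotal sc G) ?u"
    unfolding linear_map_on_def
  proof (intro conjI ballI allI)
    fix v assume v: "v \<in> gtotal sc G"
    show "?u (sc c v) = c * ?u v" for c
      using v total_scale[OF v] by (simp add: gcomp_scale[OF v] assms(2)[OF gcomp_mem[OF v]])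
    fix w assume w: "w \<in> gtotal sc G"
    show "?u (v + w) = ?u v + ?u w"
      using v w total_add[OF v w]
      by (simp add: gcomp_add[OF v w] assms(1)[OF gcomp_mem[OF v] gcomp_mem[OF w]])
  qed
  moreover have "?u v = 0" if "(h', k') \<noteq> (h, k)" "v \<in> G h' k'" for h' k' v
    using that gcomp_piece[OF that(2), of h k] f0 by auto
  ultimately show ?thesis unfolding dual_piece_def by auto
qed

text \<open>For a basis \<open>B\<close> of \<open>G h k\<close> these are the elements of the dual
  basis, composed with the projection to the piece and extended by 0 as \<open>dual_piece\<close>
  requires.\<close>

definition coordinate :: "'v set \<Rightarrow> 'v \<Rightarrow> real \<Rightarrow> real \<Rightarrow> 'v \<Rightarrow> complex" where
  "coordinate B b h k v = (if v \<in> gtotal sc G then representation B (gcomp G v h k) b else 0)"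

lemma coordinate_dual:
  assumes "independent B" "span B = G h k"
  shows "coordinate B b h k \<in> dual_piece sc G h k"
  unfolding coordinate_def[abs_def]
proof (rule dual_pieceI)
  fix v w c assume v: "v \<in> G h k"
  show "representation B (sc c v) b = c * representation B v b"
    using representation_scale[OF assms(1), of v c] v assms(2) by simp
  assume "w \<in> G h k"
  then show "representation B (v + w) b = representation B v b + representation B w b"
    using representation_add[OF assms(1), of w v] v assms(2) by simp
qed

lemma coordinate_piece: "v \<in> G h k \<Longrightarrow> coordinate B b h k v = representation B v b"
  by (simp add: coordinate_def total_base gcomp_piece)

text \<open>Some coordinate of \<open>v\<close> in a basis of the piece is non-zero. Since
  correlators control matrix coefficients only, identities between vectors are proved through this
  separation.\<close>

lemma dual_separates:
  assumes "v \<in> G h k" "v \<noteq> 0"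
  shows "\<exists>u\<in>dual_piece sc G h k. u v \<noteq> 0"
proof -
  obtain B where B: "B \<subseteq> G h k" "independent B" "G h k \<subseteq> span B"
    using maximal_independent_subset by blast
  have sp: "span B = G h k" using B span_minimal[OF B(1) subspace_piece] by blast
  have "(\<Sum>b | representation B v b \<noteq> 0. sc (representation B v b) b) = v"
    by (rule sum_nonzero_representation_eq) (use B assms in auto)
  then have "{b. representation B v b \<noteq> 0} \<noteq> {}" using assms(2) by (intro notI) simp
  then obtain b where "representation B v b \<noteq> 0" by blast
  then show ?thesis
    using coordinate_dual[OF B(2) sp, of b] coordinate_piece[OF assms(1), of B b] by (intro bexI[of _ "coordinate B b h k"]) auto
qed

lemma dual_eqI:
  assumes "v \<in> G h k" "w \<in> G h k" "\<And>u. u \<in> dual_piece sc G h k \<Longrightarrow> u v = u w"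
  shows "v = w"
proof (rule ccontr)
  assume "v \<noteq> w"
  then obtain u where u: "u \<in> dual_piece sc G h k" "u (v - w) \<noteq> 0"
    using dual_separates[OF piece_diff[OF assms(1,2)]] by auto
  have "u ((v - w) + w) = u (v - w) + u w"
    by (rule dual_piece_linear(1)[OF u(1) total_base[OF piece_diff[OF assms(1,2)]] total_base[OF assms(2)]])
  then show False using assms(3)[OF u(1)] u(2) by simp
qed

text \<open>Directness: on \<open>G h k\<close> every summand but the one of degree
  \<open>(h, k)\<close> vanishes, and a functional of that degree is determined by its values
  there.\<close>

lemma dual_bigraded: "bigraded_space fun_scale (dual_piece sc G)"
proof -
  interpret D: vector_space fun_scale
    by unfold_locales (auto simp: fun_scale_def fun_eq_iff algebra_simps)
  show ?thesis
  proof (unfold_locales)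
    show "module.subspace fun_scale (dual_piece sc G h k)" for h k
      unfolding D.subspace_def dual_piece_def linear_map_on_def fun_scale_def
      by (auto simp: algebra_simps)
    fix I :: "(real \<times> real) set" and w i
    assume I: "finite I" "\<And>h k. (h, k) \<in> I \<Longrightarrow> w (h, k) \<in> dual_piece sc G h k" "(\<Sum>i\<in>I. w i) = 0" "i \<in> I"
    obtain h k where i: "i = (h, k)" by force
    have wi: "w i \<in> dual_piece sc G h k" using I i by blast
    have "w i v = 0" if v: "v \<in> G h k" for v
    proof -
      have "0 = (\<Sum>j\<in>I. w j v)" using fun_cong[OF I(3), of v] by (simp add: fun_sum_apply)
      also have "\<dots> = (\<Sum>j\<in>{i}. w j v)"
      proof (rule sum.mono_neutral_right[OF I(1)])
        show "\<forall>j\<in>I - {i}. w j v = 0"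
        proof
          fix j assume j: "j \<in> I - {i}"
          obtain h' k' where j': "j = (h', k')" by force
          have "w j \<in> dual_piece sc G h' k'" using I(2) j j' by blast
          then show "w j v = 0" by (rule dual_piece_linear(4)[OF _ v]) (use i j j' in blast)
        qed
      qed (use I in blast)
      finally show ?thesis by simp
    qed
    moreover have "0 \<in> dual_piece sc G h k"
      unfolding dual_piece_def linear_map_on_def by auto
    ultimately show "w i = 0"
      using dual_piece_ext[OF wi, of 0] by simp
  qed
qed

lemma finite_basis:
  assumes "finite B'" "span B' = G h k"
  obtains B where "finite B" "independent B" "span B = G h k"
proof -
  obtain B where B: "B \<subseteq> B'" "independent B" "B' \<subseteq> span B"
    using maximal_independent_subset[of B'] by blast
  have "span B \<subseteq> span B'" by (rule span_mono[OF B(1)])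
  moreover have "span B' \<subseteq> span B" by (rule span_minimal[OF B(3) subspace_span])
  ultimately have "span B = G h k" using assms(2) by simp
  then show thesis by (rule that[OF finite_subset[OF B(1) assms(1)] B(2)])
qed

lemma dual_expansion:
  assumes B: "finite B" "independent B" "span B = G h k" and u: "u \<in> dual_piece sc G h k"
  shows "u = (\<Sum>b\<in>B. fun_scale (u b) (coordinate B b h k))"
proof -
  interpret D: bigraded_space fun_scale "dual_piece sc G" by (rule dual_bigraded)
  have BG: "b \<in> G h k" if "b \<in> B" for b using B(3) span_base[OF that] by simp
  have lin: "linear_map_on sc (*) (gtotal sc G) u" using u by (simp add: dual_piece_def)
  show ?thesis
  proof (rule dual_piece_ext[OF u])
    show "(\<Sum>b\<in>B. fun_scale (u b) (coordinate B b h k)) \<in> dual_piece sc G h k"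
      by (intro D.piece_sum D.piece_scale coordinate_dual B)
    fix v assume v: "v \<in> G h k"
    have "v = (\<Sum>b\<in>B. sc (representation B v b) b)"
      using sum_representation_eq[OF B(2) _ B(1) subset_refl, of v] v B(3) by simp
    then have "u v = u (\<Sum>b\<in>B. sc (representation B v b) b)" by simp
    also have "\<dots> = (\<Sum>b\<in>B. u (sc (representation B v b) b))"
      by (rule linear_total_sum[OF lin]) (rule total_scale[OF total_base[OF BG]])
    also have "\<dots> = (\<Sum>b\<in>B. u b * coordinate B b h k v)"
      by (intro sum.cong refl) (simp add: dual_piece_linear(2)[OF u total_base[OF BG]] coordinate_piece[OF v])
    finally show "u v = (\<Sum>b\<in>B. fun_scale (u b) (coordinate B b h k)) v"
      by (simp add: fun_scale_def fun_sum_apply)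
  qed
qed

lemma dual_finite_dim:
  assumes "pieces_finite_dim sc G"
  shows "pieces_finite_dim fun_scale (dual_piece sc G)"
  unfolding pieces_finite_dim_def
proof (intro allI)
  fix h k
  interpret D: bigraded_space fun_scale "dual_piece sc G" by (rule dual_bigraded)
  obtain B' where "finite B'" "span B' = G h k" using assms unfolding pieces_finite_dim_def by blast
  then obtain B where B: "finite B" "independent B" "span B = G h k" by (rule finite_basis)
  let ?C = "(\<lambda>b. coordinate B b h k) ` B"
  have "D.span ?C \<subseteq> dual_piece sc G h k"
    by (rule D.span_minimal[OF _ D.subspace_piece]) (use coordinate_dual[OF B(2,3)] in blast)
  moreover have "dual_piece sc G h k \<subseteq> D.span ?C"
  proof
    fix u assume "u \<in> dual_piece sc G h k"
    then have "u = (\<Sum>b\<in>B. fun_scale (u b) (coordinate B b h k))" by (rule dual_expansion[OF B])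
    also have "\<dots> \<in> D.span ?C" by (rule D.span_sum, rule D.span_scale, rule D.span_base, blast)
    finally show "u \<in> D.span ?C" .
  qed
  ultimately show "\<exists>C. finite C \<and> module.span fun_scale C = dual_piece sc G h k"
    using B(1) by (intro exI[of _ ?C]) auto
qed

lemma dual_linear_total:
  assumes "u \<in> graded_dual sc G"
  shows "linear_map_on sc (*) (gtotal sc G) u \<and> (\<forall>v. v \<notin> gtotal sc G \<longrightarrow> u v = 0)"
proof -
  interpret D: bigraded_space fun_scale "dual_piece sc G" by (rule dual_bigraded)
  from assms show ?thesis
  proof (induction rule: D.total_induct)
    case (piece h k v)
    then show ?case by (simp add: dual_piece_def)
  next
    case (add v w)
    then have l: "linear_map_on sc (*) (gtotal sc G) v" "linear_map_on sc (*) (gtotal sc G) w"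
      and z: "\<forall>x. x \<notin> gtotal sc G \<longrightarrow> v x = 0" "\<forall>x. x \<notin> gtotal sc G \<longrightarrow> w x = 0" by blast+
    have "linear_map_on sc (*) (gtotal sc G) (v + w)"
      unfolding linear_map_on_def
      by (simp add: linear_map_onD[OF l(1)] linear_map_onD[OF l(2)] distrib_left)
    moreover have "\<forall>x. x \<notin> gtotal sc G \<longrightarrow> (v + w) x = 0" using z by simp
    ultimately show ?case by (rule conjI)
  qed
qed

text \<open>Reflexivity of a finite-dimensional piece: the coordinates of the vector are the values
  of \<open>U\<close> on the dual basis. Functionals of other degrees give 0 on both sides.\<close>

lemma double_dual_piece:
  assumes "pieces_finite_dim sc G" "U \<in> dual_piece fun_scale (dual_piece sc G) h k"
  obtains v where "v \<in> G h k" "\<And>u. u \<in> graded_dual sc G \<Longrightarrow> U u = u v"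
proof -
  interpret D: bigraded_space fun_scale "dual_piece sc G" by (rule dual_bigraded)
  obtain B' where "finite B'" "span B' = G h k" using assms unfolding pieces_finite_dim_def by blast
  then obtain B where B: "finite B" "independent B" "span B = G h k" by (rule finite_basis)
  have BG: "b \<in> G h k" if "b \<in> B" for b using B(3) span_base[OF that] by simp
  define v where "v = (\<Sum>b\<in>B. sc (U (coordinate B b h k)) b)"
  have v: "v \<in> G h k" unfolding v_def by (intro piece_sum piece_scale BG)
  have linU: "linear_map_on fun_scale (*) (graded_dual sc G) U" using assms(2) by (simp add: dual_piece_def)
  have "U u = u v" if "u \<in> graded_dual sc G" for u
    using that
  proof (induction rule: D.total_induct)
    case (piece h' k' u)
    show ?case
    proof (cases "(h', k') = (h, k)")
      case False
      have "U u = 0" by (rule D.dual_piece_linear(4)[OF assms(2) piece False])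
      moreover have "u v = 0" by (rule dual_piece_linear(4)[OF piece v]) (use False in auto)
      ultimately show ?thesis by simp
    next
      case True
      then have u: "u \<in> dual_piece sc G h k" using piece by simp
      have c: "coordinate B b h k \<in> graded_dual sc G" for b
        by (rule D.total_base[OF coordinate_dual[OF B(2,3)]])
      have "U u = U (\<Sum>b\<in>B. fun_scale (u b) (coordinate B b h k))"
        using dual_expansion[OF B u] by simp
      also have "\<dots> = (\<Sum>b\<in>B. U (fun_scale (u b) (coordinate B b h k)))"
        by (rule D.linear_total_sum[OF linU]) (rule D.total_scale[OF c])
      also have "\<dots> = (\<Sum>b\<in>B. u b * U (coordinate B b h k))"
        by (simp add: linear_map_onD(2)[OF linU c])
      also have "\<dots> = (\<Sum>b\<in>B. u (sc (U (coordinate B b h k)) b))"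
        by (intro sum.cong refl) (simp add: dual_piece_linear(2)[OF u total_base[OF BG]])
      also have "\<dots> = u v"
        unfolding v_def
        by (rule linear_total_sum[symmetric, of "(*)"])
          (use u total_scale[OF total_base[OF BG]] in \<open>auto simp: dual_piece_def\<close>)
      finally show ?thesis .
    qed
  next
    case (add u w)
    have "U (u + w) = U u + U w" by (rule linear_map_onD(1)[OF linU add(1,2)])
    also have "\<dots> = (u + w) v" by (simp add: add(3,4))
    finally show ?case .
  qed
  with v show thesis by (rule that)
qed

text \<open>The correlator axiom for the dual module is tested against functionals on the dual; this
  turns them into vectors of the original module, to which its own correlators apply.\<close>

lemma double_dual:
  assumes "pieces_finite_dim sc G" "U \<in> graded_dual fun_scale (dual_piece sc G)"
  shows "\<exists>v\<in>gtotal sc G. \<forall>u\<in>graded_dual sc G. U u = u v"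
proof -
  interpret D: bigraded_space fun_scale "dual_piece sc G" by (rule dual_bigraded)
  interpret DD: bigraded_space fun_scale "dual_piece fun_scale (dual_piece sc G)" by (rule D.dual_bigraded)
  from assms(2) show ?thesis
  proof (induction rule: DD.total_induct)
    case (piece h k U)
    then obtain v where "v \<in> G h k" "\<And>u. u \<in> graded_dual sc G \<Longrightarrow> U u = u v"
      using double_dual_piece[OF assms(1)] by blast
    then show ?case using total_base by blast
  next
    case (add U U')
    obtain v where v: "v \<in> gtotal sc G" "\<And>u. u \<in> graded_dual sc G \<Longrightarrow> U u = u v" using add by blast
    obtain v' where v': "v' \<in> gtotal sc G" "\<And>u. u \<in> graded_dual sc G \<Longrightarrow> U' u = u v'" using add by blast
    have "(U + U') u = u (v + v')" if u: "u \<in> graded_dual sc G" for u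
      using v v' u dual_linear_total[OF u] by (simp add: linear_map_on_def)
    then show ?case using total_add[OF v(1) v'(1)] by blast
  qed
qed

lemma dual_piece_trivial:
  assumes "G h k = {0}"
  shows "dual_piece sc G h k = {0}"
proof -
  have z: "0 \<in> dual_piece sc G h k"
    unfolding dual_piece_def linear_map_on_def by auto
  have "u = 0" if u: "u \<in> dual_piece sc G h k" for u
  proof (rule dual_piece_ext[OF u z])
    fix v assume "v \<in> G h k"
    then have "v = 0" using assms by simp
    then show "u v = 0 v" using dual_piece_linear(2)[OF u total_zero, of 0] by simp
  qed
  then show ?thesis using z by blast
qed

end

section \<open>Modes\<close>

context full_vertex_action
begin

lemma YM_piece:
  assumes "a \<in> F h k" "v \<in> M h' k'"
  shows "YM a x y v \<in> M (h + h' + x) (k + k' + y)"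
  using graded[OF assms, of "- x - 1" "- y - 1"] by (simp add: mode_def algebra_simps)

lemma YM_int:
  assumes "a \<in> gtotal sF F" "v \<in> gtotal sM M" "YM a x y v \<noteq> 0"
  shows "x - y \<in> \<int>"
  using support[OF assms(1)] assms(2,3) unfolding admissible_support_def by blast

lemma YM_add_right:
  "a \<in> gtotal sF F \<Longrightarrow> v \<in> gtotal sM M \<Longrightarrow> w \<in> gtotal sM M \<Longrightarrow> YM a x y (v + w) = YM a x y v + YM a x y w"
  by (rule linear_map_onD(1)[OF endomorphism_linear])

lemma YM_scale_right: "a \<in> gtotal sF F \<Longrightarrow> v \<in> gtotal sM M \<Longrightarrow> YM a x y (sM c v) = sM c (YM a x y v)"
  by (rule linear_map_onD(2)[OF endomorphism_linear])

lemma YM_sum_right: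
  "a \<in> gtotal sF F \<Longrightarrow> (\<And>i. i \<in> I \<Longrightarrow> v i \<in> gtotal sM M) \<Longrightarrow> YM a x y (\<Sum>i\<in>I. v i) = (\<Sum>i\<in>I. YM a x y (v i))"
  by (rule M.linear_total_sum[OF endomorphism_linear])

lemma YM_zero_right: "a \<in> gtotal sF F \<Longrightarrow> YM a x y 0 = 0"
  using YM_sum_right[of a "{}" "\<lambda>_. 0"] by simp

lemma YM_add_left:
  "a \<in> gtotal sF F \<Longrightarrow> b \<in> gtotal sF F \<Longrightarrow> v \<in> gtotal sM M \<Longrightarrow> YM (a + b) x y v = YM a x y v + YM b x y v"
  by (rule linear_map_onD(1)[OF state_linear])

lemma YM_scale_left: "a \<in> gtotal sF F \<Longrightarrow> v \<in> gtotal sM M \<Longrightarrow> YM (sF c a) x y v = sM c (YM a x y v)"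
  by (rule linear_map_onD(2)[OF state_linear])

lemma YM_sum_left:
  "v \<in> gtotal sM M \<Longrightarrow> (\<And>i. i \<in> I \<Longrightarrow> a i \<in> gtotal sF F) \<Longrightarrow> YM (\<Sum>i\<in>I. a i) x y v = (\<Sum>i\<in>I. YM (a i) x y v)"
  by (rule F.linear_total_sum[OF state_linear])

lemma YM_zero_left: "v \<in> gtotal sM M \<Longrightarrow> YM 0 x y v = 0"
  using YM_sum_left[of v "{}" "\<lambda>_. 0"] by simp

end

section \<open>Translation covariance and holomorphic states\<close>

context full_vertex_algebra
begin

text \<open>Each mode shifts degrees by its exponents, so all three expansions have one total
  degree, that of \<open>u\<close> minus those of the three states. This is the hypothesis under
  which the slice \<open>z2 = 1\<close> loses nothing.\<close>

lemma homogeneous_correlator: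
  assumes a: "a \<in> F ha ka" and b: "b \<in> F hb kb" and c: "c \<in> F hc kc" and u: "u \<in> dual_piece sF F h k"
  obtains \<mu> where "gcor2 \<mu>
        (\<lambda>x1 y1 x2 y2. u (Y a x1 y1 (Y b x2 y2 c)))
        (\<lambda>x0 y0 x2 y2. u (Y (Y a x0 y0 b) x2 y2 c))
        (\<lambda>x1 y1 x2 y2. u (Y b x2 y2 (Y a x1 y1 c)))"
    and "\<And>x1 y1 x2 y2. u (Y a x1 y1 (Y b x2 y2 c)) \<noteq> 0 \<or> u (Y (Y a x1 y1 b) x2 y2 c) \<noteq> 0 \<or>
        u (Y b x2 y2 (Y a x1 y1 c)) \<noteq> 0 \<Longrightarrow> x1 + x2 = h - ha - hb - hc \<and> y1 + y2 = k - ka - kb - kc"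
proof -
  interpret D: bigraded_space fun_scale "dual_piece sF F" by (rule F.dual_bigraded)
  obtain \<mu> where \<mu>: "gcor2 \<mu>
        (\<lambda>x1 y1 x2 y2. u (Y a x1 y1 (Y b x2 y2 c)))
        (\<lambda>x0 y0 x2 y2. u (Y (Y a x0 y0 b) x2 y2 c))
        (\<lambda>x1 y1 x2 y2. u (Y b x2 y2 (Y a x1 y1 c)))"
    using correlator[OF F.total_base[OF a] F.total_base[OF b] F.total_base[OF c] D.total_base[OF u]] by blast
  have deg: "x1 + x2 = h - ha - hb - hc \<and> y1 + y2 = k - ka - kb - kc"
    if nz: "u (Y a x1 y1 (Y b x2 y2 c)) \<noteq> 0 \<or> u (Y (Y a x1 y1 b) x2 y2 c) \<noteq> 0 \<or>
        u (Y b x2 y2 (Y a x1 y1 c)) \<noteq> 0" for x1 y1 x2 y2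
  proof -
    have z: "(h', k') = (h, k)" if "w \<in> F h' k'" "u w \<noteq> 0" for w h' k'
      using F.dual_piece_linear(4)[OF u that(1)] that(2) by blast
    note m1 = YM_piece[OF a YM_piece[OF b c, of x2 y2], of x1 y1]
      and m2 = YM_piece[OF YM_piece[OF a b, of x1 y1] c, of x2 y2]
      and m3 = YM_piece[OF b YM_piece[OF a c, of x1 y1], of x2 y2]
    show ?thesis
      using nz
    proof (elim disjE)
      assume "u (Y a x1 y1 (Y b x2 y2 c)) \<noteq> 0"
      from z[OF m1 this] show ?thesis by auto
    next
      assume "u (Y (Y a x1 y1 b) x2 y2 c) \<noteq> 0"
      from z[OF m2 this] show ?thesis by auto
    next
      assume "u (Y b x2 y2 (Y a x1 y1 c)) \<noteq> 0"
      from z[OF m3 this] show ?thesis by auto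
    qed
  qed
  show thesis by (rule that[OF \<mu> deg])
qed

lemma dual_piece_zero: "u \<in> dual_piece sF F h k \<Longrightarrow> u 0 = 0"
  using F.dual_piece_linear(2)[OF _ F.total_zero, of u h k 0] by simp

text \<open>The vacuum is taken as second state. \<open>Y vac\<close> is the identity, so the
  expansion in \<open>|z1| > |z2|\<close> is a single monomial, while (FV3) makes the expansion
  around \<open>z1 = z2\<close> a Taylor series; comparison to first order shows that
  \<open>D\<close> and \<open>Dbar\<close> act on \<open>Y\<close> as derivatives in
  \<open>z\<close> and its conjugate.\<close>

lemma translation:
  assumes a: "a \<in> F h k" and c: "c \<in> F h' k'"
  shows "Y (Y a 1 0 vac) x y c = sF (of_real (x + 1)) (Y a (x + 1) y c)"
    and "Y (Y a 0 1 vac) x y c = sF (of_real (y + 1)) (Y a x (y + 1) c)"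
proof -
  have aux: "(x1 - y1 \<in> \<int> \<longrightarrow> u (Y (Y a 1 0 vac) (x1 - 1) y1 c) = of_real x1 * u (Y a x1 y1 c)) \<and>
    (x1 - y1 \<in> \<int> \<longrightarrow> u (Y (Y a 0 1 vac) x1 (y1 - 1) c) = of_real y1 * u (Y a x1 y1 c))"
    if u: "u \<in> dual_piece sF F (h + h' + x1) (k + k' + y1)" for u x1 y1
  proof (cases "x1 - y1 \<in> \<int>")
    case True
    obtain \<mu> where \<mu>: "gcor2 \<mu>
        (\<lambda>x1 y1 x2 y2. u (Y a x1 y1 (Y vac x2 y2 c)))
        (\<lambda>x0 y0 x2 y2. u (Y (Y a x0 y0 vac) x2 y2 c))
        (\<lambda>x1 y1 x2 y2. u (Y vac x2 y2 (Y a x1 y1 c)))"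
      and deg0: "\<And>x1' y1' x2 y2. u (Y a x1' y1' (Y vac x2 y2 c)) \<noteq> 0 \<or> u (Y (Y a x1' y1' vac) x2 y2 c) \<noteq> 0 \<or>
        u (Y vac x2 y2 (Y a x1' y1' c)) \<noteq> 0 \<Longrightarrow> x1' + x2 = h + h' + x1 - h - 0 - h' \<and> y1' + y2 = k + k' + y1 - k - 0 - k'"
      by (rule homogeneous_correlator[OF a vacuum_degree c u], rule that; assumption)
    have deg: "x1' + x2 = x1 \<and> y1' + y2 = y1" if "u (Y a x1' y1' (Y vac x2 y2 c)) \<noteq> 0 \<or> u (Y (Y a x1' y1' vac) x2 y2 c) \<noteq> 0 \<or>
        u (Y vac x2 y2 (Y a x1' y1' c)) \<noteq> 0" for x1' y1' x2 y2
      using deg0[OF that] by auto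
    have A: "x1' = x1 \<and> y1' = y1" if nz: "u (Y a x1' y1' (Y vac x2 y2 c)) \<noteq> 0" for x1' y1' x2 y2
    proof -
      have "x2 = 0 \<and> y2 = 0"
      proof (rule ccontr)
        assume "\<not> ?thesis"
        then have "Y vac x2 y2 c = 0" by (auto simp: vacuum_identity[OF F.total_base[OF c]])
        then show False using nz by (simp add: YM_zero_right[OF F.total_base[OF a]] dual_piece_zero[OF u])
      qed
      then show ?thesis using deg[of x1' y1' x2 y2] nz by auto
    qed
    have B: "x1' \<in> \<nat> \<and> y1' \<in> \<nat>" if nz: "u (Y (Y a x1' y1' vac) x2 y2 c) \<noteq> 0" for x1' y1' x2 y2
    proof (rule creation_regular[OF F.total_base[OF a]])
      show "Y a x1' y1' vac \<noteq> 0"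
      proof
        assume "Y a x1' y1' vac = 0"
        then show False using nz by (simp add: YM_zero_left[OF F.total_base[OF c]] dual_piece_zero[OF u])
      qed
    qed
    from gcor2_monomial_first_order[OF \<mu> deg A True B]
    show ?thesis using vacuum_identity[OF F.total_base[OF c]] by simp
  qed simp
  have Da: "Y a 1 0 vac \<in> F (h + 1) k" and Da': "Y a 0 1 vac \<in> F h (k + 1)"
    using YM_piece[OF a vacuum_degree, of 1 0] YM_piece[OF a vacuum_degree, of 0 1] by simp_all
  \<comment> \<open>The comparison with a monomial requires it to be single-valued; modes with a
    non-integral difference of exponents vanish by the support axiom.\<close>
  have nonint: "Y b x' y' c = 0" if "b \<in> gtotal sF F" "x' - y' \<notin> \<int>" for b x' y'
    using YM_int[OF that(1) F.total_base[OF c]] that(2) by blast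
  show "Y (Y a 1 0 vac) x y c = sF (of_real (x + 1)) (Y a (x + 1) y c)"
  proof (cases "x - y \<in> \<int>")
    case False
    moreover have "x + 1 - y \<notin> \<int>"
      using False Ints_diff[of "x + 1 - y" 1] by auto
    ultimately show ?thesis
      using nonint[OF F.total_base[OF Da]] nonint[OF F.total_base[OF a]] by simp
  next
    case True
    have int: "x + 1 - y \<in> \<int>" using Ints_add[OF True Ints_1] by (simp add: algebra_simps)
    have p1: "Y (Y a 1 0 vac) x y c \<in> F (h + h' + (x + 1)) (k + k' + y)"
      using YM_piece[OF Da c, of x y] by (simp add: algebra_simps)
    have p2: "Y a (x + 1) y c \<in> F (h + h' + (x + 1)) (k + k' + y)"
      by (rule YM_piece[OF a c])
    show ?thesis
    proof (rule F.dual_eqI[OF p1 F.piece_scale[OF p2]])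
      fix u assume u: "u \<in> dual_piece sF F (h + h' + (x + 1)) (k + k' + y)"
      have "u (Y (Y a 1 0 vac) (x + 1 - 1) y c) = of_real (x + 1) * u (Y a (x + 1) y c)"
        using aux[OF u] int by blast
      then show "u (Y (Y a 1 0 vac) x y c) = u (sF (of_real (x + 1)) (Y a (x + 1) y c))"
        by (simp add: F.dual_piece_linear(2)[OF u F.total_base[OF p2]] del: of_real_add)
    qed
  qed
  show "Y (Y a 0 1 vac) x y c = sF (of_real (y + 1)) (Y a x (y + 1) c)"
  proof (cases "x - y \<in> \<int>")
    case False
    moreover have "x - (y + 1) \<notin> \<int>"
      using False Ints_add[of "x - (y + 1)" 1] by auto
    ultimately show ?thesis
      using nonint[OF F.total_base[OF Da']] nonint[OF F.total_base[OF a]] by simp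
  next
    case True
    have int: "x - (y + 1) \<in> \<int>" using Ints_diff[OF True Ints_1] by (simp add: algebra_simps)
    have p1: "Y (Y a 0 1 vac) x y c \<in> F (h + h' + x) (k + k' + (y + 1))"
      using YM_piece[OF Da' c, of x y] by (simp add: algebra_simps)
    have p2: "Y a x (y + 1) c \<in> F (h + h' + x) (k + k' + (y + 1))"
      by (rule YM_piece[OF a c])
    show ?thesis
    proof (rule F.dual_eqI[OF p1 F.piece_scale[OF p2]])
      fix u assume u: "u \<in> dual_piece sF F (h + h' + x) (k + k' + (y + 1))"
      have "u (Y (Y a 0 1 vac) x (y + 1 - 1) c) = of_real (y + 1) * u (Y a x (y + 1) c)"
        using aux[OF u] int by blast
      then show "u (Y (Y a 0 1 vac) x y c) = u (sF (of_real (y + 1)) (Y a x (y + 1) c))"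
        by (simp add: F.dual_piece_linear(2)[OF u F.total_base[OF p2]] del: of_real_add)
    qed
  qed
qed

text \<open>\<open>Dbar a = 0\<close> makes the derivative in the conjugate variable vanish, so only
  its exponent 0 survives.\<close>

lemma holomorphic_modes:
  assumes a: "a \<in> F h k" and hol: "Y a 0 1 vac = 0" and c: "c \<in> F h' k'" and nz: "Y a x y c \<noteq> 0"
  shows "y = 0"
proof (rule ccontr)
  assume y: "y \<noteq> 0"
  have "sF (of_real y) (Y a x y c) = 0"
    using translation(2)[OF a c, of x "y - 1"] by (simp add: hol YM_zero_left[OF F.total_base[OF c]])
  then show False using y nz by simp
qed

lemma antiholomorphic_modes:
  assumes a: "a \<in> F h k" and hol: "Y a 1 0 vac = 0" and c: "c \<in> F h' k'" and nz: "Y a x y c \<noteq> 0"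
  shows "x = 0"
proof (rule ccontr)
  assume x: "x \<noteq> 0"
  have "sF (of_real x) (Y a x y c) = 0"
    using translation(1)[OF a c, of "x - 1" y] by (simp add: hol YM_zero_left[OF F.total_base[OF c]])
  then show False using x nz by simp
qed

text \<open>Homogeneity, together with one exponent being 0 for each state, reduces both orders of
  the product to the same monomial, so \<open>gcor2_monomials_agree\<close> applies.\<close>

lemma holomorphic_antiholomorphic_commute:
  assumes a: "a \<in> F h k" "Y a 0 1 vac = 0" and b: "b \<in> F h' k'" "Y b 1 0 vac = 0" and c: "c \<in> F hc kc"
  shows "Y a x 0 (Y b 0 y c) = Y b 0 y (Y a x 0 c)"
proof (cases "x \<in> \<int>")
  case False
  have "Y a x 0 w = 0" if "w \<in> gtotal sF F" for w
    using YM_int[OF F.total_base[OF a(1)] that, of x 0] False by auto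
  moreover have "Y b 0 y c \<in> gtotal sF F" by (rule F.total_base[OF YM_piece[OF b(1) c]])
  ultimately show ?thesis
    using F.total_base[OF c] by (simp add: YM_zero_right[OF F.total_base[OF b(1)]])
next
  case True
  have p1: "Y a x 0 (Y b 0 y c) \<in> F (h + h' + hc + x) (k + k' + kc + y)"
    using YM_piece[OF a(1) YM_piece[OF b(1) c, of 0 y], of x 0] by (simp add: algebra_simps)
  have p2: "Y b 0 y (Y a x 0 c) \<in> F (h + h' + hc + x) (k + k' + kc + y)"
    using YM_piece[OF b(1) YM_piece[OF a(1) c, of x 0], of 0 y] by (simp add: algebra_simps)
  show ?thesis
  proof (rule F.dual_eqI[OF p1 p2])
    fix u assume u: "u \<in> dual_piece sF F (h + h' + hc + x) (k + k' + kc + y)"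
    obtain \<mu> where \<mu>: "gcor2 \<mu>
        (\<lambda>x1 y1 x2 y2. u (Y a x1 y1 (Y b x2 y2 c)))
        (\<lambda>x0 y0 x2 y2. u (Y (Y a x0 y0 b) x2 y2 c))
        (\<lambda>x1 y1 x2 y2. u (Y b x2 y2 (Y a x1 y1 c)))"
      and deg0: "\<And>x1 y1 x2 y2. u (Y a x1 y1 (Y b x2 y2 c)) \<noteq> 0 \<or> u (Y (Y a x1 y1 b) x2 y2 c) \<noteq> 0 \<or>
        u (Y b x2 y2 (Y a x1 y1 c)) \<noteq> 0 \<Longrightarrow> x1 + x2 = h + h' + hc + x - h - h' - hc \<and> y1 + y2 = k + k' + kc + y - k - k' - kc"
      by (rule homogeneous_correlator[OF a(1) b(1) c u], rule that; assumption)
    have deg: "x1 + x2 = x \<and> y1 + y2 = y" if "u (Y a x1 y1 (Y b x2 y2 c)) \<noteq> 0 \<or> u (Y (Y a x1 y1 b) x2 y2 c) \<noteq> 0 \<or>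
        u (Y b x2 y2 (Y a x1 y1 c)) \<noteq> 0" for x1 y1 x2 y2
      using deg0[OF that] by auto
    have A: "x1 = x \<and> y1 = 0" if nz: "u (Y a x1 y1 (Y b x2 y2 c)) \<noteq> 0" for x1 y1 x2 y2
    proof -
      have n1: "Y a x1 y1 (Y b x2 y2 c) \<noteq> 0" using nz dual_piece_zero[OF u] by auto
      then have n2: "Y b x2 y2 c \<noteq> 0" using YM_zero_right[OF F.total_base[OF a(1)]] by auto
      have "y1 = 0" by (rule holomorphic_modes[OF a YM_piece[OF b(1) c] n1])
      moreover have "x2 = 0" by (rule antiholomorphic_modes[OF b c n2])
      ultimately show ?thesis using deg[of x1 y1 x2 y2] nz by auto
    qed
    have C: "x1 = x \<and> y1 = 0" if nz: "u (Y b x2 y2 (Y a x1 y1 c)) \<noteq> 0" for x1 y1 x2 y2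
    proof -
      have n1: "Y b x2 y2 (Y a x1 y1 c) \<noteq> 0" using nz dual_piece_zero[OF u] by auto
      then have n2: "Y a x1 y1 c \<noteq> 0" using YM_zero_right[OF F.total_base[OF b(1)]] by auto
      have "y1 = 0" by (rule holomorphic_modes[OF a c n2])
      moreover have "x2 = 0" by (rule antiholomorphic_modes[OF b YM_piece[OF a(1) c] n1])
      ultimately show ?thesis using deg[of x1 y1 x2 y2] nz by auto
    qed
    have "x - 0 \<in> \<int>" using True by simp
    from gcor2_monomials_agree[OF \<mu> deg A this C]
    show "u (Y a x 0 (Y b 0 y c)) = u (Y b 0 y (Y a x 0 c))" by simp
  qed
qed

end

section \<open>Degrees of the conformal vectors\<close>

context full_vertex_operator_algebra
begin

abbreviation "L n \<equiv> L_op Y \<omega> n"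
abbreviation "L' n \<equiv> L_op_bar Y \<omega>' n"

lemma L_eq: "L n a = Y \<omega> (- of_int n - 2) 0 a"
proof -
  have e: "- (of_int n + 1) - 1 = - of_int n - (2::real)" by simp
  show ?thesis unfolding L_op_def mode_def e by simp
qed

lemma L'_eq: "L' n a = Y \<omega>' 0 (- of_int n - 2) a"
proof -
  have e: "- (of_int n + 1) - 1 = - of_int n - (2::real)" by simp
  show ?thesis unfolding L_op_bar_def mode_def e by simp
qed

lemma vac_total: "vac \<in> gtotal sF F"
  by (rule F.total_base[OF vacuum_degree])

lemma gcomp_L_zero:
  assumes "v \<in> gtotal sF F"
  shows "gcomp F (L 0 v) h k = sF (of_real h) (gcomp F v h k)"
  using assms
proof (induction rule: F.total_induct)
  case (piece h' k' v)
  then show ?case using F.gcomp_scale[OF F.total_base[OF piece]] by (simp add: L_zero F.gcomp_piece)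
next
  case (add v w)
  then show ?case
    using endomorphism[OF conformal_vectors(1)] 
    by (simp add: L_eq YM_add_right[OF conformal_vectors(1)] F.gcomp_add F.scale_right_distrib)
qed

lemma gcomp_L'_zero:
  assumes "v \<in> gtotal sF F"
  shows "gcomp F (L' 0 v) h k = sF (of_real k) (gcomp F v h k)"
  using assms
proof (induction rule: F.total_induct)
  case (piece h' k' v)
  then show ?case using F.gcomp_scale[OF F.total_base[OF piece]] by (simp add: L_bar_zero F.gcomp_piece)
next
  case (add v w)
  then show ?case
    using endomorphism[OF conformal_vectors(2)] 
    by (simp add: L'_eq YM_add_right[OF conformal_vectors(2)] F.gcomp_add F.scale_right_distrib)
qed

text \<open>\<open>\<omega> = L (- 2) vac\<close> by (FV3), and
  \<open>[L 0, L (- 2)] = 2 L (- 2)\<close> has no central term.\<close>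

lemma L_zero_omega: "L 0 \<omega> = sF 2 \<omega>"
proof -
  obtain c where c: "virasoro_on sF (gtotal sF F) L c" using virasoro by blast
  have "L 0 (L (- 2) vac) - L (- 2) (L 0 vac) = sF (of_int (0 - (- 2))) (L (0 + (- 2)) vac)
       + (if (0::int) + (- 2) = 0 then sF (of_int (0 ^ 3 - 0) / 12 * c) vac else 0)"
    using c vac_total unfolding virasoro_on_def by blast
  moreover have "L 0 vac = 0" using L_zero[OF vacuum_degree] by simp
  moreover have "L (- 2) vac = \<omega>" using creation[OF conformal_vectors(1)] by (simp add: L_eq)
  moreover have "L (- 2) 0 = 0" by (simp add: L_eq YM_zero_right[OF conformal_vectors(1)])
  ultimately show ?thesis by simp
qed

lemma L'_zero_omega': "L' 0 \<omega>' = sF 2 \<omega>'"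
proof -
  obtain c where c: "virasoro_on sF (gtotal sF F) L' c" using virasoro_bar by blast
  have "L' 0 (L' (- 2) vac) - L' (- 2) (L' 0 vac) = sF (of_int (0 - (- 2))) (L' (0 + (- 2)) vac)
       + (if (0::int) + (- 2) = 0 then sF (of_int (0 ^ 3 - 0) / 12 * c) vac else 0)"
    using c vac_total unfolding virasoro_on_def by blast
  moreover have "L' 0 vac = 0" using L_bar_zero[OF vacuum_degree] by simp
  moreover have "L' (- 2) vac = \<omega>'" using creation[OF conformal_vectors(2)] by (simp add: L'_eq)
  moreover have "L' (- 2) 0 = 0" by (simp add: L'_eq YM_zero_right[OF conformal_vectors(2)])
  ultimately show ?thesis by simp
qed

lemma component_mode:
  assumes "a \<in> gtotal sF F" "c \<in> gtotal sF F"
  shows "Y a x y c = (\<Sum>(h, k) \<in> {(h, k). gcomp F a h k \<noteq> 0}. Y (gcomp F a h k) x y c)"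
proof -
  have "Y a x y c = Y (\<Sum>(h, k) \<in> {(h, k). gcomp F a h k \<noteq> 0}. gcomp F a h k) x y c"
    using F.sum_gcomp(2)[OF assms(1)] by simp
  also have "\<dots> = (\<Sum>(h, k) \<in> {(h, k). gcomp F a h k \<noteq> 0}. Y (gcomp F a h k) x y c)"
    unfolding case_prod_unfold
    by (rule YM_sum_left[OF assms(2)]) (use F.total_base[OF F.gcomp_mem[OF assms(1)]] in blast)
  finally show ?thesis .
qed

text \<open>A mode applied to the vacuum shifts all degrees by the same amount, so the contributions
  of different components of \<open>a\<close> lie in different pieces and cannot cancel.\<close>

lemma component_derivative_zero:
  assumes a: "a \<in> gtotal sF F" and z: "Y a x y vac = 0"
  shows "Y (gcomp F a h k) x y vac = 0"
proof -
  let ?I = "insert (h, k) {(h, k). gcomp F a h k \<noteq> 0}"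
  let ?w = "\<lambda>(h, k). Y (gcomp F a (h - x) (k - y)) x y vac"
  let ?J = "(\<lambda>(h, k). (h + x, k + y)) ` ?I"
  have inj: "inj_on (\<lambda>(h, k). (h + x, k + y)) ?I" by (auto simp: inj_on_def)
  have fin: "finite ?I" using F.sum_gcomp(1)[OF a] by simp
  have "(\<Sum>i\<in>?J. ?w i) = (\<Sum>(h, k)\<in>?I. Y (gcomp F a h k) x y vac)"
    by (subst sum.reindex[OF inj]) (simp add: case_prod_unfold)
  also have "\<dots> = (\<Sum>(h, k) \<in> {(h, k). gcomp F a h k \<noteq> 0}. Y (gcomp F a h k) x y vac)"
    by (rule sum.mono_neutral_right[OF fin]) (auto simp: YM_zero_left[OF vac_total])
  also have "\<dots> = 0" using component_mode[OF a vac_total, of x y] z by simp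
  finally have s: "(\<Sum>i\<in>?J. ?w i) = 0" .
  have "?w (h + x, k + y) = 0"
  proof (rule F.direct_sum[OF _ _ s])
    show "finite ?J" using fin by simp
    show "?w (h, k) \<in> F h k" for h k
      using YM_piece[OF F.gcomp_mem[OF a, of "h - x" "k - y"] vacuum_degree, of x y] by simp
    show "(h + x, k + y) \<in> ?J" by (rule image_eqI[of _ _ "(h, k)"]) auto
  qed
  then show ?thesis by simp
qed

text \<open>The axioms place \<open>\<omega>\<close> only in the total space. The eigenvalue of
  \<open>L 0\<close> forces \<open>h = 2\<close>. For \<open>k\<close>, the component is written as
  its creation mode on the vacuum; its modes commute with those of the antiholomorphic
  \<open>\<omega>'\<close>, so \<open>L' 0\<close> passes through to the vacuum, where it is
  0.\<close>

lemma omega_component_degree: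
  assumes nz: "gcomp F \<omega> h k \<noteq> 0"
  shows "h = 2 \<and> k = 0"
proof
  let ?a = "gcomp F \<omega> h k"
  have a: "?a \<in> F h k" by (rule F.gcomp_mem[OF conformal_vectors(1)])
  have "sF (of_real h) ?a = sF 2 ?a"
    using gcomp_L_zero[OF conformal_vectors(1), of h k] F.gcomp_scale[OF conformal_vectors(1), of 2 h k]
    by (simp add: L_zero_omega)
  then show "h = 2" using nz by simp (metis of_real_eq_iff of_real_numeral)
  have hol: "Y ?a 0 1 vac = 0"
    using omega_holomorphic component_derivative_zero[OF conformal_vectors(1)] by (simp add: deriv_op_bar_def)
  have anti: "Y (gcomp F \<omega>' h' k') 1 0 vac = 0" for h' k'
    using omega'_antiholomorphic component_derivative_zero[OF conformal_vectors(2)] by (simp add: deriv_op_def)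
  let ?I = "{(h, k). gcomp F \<omega>' h k \<noteq> 0}"
  have "L' 0 ?a = Y \<omega>' 0 (- 2) (Y ?a 0 0 vac)"
    using creation[OF F.total_base[OF a]] by (simp add: L'_eq)
  also have "\<dots> = (\<Sum>(h', k')\<in>?I. Y (gcomp F \<omega>' h' k') 0 (- 2) (Y ?a 0 0 vac))"
    by (rule component_mode[OF conformal_vectors(2) F.total_base[OF YM_piece[OF a vacuum_degree]]])
  also have "\<dots> = (\<Sum>(h', k')\<in>?I. Y ?a 0 0 (Y (gcomp F \<omega>' h' k') 0 (- 2) vac))"
  proof (intro sum.cong refl)
    fix i assume "i \<in> ?I"
    obtain h' k' where i: "i = (h', k')" by force
    show "(case i of (h', k') \<Rightarrow> Y (gcomp F \<omega>' h' k') 0 (- 2) (Y ?a 0 0 vac)) =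
      (case i of (h', k') \<Rightarrow> Y ?a 0 0 (Y (gcomp F \<omega>' h' k') 0 (- 2) vac))"
      unfolding i prod.case
      by (rule holomorphic_antiholomorphic_commute[OF a hol F.gcomp_mem[OF conformal_vectors(2)] anti vacuum_degree, symmetric])
  qed
  also have "\<dots> = Y ?a 0 0 (\<Sum>(h', k')\<in>?I. Y (gcomp F \<omega>' h' k') 0 (- 2) vac)"
    unfolding case_prod_unfold
    by (rule YM_sum_right[OF F.total_base[OF a], symmetric])
      (rule F.total_base[OF YM_piece[OF F.gcomp_mem[OF conformal_vectors(2)] vacuum_degree]])
  also have "(\<Sum>(h', k')\<in>?I. Y (gcomp F \<omega>' h' k') 0 (- 2) vac) = L' 0 vac"
    using component_mode[OF conformal_vectors(2) vac_total, of 0 "- 2"] by (simp add: L'_eq)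
  also have "L' 0 vac = 0" using L_bar_zero[OF vacuum_degree] by simp
  finally have "L' 0 ?a = 0" by (simp add: YM_zero_right[OF F.total_base[OF a]])
  then show "k = 0" using L_bar_zero[OF a] nz by simp
qed

lemma omega'_component_degree:
  assumes nz: "gcomp F \<omega>' h k \<noteq> 0"
  shows "h = 0 \<and> k = 2"
proof
  let ?a = "gcomp F \<omega>' h k"
  have a: "?a \<in> F h k" by (rule F.gcomp_mem[OF conformal_vectors(2)])
  have "sF (of_real k) ?a = sF 2 ?a"
    using gcomp_L'_zero[OF conformal_vectors(2), of h k] F.gcomp_scale[OF conformal_vectors(2), of 2 h k]
    by (simp add: L'_zero_omega')
  then show "k = 2" using nz by simp (metis of_real_eq_iff of_real_numeral)
  have anti: "Y ?a 1 0 vac = 0"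
    using omega'_antiholomorphic component_derivative_zero[OF conformal_vectors(2)] by (simp add: deriv_op_def)
  have hol: "Y (gcomp F \<omega> h' k') 0 1 vac = 0" for h' k'
    using omega_holomorphic component_derivative_zero[OF conformal_vectors(1)] by (simp add: deriv_op_bar_def)
  let ?I = "{(h, k). gcomp F \<omega> h k \<noteq> 0}"
  have "L 0 ?a = Y \<omega> (- 2) 0 (Y ?a 0 0 vac)"
    using creation[OF F.total_base[OF a]] by (simp add: L_eq)
  also have "\<dots> = (\<Sum>(h', k')\<in>?I. Y (gcomp F \<omega> h' k') (- 2) 0 (Y ?a 0 0 vac))"
    by (rule component_mode[OF conformal_vectors(1) F.total_base[OF YM_piece[OF a vacuum_degree]]])
  also have "\<dots> = (\<Sum>(h', k')\<in>?I. Y ?a 0 0 (Y (gcomp F \<omega> h' k') (- 2) 0 vac))"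
  proof (intro sum.cong refl)
    fix i assume "i \<in> ?I"
    obtain h' k' where i: "i = (h', k')" by force
    show "(case i of (h', k') \<Rightarrow> Y (gcomp F \<omega> h' k') (- 2) 0 (Y ?a 0 0 vac)) =
      (case i of (h', k') \<Rightarrow> Y ?a 0 0 (Y (gcomp F \<omega> h' k') (- 2) 0 vac))"
      unfolding i prod.case
      by (rule holomorphic_antiholomorphic_commute[OF F.gcomp_mem[OF conformal_vectors(1)] hol a anti vacuum_degree])
  qed
  also have "\<dots> = Y ?a 0 0 (\<Sum>(h', k')\<in>?I. Y (gcomp F \<omega> h' k') (- 2) 0 vac)"
    unfolding case_prod_unfold
    by (rule YM_sum_right[OF F.total_base[OF a], symmetric])
      (rule F.total_base[OF YM_piece[OF F.gcomp_mem[OF conformal_vectors(1)] vacuum_degree]])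
  also have "(\<Sum>(h', k')\<in>?I. Y (gcomp F \<omega> h' k') (- 2) 0 vac) = L 0 vac"
    using component_mode[OF conformal_vectors(1) vac_total, of "- 2" 0] by (simp add: L_eq)
  also have "L 0 vac = 0" using L_zero[OF vacuum_degree] by simp
  finally have "L 0 ?a = 0" by (simp add: YM_zero_right[OF F.total_base[OF a]])
  then show "h = 0" using L_zero[OF a] nz by simp
qed

lemma omega_piece: "\<omega> \<in> F 2 0"
proof -
  have "\<omega> = (\<Sum>(h, k) \<in> {(h, k). gcomp F \<omega> h k \<noteq> 0}. gcomp F \<omega> h k)"
    by (rule F.sum_gcomp(2)[OF conformal_vectors(1)])
  also have "\<dots> \<in> F 2 0"
    by (rule F.piece_sum) (use omega_component_degree F.gcomp_mem[OF conformal_vectors(1), of 2 0] in auto)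
  finally show ?thesis .
qed

lemma omega'_piece: "\<omega>' \<in> F 0 2"
proof -
  have "\<omega>' = (\<Sum>(h, k) \<in> {(h, k). gcomp F \<omega>' h k \<noteq> 0}. gcomp F \<omega>' h k)"
    by (rule F.sum_gcomp(2)[OF conformal_vectors(2)])
  also have "\<dots> \<in> F 0 2"
    by (rule F.piece_sum) (use omega'_component_degree F.gcomp_mem[OF conformal_vectors(2), of 0 2] in auto)
  finally show ?thesis .
qed

lemma omega_hol: "Y \<omega> 0 1 vac = 0"
  using omega_holomorphic by (simp add: deriv_op_bar_def)

lemma omega'_antihol: "Y \<omega>' 1 0 vac = 0"
  using omega'_antiholomorphic by (simp add: deriv_op_def)

section \<open>Commutators with \<open>L 1\<close> and \<open>L' 1\<close>\<close>

lemma L_one_piece: "a \<in> F h k \<Longrightarrow> L 1 a \<in> F (h - 1) k"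
  using YM_piece[OF omega_piece, of a h k "- 3" 0] by (simp add: L_eq algebra_simps)

lemma L'_one_piece: "a \<in> F h k \<Longrightarrow> L' 1 a \<in> F h (k - 1)"
  using YM_piece[OF omega'_piece, of a h k 0 "- 3"] by (simp add: L'_eq algebra_simps)

lemma L_one_commute: "a \<in> F h k \<Longrightarrow> L 1 (L' 1 a) = L' 1 (L 1 a)"
  unfolding L_eq L'_eq
  by (rule holomorphic_antiholomorphic_commute[OF omega_piece omega_hol omega'_piece omega'_antihol])

text \<open>In generating form, \<open>[L 1, Y(b,z)] = Y(L 1 b, z) + 2 z Y(L 0 b, z) + z^2 Y(L (- 1)
  b, z)\<close>. At exponent \<open>x\<close> translation turns the last term into the factor
  \<open>x - 1\<close>, and the middle one gives \<open>2 * h\<close>.\<close>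

lemma L_one_bracket:
  assumes b: "b \<in> F h k" and c: "c \<in> F h' k'"
  shows "L 1 (Y b x y c) = Y (L 1 b) x y c + sF (of_real (2 * h + x - 1)) (Y b (x - 1) y c) + Y b x y (L 1 c)"
proof -
  let ?h = "h + h' + x - 1" and ?k = "k + k' + y"
  have p0: "L 1 (Y b x y c) \<in> F ?h ?k" by (rule L_one_piece[OF YM_piece[OF b c]])
  have p1: "Y (L 1 b) x y c \<in> F ?h ?k"
    using YM_piece[OF L_one_piece[OF b] c, of x y] by (simp add: algebra_simps)
  have p2: "Y b (x - 1) y c \<in> F ?h ?k"
    using YM_piece[OF b c, of "x - 1" y] by (simp add: algebra_simps)
  have p3: "Y b x y (L 1 c) \<in> F ?h ?k"
    using YM_piece[OF b L_one_piece[OF c], of x y] by (simp add: algebra_simps)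
  show ?thesis
  proof (rule F.dual_eqI[OF p0 F.piece_add[OF F.piece_add[OF p1 F.piece_scale[OF p2]] p3]])
    fix u assume u: "u \<in> dual_piece sF F ?h ?k"
    obtain \<mu> where \<mu>: "gcor2 \<mu>
        (\<lambda>x1 y1 x2 y2. u (Y \<omega> x1 y1 (Y b x2 y2 c)))
        (\<lambda>x0 y0 x2 y2. u (Y (Y \<omega> x0 y0 b) x2 y2 c))
        (\<lambda>x1 y1 x2 y2. u (Y b x2 y2 (Y \<omega> x1 y1 c)))"
      and deg0: "\<And>x1 y1 x2 y2. u (Y \<omega> x1 y1 (Y b x2 y2 c)) \<noteq> 0 \<or> u (Y (Y \<omega> x1 y1 b) x2 y2 c) \<noteq> 0 \<or>
        u (Y b x2 y2 (Y \<omega> x1 y1 c)) \<noteq> 0 \<Longrightarrow> x1 + x2 = ?h - 2 - h - h' \<and> y1 + y2 = ?k - 0 - k - k'"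
      by (rule homogeneous_correlator[OF omega_piece b c u], rule that; assumption)
    have deg: "x1 + x2 = x - 3 \<and> y1 + y2 = y" if "u (Y \<omega> x1 y1 (Y b x2 y2 c)) \<noteq> 0 \<or> u (Y (Y \<omega> x1 y1 b) x2 y2 c) \<noteq> 0 \<or>
        u (Y b x2 y2 (Y \<omega> x1 y1 c)) \<noteq> 0" for x1 y1 x2 y2
      using deg0[OF that] by auto
    have hol: "x1 \<in> \<int> \<and> y1 = 0" if nz: "u (Y \<omega> x1 y1 (Y b x2 y2 c)) \<noteq> 0 \<or> u (Y (Y \<omega> x1 y1 b) x2 y2 c) \<noteq> 0 \<or>
        u (Y b x2 y2 (Y \<omega> x1 y1 c)) \<noteq> 0" for x1 y1 x2 y2
    proof -
      have w: "x1 \<in> \<int> \<and> y1 = 0" if "d \<in> F h1 k1" "Y \<omega> x1 y1 d \<noteq> 0" for d h1 k1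
        using holomorphic_modes[OF omega_piece omega_hol that] YM_int[OF conformal_vectors(1) F.total_base[OF that(1)] that(2)] by simp
      consider "Y \<omega> x1 y1 (Y b x2 y2 c) \<noteq> 0" | "Y \<omega> x1 y1 b \<noteq> 0" | "Y \<omega> x1 y1 c \<noteq> 0"
        using nz dual_piece_zero[OF u] YM_zero_left[OF F.total_base[OF c]] YM_zero_right[OF F.total_base[OF b]] by metis
      then show ?thesis
        by cases (rule w[OF YM_piece[OF b c]] w[OF b] w[OF c]; assumption)+
    qed
    \<comment> \<open>The total exponent is \<open>x - 3\<close> because \<open>L 1\<close> sits at
      \<open>- 3\<close>; it fixes the second exponents of all terms.\<close>
    have "u (Y \<omega> (- 3) 0 (Y b (x - 3 + 3) y c)) = u (Y (Y \<omega> (- 1) 0 b) (x - 3 + 1) y c)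
        + 2 * u (Y (Y \<omega> (- 2) 0 b) (x - 3 + 2) y c) + u (Y (Y \<omega> (- 3) 0 b) (x - 3 + 3) y c)
        + u (Y b (x - 3 + 3) y (Y \<omega> (- 3) 0 c))"
      by (rule gcor2_holomorphic_relation[OF \<mu> deg hol])
    then have rel: "u (L 1 (Y b x y c)) = u (Y (L (- 1) b) (x - 2) y c) + 2 * u (Y (L 0 b) (x - 1) y c)
        + u (Y (L 1 b) x y c) + u (Y b x y (L 1 c))"
      by (simp add: L_eq)
    have "L (- 1) b = Y b 1 0 vac" using L_minus_one[OF F.total_base[OF b]] by (simp add: deriv_op_def)
    then have t1: "Y (L (- 1) b) (x - 2) y c = sF (of_real (x - 1)) (Y b (x - 1) y c)"
      using translation(1)[OF b c, of "x - 2" y] by (simp add: algebra_simps)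
    have t2: "Y (L 0 b) (x - 1) y c = sF (of_real h) (Y b (x - 1) y c)"
      by (simp add: L_zero[OF b] YM_scale_left[OF F.total_base[OF b] F.total_base[OF c]])
    note m = F.total_base[OF p1] F.total_base[OF p2] F.total_base[OF p3]
    have e: "u (Y (L 1 b) x y c + sF (of_real (2 * h + x - 1)) (Y b (x - 1) y c) + Y b x y (L 1 c)) =
      u (Y (L 1 b) x y c) + of_real (2 * h + x - 1) * u (Y b (x - 1) y c) + u (Y b x y (L 1 c))"
      by (simp only: F.dual_piece_linear(1)[OF u F.total_add[OF m(1) F.total_scale[OF m(2)]] m(3)]
          F.dual_piece_linear(1)[OF u m(1) F.total_scale[OF m(2)]] F.dual_piece_linear(2)[OF u m(2)])
    show "u (L 1 (Y b x y c)) = u (Y (L 1 b) x y c + sF (of_real (2 * h + x - 1)) (Y b (x - 1) y c) + Y b x y (L 1 c))"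
      unfolding rel t1 t2 e F.dual_piece_linear(2)[OF u m(2)] by (simp add: algebra_simps)
  qed
qed

lemma L'_one_bracket:
  assumes b: "b \<in> F h k" and c: "c \<in> F h' k'"
  shows "L' 1 (Y b x y c) = Y (L' 1 b) x y c + sF (of_real (2 * k + y - 1)) (Y b x (y - 1) c) + Y b x y (L' 1 c)"
proof -
  let ?h = "h + h' + x" and ?k = "k + k' + y - 1"
  have p0: "L' 1 (Y b x y c) \<in> F ?h ?k" by (rule L'_one_piece[OF YM_piece[OF b c]])
  have p1: "Y (L' 1 b) x y c \<in> F ?h ?k"
    using YM_piece[OF L'_one_piece[OF b] c, of x y] by (simp add: algebra_simps)
  have p2: "Y b x (y - 1) c \<in> F ?h ?k"
    using YM_piece[OF b c, of x "y - 1"] by (simp add: algebra_simps)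
  have p3: "Y b x y (L' 1 c) \<in> F ?h ?k"
    using YM_piece[OF b L'_one_piece[OF c], of x y] by (simp add: algebra_simps)
  show ?thesis
  proof (rule F.dual_eqI[OF p0 F.piece_add[OF F.piece_add[OF p1 F.piece_scale[OF p2]] p3]])
    fix u assume u: "u \<in> dual_piece sF F ?h ?k"
    obtain \<mu> where \<mu>: "gcor2 \<mu>
        (\<lambda>x1 y1 x2 y2. u (Y \<omega>' x1 y1 (Y b x2 y2 c)))
        (\<lambda>x0 y0 x2 y2. u (Y (Y \<omega>' x0 y0 b) x2 y2 c))
        (\<lambda>x1 y1 x2 y2. u (Y b x2 y2 (Y \<omega>' x1 y1 c)))"
      and deg0: "\<And>x1 y1 x2 y2. u (Y \<omega>' x1 y1 (Y b x2 y2 c)) \<noteq> 0 \<or> u (Y (Y \<omega>' x1 y1 b) x2 y2 c) \<noteq> 0 \<or>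
        u (Y b x2 y2 (Y \<omega>' x1 y1 c)) \<noteq> 0 \<Longrightarrow> x1 + x2 = ?h - 0 - h - h' \<and> y1 + y2 = ?k - 2 - k - k'"
      by (rule homogeneous_correlator[OF omega'_piece b c u], rule that; assumption)
    have deg: "x1 + x2 = x \<and> y1 + y2 = y - 3" if "u (Y \<omega>' x1 y1 (Y b x2 y2 c)) \<noteq> 0 \<or> u (Y (Y \<omega>' x1 y1 b) x2 y2 c) \<noteq> 0 \<or>
        u (Y b x2 y2 (Y \<omega>' x1 y1 c)) \<noteq> 0" for x1 y1 x2 y2
      using deg0[OF that] by auto
    have hol: "x1 = 0 \<and> y1 \<in> \<int>" if nz: "u (Y \<omega>' x1 y1 (Y b x2 y2 c)) \<noteq> 0 \<or> u (Y (Y \<omega>' x1 y1 b) x2 y2 c) \<noteq> 0 \<or>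
        u (Y b x2 y2 (Y \<omega>' x1 y1 c)) \<noteq> 0" for x1 y1 x2 y2
    proof -
      have w: "x1 = 0 \<and> y1 \<in> \<int>" if "d \<in> F h1 k1" "Y \<omega>' x1 y1 d \<noteq> 0" for d h1 k1
        using antiholomorphic_modes[OF omega'_piece omega'_antihol that]
          Ints_minus[OF YM_int[OF conformal_vectors(2) F.total_base[OF that(1)] that(2)]] by simp
      consider "Y \<omega>' x1 y1 (Y b x2 y2 c) \<noteq> 0" | "Y \<omega>' x1 y1 b \<noteq> 0" | "Y \<omega>' x1 y1 c \<noteq> 0"
        using nz dual_piece_zero[OF u] YM_zero_left[OF F.total_base[OF c]] YM_zero_right[OF F.total_base[OF b]] by metis
      then show ?thesis
        by cases (rule w[OF YM_piece[OF b c]] w[OF b] w[OF c]; assumption)+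
    qed
    have "u (Y \<omega>' 0 (- 3) (Y b x (y - 3 + 3) c)) = u (Y (Y \<omega>' 0 (- 1) b) x (y - 3 + 1) c)
        + 2 * u (Y (Y \<omega>' 0 (- 2) b) x (y - 3 + 2) c) + u (Y (Y \<omega>' 0 (- 3) b) x (y - 3 + 3) c)
        + u (Y b x (y - 3 + 3) (Y \<omega>' 0 (- 3) c))"
      by (rule gcor2_antiholomorphic_relation[OF \<mu> deg hol])
    then have rel: "u (L' 1 (Y b x y c)) = u (Y (L' (- 1) b) x (y - 2) c) + 2 * u (Y (L' 0 b) x (y - 1) c)
        + u (Y (L' 1 b) x y c) + u (Y b x y (L' 1 c))"
      by (simp add: L'_eq)
    have "L' (- 1) b = Y b 0 1 vac" using L_bar_minus_one[OF F.total_base[OF b]] by (simp add: deriv_op_bar_def)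
    then have t1: "Y (L' (- 1) b) x (y - 2) c = sF (of_real (y - 1)) (Y b x (y - 1) c)"
      using translation(2)[OF b c, of x "y - 2"] by (simp add: algebra_simps)
    have t2: "Y (L' 0 b) x (y - 1) c = sF (of_real k) (Y b x (y - 1) c)"
      by (simp add: L_bar_zero[OF b] YM_scale_left[OF F.total_base[OF b] F.total_base[OF c]])
    note m = F.total_base[OF p1] F.total_base[OF p2] F.total_base[OF p3]
    have e: "u (Y (L' 1 b) x y c + sF (of_real (2 * k + y - 1)) (Y b x (y - 1) c) + Y b x y (L' 1 c)) =
      u (Y (L' 1 b) x y c) + of_real (2 * k + y - 1) * u (Y b x (y - 1) c) + u (Y b x y (L' 1 c))"
      by (simp only: F.dual_piece_linear(1)[OF u F.total_add[OF m(1) F.total_scale[OF m(2)]] m(3)]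
          F.dual_piece_linear(1)[OF u m(1) F.total_scale[OF m(2)]] F.dual_piece_linear(2)[OF u m(2)])
    show "u (L' 1 (Y b x y c)) = u (Y (L' 1 b) x y c + sF (of_real (2 * k + y - 1)) (Y b x (y - 1) c) + Y b x y (L' 1 c))"
      unfolding rel t1 t2 e F.dual_piece_linear(2)[OF u m(2)] by (simp add: algebra_simps)
  qed
qed

end

section \<open>Conjugation of modes by \<open>exp(z L(1))\<close>\<close>

text \<open>Index set for \<open>n\<close> applications of the bracket: \<open>i\<close> of them act
  on the left state, \<open>l\<close> on the right one, and \<open>m\<close> lower the
  exponent.\<close>

definition triples :: "nat \<Rightarrow> (nat \<times> nat \<times> nat) set" where
  "triples n = {(i, m, l). i + m + l = n}"

lemma finite_triples [simp]: "finite (triples n)"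
  by (rule finite_subset[of _ "{..n} \<times> {..n} \<times> {..n}"]) (auto simp: triples_def)

lemma triples_0: "triples 0 = {(0, 0, 0)}"
  by (auto simp: triples_def)

text \<open>One more bracket raises exactly one of the three indices. The terms added by enlarging
  the index set are those with that index 0, where \<open>\<phi>\<close> is required to
  vanish.\<close>

lemma sum_triples_shift:
  fixes \<phi> :: "nat \<Rightarrow> nat \<Rightarrow> nat \<Rightarrow> 'a::comm_monoid_add"
  shows "(\<And>m l. \<phi> 0 m l = 0) \<Longrightarrow> (\<Sum>(i, m, l)\<in>triples n. \<phi> (Suc i) m l) = (\<Sum>(i, m, l)\<in>triples (Suc n). \<phi> i m l)"
    and "(\<And>i l. \<phi> i 0 l = 0) \<Longrightarrow> (\<Sum>(i, m, l)\<in>triples n. \<phi> i (Suc m) l) = (\<Sum>(i, m, l)\<in>triples (Suc n). \<phi> i m l)"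
    and "(\<And>i m. \<phi> i m 0 = 0) \<Longrightarrow> (\<Sum>(i, m, l)\<in>triples n. \<phi> i m (Suc l)) = (\<Sum>(i, m, l)\<in>triples (Suc n). \<phi> i m l)"
proof -
  have *: "(\<Sum>t\<in>triples n. f (g t)) = (\<Sum>t\<in>triples (Suc n). f t)"
    if "inj_on g (triples n)" "g ` triples n \<subseteq> triples (Suc n)" "\<And>t. t \<in> triples (Suc n) - g ` triples n \<Longrightarrow> f t = 0"
    for f :: "nat \<times> nat \<times> nat \<Rightarrow> 'a" and g
  proof -
    have "(\<Sum>t\<in>triples (Suc n). f t) = (\<Sum>t\<in>g ` triples n. f t)"
      by (rule sum.mono_neutral_right) (use that in auto)
    also have "\<dots> = (\<Sum>t\<in>triples n. f (g t))"
      by (subst sum.reindex[OF that(1)]) simp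
    finally show ?thesis by simp
  qed
  show "(\<Sum>(i, m, l)\<in>triples n. \<phi> (Suc i) m l) = (\<Sum>(i, m, l)\<in>triples (Suc n). \<phi> i m l)" if z: "\<And>m l. \<phi> 0 m l = 0"
  proof -
    have "(case t of (i, m, l) \<Rightarrow> \<phi> i m l) = 0" if t: "t \<in> triples (Suc n) - (\<lambda>(i, m, l). (Suc i, m, l)) ` triples n" for t
    proof -
      obtain i m l where t': "t = (i, m, l)" by (metis prod_cases3)
      show ?thesis
      proof (cases i)
        case (Suc i')
        then have "t = (\<lambda>(i, m, l). (Suc i, m, l)) (i', m, l)" "(i', m, l) \<in> triples n"
          using t by (auto simp: t' triples_def)
        then show ?thesis using t by blast
      qed (simp add: t' z)
    qed
    then show ?thesis
      using *[of "\<lambda>(i, m, l). (Suc i, m, l)" "\<lambda>(i, m, l). \<phi> i m l"]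
      by (simp add: case_prod_unfold inj_on_def triples_def image_subset_iff prod_eq_iff)
  qed
  show "(\<Sum>(i, m, l)\<in>triples n. \<phi> i (Suc m) l) = (\<Sum>(i, m, l)\<in>triples (Suc n). \<phi> i m l)" if z: "\<And>i l. \<phi> i 0 l = 0"
  proof -
    have "(case t of (i, m, l) \<Rightarrow> \<phi> i m l) = 0" if t: "t \<in> triples (Suc n) - (\<lambda>(i, m, l). (i, Suc m, l)) ` triples n" for t
    proof -
      obtain i m l where t': "t = (i, m, l)" by (metis prod_cases3)
      show ?thesis
      proof (cases m)
        case (Suc m')
        then have "t = (\<lambda>(i, m, l). (i, Suc m, l)) (i, m', l)" "(i, m', l) \<in> triples n"
          using t by (auto simp: t' triples_def)
        then show ?thesis using t by blast
      qed (simp add: t' z)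
    qed
    then show ?thesis
      using *[of "\<lambda>(i, m, l). (i, Suc m, l)" "\<lambda>(i, m, l). \<phi> i m l"]
      by (simp add: case_prod_unfold inj_on_def triples_def image_subset_iff prod_eq_iff)
  qed
  show "(\<Sum>(i, m, l)\<in>triples n. \<phi> i m (Suc l)) = (\<Sum>(i, m, l)\<in>triples (Suc n). \<phi> i m l)" if z: "\<And>i m. \<phi> i m 0 = 0"
  proof -
    have "(case t of (i, m, l) \<Rightarrow> \<phi> i m l) = 0" if t: "t \<in> triples (Suc n) - (\<lambda>(i, m, l). (i, m, Suc l)) ` triples n" for t
    proof -
      obtain i m l where t': "t = (i, m, l)" by (metis prod_cases3)
      show ?thesis
      proof (cases l)
        case (Suc l')
        then have "t = (\<lambda>(i, m, l). (i, m, Suc l)) (i, m, l')" "(i, m, l') \<in> triples n"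
          using t by (auto simp: t' triples_def)
        then show ?thesis using t by blast
      qed (simp add: t' z)
    qed
    then show ?thesis
      using *[of "\<lambda>(i, m, l). (i, m, Suc l)" "\<lambda>(i, m, l). \<phi> i m l"]
      by (simp add: case_prod_unfold inj_on_def triples_def image_subset_iff prod_eq_iff)
  qed
qed

lemma sum_triples_box:
  fixes \<phi> :: "nat \<Rightarrow> nat \<Rightarrow> nat \<Rightarrow> 'a::comm_monoid_add"
  assumes "\<And>i m l. K < i + m + l \<Longrightarrow> \<phi> i m l = 0"
  shows "(\<Sum>p\<le>K. \<Sum>(i, m, l)\<in>triples p. \<phi> i m l) = (\<Sum>i\<le>K. \<Sum>l\<le>K. \<Sum>m\<le>K. \<phi> i m l)"
proof -
  have "(\<Sum>p\<le>K. \<Sum>(i, m, l)\<in>triples p. \<phi> i m l) = (\<Sum>(i, m, l)\<in>(\<Union>p\<le>K. triples p). \<phi> i m l)"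
  proof (rule sum.UNION_disjoint[symmetric])
    show "\<forall>p\<in>{..K}. \<forall>q\<in>{..K}. p \<noteq> q \<longrightarrow> triples p \<inter> triples q = {}" by (auto simp: triples_def)
  qed simp_all
  also have "\<dots> = (\<Sum>(i, m, l)\<in>{..K} \<times> {..K} \<times> {..K}. \<phi> i m l)"
  proof (rule sum.mono_neutral_left)
    show "\<forall>t\<in>{..K} \<times> {..K} \<times> {..K} - (\<Union>p\<le>K. triples p). (case t of (i, m, l) \<Rightarrow> \<phi> i m l) = 0"
    proof
      fix t assume t: "t \<in> {..K} \<times> {..K} \<times> {..K} - (\<Union>p\<le>K. triples p)"
      obtain i m l where t': "t = (i, m, l)" by (metis prod_cases3)
      have "K < i + m + l" using t by (auto simp: t' triples_def)
      then show "(case t of (i, m, l) \<Rightarrow> \<phi> i m l) = 0" using assms by (simp add: t')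
    qed
  qed (auto simp: triples_def)
  also have "\<dots> = (\<Sum>i\<le>K. \<Sum>m\<le>K. \<Sum>l\<le>K. \<phi> i m l)"
    by (simp add: sum.cartesian_product)
  also have "\<dots> = (\<Sum>i\<le>K. \<Sum>l\<le>K. \<Sum>m\<le>K. \<phi> i m l)"
    by (intro sum.cong refl sum.swap)
  finally show ?thesis .
qed

text \<open>The sums over \<open>m\<close> and \<open>m'\<close> end up innermost, where they will
  form one value of \<open>inversion_02\<close> for each choice of \<open>i\<close>,
  \<open>l\<close>, \<open>i'\<close>, \<open>l'\<close>.\<close>

lemma sum_triples_box2:
  fixes \<phi> :: "nat \<Rightarrow> nat \<Rightarrow> nat \<Rightarrow> nat \<Rightarrow> nat \<Rightarrow> nat \<Rightarrow> 'a::comm_monoid_add"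
  assumes z: "\<And>i m l i' m' l'. K < i + m + l \<or> K < i' + m' + l' \<Longrightarrow> \<phi> i m l i' m' l' = 0"
  shows "(\<Sum>p\<le>K. \<Sum>q\<le>K. \<Sum>(i', m', l')\<in>triples q. \<Sum>(i, m, l)\<in>triples p. \<phi> i m l i' m' l') =
    (\<Sum>i\<le>K. \<Sum>l\<le>K. \<Sum>i'\<le>K. \<Sum>l'\<le>K. \<Sum>m\<le>K. \<Sum>m'\<le>K. \<phi> i m l i' m' l')"
proof -
  have "(\<Sum>p\<le>K. \<Sum>q\<le>K. \<Sum>(i', m', l')\<in>triples q. \<Sum>(i, m, l)\<in>triples p. \<phi> i m l i' m' l') =
    (\<Sum>p\<le>K. \<Sum>i'\<le>K. \<Sum>l'\<le>K. \<Sum>m'\<le>K. \<Sum>(i, m, l)\<in>triples p. \<phi> i m l i' m' l')"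
    by (intro sum.cong refl sum_triples_box) (auto intro!: sum.neutral z)
  also have "\<dots> = (\<Sum>p\<le>K. \<Sum>(i, m, l)\<in>triples p. \<Sum>i'\<le>K. \<Sum>l'\<le>K. \<Sum>m'\<le>K. \<phi> i m l i' m' l')"
    unfolding case_prod_unfold
    by (intro sum.cong refl) (simp only: sum.swap[of _ "{..K}" "triples _"])
  also have "\<dots> = (\<Sum>i\<le>K. \<Sum>l\<le>K. \<Sum>m\<le>K. \<Sum>i'\<le>K. \<Sum>l'\<le>K. \<Sum>m'\<le>K. \<phi> i m l i' m' l')"
    by (rule sum_triples_box) (auto intro!: sum.neutral z)
  also have "\<dots> = (\<Sum>i\<le>K. \<Sum>l\<le>K. \<Sum>i'\<le>K. \<Sum>m\<le>K. \<Sum>l'\<le>K. \<Sum>m'\<le>K. \<phi> i m l i' m' l')"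
    by (rule sum.cong[OF refl], rule sum.cong[OF refl], rule sum.swap)
  also have "\<dots> = (\<Sum>i\<le>K. \<Sum>l\<le>K. \<Sum>i'\<le>K. \<Sum>l'\<le>K. \<Sum>m\<le>K. \<Sum>m'\<le>K. \<phi> i m l i' m' l')"
    by (rule sum.cong[OF refl], rule sum.cong[OF refl], rule sum.cong[OF refl], rule sum.swap)
  finally show ?thesis .
qed

text \<open>The operator \<open>f^n / n!\<close>. With divided powers the iterated bracket carries
  no multinomial factors.\<close>

primrec divided_power :: "(complex \<Rightarrow> 'v \<Rightarrow> 'v) \<Rightarrow> ('v \<Rightarrow> 'v) \<Rightarrow> nat \<Rightarrow> 'v \<Rightarrow> 'v" where
  "divided_power sc f 0 v = v"
| "divided_power sc f (Suc n) v = sc (1 / of_nat (Suc n)) (f (divided_power sc f n v))"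

text \<open>The recursion for the coefficient at \<open>(i, m)\<close>: one term comes from raising
  \<open>i\<close>, one from raising \<open>m\<close>. With \<open>N = 2 * h + X - i - 1\<close> the
  first is treated by Pascal's rule, the second by
  \<open>N (N choose k) = k (N choose k) + (k + 1) (N choose k + 1)\<close>. Raising
  \<open>l\<close> later completes the factor \<open>i + m\<close> to
  \<open>i + m + l\<close>.\<close>

lemma conjugation_coefficient:
  fixes h X :: real
  shows "real (i + m) * (2 * h + X - real i - 1 gchoose m) =
    real i * (2 * h + X - real (i - 1) - 1 gchoose m) +
    (if m = 0 then 0 else (2 * (h - real i) + X - real (m - 1) - 1) * (2 * h + X - real i - 1 gchoose (m - 1)))"
proof (cases m)
  case (Suc k)
  define N where "N = 2 * h + X - real i - 1"
  have "N * (N gchoose k) = real k * (N gchoose k) + real (Suc k) * (N gchoose Suc k)"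
    by (rule gbinomial_mult_1)
  moreover have "real i * (2 * h + X - real (i - 1) - 1 gchoose m) = real i * ((N gchoose k) + (N gchoose Suc k))"
  proof (cases i)
    case (Suc j)
    then have "2 * h + X - real (i - 1) - 1 = N + 1" by (simp add: N_def)
    then show ?thesis using gbinomial_Suc_Suc[of N k] \<open>m = Suc k\<close> by (simp only: Suc)
  qed simp
  moreover have "2 * (h - real i) + X - real (m - 1) - 1 = N - real i - real k"
    by (simp add: N_def Suc algebra_simps)
  ultimately show ?thesis
    unfolding N_def[symmetric] by (simp add: Suc algebra_simps)
qed simp

context full_vertex_operator_algebra
begin

abbreviation "E n \<equiv> divided_power sF (L 1) n"
abbreviation "E' n \<equiv> divided_power sF (L' 1) n"

lemma L_E: "L 1 (E n a) = sF (of_nat (Suc n)) (E (Suc n) a)"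
  by (simp del: of_nat_Suc)

lemma L'_E': "L' 1 (E' n a) = sF (of_nat (Suc n)) (E' (Suc n) a)"
  by (simp del: of_nat_Suc)

lemma E_piece: "a \<in> F h k \<Longrightarrow> E n a \<in> F (h - real n) k"
proof (induction n)
  case (Suc n)
  then have "L 1 (E n a) \<in> F (h - real n - 1) k" using L_one_piece by blast
  then have "L 1 (E n a) \<in> F (h - real (Suc n)) k" by (simp add: algebra_simps)
  then show ?case by (simp add: F.piece_scale del: of_nat_Suc)
qed simp

lemma E'_piece: "a \<in> F h k \<Longrightarrow> E' n a \<in> F h (k - real n)"
proof (induction n)
  case (Suc n)
  then have "L' 1 (E' n a) \<in> F h (k - real n - 1)" using L'_one_piece by blast
  then have "L' 1 (E' n a) \<in> F h (k - real (Suc n))" by (simp add: algebra_simps)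
  then show ?case by (simp add: F.piece_scale del: of_nat_Suc)
qed simp

lemma L_linear: "linear_map_on sF sF (gtotal sF F) (L n)"
  unfolding L_eq[abs_def] by (rule endomorphism_linear[OF conformal_vectors(1)])

lemma L'_linear: "linear_map_on sF sF (gtotal sF F) (L' n)"
  unfolding L'_eq[abs_def] by (rule endomorphism_linear[OF conformal_vectors(2)])

lemma L_total: "v \<in> gtotal sF F \<Longrightarrow> L n v \<in> gtotal sF F"
  unfolding L_eq by (rule endomorphism[OF conformal_vectors(1)])

lemma L'_total: "v \<in> gtotal sF F \<Longrightarrow> L' n v \<in> gtotal sF F"
  unfolding L'_eq by (rule endomorphism[OF conformal_vectors(2)])

lemma divided_power_linear:
  assumes f: "linear_map_on sF sF (gtotal sF F) f" "\<And>v. v \<in> gtotal sF F \<Longrightarrow> f v \<in> gtotal sF F"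
  shows "linear_map_on sF sF (gtotal sF F) (divided_power sF f n) \<and>
    (\<forall>v\<in>gtotal sF F. divided_power sF f n v \<in> gtotal sF F)"
proof (induction n)
  case (Suc n)
  have l: "linear_map_on sF sF (gtotal sF F) (divided_power sF f n)"
    and t: "\<And>v. v \<in> gtotal sF F \<Longrightarrow> divided_power sF f n v \<in> gtotal sF F" using Suc by blast+
  have "divided_power sF f (Suc n) (v + w) = divided_power sF f (Suc n) v + divided_power sF f (Suc n) w"
    if vw: "v \<in> gtotal sF F" "w \<in> gtotal sF F" for v w
    by (simp add: linear_map_onD(1)[OF l vw] linear_map_onD(1)[OF f(1) t[OF vw(1)] t[OF vw(2)]] F.scale_right_distrib del: of_nat_Suc)
  moreover have "divided_power sF f (Suc n) (sF c v) = sF c (divided_power sF f (Suc n) v)" if v: "v \<in> gtotal sF F" for v c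
    by (simp add: linear_map_onD(2)[OF l v] linear_map_onD(2)[OF f(1) t[OF v]] del: of_nat_Suc)
  ultimately show ?case
    unfolding linear_map_on_def using f(2) t by (auto intro!: F.total_scale)
qed (auto simp: linear_map_on_def)

lemma E_linear: "linear_map_on sF sF (gtotal sF F) (E n)"
  using divided_power_linear[OF L_linear[of 1] L_total] by blast

text \<open>These are the coefficients of the known formula \<open>exp(w L(1)) Y(a,z) exp(- w L(1))
  = Y(exp(w (1 - w z) L(1)) (1 - w z)^(-2 L(0)) a, z/(1 - w z))\<close>. Here
  \<open>\<Phi> i m l\<close> stands for the mode at exponent \<open>X - m\<close>, with the
  \<open>i\<close>-th and \<open>l\<close>-th divided powers applied to the two states. An abstract
  \<open>\<Phi>\<close> covers the holomorphic and the antiholomorphic case at once.\<close>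

lemma conjugation_sum:
  fixes \<Phi> :: "nat \<Rightarrow> nat \<Rightarrow> nat \<Rightarrow> 'a" and f :: "'a \<Rightarrow> 'a" and h X :: real
  assumes f: "linear_map_on sF sF (gtotal sF F) f"
    and tot: "\<And>i m l. \<Phi> i m l \<in> gtotal sF F"
    and br: "\<And>i m l. f (\<Phi> i m l) = sF (of_nat (Suc i)) (\<Phi> (Suc i) m l) +
      sF (of_real (2 * (h - real i) + X - real m - 1)) (\<Phi> i (Suc m) l) + sF (of_nat (Suc l)) (\<Phi> i m (Suc l))"
  shows "divided_power sF f n (\<Phi> 0 0 0) =
    (\<Sum>(i, m, l)\<in>triples n. sF (of_real (2 * h + X - real i - 1 gchoose m)) (\<Phi> i m l))"
proof (induction n)
  case 0
  then show ?case by (simp add: triples_0)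
next
  case (Suc n)
  let ?c = "\<lambda>i m. (of_real (2 * h + X - real i - 1 gchoose m) :: complex)"
  let ?d = "\<lambda>i m. (of_real (2 * (h - real i) + X - real m - 1) :: complex)"
  have "f (divided_power sF f n (\<Phi> 0 0 0)) = f (\<Sum>t\<in>triples n. case t of (i, m, l) \<Rightarrow> sF (?c i m) (\<Phi> i m l))"
    using Suc by simp
  also have "\<dots> = (\<Sum>t\<in>triples n. f (case t of (i, m, l) \<Rightarrow> sF (?c i m) (\<Phi> i m l)))"
    by (rule F.linear_total_sum[OF f]) (auto intro!: F.total_scale tot)
  also have "\<dots> = (\<Sum>(i, m, l)\<in>triples n. sF (of_nat (Suc i) * ?c i m) (\<Phi> (Suc i) m l) +
      sF (?d i m * ?c i m) (\<Phi> i (Suc m) l) + sF (of_nat (Suc l) * ?c i m) (\<Phi> i m (Suc l)))"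
  proof (rule sum.cong[OF refl])
    fix t :: "nat \<times> nat \<times> nat"
    obtain i m l where t: "t = (i, m, l)" by (metis prod_cases3)
    show "f (case t of (i, m, l) \<Rightarrow> sF (?c i m) (\<Phi> i m l)) = (case t of (i, m, l) \<Rightarrow> sF (of_nat (Suc i) * ?c i m) (\<Phi> (Suc i) m l) +
      sF (?d i m * ?c i m) (\<Phi> i (Suc m) l) + sF (of_nat (Suc l) * ?c i m) (\<Phi> i m (Suc l)))"
      unfolding t prod.case linear_map_onD(2)[OF f tot] br
      by (simp only: F.scale_right_distrib F.scale_scale mult.commute)
  qed
  \<comment> \<open>Each term is rewritten as a function of its raised index that vanishes at index
    0, so that \<open>sum_triples_shift\<close> applies.\<close>
  also have "\<dots> = (\<Sum>(i, m, l)\<in>triples n. sF (of_nat (Suc i) * ?c (Suc i - 1) m) (\<Phi> (Suc i) m l)) +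
      (\<Sum>(i, m, l)\<in>triples n. sF (if Suc m = 0 then 0 else ?d i (Suc m - 1) * ?c i (Suc m - 1)) (\<Phi> i (Suc m) l)) +
      (\<Sum>(i, m, l)\<in>triples n. sF (of_nat (Suc l) * ?c i m) (\<Phi> i m (Suc l)))"
    by (simp add: sum.distrib case_prod_unfold del: of_nat_Suc)
  also have "\<dots> = (\<Sum>(i, m, l)\<in>triples (Suc n). sF (of_nat i * ?c (i - 1) m) (\<Phi> i m l)) +
      (\<Sum>(i, m, l)\<in>triples (Suc n). sF (if m = 0 then 0 else ?d i (m - 1) * ?c i (m - 1)) (\<Phi> i m l)) +
      (\<Sum>(i, m, l)\<in>triples (Suc n). sF (of_nat l * ?c i m) (\<Phi> i m l))"
    by (subst sum_triples_shift(1)[of "\<lambda>i m l. sF (of_nat i * ?c (i - 1) m) (\<Phi> i m l)"], simp,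
        subst sum_triples_shift(2)[of "\<lambda>i m l. sF (if m = 0 then 0 else ?d i (m - 1) * ?c i (m - 1)) (\<Phi> i m l)"], simp,
        subst sum_triples_shift(3)[of "\<lambda>i m l. sF (of_nat l * ?c i m) (\<Phi> i m l)"], simp, rule refl)
  also have "\<dots> = (\<Sum>(i, m, l)\<in>triples (Suc n). sF (of_nat (Suc n) * ?c i m) (\<Phi> i m l))"
    unfolding sum.distrib[symmetric]
  proof (rule sum.cong[OF refl])
    fix t assume tn: "t \<in> triples (Suc n)"
    obtain i m l where t: "t = (i, m, l)" by (metis prod_cases3)
    have iml: "i + m + l = Suc n" using tn by (simp add: t triples_def)
    have "of_nat i * ?c (i - 1) m + (if m = 0 then 0 else ?d i (m - 1) * ?c i (m - 1)) =
      of_real (real i * (2 * h + X - real (i - 1) - 1 gchoose m) +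
    (if m = 0 then 0 else (2 * (h - real i) + X - real (m - 1) - 1) * (2 * h + X - real i - 1 gchoose (m - 1))))"
      by simp
    also have "\<dots> = of_real (real (i + m) * (2 * h + X - real i - 1 gchoose m))"
      by (simp only: conjugation_coefficient)
    finally have "of_nat i * ?c (i - 1) m + (if m = 0 then 0 else ?d i (m - 1) * ?c i (m - 1)) + of_nat l * ?c i m =
      of_nat (i + m + l) * ?c i m"
      by (simp add: distrib_right)
    then show "(case t of (i, m, l) \<Rightarrow> sF (of_nat i * ?c (i - 1) m) (\<Phi> i m l)) +
      (case t of (i, m, l) \<Rightarrow> sF (if m = 0 then 0 else ?d i (m - 1) * ?c i (m - 1)) (\<Phi> i m l)) +
      (case t of (i, m, l) \<Rightarrow> sF (of_nat l * ?c i m) (\<Phi> i m l)) =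
      (case t of (i, m, l) \<Rightarrow> sF (of_nat (Suc n) * ?c i m) (\<Phi> i m l))"
      unfolding t prod.case F.scale_left_distrib[symmetric] iml by simp
  qed
  finally have "divided_power sF f (Suc n) (\<Phi> 0 0 0) = sF (1 / of_nat (Suc n)) (\<Sum>(i, m, l)\<in>triples (Suc n). sF (of_nat (Suc n) * ?c i m) (\<Phi> i m l))"
    by simp
  also have "\<dots> = (\<Sum>(i, m, l)\<in>triples (Suc n). sF (?c i m) (\<Phi> i m l))"
    by (simp add: F.scale_sum_right case_prod_unfold del: of_nat_Suc)
  finally show ?case .
qed

lemma E_mode:
  assumes a: "a \<in> F h k" and b: "b \<in> F h' k'"
  shows "E n (Y a x y b) = (\<Sum>(i, m, l)\<in>triples n. sF (of_real (2 * h + x - real i - 1 gchoose m)) (Y (E i a) (x - real m) y (E l b)))"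
proof -
  have "E n (Y (E 0 a) (x - real 0) y (E 0 b)) = (\<Sum>(i, m, l)\<in>triples n. sF (of_real (2 * h + x - real i - 1 gchoose m)) (Y (E i a) (x - real m) y (E l b)))"
  proof (rule conjugation_sum[OF L_linear])
    fix i m l
    show "Y (E i a) (x - real m) y (E l b) \<in> gtotal sF F"
      by (rule F.total_base[OF YM_piece[OF E_piece[OF a] E_piece[OF b]]])
    have e: "2 * (h - real i) + (x - real m) - 1 = 2 * (h - real i) + x - real m - 1" "x - real m - 1 = x - real (Suc m)"
      by simp_all
    show "L 1 (Y (E i a) (x - real m) y (E l b)) = sF (of_nat (Suc i)) (Y (E (Suc i) a) (x - real m) y (E l b)) +
      sF (of_real (2 * (h - real i) + x - real m - 1)) (Y (E i a) (x - real (Suc m)) y (E l b)) +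
      sF (of_nat (Suc l)) (Y (E i a) (x - real m) y (E (Suc l) b))"
      unfolding L_one_bracket[OF E_piece[OF a] E_piece[OF b]] L_E e
        YM_scale_left[OF F.total_base[OF E_piece[OF a]] F.total_base[OF E_piece[OF b]]]
        YM_scale_right[OF F.total_base[OF E_piece[OF a]] F.total_base[OF E_piece[OF b]]] ..
  qed
  then show ?thesis by simp
qed

lemma E'_mode:
  assumes a: "a \<in> F h k" and b: "b \<in> F h' k'"
  shows "E' n (Y a x y b) = (\<Sum>(i, m, l)\<in>triples n. sF (of_real (2 * k + y - real i - 1 gchoose m)) (Y (E' i a) x (y - real m) (E' l b)))"
proof -
  have "E' n (Y (E' 0 a) x (y - real 0) (E' 0 b)) = (\<Sum>(i, m, l)\<in>triples n. sF (of_real (2 * k + y - real i - 1 gchoose m)) (Y (E' i a) x (y - real m) (E' l b)))"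
  proof (rule conjugation_sum[OF L'_linear])
    fix i m l
    show "Y (E' i a) x (y - real m) (E' l b) \<in> gtotal sF F"
      by (rule F.total_base[OF YM_piece[OF E'_piece[OF a] E'_piece[OF b]]])
    have e: "2 * (k - real i) + (y - real m) - 1 = 2 * (k - real i) + y - real m - 1" "y - real m - 1 = y - real (Suc m)"
      by simp_all
    show "L' 1 (Y (E' i a) x (y - real m) (E' l b)) = sF (of_nat (Suc i)) (Y (E' (Suc i) a) x (y - real m) (E' l b)) +
      sF (of_real (2 * (k - real i) + y - real m - 1)) (Y (E' i a) x (y - real (Suc m)) (E' l b)) +
      sF (of_nat (Suc l)) (Y (E' i a) x (y - real m) (E' (Suc l) b))"
      unfolding L'_one_bracket[OF E'_piece[OF a] E'_piece[OF b]] L'_E' e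
        YM_scale_left[OF F.total_base[OF E'_piece[OF a]] F.total_base[OF E'_piece[OF b]]]
        YM_scale_right[OF F.total_base[OF E'_piece[OF a]] F.total_base[OF E'_piece[OF b]]] ..
  qed
  then show ?thesis by simp
qed

text \<open>Since \<open>L 1\<close> and \<open>L' 1\<close> commute, this is the coefficient of
  \<open>z^i zbar^j\<close> in \<open>exp(z L(1) + zbar Lbar(1)) a\<close>.\<close>

definition P :: "nat \<Rightarrow> nat \<Rightarrow> 'a \<Rightarrow> 'a" where
  "P i j a = E i (E' j a)"

lemma P_piece: "a \<in> F h k \<Longrightarrow> P i j a \<in> F (h - real i) (k - real j)"
  unfolding P_def by (intro E_piece E'_piece)

lemma P_0_0 [simp]: "P 0 0 a = a"
  by (simp add: P_def)

lemma P_mode: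
  assumes a: "a \<in> F h k" and b: "b \<in> F h' k'"
  shows "P n n' (Y a x y b) = (\<Sum>(i', m', l')\<in>triples n'. \<Sum>(i, m, l)\<in>triples n.
    sF (of_real (2 * h + x - real i - 1 gchoose m) * of_real (2 * k + y - real i' - 1 gchoose m'))
      (Y (P i i' a) (x - real m) (y - real m') (P l l' b)))"
proof -
  have tot: "Y (E' i a) x (y - real m) (E' l b) \<in> gtotal sF F" for i m l
    by (rule F.total_base[OF YM_piece[OF E'_piece[OF a] E'_piece[OF b]]])
  have "P n n' (Y a x y b) = E n (\<Sum>t\<in>triples n'. case t of (i, m, l) \<Rightarrow>
      sF (of_real (2 * k + y - real i - 1 gchoose m)) (Y (E' i a) x (y - real m) (E' l b)))"
    unfolding P_def E'_mode[OF a b] ..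
  also have "\<dots> = (\<Sum>t\<in>triples n'. E n (case t of (i, m, l) \<Rightarrow>
      sF (of_real (2 * k + y - real i - 1 gchoose m)) (Y (E' i a) x (y - real m) (E' l b))))"
    by (rule F.linear_total_sum[OF E_linear]) (auto intro!: F.total_scale tot)
  also have "\<dots> = (\<Sum>(i', m', l')\<in>triples n'. \<Sum>(i, m, l)\<in>triples n.
    sF (of_real (2 * h + x - real i - 1 gchoose m) * of_real (2 * k + y - real i' - 1 gchoose m'))
      (Y (P i i' a) (x - real m) (y - real m') (P l l' b)))"
  proof (rule sum.cong[OF refl])
    fix t :: "nat \<times> nat \<times> nat"
    obtain i' m' l' where t: "t = (i', m', l')" by (metis prod_cases3)
    show "E n (case t of (i, m, l) \<Rightarrow>
      sF (of_real (2 * k + y - real i - 1 gchoose m)) (Y (E' i a) x (y - real m) (E' l b))) =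
      (case t of (i', m', l') \<Rightarrow> \<Sum>(i, m, l)\<in>triples n.
    sF (of_real (2 * h + x - real i - 1 gchoose m) * of_real (2 * k + y - real i' - 1 gchoose m'))
      (Y (P i i' a) (x - real m) (y - real m') (P l l' b)))"
      unfolding t prod.case linear_map_onD(2)[OF E_linear tot] E_mode[OF E'_piece[OF a] E'_piece[OF b]] P_def
      by (simp add: F.scale_sum_right case_prod_unfold mult.commute)
  qed
  finally show ?thesis .
qed

text \<open>\<open>L 1\<close> and \<open>L' 1\<close> lower degrees, and the degrees of
  \<open>F\<close> are bounded below; this is the finiteness of \<open>S_z a\<close>.\<close>

lemma P_bound:
  assumes a: "a \<in> F h k"
  obtains n where "\<And>i j. n < i \<or> n < j \<Longrightarrow> P i j a = 0"
proof -
  obtain N where N: "\<And>h k. h \<le> N \<or> k \<le> N \<Longrightarrow> F h k = {0}"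
    using bounded_below unfolding degrees_bounded_below_def by blast
  obtain n :: nat where n: "h - N < real n + 1" "k - N < real n + 1" by (rule box_index_exists)
  have "P i j a = 0" if "n < i \<or> n < j" for i j
  proof -
    have "real n + 1 \<le> real i \<or> real n + 1 \<le> real j" using that by linarith
    then have "h - real i \<le> N \<or> k - real j \<le> N" using n by linarith
    then show ?thesis using N P_piece[OF a, of i j] by blast
  qed
  then show thesis by (rule that)
qed

lemma L'_E_commute: "a \<in> F h k \<Longrightarrow> L' 1 (E n a) = E n (L' 1 a)"
proof (induction n)
  case (Suc n)
  have "L' 1 (E (Suc n) a) = sF (1 / of_nat (Suc n)) (L' 1 (L 1 (E n a)))"
    using linear_map_onD(2)[OF L'_linear F.total_base[OF L_one_piece[OF E_piece[OF Suc.prems]]]] by (simp del: of_nat_Suc)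
  also have "L' 1 (L 1 (E n a)) = L 1 (E n (L' 1 a))"
    unfolding L_one_commute[OF E_piece[OF Suc.prems], symmetric] Suc.IH[OF Suc.prems] ..
  finally show ?case by simp
qed simp

lemma L_P: "L 1 (P i j a) = sF (of_nat (Suc i)) (P (Suc i) j a)"
  unfolding P_def by (rule L_E)

lemma L'_P:
  assumes a: "a \<in> F h k"
  shows "L' 1 (P i j a) = sF (of_nat (Suc j)) (P i (Suc j) a)"
proof -
  have "L' 1 (P i j a) = E i (L' 1 (E' j a))" unfolding P_def by (rule L'_E_commute[OF E'_piece[OF a]])
  also have "\<dots> = E i (sF (of_nat (Suc j)) (E' (Suc j) a))" by (simp only: L'_E')
  also have "\<dots> = sF (of_nat (Suc j)) (P i (Suc j) a)"
    unfolding P_def by (rule linear_map_onD(2)[OF E_linear F.total_base[OF E'_piece[OF a]]])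
  finally show ?thesis .
qed

section \<open>The series \<open>S\<close>\<close>

definition S_pow :: "nat \<Rightarrow> 'a \<Rightarrow> real \<Rightarrow> real \<Rightarrow> 'a" where
  "S_pow n a = (S_exponent Y \<omega> \<omega>' ^^ n) (S_initial sF F a)"

abbreviation "S \<equiv> S_series sF F Y \<omega> \<omega>'"

lemma S_eq: "S a x y = (\<Sum>n | S_pow n a x y \<noteq> 0. sF (1 / fact n) (S_pow n a x y))"
  by (simp add: S_series_def S_pow_def)

lemma S_pow_0: "S_pow 0 a x y = sF (sign_pow ((- x / 2) - (- y / 2))) (gcomp F a (- x / 2) (- y / 2))"
  by (simp add: S_pow_def S_initial_def)

lemma S_pow_Suc: "S_pow (Suc n) a x y = L 1 (S_pow n a (x - 1) y) + L' 1 (S_pow n a x (y - 1))"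
  by (simp add: S_pow_def S_exponent_def)

lemma S_pow_total: "a \<in> gtotal sF F \<Longrightarrow> S_pow n a x y \<in> gtotal sF F"
proof (induction n arbitrary: x y)
  case 0
  then show ?case unfolding S_pow_0 by (intro F.total_scale F.total_base[OF F.gcomp_mem])
next
  case (Suc n)
  then show ?case unfolding S_pow_Suc by (intro F.total_add L_total L'_total)
qed

lemma S_pow_add:
  assumes "a \<in> gtotal sF F" "b \<in> gtotal sF F"
  shows "S_pow n (a + b) x y = S_pow n a x y + S_pow n b x y"
proof (induction n arbitrary: x y)
  case 0
  then show ?case unfolding S_pow_0 by (simp add: F.gcomp_add[OF assms] F.scale_right_distrib)
next
  case (Suc n)
  then show ?case
    unfolding S_pow_Suc
    by (simp add: linear_map_onD(1)[OF L_linear S_pow_total[OF assms(1)] S_pow_total[OF assms(2)]]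
        linear_map_onD(1)[OF L'_linear S_pow_total[OF assms(1)] S_pow_total[OF assms(2)]])
qed

lemma S_pow_scale:
  assumes "a \<in> gtotal sF F"
  shows "S_pow n (sF c a) x y = sF c (S_pow n a x y)"
proof (induction n arbitrary: x y)
  case 0
  then show ?case unfolding S_pow_0 by (simp add: F.gcomp_scale[OF assms] mult.commute)
next
  case (Suc n)
  then show ?case
    unfolding S_pow_Suc
    by (simp add: linear_map_onD(2)[OF L_linear S_pow_total[OF assms]]
        linear_map_onD(2)[OF L'_linear S_pow_total[OF assms]] F.scale_right_distrib)
qed

lemma L_zero_arg: "L n 0 = 0" "L' n 0 = 0"
  using YM_zero_right[OF conformal_vectors(1)] YM_zero_right[OF conformal_vectors(2)] by (simp_all add: L_eq L'_eq)

text \<open>By commutation the \<open>n\<close>-th power of \<open>z L(1) + zbar Lbar(1)\<close> has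
  the coefficient \<open>n! / (i! j!)\<close> at \<open>L(1)^i Lbar(1)^j\<close> with
  \<open>i + j = n\<close>, that is \<open>n!\<close> in front of \<open>P i j\<close>. In the
  induction the two summands contribute \<open>i * n!\<close> and \<open>j * n!\<close>, together
  \<open>(n + 1)!\<close>.\<close>

lemma S_pow_piece:
  assumes a: "a \<in> F h k"
  shows "S_pow n a (real i - 2 * h) (real j - 2 * k) =
      (if i + j = n then sF (fact n * sign_pow (h - k)) (P i j a) else 0)"
    and "\<And>x y. (\<And>i j. x = real i - 2 * h \<Longrightarrow> y = real j - 2 * k \<Longrightarrow> False) \<Longrightarrow> S_pow n a x y = 0"
proof -
  have "(\<forall>i j. S_pow n a (real i - 2 * h) (real j - 2 * k) =
      (if i + j = n then sF (fact n * sign_pow (h - k)) (P i j a) else 0)) \<and>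
    (\<forall>x y. (\<nexists>i j. x = real i - 2 * h \<and> y = real j - 2 * k) \<longrightarrow> S_pow n a x y = 0)"
  proof (induction n)
    case 0
    have "S_pow 0 a (real i - 2 * h) (real j - 2 * k) = (if i + j = 0 then sF (fact 0 * sign_pow (h - k)) (P i j a) else 0)" for i j
    proof -
      have "(- (real i - 2 * h) / 2 = h) \<longleftrightarrow> i = 0" "(- (real j - 2 * k) / 2 = k) \<longleftrightarrow> j = 0" by auto
      then show ?thesis unfolding S_pow_0 F.gcomp_piece[OF a] by auto
    qed
    moreover have "S_pow 0 a x y = 0" if "\<nexists>i j. x = real i - 2 * h \<and> y = real j - 2 * k" for x y
    proof -
      have "\<not> (- x / 2 = h \<and> - y / 2 = k)"
      proof
        assume "- x / 2 = h \<and> - y / 2 = k"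
        then have "x = real 0 - 2 * h \<and> y = real 0 - 2 * k" by auto
        then show False using that by blast
      qed
      then show ?thesis unfolding S_pow_0 F.gcomp_piece[OF a] by auto
    qed
    ultimately show ?case by blast
  next
    case (Suc n)
    let ?s = "sign_pow (h - k)"
    have IH1: "S_pow n a (real i - 2 * h) (real j - 2 * k) =
      (if i + j = n then sF (fact n * ?s) (P i j a) else 0)" for i j using Suc by blast
    have IH2: "S_pow n a x y = 0" if "\<nexists>i j. x = real i - 2 * h \<and> y = real j - 2 * k" for x y using Suc that by blast
    have tP: "P i j a \<in> gtotal sF F" for i j by (rule F.total_base[OF P_piece[OF a]])
    have t1: "L 1 (S_pow n a (real i - 2 * h - 1) (real j - 2 * k)) =
      (if i + j = Suc n then sF (of_nat i * (fact n * ?s)) (P i j a) else 0)" for i j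
    proof (cases i)
      case 0
      have "\<nexists>i' j'. real i - 2 * h - 1 = real i' - 2 * h \<and> real j - 2 * k = real j' - 2 * k" using 0 by auto
      then show ?thesis using IH2 0 by (simp add: L_zero_arg)
    next
      case (Suc i')
      have e: "real i - 2 * h - 1 = real i' - 2 * h" using Suc by simp
      show ?thesis
        unfolding e IH1 using Suc
        by (auto simp: L_zero_arg linear_map_onD(2)[OF L_linear tP] L_P mult_ac simp del: of_nat_Suc)
    qed
    have t2: "L' 1 (S_pow n a (real i - 2 * h) (real j - 2 * k - 1)) =
      (if i + j = Suc n then sF (of_nat j * (fact n * ?s)) (P i j a) else 0)" for i j
    proof (cases j)
      case 0
      have "\<nexists>i' j'. real i - 2 * h = real i' - 2 * h \<and> real j - 2 * k - 1 = real j' - 2 * k" using 0 by auto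
      then show ?thesis using IH2 0 by (simp add: L_zero_arg)
    next
      case (Suc j')
      have e: "real j - 2 * k - 1 = real j' - 2 * k" using Suc by simp
      show ?thesis
        unfolding e IH1 using Suc
        by (auto simp: L_zero_arg linear_map_onD(2)[OF L'_linear tP] L'_P[OF a] mult_ac simp del: of_nat_Suc)
    qed
    have "S_pow (Suc n) a (real i - 2 * h) (real j - 2 * k) =
      (if i + j = Suc n then sF (fact (Suc n) * ?s) (P i j a) else 0)" for i j
    proof (cases "i + j = Suc n")
      case True
      have "sF (of_nat i * (fact n * ?s)) (P i j a) + sF (of_nat j * (fact n * ?s)) (P i j a) =
        sF (of_nat (i + j) * (fact n * ?s)) (P i j a)"
        by (simp add: F.scale_left_distrib[symmetric] distrib_right)
      then show ?thesis unfolding S_pow_Suc t1 t2 using True by (simp add: fact_Suc mult.assoc)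
    qed (simp add: S_pow_Suc t1 t2)
    moreover have "S_pow (Suc n) a x y = 0" if no: "\<nexists>i j. x = real i - 2 * h \<and> y = real j - 2 * k" for x y
    proof -
      have "\<nexists>i j. x - 1 = real i - 2 * h \<and> y = real j - 2 * k"
      proof
        assume "\<exists>i j. x - 1 = real i - 2 * h \<and> y = real j - 2 * k"
        then obtain i j where "x - 1 = real i - 2 * h" "y = real j - 2 * k" by blast
        then have "x = real (Suc i) - 2 * h \<and> y = real j - 2 * k" by simp
        then show False using no by blast
      qed
      moreover have "\<nexists>i j. x = real i - 2 * h \<and> y - 1 = real j - 2 * k"
      proof
        assume "\<exists>i j. x = real i - 2 * h \<and> y - 1 = real j - 2 * k"
        then obtain i j where "x = real i - 2 * h" "y - 1 = real j - 2 * k" by blast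
        then have "x = real i - 2 * h \<and> y = real (Suc j) - 2 * k" by simp
        then show False using no by blast
      qed
      ultimately show ?thesis unfolding S_pow_Suc using IH2 by (simp add: L_zero_arg)
    qed
    ultimately show ?case by blast
  qed
  then show "S_pow n a (real i - 2 * h) (real j - 2 * k) =
      (if i + j = n then sF (fact n * sign_pow (h - k)) (P i j a) else 0)"
    and "\<And>x y. (\<And>i j. x = real i - 2 * h \<Longrightarrow> y = real j - 2 * k \<Longrightarrow> False) \<Longrightarrow> S_pow n a x y = 0"
    by blast+
qed

text \<open>The exponents determine \<open>i\<close> and \<open>j\<close>, so a single power
  \<open>n = i + j\<close> contributes, and its factorial cancels.\<close>

lemma S_piece:
  assumes a: "a \<in> F h k"
  shows "S a (real i - 2 * h) (real j - 2 * k) = sF (sign_pow (h - k)) (P i j a)"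
    and "\<And>x y. (\<And>i j. x = real i - 2 * h \<Longrightarrow> y = real j - 2 * k \<Longrightarrow> False) \<Longrightarrow> S a x y = 0"
proof -
  let ?t = "\<lambda>n. sF (1 / fact n) (S_pow n a (real i - 2 * h) (real j - 2 * k))"
  have "S a (real i - 2 * h) (real j - 2 * k) = (\<Sum>n\<in>{i + j}. ?t n)"
    unfolding S_eq by (rule sum.mono_neutral_left) (auto simp: S_pow_piece(1)[OF a])
  also have "\<dots> = sF (sign_pow (h - k)) (P i j a)"
    by (simp add: S_pow_piece(1)[OF a])
  finally show "S a (real i - 2 * h) (real j - 2 * k) = sF (sign_pow (h - k)) (P i j a)" .
  show "S a x y = 0" if "\<And>i j. x = real i - 2 * h \<Longrightarrow> y = real j - 2 * k \<Longrightarrow> False" for x y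
    unfolding S_eq using S_pow_piece(2)[OF a that] by simp
qed

lemma finite_S_pow: "a \<in> gtotal sF F \<Longrightarrow> finite {n. S_pow n a x y \<noteq> 0}"
proof (induction rule: F.total_induct)
  case (piece h k a)
  show ?case
  proof (cases "\<exists>i j. x = real i - 2 * h \<and> y = real j - 2 * k")
    case True
    then obtain i j where ij: "x = real i - 2 * h" "y = real j - 2 * k" by blast
    have "{n. S_pow n a x y \<noteq> 0} \<subseteq> {i + j}" unfolding ij S_pow_piece(1)[OF piece] by auto
    then show ?thesis by (rule finite_subset) simp
  next
    case False
    then have "S_pow n a x y = 0" for n using S_pow_piece(2)[OF piece, of x y] by blast
    then show ?thesis by simp
  qed
next
  case (add v w)
  have "{n. S_pow n (v + w) x y \<noteq> 0} \<subseteq> {n. S_pow n v x y \<noteq> 0} \<union> {n. S_pow n w x y \<noteq> 0}"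
    by (auto simp: S_pow_add[OF add(1,2)])
  then show ?case by (rule finite_subset) (use add in simp)
qed

lemma S_on:
  assumes "finite I" "{n. S_pow n a x y \<noteq> 0} \<subseteq> I"
  shows "S a x y = (\<Sum>n\<in>I. sF (1 / fact n) (S_pow n a x y))"
  unfolding S_eq by (rule sum.mono_neutral_left) (use assms in auto)

lemma S_add:
  assumes ab: "a \<in> gtotal sF F" "b \<in> gtotal sF F"
  shows "S (a + b) x y = S a x y + S b x y"
proof -
  let ?I = "{n. S_pow n a x y \<noteq> 0} \<union> {n. S_pow n b x y \<noteq> 0}"
  have I: "finite ?I" using finite_S_pow[OF ab(1)] finite_S_pow[OF ab(2)] by simp
  have "S (a + b) x y = (\<Sum>n\<in>?I. sF (1 / fact n) (S_pow n (a + b) x y))"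
    by (rule S_on[OF I]) (auto simp: S_pow_add[OF ab])
  also have "\<dots> = (\<Sum>n\<in>?I. sF (1 / fact n) (S_pow n a x y)) + (\<Sum>n\<in>?I. sF (1 / fact n) (S_pow n b x y))"
    by (simp add: S_pow_add[OF ab] F.scale_right_distrib sum.distrib)
  also have "\<dots> = S a x y + S b x y"
    using S_on[OF I, of a x y] S_on[OF I, of b x y] by auto
  finally show ?thesis .
qed

lemma S_scale:
  assumes a: "a \<in> gtotal sF F"
  shows "S (sF c a) x y = sF c (S a x y)"
proof -
  let ?I = "{n. S_pow n a x y \<noteq> 0}"
  have "S (sF c a) x y = (\<Sum>n\<in>?I. sF (1 / fact n) (S_pow n (sF c a) x y))"
    by (rule S_on[OF finite_S_pow[OF a]]) (auto simp: S_pow_scale[OF a])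
  also have "\<dots> = sF c (S a x y)"
    by (simp add: S_pow_scale[OF a] S_eq F.scale_sum_right mult.commute)
  finally show ?thesis .
qed

lemma S_total: "a \<in> gtotal sF F \<Longrightarrow> S a x y \<in> gtotal sF F"
  unfolding S_eq by (intro F.total_sum F.total_scale S_pow_total)

lemma S_support_piece:
  assumes a: "a \<in> F h k" and n: "\<And>i j. n < i \<or> n < j \<Longrightarrow> P i j a = 0"
  shows "{(r, s). S a r s \<noteq> 0} \<subseteq> (\<lambda>(i, j). (real i - 2 * h, real j - 2 * k)) ` ({..n} \<times> {..n})"
proof clarify
  fix r s assume nz: "S a r s \<noteq> 0"
  then obtain i j where ij: "r = real i - 2 * h" "s = real j - 2 * k" using S_piece(2)[OF a, of r s] by blast
  have "P i j a \<noteq> 0"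
  proof
    assume "P i j a = 0"
    then show False using nz S_piece(1)[OF a, of i j] by (simp add: ij)
  qed
  then have "i \<le> n \<and> j \<le> n" using n[of i j] by (meson not_le)
  then show "(r, s) \<in> (\<lambda>(i, j). (real i - 2 * h, real j - 2 * k)) ` ({..n} \<times> {..n})"
    unfolding ij by (intro image_eqI[of _ _ "(i, j)"]) auto
qed

lemma finite_S: "a \<in> gtotal sF F \<Longrightarrow> finite {(r, s). S a r s \<noteq> 0}"
proof (induction rule: F.total_induct)
  case (piece h k a)
  obtain n where "\<And>i j. n < i \<or> n < j \<Longrightarrow> P i j a = 0" by (rule P_bound[OF piece], rule that; assumption)
  from S_support_piece[OF piece this] show ?case by (rule finite_subset) auto
next
  case (add v w)
  have "{(r, s). S (v + w) r s \<noteq> 0} \<subseteq> {(r, s). S v r s \<noteq> 0} \<union> {(r, s). S w r s \<noteq> 0}"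
    by (auto simp: S_add[OF add(1,2)])
  then show ?case by (rule finite_subset) (use add in simp)
qed

section \<open>States annihilated by \<open>L 1\<close> and \<open>L' 1\<close>\<close>

lemma L_one_vac: "L 1 vac = 0" "L' 1 vac = 0"
proof -
  have neg: "- 3 \<notin> (\<nat> :: real set)" by (auto elim!: Nats_cases)
  show "L 1 vac = 0" using creation_regular[OF conformal_vectors(1), of "- 3" 0] neg by (auto simp: L_eq)
  show "L' 1 vac = 0" using creation_regular[OF conformal_vectors(2), of 0 "- 3"] neg by (auto simp: L'_eq)
qed

text \<open>\<open>[L 1, L (- 2)] vac = 3 L (- 1) vac\<close>, and
  \<open>L (- 1) vac = D vac\<close> vanishes because \<open>Y vac\<close> is the identity. Together
  with \<open>L'_one_omega\<close> this reduces \<open>S_z \<omega>\<close> to the single term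
  \<open>z^(-4) \<omega>\<close>.\<close>

lemma L_one_omega: "L 1 \<omega> = 0"
proof -
  obtain c where c: "virasoro_on sF (gtotal sF F) L c" using virasoro by blast
  have "L 1 (L (- 2) vac) - L (- 2) (L 1 vac) = sF (of_int (1 - (- 2))) (L (1 + (- 2)) vac)
       + (if (1::int) + (- 2) = 0 then sF (of_int (1 ^ 3 - 1) / 12 * c) vac else 0)"
    using c vac_total unfolding virasoro_on_def by blast
  moreover have "L (- 2) vac = \<omega>" using creation[OF conformal_vectors(1)] by (simp add: L_eq)
  moreover have "L (- 1) vac = 0"
    using L_minus_one[OF vac_total] vacuum_identity[OF vac_total, of 1 0] by (simp add: deriv_op_def)
  ultimately show ?thesis by (simp add: L_one_vac L_zero_arg)
qed

lemma L'_one_omega': "L' 1 \<omega>' = 0"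
proof -
  obtain c where c: "virasoro_on sF (gtotal sF F) L' c" using virasoro_bar by blast
  have "L' 1 (L' (- 2) vac) - L' (- 2) (L' 1 vac) = sF (of_int (1 - (- 2))) (L' (1 + (- 2)) vac)
       + (if (1::int) + (- 2) = 0 then sF (of_int (1 ^ 3 - 1) / 12 * c) vac else 0)"
    using c vac_total unfolding virasoro_on_def by blast
  moreover have "L' (- 2) vac = \<omega>'" using creation[OF conformal_vectors(2)] by (simp add: L'_eq)
  moreover have "L' (- 1) vac = 0"
    using L_bar_minus_one[OF vac_total] vacuum_identity[OF vac_total, of 0 1] by (simp add: deriv_op_bar_def)
  ultimately show ?thesis by (simp add: L_one_vac L_zero_arg)
qed

text \<open>With \<open>\<omega> = Y \<omega> 0 0 vac\<close> the operator \<open>L' 1\<close>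
  passes through the holomorphic mode to the vacuum.\<close>

lemma L'_one_omega: "L' 1 \<omega> = 0"
proof -
  have "L' 1 (Y \<omega> 0 0 vac) = Y \<omega> 0 0 (L' 1 vac)"
    unfolding L'_eq
    by (rule holomorphic_antiholomorphic_commute[OF omega_piece omega_hol omega'_piece omega'_antihol vacuum_degree, symmetric])
  then show ?thesis
    by (simp add: creation[OF conformal_vectors(1)] L_one_vac YM_zero_right[OF conformal_vectors(1)])
qed

lemma L_one_omega': "L 1 \<omega>' = 0"
proof -
  have "L 1 (Y \<omega>' 0 0 vac) = Y \<omega>' 0 0 (L 1 vac)"
    unfolding L_eq
    by (rule holomorphic_antiholomorphic_commute[OF omega_piece omega_hol omega'_piece omega'_antihol vacuum_degree])
  then show ?thesis
    by (simp add: creation[OF conformal_vectors(2)] L_one_vac YM_zero_right[OF conformal_vectors(2)])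
qed

lemma P_primary:
  assumes "L 1 a = 0" "L' 1 a = 0" "0 < i \<or> 0 < j"
  shows "P i j a = 0"
proof -
  have z: "divided_power sF (L 1) n 0 = 0" "divided_power sF (L' 1) n 0 = 0" for n
    by (induction n) (simp_all add: L_zero_arg)
  have s: "divided_power sF f (Suc n) v = 0" if f: "f v = 0" "f 0 = 0" for f n v
  proof (induction n)
    case (Suc n)
    then show ?case unfolding divided_power.simps(2)[of _ _ "Suc n"] by (simp only: f F.scale_zero_right)
  qed (simp add: f)
  show ?thesis
  proof (cases j)
    case 0
    then obtain i' where "i = Suc i'" using assms(3) by (cases i) auto
    then show ?thesis unfolding P_def 0 by (simp only: divided_power.simps(1) s[OF assms(1) L_zero_arg(1)])
  next
    case (Suc j')
    then show ?thesis unfolding P_def by (simp only: s[OF assms(2) L_zero_arg(2)] z)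
  qed
qed

end

section \<open>The contragredient module\<close>

lemma sum_atMost_reduce:
  fixes f :: "nat \<Rightarrow> 'a::comm_monoid_add"
  assumes "n \<le> K" "\<And>i. n < i \<Longrightarrow> f i = 0"
  shows "(\<Sum>i\<le>K. f i) = (\<Sum>i\<le>n. f i)"
  by (rule sum.mono_neutral_right) (use assms in auto)

lemma sum_atMost_reduce4:
  fixes f :: "nat \<Rightarrow> nat \<Rightarrow> nat \<Rightarrow> nat \<Rightarrow> 'a::comm_monoid_add"
  assumes n: "n \<le> K" and z: "\<And>i j k l. n < i \<or> n < j \<or> n < k \<or> n < l \<Longrightarrow> f i j k l = 0"
  shows "(\<Sum>i\<le>K. \<Sum>j\<le>K. \<Sum>k\<le>K. \<Sum>l\<le>K. f i j k l) = (\<Sum>i\<le>n. \<Sum>j\<le>n. \<Sum>k\<le>n. \<Sum>l\<le>n. f i j k l)"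
proof -
  have "(\<Sum>i\<le>K. \<Sum>j\<le>K. \<Sum>k\<le>K. \<Sum>l\<le>K. f i j k l) = (\<Sum>i\<le>n. \<Sum>j\<le>K. \<Sum>k\<le>K. \<Sum>l\<le>K. f i j k l)"
    by (rule sum_atMost_reduce[OF n]) (simp add: z)
  also have "\<dots> = (\<Sum>i\<le>n. \<Sum>j\<le>n. \<Sum>k\<le>K. \<Sum>l\<le>K. f i j k l)"
    by (rule sum.cong[OF refl], rule sum_atMost_reduce[OF n]) (simp add: z)
  also have "\<dots> = (\<Sum>i\<le>n. \<Sum>j\<le>n. \<Sum>k\<le>n. \<Sum>l\<le>K. f i j k l)"
    by (rule sum.cong[OF refl], rule sum.cong[OF refl], rule sum_atMost_reduce[OF n]) (simp add: z)
  also have "\<dots> = (\<Sum>i\<le>n. \<Sum>j\<le>n. \<Sum>k\<le>n. \<Sum>l\<le>n. f i j k l)"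
    by (rule sum.cong[OF refl], rule sum.cong[OF refl], rule sum.cong[OF refl], rule sum_atMost_reduce[OF n]) (simp add: z)
  finally show ?thesis .
qed

lemma sum_swap4:
  fixes f :: "'i \<Rightarrow> 'i \<Rightarrow> 'i \<Rightarrow> 'i \<Rightarrow> 'a::comm_monoid_add"
  shows "(\<Sum>l\<in>A. \<Sum>l'\<in>A. \<Sum>i\<in>A. \<Sum>i'\<in>A. f i l i' l') = (\<Sum>i\<in>A. \<Sum>l\<in>A. \<Sum>i'\<in>A. \<Sum>l'\<in>A. f i l i' l')"
proof -
  have "(\<Sum>l\<in>A. \<Sum>l'\<in>A. \<Sum>i\<in>A. \<Sum>i'\<in>A. f i l i' l') = (\<Sum>l\<in>A. \<Sum>i\<in>A. \<Sum>l'\<in>A. \<Sum>i'\<in>A. f i l i' l')"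
    by (rule sum.cong[OF refl], rule sum.swap)
  also have "\<dots> = (\<Sum>i\<in>A. \<Sum>l\<in>A. \<Sum>l'\<in>A. \<Sum>i'\<in>A. f i l i' l')"
    by (rule sum.swap)
  also have "\<dots> = (\<Sum>i\<in>A. \<Sum>l\<in>A. \<Sum>i'\<in>A. \<Sum>l'\<in>A. f i l i' l')"
    by (rule sum.cong[OF refl], rule sum.cong[OF refl], rule sum.swap)
  finally show ?thesis .
qed

text \<open>The exponents for a state of degree \<open>(h, k)\<close> are \<open>i - 2h\<close> and
  \<open>j - 2k\<close>, and \<open>h - k\<close> is integral unless the state is 0.\<close>

lemma (in full_vertex_operator_algebra) S_int:
  "a \<in> gtotal sF F \<Longrightarrow> S a r s \<noteq> 0 \<Longrightarrow> r - s \<in> \<int>"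
proof (induction arbitrary: r s rule: F.total_induct)
  case (piece h k a)
  then obtain i j where ij: "r = real i - 2 * h" "s = real j - 2 * k" using S_piece(2)[OF piece(1), of r s] by blast
  have "h - k \<in> \<int>"
  proof (rule ccontr)
    assume "h - k \<notin> \<int>"
    then have "a = 0" using integral_spin piece(1) by blast
    then have "S a r s = 0" using S_scale[OF F.total_zero, of 0 r s] by simp
    then show False using piece by simp
  qed
  then have "of_int (int i - int j) - 2 * (h - k) \<in> \<int>"
    by (intro Ints_diff[OF Ints_of_int] Ints_mult) simp_all
  then show ?case by (simp add: ij algebra_simps)
next
  case (add v w)
  have "S v r s \<noteq> 0 \<or> S w r s \<noteq> 0"
  proof (rule ccontr)
    assume "\<not> ?thesis"
    then have "S (v + w) r s = 0" unfolding S_add[OF add(1,2)] by simp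
    then show False using add.prems by simp
  qed
  then show ?case using add.IH by blast
qed

context full_vertex_operator_module
begin

abbreviation "Yv \<equiv> contragredient sF F Y \<omega> \<omega>' sM M YM"
abbreviation "functional u \<equiv> linear_map_on sM (*) (gtotal sM M) u"

lemma functional_at_zero: "functional u \<Longrightarrow> u 0 = 0"
  using linear_map_onD(2)[of sM "(*)" "gtotal sM M" u 0 0] M.total_zero by simp

lemma dual_functional: "u \<in> graded_dual sM M \<Longrightarrow> functional u"
  using M.dual_linear_total by blast

text \<open>Enlarging the index set to a finite superset of the support lets the sums for several
  states run over the same set.\<close>

lemma contra_on:
  assumes u: "functional u" and v: "v \<in> gtotal sM M" and I: "finite I" "{(r, s). alg.S a r s \<noteq> 0} \<subseteq> I"
  shows "Yv a x y u v = (\<Sum>(r, s)\<in>I. u (YM (alg.S a r s) (r - x) (s - y) v))"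
proof -
  have "(\<Sum>(r, s)\<in>{(r, s). alg.S a r s \<noteq> 0}. u (YM (alg.S a r s) (r - x) (s - y) v)) =
    (\<Sum>(r, s)\<in>I. u (YM (alg.S a r s) (r - x) (s - y) v))"
    by (rule sum.mono_neutral_left[OF I]) (auto simp: YM_zero_left[OF v] functional_at_zero[OF u])
  then show ?thesis using v by (simp add: contragredient_def)
qed

lemma contra_add_left:
  assumes u: "functional u" and ab: "a \<in> gtotal sF F" "b \<in> gtotal sF F"
  shows "Yv (a + b) x y u v = Yv a x y u v + Yv b x y u v"
proof (cases "v \<in> gtotal sM M")
  case True
  let ?I = "{(r, s). alg.S a r s \<noteq> 0} \<union> {(r, s). alg.S b r s \<noteq> 0}"
  have I: "finite ?I" using alg.finite_S[OF ab(1)] alg.finite_S[OF ab(2)] by simp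
  have 1: "Yv (a + b) x y u v = (\<Sum>(r, s)\<in>?I. u (YM (alg.S (a + b) r s) (r - x) (s - y) v))"
    by (rule contra_on[OF u True I]) (auto simp: alg.S_add[OF ab])
  have 2: "Yv a x y u v = (\<Sum>(r, s)\<in>?I. u (YM (alg.S a r s) (r - x) (s - y) v))"
    by (rule contra_on[OF u True I]) auto
  have 3: "Yv b x y u v = (\<Sum>(r, s)\<in>?I. u (YM (alg.S b r s) (r - x) (s - y) v))"
    by (rule contra_on[OF u True I]) auto
  show ?thesis
    unfolding 1 2 3 sum.distrib[symmetric]
    by (rule sum.cong[OF refl])
      (auto simp: alg.S_add[OF ab] YM_add_left[OF alg.S_total[OF ab(1)] alg.S_total[OF ab(2)] True]
        linear_map_onD(1)[OF u endomorphism[OF alg.S_total[OF ab(1)] True] endomorphism[OF alg.S_total[OF ab(2)] True]])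
qed (simp add: contragredient_def)

lemma contra_scale_left:
  assumes u: "functional u" and a: "a \<in> gtotal sF F"
  shows "Yv (sF c a) x y u v = c * Yv a x y u v"
proof (cases "v \<in> gtotal sM M")
  case True
  let ?I = "{(r, s). alg.S a r s \<noteq> 0}"
  have I: "finite ?I" by (rule alg.finite_S[OF a])
  have 1: "Yv (sF c a) x y u v = (\<Sum>(r, s)\<in>?I. u (YM (alg.S (sF c a) r s) (r - x) (s - y) v))"
    by (rule contra_on[OF u True I]) (auto simp: alg.S_scale[OF a])
  have 2: "Yv a x y u v = (\<Sum>(r, s)\<in>?I. u (YM (alg.S a r s) (r - x) (s - y) v))"
    by (rule contra_on[OF u True I]) auto
  show ?thesis
    unfolding 1 2 sum_distrib_left
    by (rule sum.cong[OF refl])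
      (auto simp: alg.S_scale[OF a] YM_scale_left[OF alg.S_total[OF a] True]
        linear_map_onD(2)[OF u endomorphism[OF alg.S_total[OF a] True]])
qed (simp add: contragredient_def)

lemma contra_functional:
  assumes u: "functional u" and a: "a \<in> gtotal sF F"
  shows "functional (Yv a x y u)"
  unfolding linear_map_on_def
proof (intro conjI ballI allI)
  fix v w assume vw: "v \<in> gtotal sM M" "w \<in> gtotal sM M"
  show "Yv a x y u (v + w) = Yv a x y u v + Yv a x y u w"
    using vw M.total_add[OF vw]
    by (simp add: contragredient_def YM_add_right[OF alg.S_total[OF a] vw] case_prod_unfold sum.distrib
        linear_map_onD(1)[OF u endomorphism[OF alg.S_total[OF a] vw(1)] endomorphism[OF alg.S_total[OF a] vw(2)]])
next
  fix c v assume v: "v \<in> gtotal sM M"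
  show "Yv a x y u (sM c v) = c * Yv a x y u v"
    using v M.total_scale[OF v]
    by (simp add: contragredient_def YM_scale_right[OF alg.S_total[OF a] v] case_prod_unfold sum_distrib_left
        linear_map_onD(2)[OF u endomorphism[OF alg.S_total[OF a] v]])
qed

lemma contra_add_right: "Yv a x y (u + w) = Yv a x y u + Yv a x y w"
  by (rule ext) (simp add: contragredient_def case_prod_unfold sum.distrib)

lemma contra_scale_right: "Yv a x y (fun_scale c u) = fun_scale c (Yv a x y u)"
  by (rule ext) (simp add: contragredient_def fun_scale_def case_prod_unfold sum_distrib_left)

text \<open>The free bound \<open>n\<close> allows different states to be expanded over the same
  range of indices.\<close>

lemma contra_homogeneous:
  assumes a: "a \<in> F h k" and n: "\<And>i j. n < i \<or> n < j \<Longrightarrow> alg.P i j a = 0"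
    and u: "functional u" and v: "v \<in> gtotal sM M"
  shows "Yv a x y u v = (\<Sum>i\<le>n. \<Sum>j\<le>n. sign_pow (h - k) * u (YM (alg.P i j a) (real i - 2 * h - x) (real j - 2 * k - y) v))"
proof -
  let ?g = "\<lambda>(i, j). (real i - 2 * h, real j - 2 * k)"
  have tot: "alg.P i j a \<in> gtotal sF F" for i j by (rule alg.F.total_base[OF alg.P_piece[OF a]])
  have inj: "inj_on ?g ({..n} \<times> {..n})" by (auto simp: inj_on_def)
  have "Yv a x y u v = (\<Sum>(r, s)\<in>?g ` ({..n} \<times> {..n}). u (YM (alg.S a r s) (r - x) (s - y) v))"
    by (rule contra_on[OF u v _ alg.S_support_piece[OF a n]]) simp_all
  also have "\<dots> = (\<Sum>(i, j)\<in>{..n} \<times> {..n}. u (YM (alg.S a (real i - 2 * h) (real j - 2 * k)) (real i - 2 * h - x) (real j - 2 * k - y) v))"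
    by (subst sum.reindex[OF inj]) (simp add: case_prod_unfold)
  also have "\<dots> = (\<Sum>(i, j)\<in>{..n} \<times> {..n}. sign_pow (h - k) * u (YM (alg.P i j a) (real i - 2 * h - x) (real j - 2 * k - y) v))"
    by (simp add: alg.S_piece(1)[OF a] YM_scale_left[OF tot v] linear_map_onD(2)[OF u endomorphism[OF tot v]])
  finally show ?thesis by (simp add: sum.cartesian_product)
qed

lemma contra_primary:
  assumes a: "a \<in> F h k" "alg.L 1 a = 0" "alg.L' 1 a = 0" and u: "functional u" and v: "v \<in> gtotal sM M"
  shows "Yv a x y u v = sign_pow (h - k) * u (YM a (- 2 * h - x) (- 2 * k - y) v)"
  using contra_homogeneous[OF a(1) _ u v, of 0 x y] alg.P_primary[OF a(2,3)] by simp

text \<open>\<open>L(1)^i\<close> lowers the degree of the state by \<open>i\<close>, and its power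
  of \<open>z\<close> raises the exponent by \<open>i\<close>. So all terms of \<open>S_z a\<close>
  shift degrees equally: a vector of degree \<open>h2\<close> is sent to degree
  \<open>h2 - h - x\<close>, which must be \<open>h'\<close>.\<close>

lemma contra_piece:
  assumes a: "a \<in> F h k" and u: "u \<in> dual_piece sM M h' k'"
  shows "Yv a x y u \<in> dual_piece sM M (h + h' + x) (k + k' + y)"
  unfolding dual_piece_def mem_Collect_eq
proof (intro conjI allI impI ballI)
  have fu: "functional u" using u by (simp add: dual_piece_def)
  show "functional (Yv a x y u)" by (rule contra_functional[OF fu alg.F.total_base[OF a]])
  fix v
  show "v \<notin> gtotal sM M \<Longrightarrow> Yv a x y u v = 0" by (simp add: contragredient_def)
  fix h2 k2 assume ne: "(h2, k2) \<noteq> (h + h' + x, k + k' + y)" and v: "v \<in> M h2 k2"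
  obtain n where n: "\<And>i j. n < i \<or> n < j \<Longrightarrow> alg.P i j a = 0" by (rule alg.P_bound[OF a], rule that; assumption)
  have "u (YM (alg.P i j a) (real i - 2 * h - x) (real j - 2 * k - y) v) = 0" for i j
  proof (rule M.dual_piece_linear(4)[OF u])
    show "YM (alg.P i j a) (real i - 2 * h - x) (real j - 2 * k - y) v \<in>
      M (h - real i + h2 + (real i - 2 * h - x)) (k - real j + k2 + (real j - 2 * k - y))"
      by (rule YM_piece[OF alg.P_piece[OF a] v])
    show "(h - real i + h2 + (real i - 2 * h - x), k - real j + k2 + (real j - 2 * k - y)) \<noteq> (h', k')"
      using ne by auto
  qed
  then show "Yv a x y u v = 0"
    by (subst contra_homogeneous[OF a n fu M.total_base[OF v]]) simp_all
qed

sublocale D: bigraded_space fun_scale "dual_piece sM M"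
  by (rule M.dual_bigraded)

lemma contra_total:
  assumes a: "a \<in> gtotal sF F" and u: "u \<in> graded_dual sM M"
  shows "Yv a x y u \<in> graded_dual sM M"
  using a
proof (induction rule: alg.F.total_induct)
  case (piece h k a)
  show ?case using u
  proof (induction rule: D.total_induct)
    case (piece h' k' u)
    show ?case by (rule D.total_base[OF contra_piece[OF \<open>a \<in> F h k\<close> piece]])
  next
    case (add u w)
    then show ?case unfolding contra_add_right by (intro D.total_add)
  qed
next
  case (add a b)
  have "Yv (a + b) x y u = Yv a x y u + Yv b x y u"
    by (rule ext) (simp add: contra_add_left[OF dual_functional[OF u] add(1,2)])
  then show ?case using D.total_add[OF add.IH] by (simp only:)
qed

text \<open>Only finitely many coefficients of \<open>S_z a\<close> occur, and each contributes a
  reflected and translated copy of a countable support.\<close>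

lemma contra_support:
  assumes a: "a \<in> gtotal sF F"
  shows "admissible_support {(x, y). \<exists>u\<in>graded_dual sM M. Yv a x y u \<noteq> 0}"
proof -
  define I where "I = {(r, s). alg.S a r s \<noteq> 0}"
  define Z where "Z r s = {(X, Y). \<exists>v\<in>gtotal sM M. YM (alg.S a r s) X Y v \<noteq> 0}" for r s
  have Z: "countable (Z r s)" "\<And>X Y. (X, Y) \<in> Z r s \<Longrightarrow> X - Y \<in> \<int>" for r s
    using support[OF alg.S_total[OF a]] unfolding admissible_support_def Z_def by auto
  have ex: "\<exists>r s. (r, s) \<in> I \<and> (r - x, s - y) \<in> Z r s" if u: "u \<in> graded_dual sM M" and nz: "Yv a x y u \<noteq> 0" for x y u
  proof -
    obtain v where v: "Yv a x y u v \<noteq> 0" using nz by (auto simp: fun_eq_iff)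
    then have vt: "v \<in> gtotal sM M" by (auto simp: contragredient_def split: if_splits)
    have "(\<Sum>t\<in>I. case t of (r, s) \<Rightarrow> u (YM (alg.S a r s) (r - x) (s - y) v)) \<noteq> 0"
      using v vt by (simp add: contragredient_def I_def)
    then obtain t where t: "t \<in> I" "(case t of (r, s) \<Rightarrow> u (YM (alg.S a r s) (r - x) (s - y) v)) \<noteq> 0"
      using sum.not_neutral_contains_not_neutral by blast
    obtain r s where rs: "t = (r, s)" by force
    have "YM (alg.S a r s) (r - x) (s - y) v \<noteq> 0"
      using t(2) functional_at_zero[OF dual_functional[OF u]] by (auto simp: rs)
    then have "(r - x, s - y) \<in> Z r s" using vt by (auto simp: Z_def)
    then show ?thesis using t(1) rs by blast
  qed
  have "countable (\<Union>(r, s)\<in>I. (\<lambda>(X, Y). (r - X, s - Y)) ` Z r s)"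
    using alg.finite_S[OF a] Z(1) by (intro countable_UN) (auto simp: I_def intro: countable_finite)
  moreover have "{(x, y). \<exists>u\<in>graded_dual sM M. Yv a x y u \<noteq> 0} \<subseteq> (\<Union>(r, s)\<in>I. (\<lambda>(X, Y). (r - X, s - Y)) ` Z r s)"
  proof clarify
    fix x y u assume "u \<in> graded_dual sM M" "Yv a x y u \<noteq> 0"
    then obtain r s where rs: "(r, s) \<in> I" "(r - x, s - y) \<in> Z r s" using ex by blast
    have "(x, y) = (\<lambda>(X, Y). (r - X, s - Y)) (r - x, s - y)" by simp
    then show "(x, y) \<in> (\<Union>(r, s)\<in>I. (\<lambda>(X, Y). (r - X, s - Y)) ` Z r s)" using rs by blast
  qed
  moreover have "x - y \<in> \<int>" if u: "u \<in> graded_dual sM M" "Yv a x y u \<noteq> 0" for x y u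
  proof -
    obtain r s where rs: "(r, s) \<in> I" "(r - x, s - y) \<in> Z r s" using ex[OF u] by blast
    have "r - s \<in> \<int>" using alg.S_int[OF a, of r s] rs(1) by (auto simp: I_def)
    then have "(r - s) - ((r - x) - (s - y)) \<in> \<int>" by (rule Ints_diff[OF _ Z(2)[OF rs(2)]])
    then show ?thesis by simp
  qed
  ultimately show ?thesis
    unfolding admissible_support_def by (auto intro: countable_subset)
qed

text \<open>Inversion of the variable turns the truncation of \<open>YM\<close> into an upper bound
  on exponents. The lower bound comes from the degrees instead: those of \<open>M\<close> are
  bounded below, hence so are those of the dual, and high modes map into trivial pieces.\<close>

lemma contra_truncation:
  assumes a: "a \<in> gtotal sF F" and u: "u \<in> graded_dual sM M"
  shows "\<exists>N. \<forall>r s. r \<ge> N \<or> s \<ge> N \<longrightarrow> mode Yv a r s u = 0"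
  using a
proof (induction rule: alg.F.total_induct)
  case (piece h k a)
  obtain N where N: "\<And>h k. h \<le> N \<or> k \<le> N \<Longrightarrow> M h k = {0}"
    using module_bounded_below unfolding degrees_bounded_below_def by blast
  show ?case using u
  proof (induction rule: D.total_induct)
    case (piece h' k' u)
    have "mode Yv a r s u = 0" if "r \<ge> \<bar>h + h' - N\<bar> + \<bar>k + k' - N\<bar> \<or> s \<ge> \<bar>h + h' - N\<bar> + \<bar>k + k' - N\<bar>" for r s
    proof -
      have "h + h' + (- r - 1) \<le> N \<or> k + k' + (- s - 1) \<le> N" using that by linarith
      then have "dual_piece sM M (h + h' + (- r - 1)) (k + k' + (- s - 1)) = {0}"
        using M.dual_piece_trivial N by blast
      then show ?thesis
        using contra_piece[OF \<open>a \<in> F h k\<close> piece, of "- r - 1" "- s - 1"] unfolding mode_def by simp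
    qed
    then show ?case by blast
  next
    case (add u w)
    then obtain N1 N2 where "\<And>r s. r \<ge> N1 \<or> s \<ge> N1 \<Longrightarrow> mode Yv a r s u = 0"
      "\<And>r s. r \<ge> N2 \<or> s \<ge> N2 \<Longrightarrow> mode Yv a r s w = 0" by blast
    then have "r \<ge> max N1 N2 \<or> s \<ge> max N1 N2 \<longrightarrow> mode Yv a r s (u + w) = 0" for r s
      by (simp add: mode_def contra_add_right)
    then show ?case by blast
  qed
next
  case (add a b)
  then obtain N1 N2 where N: "\<And>r s. r \<ge> N1 \<or> s \<ge> N1 \<Longrightarrow> mode Yv a r s u = 0"
    "\<And>r s. r \<ge> N2 \<or> s \<ge> N2 \<Longrightarrow> mode Yv b r s u = 0" by blast
  have "mode Yv (a + b) r s u = mode Yv a r s u + mode Yv b r s u" for r s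
    unfolding mode_def by (rule ext) (simp add: contra_add_left[OF dual_functional[OF u] add(1,2)])
  then have "r \<ge> max N1 N2 \<or> s \<ge> max N1 N2 \<longrightarrow> mode Yv (a + b) r s u = 0" for r s
    using N by simp
  then show ?case by blast
qed

section \<open>The vacuum and the grading operators on the dual\<close>

lemma contra_vacuum:
  assumes u: "u \<in> graded_dual sM M"
  shows "Yv vac x y u = (if x = 0 \<and> y = 0 then u else 0)"
proof (rule ext)
  fix v
  show "Yv vac x y u v = (if x = 0 \<and> y = 0 then u else 0) v"
  proof (cases "v \<in> gtotal sM M")
    case True
    show ?thesis
      using contra_primary[OF alg.vacuum_degree alg.L_one_vac dual_functional[OF u] True, of x y]
        vacuum_identity[OF True, of "- x" "- y"] functional_at_zero[OF dual_functional[OF u]]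
      by (simp add: sign_pow_0)
  next
    case False
    then have "u v = 0" using M.dual_linear_total[OF u] by blast
    then show ?thesis using False by (simp add: contragredient_def)
  qed
qed

text \<open>As \<open>\<omega>\<close> has degree (2, 0) and is annihilated by \<open>L 1\<close>
  and \<open>L' 1\<close>, the exponent \<open>- 2\<close> of \<open>L 0\<close> is sent to
  \<open>- 2 * 2 - (- 2) = - 2\<close> with sign \<open>(- 1)^2 = 1\<close>. Thus \<open>L 0\<close>
  on the dual is the transpose of \<open>L 0\<close> on \<open>M\<close>.\<close>

lemma contra_L_zero:
  assumes u: "u \<in> dual_piece sM M h k"
  shows "L_op Yv \<omega> 0 u = fun_scale (of_real h) u"
proof (rule M.dual_piece_ext)
  have fu: "functional u" using u by (simp add: dual_piece_def)
  have e: "L_op Yv \<omega> 0 u = Yv \<omega> (- 2) 0 u" by (simp add: L_op_def mode_def)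
  show "L_op Yv \<omega> 0 u \<in> dual_piece sM M h k"
    using contra_piece[OF alg.omega_piece u, of "- 2" 0] by (simp add: e)
  show "fun_scale (of_real h) u \<in> dual_piece sM M h k" by (rule D.piece_scale[OF u])
  fix v assume v: "v \<in> M h k"
  have "L_op Yv \<omega> 0 u v = sign_pow 2 * u (YM \<omega> (- 2) 0 v)"
    using contra_primary[OF alg.omega_piece alg.L_one_omega alg.L'_one_omega fu M.total_base[OF v], of "- 2" 0] by (simp add: e)
  also have "YM \<omega> (- 2) 0 v = sM (of_real h) v"
    using module_L_zero[OF v] by (simp add: L_op_def mode_def)
  finally show "L_op Yv \<omega> 0 u v = fun_scale (of_real h) u v"
    using linear_map_onD(2)[OF fu M.total_base[OF v]] by (simp add: fun_scale_def sign_pow_def)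
qed

lemma contra_L_bar_zero:
  assumes u: "u \<in> dual_piece sM M h k"
  shows "L_op_bar Yv \<omega>' 0 u = fun_scale (of_real k) u"
proof (rule M.dual_piece_ext)
  have fu: "functional u" using u by (simp add: dual_piece_def)
  have e: "L_op_bar Yv \<omega>' 0 u = Yv \<omega>' 0 (- 2) u" by (simp add: L_op_bar_def mode_def)
  show "L_op_bar Yv \<omega>' 0 u \<in> dual_piece sM M h k"
    using contra_piece[OF alg.omega'_piece u, of 0 "- 2"] by (simp add: e)
  show "fun_scale (of_real k) u \<in> dual_piece sM M h k" by (rule D.piece_scale[OF u])
  fix v assume v: "v \<in> M h k"
  have "L_op_bar Yv \<omega>' 0 u v = sign_pow (- 2) * u (YM \<omega>' 0 (- 2) v)"
    using contra_primary[OF alg.omega'_piece alg.L_one_omega' alg.L'_one_omega' fu M.total_base[OF v], of 0 "- 2"] by (simp add: e)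
  also have "YM \<omega>' 0 (- 2) v = sM (of_real k) v"
    using module_L_bar_zero[OF v] by (simp add: L_op_bar_def mode_def)
  finally show "L_op_bar Yv \<omega>' 0 u v = fun_scale (of_real k) u v"
    using linear_map_onD(2)[OF fu M.total_base[OF v]] by (simp add: fun_scale_def sign_pow_def power_int_minus)
qed

section \<open>The correlator axiom for the dual\<close>

lemma contra_zero_left: "functional u \<Longrightarrow> Yv 0 x y u v = 0"
  using contra_scale_left[of u 0 0 x y v] alg.F.total_zero by simp

lemma contra_zero_right: "Yv a x y 0 v = 0"
  by (simp add: contragredient_def case_prod_unfold)

text \<open>By \<open>P_mode\<close> the divided powers of \<open>Y a x0 y0 b\<close> are
  combinations of modes of \<open>P i i' a\<close> on \<open>P l l' b\<close>. Negating the upper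
  index turns the coefficients \<open>2 * h + x0 - i - 1 gchoose m\<close> into those of
  \<open>inversion_02\<close> with \<open>\<rho> = i - 2h\<close> and
  \<open>\<tau> = l - 2h'\<close>; the factors \<open>(- 1) ^ m\<close> cancel against those of the
  sign of \<open>w0\<close>.\<close>

lemma contra_mode:
  assumes a: "a \<in> F h k" and b: "b \<in> F h' k'" and ints: "h - k \<in> \<int>" "h' - k' \<in> \<int>"
    and u: "functional u" and v: "v \<in> gtotal sM M"
    and na: "\<And>i j. n < i \<or> n < j \<Longrightarrow> alg.P i j a = 0" and nb: "\<And>i j. n < i \<or> n < j \<Longrightarrow> alg.P i j b = 0"
  shows "Yv (Y a x0 y0 b) x2 y2 u v = (\<Sum>i\<le>n. \<Sum>l\<le>n. \<Sum>i'\<le>n. \<Sum>l'\<le>n. sign_pow (h - k) * sign_pow (h' - k') *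
    inversion_02 (real i - 2 * h) (real i' - 2 * k) (real l - 2 * h') (real l' - 2 * k')
      (\<lambda>X0 Y0 X2 Y2. u (YM (Y (alg.P i i' a) X0 Y0 (alg.P l l' b)) X2 Y2 v)) x0 y0 x2 y2)"
proof -
  let ?W = "\<lambda>i m l i' m' l'. Y (alg.P i i' a) (x0 - real m) (y0 - real m') (alg.P l l' b)"
  have aP: "alg.P i j a \<in> F (h - real i) (k - real j)" and bP: "alg.P i j b \<in> F (h' - real i) (k' - real j)" for i j
    by (rule alg.P_piece[OF a], rule alg.P_piece[OF b])
  have W: "?W i m l i' m' l' \<in> F (h + h' + x0 - real (i + m + l)) (k + k' + y0 - real (i' + m' + l'))" for i m l i' m' l'
    using alg.YM_piece[OF aP[of i i'] bP[of l l'], of "x0 - real m" "y0 - real m'"] by (simp add: algebra_simps)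
  have Wt: "?W i m l i' m' l' \<in> gtotal sF F" for i m l i' m' l' by (rule alg.F.total_base[OF W])
  let ?B = "\<lambda>i i' l l' X0 Y0 X2 Y2. u (YM (Y (alg.P i i' a) X0 Y0 (alg.P l l' b)) X2 Y2 v)"
  let ?inv = "\<lambda>i l i' l'. inversion_02 (real i - 2 * h) (real i' - 2 * k) (real l - 2 * h') (real l' - 2 * k')
      (?B i i' l l') x0 y0 x2 y2"
  have B0: "?B i i' l l' (x0 - real m) (y0 - real m') X2 Y2 = 0" if "?W i m l i' m' l' = 0" for i i' l l' m m' X2 Y2
    by (simp add: that YM_zero_left[OF v] functional_at_zero[OF u])
  have inv0: "?inv i l i' l' = 0" if z: "\<And>m m'. ?W i m l i' m' l' = 0" for i l i' l'
    unfolding inversion_02_def by (simp add: B0[OF z])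
  show ?thesis
  \<comment> \<open>For non-integral \<open>x0 - y0\<close> all modes involved vanish; otherwise the
    signs can be split by \<open>sign_pow_add\<close>, which requires integrality.\<close>
  proof (cases "x0 - y0 \<in> \<int>")
    case False
    have "?W i m l i' m' l' = 0" for i m l i' m' l'
    proof (rule ccontr)
      assume "?W i m l i' m' l' \<noteq> 0"
      then have "(x0 - real m) - (y0 - real m') \<in> \<int>"
        by (rule alg.YM_int[OF alg.F.total_base[OF aP] alg.F.total_base[OF bP]])
      then have "((x0 - real m) - (y0 - real m')) + (real m - real m') \<in> \<int>" by (rule Ints_add) simp
      then show False using False by simp
    qed
    then have "?inv i l i' l' = 0" for i l i' l' by (rule inv0)
    moreover have "Y a x0 y0 b = 0"
      using alg.YM_int[OF alg.F.total_base[OF a] alg.F.total_base[OF b]] False by blast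
    ultimately show ?thesis by (simp add: contra_zero_left[OF u])
  next
    case True
    obtain N where N: "\<And>h k. h \<le> N \<or> k \<le> N \<Longrightarrow> F h k = {0}"
      using alg.bounded_below unfolding degrees_bounded_below_def by blast
    obtain K0 :: nat where K0: "h + h' + x0 - N < real K0 + 1" "k + k' + y0 - N < real K0 + 1" by (rule box_index_exists)
    \<comment> \<open>\<open>K0\<close> bounds how often the degree of \<open>Y a x0 y0 b\<close>
      can be lowered within \<open>F\<close>, so everything beyond \<open>K\<close> is 0;
      \<open>n\<close> is included so that the box can be cut down to \<open>{..n}\<close> at the
      end.\<close>
    define K where "K = max K0 n"
    have small: "w = 0" if w: "w \<in> F (h + h' + x0 - real p) (k + k' + y0 - real q)" and "K < p \<or> K < q" for w p q
    proof -
      have "real K0 + 1 \<le> real p \<or> real K0 + 1 \<le> real q" using that(2) unfolding K_def by linarith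
      then have "h + h' + x0 - real p \<le> N \<or> k + k' + y0 - real q \<le> N" using K0 by linarith
      then show ?thesis using N w by blast
    qed
    have W0: "?W i m l i' m' l' = 0" if "K < i + m + l \<or> K < i' + m' + l'" for i m l i' m' l'
      by (rule small[OF W that])
    let ?d = "Y a x0 y0 b"
    have d: "?d \<in> F (h + h' + x0) (k + k' + y0)" by (rule alg.YM_piece[OF a b])
    define c where "c i m = (of_real (2 * h + x0 - real i - 1 gchoose m) :: complex)" for i m :: nat
    define c' where "c' i m = (of_real (2 * k + y0 - real i - 1 gchoose m) :: complex)" for i m :: nat
    define \<phi> where "\<phi> i m l i' m' l' = c i m * c' i' m' *
      u (YM (?W i m l i' m' l') (real (i + m + l) - 2 * (h + h' + x0) - x2) (real (i' + m' + l') - 2 * (k + k' + y0) - y2) v)"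
      for i m l i' m' l'
    have \<phi>0: "\<phi> i m l i' m' l' = 0" if "K < i + m + l \<or> K < i' + m' + l'" for i m l i' m' l'
      unfolding \<phi>_def W0[OF that] by (simp add: YM_zero_left[OF v] functional_at_zero[OF u])
    let ?s = "sign_pow (h + h' + x0 - (k + k' + y0))"
    have mode: "u (YM (alg.P p q ?d) (real p - 2 * (h + h' + x0) - x2) (real q - 2 * (k + k' + y0) - y2) v) =
      (\<Sum>(i', m', l')\<in>triples q. \<Sum>(i, m, l)\<in>triples p. \<phi> i m l i' m' l')" for p q
    proof -
      let ?g = "\<lambda>w. u (YM w (real p - 2 * (h + h' + x0) - x2) (real q - 2 * (k + k' + y0) - y2) v)"
      have g: "linear_map_on sF (*) (gtotal sF F) ?g"
        unfolding linear_map_on_def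
        by (auto simp: YM_add_left[OF _ _ v] YM_scale_left[OF _ v] linear_map_onD(1)[OF u endomorphism[OF _ v] endomorphism[OF _ v]]
            linear_map_onD(2)[OF u endomorphism[OF _ v]])
      have "?g (alg.P p q ?d) = ?g (\<Sum>t\<in>triples q. case t of (i', m', l') \<Rightarrow>
          (\<Sum>(i, m, l)\<in>triples p. sF (c i m * c' i' m') (?W i m l i' m' l')))"
        unfolding alg.P_mode[OF a b] c_def c'_def ..
      also have "\<dots> = (\<Sum>t\<in>triples q. ?g (case t of (i', m', l') \<Rightarrow>
          (\<Sum>(i, m, l)\<in>triples p. sF (c i m * c' i' m') (?W i m l i' m' l'))))"
        by (rule alg.F.linear_total_sum[OF g])
          (auto simp: case_prod_unfold intro!: alg.F.total_sum alg.F.total_scale Wt)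
      also have "\<dots> = (\<Sum>(i', m', l')\<in>triples q. \<Sum>(i, m, l)\<in>triples p. \<phi> i m l i' m' l')"
      proof (rule sum.cong[OF refl])
        fix t assume t: "t \<in> triples q"
        obtain i' m' l' where t': "t = (i', m', l')" by (metis prod_cases3)
        have q: "i' + m' + l' = q" using t by (simp add: t' triples_def)
        have "?g (\<Sum>w\<in>triples p. case w of (i, m, l) \<Rightarrow> sF (c i m * c' i' m') (?W i m l i' m' l')) =
          (\<Sum>w\<in>triples p. ?g (case w of (i, m, l) \<Rightarrow> sF (c i m * c' i' m') (?W i m l i' m' l')))"
          by (rule alg.F.linear_total_sum[OF g]) (auto simp: case_prod_unfold intro!: alg.F.total_scale Wt)
        also have "\<dots> = (\<Sum>(i, m, l)\<in>triples p. \<phi> i m l i' m' l')"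
        proof (rule sum.cong[OF refl])
          fix w assume w: "w \<in> triples p"
          obtain i m l where w': "w = (i, m, l)" by (metis prod_cases3)
          have p: "i + m + l = p" using w by (simp add: w' triples_def)
          show "?g (case w of (i, m, l) \<Rightarrow> sF (c i m * c' i' m') (?W i m l i' m' l')) = (case w of (i, m, l) \<Rightarrow> \<phi> i m l i' m' l')"
            unfolding w' prod.case \<phi>_def p q using linear_map_onD(2)[OF g Wt] by simp
        qed
        finally show "?g (case t of (i', m', l') \<Rightarrow>
          (\<Sum>(i, m, l)\<in>triples p. sF (c i m * c' i' m') (?W i m l i' m' l'))) =
          (case t of (i', m', l') \<Rightarrow> (\<Sum>(i, m, l)\<in>triples p. \<phi> i m l i' m' l'))"
          unfolding t' prod.case .
      qed
      finally show ?thesis .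
    qed
    have inv: "sign_pow (h - k) * sign_pow (h' - k') * ?inv i l i' l' = (\<Sum>m\<le>K. \<Sum>m'\<le>K. ?s * \<phi> i m l i' m' l')" for i l i' l'
    proof -
      have "?inv i l i' l' = (\<Sum>m\<le>K. \<Sum>m'\<le>K. sign_pow ((x0 - m) - (y0 - m')) *
        (of_real (((real i - 2 * h) - x0 + m) gchoose m) * of_real (((real i' - 2 * k) - y0 + m') gchoose m')) *
        ?B i i' l l' (x0 - m) (y0 - m') ((real i - 2 * h) + (real l - 2 * h') - 2 * x0 + m - x2) ((real i' - 2 * k) + (real l' - 2 * k') - 2 * y0 + m' - y2))"
        unfolding inversion_02_def
      proof (rule sum_support_box)
        fix m m' assume nz: "?B i i' l l' (x0 - real m) (y0 - real m') ((real i - 2 * h) + (real l - 2 * h') - 2 * x0 + m - x2)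
          ((real i' - 2 * k) + (real l' - 2 * k') - 2 * y0 + m' - y2) \<noteq> 0"
        have "\<not> (K < i + m + l \<or> K < i' + m' + l')"
          using nz B0[OF W0] by blast
        then show "m \<le> K \<and> m' \<le> K" by linarith
      qed simp
      moreover have "sign_pow (h - k) * sign_pow (h' - k') * (sign_pow ((x0 - m) - (y0 - m')) *
        (of_real (((real i - 2 * h) - x0 + m) gchoose m) * of_real (((real i' - 2 * k) - y0 + m') gchoose m')) *
        ?B i i' l l' (x0 - m) (y0 - m') ((real i - 2 * h) + (real l - 2 * h') - 2 * x0 + m - x2) ((real i' - 2 * k) + (real l' - 2 * k') - 2 * y0 + m' - y2))
        = ?s * \<phi> i m l i' m' l'" for m m'
      proof -
        have g: "(of_real (((real i - 2 * h) - x0 + m) gchoose m) :: complex) = (- 1) ^ m * c i m"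
        proof -
          have "((real i - 2 * h) - x0 + m) gchoose m = (- 1) ^ m * ((2 * h + x0 - real i - 1) gchoose m)"
            by (subst gbinomial_negated_upper) (simp add: algebra_simps)
          then show ?thesis by (simp add: c_def)
        qed
        have g': "(of_real (((real i' - 2 * k) - y0 + m') gchoose m') :: complex) = (- 1) ^ m' * c' i' m'"
        proof -
          have "((real i' - 2 * k) - y0 + m') gchoose m' = (- 1) ^ m' * ((2 * k + y0 - real i' - 1) gchoose m')"
            by (subst gbinomial_negated_upper) (simp add: algebra_simps)
          then show ?thesis by (simp add: c'_def)
        qed
        have s: "?s = sign_pow (h - k) * sign_pow (h' - k') * sign_pow (x0 - y0)"
        proof -
          have "h + h' + x0 - (k + k' + y0) = (h - k) + (h' - k') + (x0 - y0)" by simp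
          then show ?thesis by (simp only: sign_pow_add[OF Ints_add[OF ints] True] sign_pow_add[OF ints])
        qed
        have e: "(real i - 2 * h) + (real l - 2 * h') - 2 * x0 + m - x2 = real (i + m + l) - 2 * (h + h' + x0) - x2"
          "(real i' - 2 * k) + (real l' - 2 * k') - 2 * y0 + m' - y2 = real (i' + m' + l') - 2 * (k + k' + y0) - y2"
          by simp_all
        have q: "(- 1) ^ m * (- 1) ^ m = (1 :: complex)" "(- 1) ^ m' * (- 1) ^ m' = (1 :: complex)"
          by (simp_all flip: power_mult_distrib)
        have alg: "S1 * (T * (e1 * e2) * (e1 * x * (e2 * y)) * z) = S1 * T * (x * y * z)"
          if "e1 * e1 = 1" "e2 * e2 = 1" for S1 T e1 e2 x y z :: complex
        proof -
          have "S1 * (T * (e1 * e2) * (e1 * x * (e2 * y)) * z) = (e1 * e1) * (e2 * e2) * (S1 * T * (x * y * z))" by (simp only: mult_ac)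
          then show ?thesis by (simp add: that)
        qed
        show ?thesis
          unfolding g g' e s \<phi>_def sign_pow_diff_nat[OF True] by (rule alg[OF q])
      qed
      ultimately show ?thesis by (simp only: sum_distrib_left)
    qed
    have "Yv ?d x2 y2 u v = (\<Sum>p\<le>K. \<Sum>q\<le>K. ?s * (\<Sum>(i', m', l')\<in>triples q. \<Sum>(i, m, l)\<in>triples p. \<phi> i m l i' m' l'))"
      unfolding mode[symmetric]
      by (rule contra_homogeneous[OF d _ u v]) (rule small[OF alg.P_piece[OF d]])
    also have "\<dots> = ?s * (\<Sum>p\<le>K. \<Sum>q\<le>K. \<Sum>(i', m', l')\<in>triples q. \<Sum>(i, m, l)\<in>triples p. \<phi> i m l i' m' l')"
      by (simp only: sum_distrib_left)
    also have "\<dots> = ?s * (\<Sum>i\<le>K. \<Sum>l\<le>K. \<Sum>i'\<le>K. \<Sum>l'\<le>K. \<Sum>m\<le>K. \<Sum>m'\<le>K. \<phi> i m l i' m' l')"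
      by (subst sum_triples_box2[OF \<phi>0]) (assumption, rule refl)
    also have "\<dots> = (\<Sum>i\<le>K. \<Sum>l\<le>K. \<Sum>i'\<le>K. \<Sum>l'\<le>K. sign_pow (h - k) * sign_pow (h' - k') * ?inv i l i' l')"
      unfolding inv by (simp only: sum_distrib_left)
    also have "\<dots> = (\<Sum>i\<le>n. \<Sum>l\<le>n. \<Sum>i'\<le>n. \<Sum>l'\<le>n. sign_pow (h - k) * sign_pow (h' - k') * ?inv i l i' l')"
    proof (rule sum_atMost_reduce4)
      fix i l i' l' assume "n < i \<or> n < l \<or> n < i' \<or> n < l'"
      then have "alg.P i i' a = 0 \<or> alg.P l l' b = 0" using na[of i i'] nb[of l l'] by blast
      then have "?W i m l i' m' l' = 0" for m m'
        using alg.YM_zero_left[OF alg.F.total_base[OF bP]] alg.YM_zero_right[OF alg.F.total_base[OF aP]] by metis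
      then have "?inv i l i' l' = 0" by (rule inv0)
      then show "sign_pow (h - k) * sign_pow (h' - k') * ?inv i l i' l' = 0" by simp
    qed (simp add: K_def)
    finally show ?thesis .
  qed
qed

text \<open>Transposition reverses the order of two operators, so the product with \<open>a\<close>
  on the left is expressed by the correlator of \<open>YM\<close> with \<open>b\<close> on the left.
  Inversion exchanges the two regions as well, which puts each product back in its own
  region.\<close>

lemma contra_correlator_homogeneous:
  assumes a: "a \<in> F h k" and b: "b \<in> F h' k'" and u: "u \<in> graded_dual sM M" and v: "v \<in> gtotal sM M"
  shows "gcor (\<lambda>x1 y1 x2 y2. Yv a x1 y1 (Yv b x2 y2 u) v) (\<lambda>x0 y0 x2 y2. Yv (Y a x0 y0 b) x2 y2 u v)
    (\<lambda>x1 y1 x2 y2. Yv b x2 y2 (Yv a x1 y1 u) v)"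
\<comment> \<open>Without integral spin one of the two pieces is trivial, so \<open>a\<close> or
  \<open>b\<close> is 0.\<close>
proof (cases "h - k \<in> \<int> \<and> h' - k' \<in> \<int>")
  case False
  have fu: "functional u" by (rule dual_functional[OF u])
  have ta: "a \<in> gtotal sF F" and tb: "b \<in> gtotal sF F" by (rule alg.F.total_base[OF a], rule alg.F.total_base[OF b])
  have "Yv a x1 y1 (Yv b x2 y2 u) v = 0 \<and> Yv (Y a x1 y1 b) x2 y2 u v = 0 \<and> Yv b x2 y2 (Yv a x1 y1 u) v = 0" for x1 y1 x2 y2
  proof (cases "a = 0")
    case True
    have "Yv a x1 y1 u = 0" by (rule ext) (simp add: True contra_zero_left[OF fu])
    then have "Yv b x2 y2 (Yv a x1 y1 u) v = 0" by (simp only: contra_zero_right)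
    moreover have "Yv a x1 y1 (Yv b x2 y2 u) v = 0" unfolding True by (rule contra_zero_left[OF contra_functional[OF fu tb]])
    moreover have "Yv (Y a x1 y1 b) x2 y2 u v = 0" unfolding True alg.YM_zero_left[OF tb] by (rule contra_zero_left[OF fu])
    ultimately show ?thesis by blast
  next
    case ne: False
    have b0: "b = 0" using False ne alg.integral_spin a b by blast
    have "Yv b x2 y2 u = 0" by (rule ext) (simp add: b0 contra_zero_left[OF fu])
    then have "Yv a x1 y1 (Yv b x2 y2 u) v = 0" by (simp only: contra_zero_right)
    moreover have "Yv b x2 y2 (Yv a x1 y1 u) v = 0" unfolding b0 by (rule contra_zero_left[OF contra_functional[OF fu ta]])
    moreover have "Yv (Y a x1 y1 b) x2 y2 u v = 0" unfolding b0 alg.YM_zero_right[OF ta] by (rule contra_zero_left[OF fu])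
    ultimately show ?thesis by blast
  qed
  then show ?thesis by (simp only: gcor_zero)
next
  case True
  then have ints: "h - k \<in> \<int>" "h' - k' \<in> \<int>" by blast+
  have fu: "functional u" by (rule dual_functional[OF u])
  have ta: "a \<in> gtotal sF F" and tb: "b \<in> gtotal sF F" by (rule alg.F.total_base[OF a], rule alg.F.total_base[OF b])
  obtain n1 where n1: "\<And>i j. n1 < i \<or> n1 < j \<Longrightarrow> alg.P i j a = 0" by (rule alg.P_bound[OF a], rule that; assumption)
  obtain n2 where n2: "\<And>i j. n2 < i \<or> n2 < j \<Longrightarrow> alg.P i j b = 0" by (rule alg.P_bound[OF b], rule that; assumption)
  \<comment> \<open>One bound for both states, so that all four indices range over the same
    set.\<close>
  define n where "n = max n1 n2"
  have na: "alg.P i j a = 0" if "n < i \<or> n < j" for i j by (rule n1) (use that in \<open>auto simp: n_def\<close>)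
  have nb: "alg.P i j b = 0" if "n < i \<or> n < j" for i j by (rule n2) (use that in \<open>auto simp: n_def\<close>)
  let ?s = "sign_pow (h - k) * sign_pow (h' - k')"
  let ?A = "\<lambda>i l i' l' x1 y1 x2 y2. u (YM (alg.P i i' a) x1 y1 (YM (alg.P l l' b) x2 y2 v))"
  let ?B = "\<lambda>i l i' l' X0 Y0 X2 Y2. u (YM (Y (alg.P i i' a) X0 Y0 (alg.P l l' b)) X2 Y2 v)"
  let ?C = "\<lambda>i l i' l' x1 y1 x2 y2. u (YM (alg.P l l' b) x2 y2 (YM (alg.P i i' a) x1 y1 v))"
  have aP: "alg.P i j a \<in> gtotal sF F" and bP: "alg.P i j b \<in> gtotal sF F" for i j
    by (rule alg.F.total_base[OF alg.P_piece[OF a]], rule alg.F.total_base[OF alg.P_piece[OF b]])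
  have "gcor (?A i l i' l') (?B i l i' l') (?C i l i' l')" for i l i' l'
    unfolding gcor_def by (rule correlator[OF aP bP v u])
  moreover have "(real i - 2 * h) - (real i' - 2 * k) \<in> \<int>" "(real l - 2 * h') - (real l' - 2 * k') \<in> \<int>" for i i' l l'
  proof -
    have "of_int (int i - int i') - 2 * (h - k) \<in> \<int>" "of_int (int l - int l') - 2 * (h' - k') \<in> \<int>"
      using ints by (intro Ints_diff[OF Ints_of_int] Ints_mult; simp)+
    then show "(real i - 2 * h) - (real i' - 2 * k) \<in> \<int>" "(real l - 2 * h') - (real l' - 2 * k') \<in> \<int>"
      by (simp_all add: algebra_simps)
  qed
  ultimately have "gcor (\<lambda>x1 y1 x2 y2. ?C i l i' l' ((real i - 2 * h) - x1) ((real i' - 2 * k) - y1) ((real l - 2 * h') - x2) ((real l' - 2 * k') - y2))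
    (inversion_02 (real i - 2 * h) (real i' - 2 * k) (real l - 2 * h') (real l' - 2 * k') (?B i l i' l'))
    (\<lambda>x1 y1 x2 y2. ?A i l i' l' ((real i - 2 * h) - x1) ((real i' - 2 * k) - y1) ((real l - 2 * h') - x2) ((real l' - 2 * k') - y2))" for i l i' l'
    by (rule gcor_inversion)
  then have g: "gcor
    (\<lambda>x1 y1 x2 y2. \<Sum>i\<le>n. \<Sum>l\<le>n. \<Sum>i'\<le>n. \<Sum>l'\<le>n. ?s * ?C i l i' l' ((real i - 2 * h) - x1) ((real i' - 2 * k) - y1) ((real l - 2 * h') - x2) ((real l' - 2 * k') - y2))
    (\<lambda>x1 y1 x2 y2. \<Sum>i\<le>n. \<Sum>l\<le>n. \<Sum>i'\<le>n. \<Sum>l'\<le>n. ?s * inversion_02 (real i - 2 * h) (real i' - 2 * k) (real l - 2 * h') (real l' - 2 * k') (?B i l i' l') x1 y1 x2 y2)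
    (\<lambda>x1 y1 x2 y2. \<Sum>i\<le>n. \<Sum>l\<le>n. \<Sum>i'\<le>n. \<Sum>l'\<le>n. ?s * ?A i l i' l' ((real i - 2 * h) - x1) ((real i' - 2 * k) - y1) ((real l - 2 * h') - x2) ((real l' - 2 * k') - y2))"
    by (intro gcor_sum gcor_smult finite_atMost)
  have eA: "Yv a x1 y1 (Yv b x2 y2 u) v = (\<Sum>i\<le>n. \<Sum>l\<le>n. \<Sum>i'\<le>n. \<Sum>l'\<le>n. ?s * ?C i l i' l' ((real i - 2 * h) - x1) ((real i' - 2 * k) - y1) ((real l - 2 * h') - x2) ((real l' - 2 * k') - y2))" for x1 y1 x2 y2
  proof -
    have "Yv a x1 y1 (Yv b x2 y2 u) v = (\<Sum>i\<le>n. \<Sum>i'\<le>n. sign_pow (h - k) *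
        Yv b x2 y2 u (YM (alg.P i i' a) (real i - 2 * h - x1) (real i' - 2 * k - y1) v))"
      by (rule contra_homogeneous[OF a na contra_functional[OF fu tb] v])
    also have "\<dots> = (\<Sum>i\<le>n. \<Sum>i'\<le>n. sign_pow (h - k) * (\<Sum>l\<le>n. \<Sum>l'\<le>n. sign_pow (h' - k') *
        ?C i l i' l' ((real i - 2 * h) - x1) ((real i' - 2 * k) - y1) ((real l - 2 * h') - x2) ((real l' - 2 * k') - y2)))"
      by (intro sum.cong refl arg_cong2[where f = "(*)"] contra_homogeneous[OF b nb fu endomorphism[OF aP v]])
    also have "\<dots> = (\<Sum>i\<le>n. \<Sum>i'\<le>n. \<Sum>l\<le>n. \<Sum>l'\<le>n. ?s *
        ?C i l i' l' ((real i - 2 * h) - x1) ((real i' - 2 * k) - y1) ((real l - 2 * h') - x2) ((real l' - 2 * k') - y2))"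
      by (simp only: sum_distrib_left mult.assoc)
    also have "\<dots> = (\<Sum>i\<le>n. \<Sum>l\<le>n. \<Sum>i'\<le>n. \<Sum>l'\<le>n. ?s *
        ?C i l i' l' ((real i - 2 * h) - x1) ((real i' - 2 * k) - y1) ((real l - 2 * h') - x2) ((real l' - 2 * k') - y2))"
      by (rule sum.cong[OF refl], rule sum.swap)
    finally show ?thesis .
  qed
  have eC: "Yv b x2 y2 (Yv a x1 y1 u) v = (\<Sum>i\<le>n. \<Sum>l\<le>n. \<Sum>i'\<le>n. \<Sum>l'\<le>n. ?s * ?A i l i' l' ((real i - 2 * h) - x1) ((real i' - 2 * k) - y1) ((real l - 2 * h') - x2) ((real l' - 2 * k') - y2))" for x1 y1 x2 y2
  proof -
    have "Yv b x2 y2 (Yv a x1 y1 u) v = (\<Sum>l\<le>n. \<Sum>l'\<le>n. sign_pow (h' - k') *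
        Yv a x1 y1 u (YM (alg.P l l' b) (real l - 2 * h' - x2) (real l' - 2 * k' - y2) v))"
      by (rule contra_homogeneous[OF b nb contra_functional[OF fu ta] v])
    also have "\<dots> = (\<Sum>l\<le>n. \<Sum>l'\<le>n. sign_pow (h' - k') * (\<Sum>i\<le>n. \<Sum>i'\<le>n. sign_pow (h - k) *
        ?A i l i' l' ((real i - 2 * h) - x1) ((real i' - 2 * k) - y1) ((real l - 2 * h') - x2) ((real l' - 2 * k') - y2)))"
      by (intro sum.cong refl arg_cong2[where f = "(*)"] contra_homogeneous[OF a na fu endomorphism[OF bP v]])
    also have "\<dots> = (\<Sum>l\<le>n. \<Sum>l'\<le>n. \<Sum>i\<le>n. \<Sum>i'\<le>n. ?s *
        ?A i l i' l' ((real i - 2 * h) - x1) ((real i' - 2 * k) - y1) ((real l - 2 * h') - x2) ((real l' - 2 * k') - y2))"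
      by (simp only: sum_distrib_left mult.assoc mult.left_commute[of "sign_pow (h' - k')" "sign_pow (h - k)"])
    also have "\<dots> = (\<Sum>i\<le>n. \<Sum>l\<le>n. \<Sum>i'\<le>n. \<Sum>l'\<le>n. ?s *
        ?A i l i' l' ((real i - 2 * h) - x1) ((real i' - 2 * k) - y1) ((real l - 2 * h') - x2) ((real l' - 2 * k') - y2))"
      by (rule sum_swap4)
    finally show ?thesis .
  qed
  have eB: "Yv (Y a x0 y0 b) x2 y2 u v = (\<Sum>i\<le>n. \<Sum>l\<le>n. \<Sum>i'\<le>n. \<Sum>l'\<le>n. ?s * inversion_02 (real i - 2 * h) (real i' - 2 * k) (real l - 2 * h') (real l' - 2 * k') (?B i l i' l') x0 y0 x2 y2)" for x0 y0 x2 y2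
    by (rule contra_mode[OF a b ints fu v na nb])
  show ?thesis unfolding eA eB eC by (rule g)
qed

lemma contra_correlator:
  assumes a: "a \<in> gtotal sF F" and b: "b \<in> gtotal sF F" and u: "u \<in> graded_dual sM M" and v: "v \<in> gtotal sM M"
  shows "gcor (\<lambda>x1 y1 x2 y2. Yv a x1 y1 (Yv b x2 y2 u) v) (\<lambda>x0 y0 x2 y2. Yv (Y a x0 y0 b) x2 y2 u v)
    (\<lambda>x1 y1 x2 y2. Yv b x2 y2 (Yv a x1 y1 u) v)"
proof -
  have fu: "functional u" by (rule dual_functional[OF u])
  show ?thesis
    using a
  proof (induction rule: alg.F.total_induct)
    case (piece h k a)
    note pa = piece and ta = alg.F.total_base[OF piece]
    show ?case
      using b
    proof (induction rule: alg.F.total_induct)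
      case (piece h' k' b)
      show ?case by (rule contra_correlator_homogeneous[OF pa piece u v])
    next
      case (add b b')
      have "Yv (b + b') x2 y2 u = Yv b x2 y2 u + Yv b' x2 y2 u" for x2 y2
        by (rule ext) (simp add: contra_add_left[OF fu add(1,2)])
      then have 1: "Yv a x1 y1 (Yv (b + b') x2 y2 u) v = Yv a x1 y1 (Yv b x2 y2 u) v + Yv a x1 y1 (Yv b' x2 y2 u) v" for x1 y1 x2 y2
        by (simp only: contra_add_right plus_fun_apply)
      have 2: "Yv (Y a x0 y0 (b + b')) x2 y2 u v = Yv (Y a x0 y0 b) x2 y2 u v + Yv (Y a x0 y0 b') x2 y2 u v" for x0 y0 x2 y2
        unfolding alg.YM_add_right[OF ta add(1,2)]
        by (rule contra_add_left[OF fu alg.endomorphism[OF ta add(1)] alg.endomorphism[OF ta add(2)]])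
      have 3: "Yv (b + b') x2 y2 (Yv a x1 y1 u) v = Yv b x2 y2 (Yv a x1 y1 u) v + Yv b' x2 y2 (Yv a x1 y1 u) v" for x1 y1 x2 y2
        by (rule contra_add_left[OF contra_functional[OF fu ta] add(1,2)])
      show ?case unfolding 1 2 3 by (rule gcor_add[OF add(3,4)])
    qed
  next
    case (add a a')
    have 1: "Yv (a + a') x1 y1 (Yv b x2 y2 u) v = Yv a x1 y1 (Yv b x2 y2 u) v + Yv a' x1 y1 (Yv b x2 y2 u) v" for x1 y1 x2 y2
      by (rule contra_add_left[OF contra_functional[OF fu b] add(1,2)])
    have 2: "Yv (Y (a + a') x0 y0 b) x2 y2 u v = Yv (Y a x0 y0 b) x2 y2 u v + Yv (Y a' x0 y0 b) x2 y2 u v" for x0 y0 x2 y2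
      unfolding alg.YM_add_left[OF add(1,2) b]
      by (rule contra_add_left[OF fu alg.endomorphism[OF add(1) b] alg.endomorphism[OF add(2) b]])
    have "Yv (a + a') x1 y1 u = Yv a x1 y1 u + Yv a' x1 y1 u" for x1 y1
      by (rule ext) (simp add: contra_add_left[OF fu add(1,2)])
    then have 3: "Yv b x2 y2 (Yv (a + a') x1 y1 u) v = Yv b x2 y2 (Yv a x1 y1 u) v + Yv b x2 y2 (Yv a' x1 y1 u) v" for x1 y1 x2 y2
      by (simp only: contra_add_right plus_fun_apply)
    show ?case unfolding 1 2 3 by (rule gcor_add[OF add(3,4)])
  qed
qed

theorem contragredient_module:
  "full_vertex_operator_module sF F Y vac \<omega> \<omega>' fun_scale (dual_piece sM M) Yv"
proof unfold_locales
  fix a b :: 'a and u v :: "'m \<Rightarrow> complex" and h k h' k' x y r s c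
  show "Yv a x y u \<in> graded_dual sM M" if "a \<in> gtotal sF F" "u \<in> graded_dual sM M"
    by (rule contra_total[OF that])
  show "linear_map_on fun_scale fun_scale (graded_dual sM M) (Yv a x y)"
    unfolding linear_map_on_def by (simp add: contra_add_right contra_scale_right)
  show "linear_map_on sF fun_scale (gtotal sF F) (\<lambda>a. Yv a x y u)" if "u \<in> graded_dual sM M"
    unfolding linear_map_on_def
    by (intro conjI ballI allI ext) (simp_all add: fun_scale_def contra_add_left[OF dual_functional[OF that]] contra_scale_left[OF dual_functional[OF that]])
  show "admissible_support {(x, y). \<exists>u\<in>graded_dual sM M. Yv a x y u \<noteq> 0}" if "a \<in> gtotal sF F"
    by (rule contra_support[OF that])
  show "\<exists>N. \<forall>r s. N \<le> r \<or> N \<le> s \<longrightarrow> mode Yv a r s u = 0" if "a \<in> gtotal sF F" "u \<in> graded_dual sM M"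
    by (rule contra_truncation[OF that])
  show "dual_piece sM M h k = {0}" if "h - k \<notin> \<int>"
    by (rule M.dual_piece_trivial[where h = h and k = k, OF integral_spin[OF that]])
  show "Yv vac x y u = (if x = 0 \<and> y = 0 then u else 0)" if "u \<in> graded_dual sM M"
    by (rule contra_vacuum[OF that])
  show "\<exists>\<mu>. gcor2 \<mu> (\<lambda>x1 y1 x2 y2. U (Yv a x1 y1 (Yv b x2 y2 u))) (\<lambda>x0 y0 x2 y2. U (Yv (Y a x0 y0 b) x2 y2 u))
      (\<lambda>x1 y1 x2 y2. U (Yv b x2 y2 (Yv a x1 y1 u)))"
    if a: "a \<in> gtotal sF F" and b: "b \<in> gtotal sF F" and u: "u \<in> graded_dual sM M" and U: "U \<in> graded_dual fun_scale (dual_piece sM M)" for U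
  proof -
    obtain v where v: "v \<in> gtotal sM M" "\<And>u. u \<in> graded_dual sM M \<Longrightarrow> U u = u v"
      using M.double_dual[OF module_finite_dim U] by blast
    have "U (Yv a x1 y1 (Yv b x2 y2 u)) = Yv a x1 y1 (Yv b x2 y2 u) v"
      "U (Yv (Y a x1 y1 b) x2 y2 u) = Yv (Y a x1 y1 b) x2 y2 u v"
      "U (Yv b x2 y2 (Yv a x1 y1 u)) = Yv b x2 y2 (Yv a x1 y1 u) v" for x1 y1 x2 y2
      by (intro v(2) contra_total alg.endomorphism a b u)+
    then show ?thesis using contra_correlator[OF a b u v(1)] by (simp only: gcor_def)
  qed
  show "mode Yv a r s u \<in> dual_piece sM M (h + h' - r - 1) (k + k' - s - 1)" if "a \<in> F h k" "u \<in> dual_piece sM M h' k'"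
    using contra_piece[OF that, of "- r - 1" "- s - 1"] by (simp add: mode_def algebra_simps)
  show "L_op Yv \<omega> 0 u = fun_scale (complex_of_real h) u" if "u \<in> dual_piece sM M h k"
    by (rule contra_L_zero[OF that])
  show "L_op_bar Yv \<omega>' 0 u = fun_scale (complex_of_real k) u" if "u \<in> dual_piece sM M h k"
    by (rule contra_L_bar_zero[OF that])
  show "pieces_finite_dim fun_scale (dual_piece sM M)" by (rule M.dual_finite_dim[OF module_finite_dim])
  show "degrees_bounded_below (dual_piece sM M)"
    using module_bounded_below M.dual_piece_trivial unfolding degrees_bounded_below_def by blast
qed

end

theorem proposition3p1:
  fixes sF :: "complex \<Rightarrow> 'a::ab_group_add \<Rightarrow> 'a" and F :: "real \<Rightarrow> real \<Rightarrow> 'a set"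
    and Y :: "'a \<Rightarrow> real \<Rightarrow> real \<Rightarrow> 'a \<Rightarrow> 'a" and vac \<omega> \<omega>' :: 'a
    and sM :: "complex \<Rightarrow> 'm::ab_group_add \<Rightarrow> 'm" and M :: "real \<Rightarrow> real \<Rightarrow> 'm set"
    and YM :: "'a \<Rightarrow> real \<Rightarrow> real \<Rightarrow> 'm \<Rightarrow> 'm"
  assumes "full_vertex_operator_algebra sF F Y vac \<omega> \<omega>'"
    and "full_vertex_operator_module sF F Y vac \<omega> \<omega>' sM M YM"
  shows "full_vertex_operator_module sF F Y vac \<omega> \<omega>'
           fun_scale (dual_piece sM M) (contragredient sF F Y \<omega> \<omega>' sM M YM)"
  by (rule full_vertex_operator_module.contragredient_module[OF assms(2)])

end
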